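(* Let $N\geq 2$, and for $j=1,\dots,N$, let $V_j$ be a bounded Lipschitz domain in $\mathbb{C}^{n_j}$, $n_j\geq 1$, such that $\mathbb{C}^{n_j}\setminus V_j$ is connected. For each $j$ with $n_j\geq 2$, assume further that $H^{0,n_j-1}_{W^1}(V_j)=0$. Set $n=\sum_{j=1}^N n_j$ and let $V=V_1\times\dots\times V_N\Subset\mathbb{C}^n$. Then $H^{0,n-1}_{W^1}(V)=0$.
   Context: For an open set $U\subset\mathbb{C}^m$, $W^1(U)$ is the Sobolev space of functions in $L^2(U)$ with all first partial derivatives in $L^2(U)$, and $W^1_{p,q}(U)$ is the space of $(p,q)$-forms with coefficients in $W^1(U)$. With $\overline\partial$ acting in the sense of distributions, $$H^{p,q}_{W^1}(U)=\frac{\{f\in W^1_{p,q}(U):\overline\partial f=0\}}{\{\overline\partial g: g\in W^1_{p,q-1}(U),\ \overline\partial g\in W^1_{p,q}(U)\}},$$ so $H^{p,q}_{W^1}(U)=0$ means that every $\overline\partial$-closed $f\in W^1_{p,q}(U)$ equals $\overline\partial u$ for some $u\in W^1_{p,q-1}(U)$. *)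

theory Defs
  imports "HOL-Analysis.Analysis"
begin

text \<open>
  The dimensions \<open>n\<^sub>j\<close> and \<open>n\<close> of the main statement are related by a sum, so they cannot be types.
  Points of \<open>\<complex>\<^sup>m\<close> are the functions \<open>z :: nat \<Rightarrow> complex\<close> that are extensional on \<open>{..<m}\<close>; the
  coordinates are \<open>z 0, \<dots>, z (m - 1)\<close>.
\<close>

definition Cn_top :: "nat \<Rightarrow> (nat \<Rightarrow> complex) topology" where
  "Cn_top m = product_topology (\<lambda>_. euclidean) {..<m}"

abbreviation Cn :: "nat \<Rightarrow> (nat \<Rightarrow> complex) set" where
  "Cn m \<equiv> topspace (Cn_top m)"

definition Cn_measure :: "nat \<Rightarrow> (nat \<Rightarrow> complex) measure" where
  "Cn_measure m = Pi\<^sub>M {..<m} (\<lambda>_. lborel)"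

definition Cn_norm :: "nat \<Rightarrow> (nat \<Rightarrow> complex) \<Rightarrow> real" where
  "Cn_norm m z = L2_set (\<lambda>i. cmod (z i)) {..<m}"

text \<open>The real inner product of \<open>\<complex>\<^sup>m = \<real>\<^sup>2\<^sup>m\<close>; on \<^typ>\<open>complex\<close> the inner product is the real one.\<close>

definition Cn_inner :: "nat \<Rightarrow> (nat \<Rightarrow> complex) \<Rightarrow> (nat \<Rightarrow> complex) \<Rightarrow> real" where
  "Cn_inner m z w = (\<Sum>i<m. z i \<bullet> w i)"


subsection \<open>Bounded Lipschitz domains\<close>

text \<open>
  Near each boundary point, \<open>D\<close> is the part strictly above the graph of a Lipschitz function \<open>\<phi>\<close>,
  in orthonormal real coordinates whose last axis points along the unit vector \<open>\<nu>\<close>. The function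
  \<open>\<phi>\<close> matters only on the real hyperplane orthogonal to \<open>\<nu>\<close>, which plays the role of \<open>\<real>\<^sup>2\<^sup>m\<^sup>-\<^sup>1\<close>.
\<close>

definition lipschitz_boundary :: "nat \<Rightarrow> (nat \<Rightarrow> complex) set \<Rightarrow> bool" where
  "lipschitz_boundary m D \<longleftrightarrow>
     (\<forall>p \<in> (Cn_top m) frontier_of D.
        \<exists>r > 0. \<exists>\<nu> \<in> Cn m. \<exists>(\<phi> :: (nat \<Rightarrow> complex) \<Rightarrow> real) L.
          Cn_norm m \<nu> = 1 \<and>
          (\<forall>x \<in> Cn m. \<forall>y \<in> Cn m. Cn_inner m x \<nu> = 0 \<longrightarrow> Cn_inner m y \<nu> = 0 \<longrightarrow>
             \<bar>\<phi> x - \<phi> y\<bar> \<le> L * Cn_norm m (\<lambda>i. x i - y i)) \<and>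
          (\<forall>z \<in> Cn m. Cn_norm m (\<lambda>i. z i - p i) < r \<longrightarrow>
             (z \<in> D \<longleftrightarrow> \<phi> (\<lambda>i\<in>{..<m}. z i - Cn_inner m z \<nu> *\<^sub>R \<nu> i) < Cn_inner m z \<nu>)))"

definition bounded_lipschitz_domain :: "nat \<Rightarrow> (nat \<Rightarrow> complex) set \<Rightarrow> bool" where
  "bounded_lipschitz_domain m D \<longleftrightarrow>
     openin (Cn_top m) D \<and> connectedin (Cn_top m) D \<and> D \<noteq> {} \<and>
     (\<exists>R. \<forall>z\<in>D. Cn_norm m z \<le> R) \<and>
     lipschitz_boundary m D"


subsection \<open>Test functions\<close>

text \<open>
  Real partial derivatives: \<open>v = 1\<close> gives \<open>\<partial>/\<partial>x\<^sub>k\<close> and \<open>v = \<i>\<close> gives \<open>\<partial>/\<partial>y\<^sub>k\<close>, where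
  \<open>z\<^sub>k = x\<^sub>k + \<i> y\<^sub>k\<close>.
\<close>

definition partial :: "nat \<Rightarrow> complex \<Rightarrow> ((nat \<Rightarrow> complex) \<Rightarrow> complex) \<Rightarrow> (nat \<Rightarrow> complex) \<Rightarrow> complex"
  where "partial k v \<phi> z = vector_derivative (\<lambda>t::real. \<phi> (z(k := z k + t *\<^sub>R v))) (at 0)"

definition partial_zbar :: "nat \<Rightarrow> ((nat \<Rightarrow> complex) \<Rightarrow> complex) \<Rightarrow> (nat \<Rightarrow> complex) \<Rightarrow> complex"
  where "partial_zbar k \<phi> z = (partial k 1 \<phi> z + \<i> * partial k \<i> \<phi> z) / 2"

primrec Ck :: "nat \<Rightarrow> nat \<Rightarrow> ((nat \<Rightarrow> complex) \<Rightarrow> complex) \<Rightarrow> bool" where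
  "Ck m 0 \<phi> \<longleftrightarrow> continuous_map (Cn_top m) euclidean \<phi>"
| "Ck m (Suc r) \<phi> \<longleftrightarrow> continuous_map (Cn_top m) euclidean \<phi> \<and>
     (\<forall>k<m. \<forall>v\<in>{1, \<i>}.
        (\<forall>z\<in>Cn m. (\<lambda>t::real. \<phi> (z(k := z k + t *\<^sub>R v))) differentiable (at 0)) \<and>
        Ck m r (partial k v \<phi>))"

definition test_functions :: "nat \<Rightarrow> (nat \<Rightarrow> complex) set \<Rightarrow> ((nat \<Rightarrow> complex) \<Rightarrow> complex) set" where
  "test_functions m U = {\<phi>. (\<forall>r. Ck m r \<phi>) \<and>
     (\<exists>K. compactin (Cn_top m) K \<and> K \<subseteq> U \<and> (\<forall>z \<in> Cn m - K. \<phi> z = 0))}"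


subsection \<open>Sobolev spaces\<close>

text \<open>
  Elements of \<open>L\<^sup>2(U)\<close> and \<open>W\<^sup>1(U)\<close> are represented by functions rather than by classes modulo null
  sets; only their values on \<open>U\<close> matter, and equality is always tested against \<^const>\<open>test_functions\<close>.
\<close>

definition L2 :: "nat \<Rightarrow> (nat \<Rightarrow> complex) set \<Rightarrow> ((nat \<Rightarrow> complex) \<Rightarrow> complex) set" where
  "L2 m U = {f. set_borel_measurable (Cn_measure m) U f \<and>
                set_integrable (Cn_measure m) U (\<lambda>z. (cmod (f z))\<^sup>2)}"

definition weak_partial ::
  "nat \<Rightarrow> (nat \<Rightarrow> complex) set \<Rightarrow> nat \<Rightarrow> complex \<Rightarrow>
   ((nat \<Rightarrow> complex) \<Rightarrow> complex) \<Rightarrow> ((nat \<Rightarrow> complex) \<Rightarrow> complex) \<Rightarrow> bool" where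
  "weak_partial m U k v f g \<longleftrightarrow>
     (\<forall>\<phi> \<in> test_functions m U.
        (LINT z:U|Cn_measure m. g z * \<phi> z) = - (LINT z:U|Cn_measure m. f z * partial k v \<phi> z))"

definition W1 :: "nat \<Rightarrow> (nat \<Rightarrow> complex) set \<Rightarrow> ((nat \<Rightarrow> complex) \<Rightarrow> complex) set" where
  "W1 m U = {f \<in> L2 m U. \<forall>k<m. \<forall>v\<in>{1, \<i>}. \<exists>g \<in> L2 m U. weak_partial m U k v f g}"


subsection \<open>Forms and the Dolbeault complex\<close>

text \<open>
  A \<open>(p,q)\<close>-form \<open>\<Sum> f\<^sub>I\<^sub>J dz\<^sup>I \<and> d\<zeta>\<^sup>J\<close>, with \<open>\<zeta>\<close> the conjugate of \<open>z\<close>, is given by its coefficients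
  \<open>f I J\<close>, where \<open>I, J \<subseteq> {..<m}\<close> have \<open>p\<close> and \<open>q\<close> elements and stand for increasing multi-indices.
  Values of \<open>f\<close> at other pairs of sets are ignored.
\<close>

type_synonym form = "nat set \<Rightarrow> nat set \<Rightarrow> (nat \<Rightarrow> complex) \<Rightarrow> complex"

definition multi_indices :: "nat \<Rightarrow> nat \<Rightarrow> nat set set" where
  "multi_indices m q = {J. J \<subseteq> {..<m} \<and> card J = q}"

definition W1_forms :: "nat \<Rightarrow> nat \<Rightarrow> nat \<Rightarrow> (nat \<Rightarrow> complex) set \<Rightarrow> form set" where
  "W1_forms m p q U = {f. \<forall>I \<in> multi_indices m p. \<forall>J \<in> multi_indices m q. f I J \<in> W1 m U}"

text \<open>
  \<open>is_dbar m p q U u f\<close>: the \<open>(p,q)\<close>-form \<open>f\<close> is the \<open>\<partial>\<close>-bar of the \<open>(p,q-1)\<close>-form \<open>u\<close> on \<open>U\<close> in the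
  sense of distributions (note that \<open>q\<close> is the degree of the result). The coefficient of
  \<open>dz\<^sup>I \<and> d\<zeta>\<^sup>J\<close> in \<open>\<Sum>\<^sub>k \<partial>u/\<partial>\<zeta>\<^sub>k d\<zeta>\<^sub>k \<and> \<dots>\<close> collects the terms \<open>u I (J - {k})\<close> with \<open>k \<in> J\<close>. Moving \<open>d\<zeta>\<^sub>k\<close>
  past \<open>dz\<^sup>I\<close> and into its place in \<open>d\<zeta>\<^sup>J\<close> gives the sign, and the inner minus sign is that of the
  distributional derivative. For \<open>q = 0\<close> the sum is empty, so \<open>f\<close> has to vanish almost everywhere.
\<close>

definition is_dbar :: "nat \<Rightarrow> nat \<Rightarrow> nat \<Rightarrow> (nat \<Rightarrow> complex) set \<Rightarrow> form \<Rightarrow> form \<Rightarrow> bool" where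
  "is_dbar m p q U u f \<longleftrightarrow>
     (\<forall>I \<in> multi_indices m p. \<forall>J \<in> multi_indices m q. \<forall>\<phi> \<in> test_functions m U.
        (LINT z:U|Cn_measure m. f I J z * \<phi> z) =
        (\<Sum>k\<in>J. (-1) ^ (p + card {l\<in>J. l < k}) *
           - (LINT z:U|Cn_measure m. u I (J - {k}) z * partial_zbar k \<phi> z)))"

definition W1_closed_forms :: "nat \<Rightarrow> nat \<Rightarrow> nat \<Rightarrow> (nat \<Rightarrow> complex) set \<Rightarrow> form set" where
  "W1_closed_forms m p q U = {f \<in> W1_forms m p q U. is_dbar m p (Suc q) U f (\<lambda>_ _ _. 0)}"

definition W1_exact_forms :: "nat \<Rightarrow> nat \<Rightarrow> nat \<Rightarrow> (nat \<Rightarrow> complex) set \<Rightarrow> form set" where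
  "W1_exact_forms m p q U =
     {f \<in> W1_forms m p q U. \<exists>u \<in> W1_forms m p (q - 1) U. is_dbar m p q U u f}"

text \<open>The quotient of the closed by the exact forms, \<open>H\<^sup>p\<^sup>,\<^sup>q\<close> of \<open>U \<subseteq> \<complex>\<^sup>m\<close> with respect to \<open>W\<^sup>1\<close>, is zero.\<close>

definition W1_dolbeault_vanishes :: "nat \<Rightarrow> nat \<Rightarrow> nat \<Rightarrow> (nat \<Rightarrow> complex) set \<Rightarrow> bool" where
  "W1_dolbeault_vanishes m p q U \<longleftrightarrow> W1_closed_forms m p q U \<subseteq> W1_exact_forms m p q U"


subsection \<open>Products\<close>

text \<open>
  \<open>V 0 \<times> \<dots> \<times> V (N - 1)\<close> inside \<open>\<complex>\<^sup>n\<close>, \<open>n = d 0 + \<dots> + d (N - 1)\<close>: the \<open>j\<close>-th factor uses the \<open>d j\<close>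
  consecutive coordinates that start at \<open>d 0 + \<dots> + d (j - 1)\<close>.
\<close>

definition product_domain ::
  "nat \<Rightarrow> (nat \<Rightarrow> nat) \<Rightarrow> (nat \<Rightarrow> (nat \<Rightarrow> complex) set) \<Rightarrow> (nat \<Rightarrow> complex) set" where
  "product_domain N d V =
     {z \<in> Cn (\<Sum>j<N. d j). \<forall>j<N. (\<lambda>i\<in>{..<d j}. z ((\<Sum>l<j. d l) + i)) \<in> V j}"

end

theory Submission
  imports Defs
begin

text \<open>
  The vanishing is a Kuenneth phenomenon, and on a product it can be made explicit. Let
  \<open>V = A \<times> B\<close> with \<open>A\<close> the first factor, and let \<open>I\<close> and \<open>J\<close> be the coordinates of \<open>A\<close> and of \<open>B\<close>. A form
  of type \<open>(0, n - 1)\<close> has \<open>n\<close> coefficients, which with suitable signs are a field \<open>F\<close>; the form is closed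
  iff \<open>\<Sum>\<^sub>k dbar\<^sub>k F\<^sub>k = 0\<close>. It suffices to find \<open>U\<^sub>i\<^sub>j\<close>, for \<open>i \<in> I\<close> and \<open>j \<in> J\<close>, with
  \<open>F\<^sub>i = \<Sum>\<^sub>j dbar\<^sub>j U\<^sub>i\<^sub>j\<close> and \<open>F\<^sub>j = - \<Sum>\<^sub>i dbar\<^sub>i U\<^sub>i\<^sub>j\<close>: up to signs, these are the coefficients of a
  primitive whose other coefficients vanish.

  The function \<open>g = \<Sum>\<^sub>j dbar\<^sub>j F\<^sub>j = - \<Sum>\<^sub>i dbar\<^sub>i F\<^sub>i\<close> is square integrable. Let \<open>T\<^sub>i\<close> be the convolution
  with the \<open>i\<close>-th component of the Bochner-Martinelli kernel in the variables of \<open>I\<close>, and \<open>T\<^sub>j\<close> likewise for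
  \<open>J\<close>. Then \<open>\<Sum>\<^sub>i dbar\<^sub>i T\<^sub>i\<close> and \<open>\<Sum>\<^sub>j dbar\<^sub>j T\<^sub>j\<close> are the identity on functions that live on \<open>V\<close>, and operators of one
  block commute with the derivatives in the other block. Hence
  \<open>U\<^sub>i\<^sub>j = T\<^sub>j F\<^sub>i - T\<^sub>i F\<^sub>j + T\<^sub>j T\<^sub>i g\<close>
  solves both equations. It lies in \<open>W\<^sup>1\<close> because a first derivative hits the variables of one block only, say
  of \<open>I\<close>: in \<open>T\<^sub>j F\<^sub>i\<close> it moves to \<open>F\<^sub>i\<close>, and in the other two terms \<open>T\<^sub>i\<close> gains a derivative in its
  own block.

  Since everything is weak, the formula is transposed. With \<open>S\<^sub>i\<close>, \<open>S\<^sub>j\<close> the transposed convolutions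
  (\<open>block_op\<close>), the pairing of \<open>U\<^sub>i\<^sub>j\<close> with a test function \<open>\<phi>\<close> has to be
  \<open>\<integral> F\<^sub>i S\<^sub>j \<phi> - \<integral> F\<^sub>j S\<^sub>i \<phi> + \<integral> g S\<^sub>i S\<^sub>j \<phi>\<close>.
  This functional and its composites with first derivatives are bounded in the \<open>L\<^sup>2\<close> norm of \<open>\<phi>\<close>, so
  \<open>Riesz_L2\<close> yields \<open>U\<^sub>i\<^sub>j\<close> and its weak derivatives (\<open>field_decomposition\<close>). Two points need work:

  \<^item> The gain of a derivative, \<open>conv_bm_cut_gain\<close>. The field \<open>u\<^sub>i = S\<^sub>i \<phi>\<close> has controlled divergence
    \<open>\<Sum>\<^sub>i dbar\<^sub>i u\<^sub>i\<close> and satisfies \<open>\<partial>\<^sub>l u\<^sub>i = \<partial>\<^sub>i u\<^sub>l\<close>. After a cutoff the identity \<open>div_curl_identity\<close>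
    bounds its whole gradient; no singular integrals are needed. The kernel is regularised so that these
    two facts are classical, and the estimate passes to the limit.

  \<^item> The functions \<open>S\<^sub>i \<phi>\<close> are smooth, but their support sticks out of \<open>V\<close>; only its projection to the
    variables of \<open>J\<close> stays in a compact set. For derivatives in the directions of \<open>J\<close> this is enough
    (\<open>weak_partial_ext\<close>), because \<open>V\<close> is a product.
\<close>

section \<open>Lebesgue measure and the product topology\<close>

abbreviation LM :: "nat set \<Rightarrow> (nat \<Rightarrow> complex) measure" where
  "LM I \<equiv> Pi\<^sub>M I (\<lambda>_. lborel)"

abbreviation PT :: "nat set \<Rightarrow> (nat \<Rightarrow> complex) topology" where
  "PT I \<equiv> product_topology (\<lambda>_. euclidean) I"

text \<open>Translation of the coordinates in \<open>I\<close> only. Both the difference quotients and the convolutions in a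
  block of variables are written with it, so a single invariance statement serves both.\<close>

definition shift :: "nat set \<Rightarrow> (nat \<Rightarrow> complex) \<Rightarrow> (nat \<Rightarrow> complex) \<Rightarrow> nat \<Rightarrow> complex" where
  "shift I \<zeta> x = (\<lambda>k. if k \<in> I then x k + \<zeta> k else x k)"

lemma space_LM: "space (LM I) = extensional I"
  by (auto simp: space_PiM PiE_def)

lemma topspace_PT: "topspace (PT I) = extensional I"
  by (auto simp: PiE_def)

lemma Cn_eq: "Cn m = extensional {..<m}"
  by (simp add: Cn_top_def PiE_def)

lemma Cn_measure_eq: "Cn_measure m = LM {..<m}"
  by (simp add: Cn_measure_def)

lemma shift_extensional [intro]:
  "I \<subseteq> N \<Longrightarrow> x \<in> extensional N \<Longrightarrow> shift I \<zeta> x \<in> extensional N"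
  by (auto simp: shift_def extensional_def)

lemma shift_singleton: "shift {k} (\<lambda>_. c) x = x(k := x k + c)"
  by (auto simp: shift_def)

interpretation LP: product_sigma_finite "\<lambda>_::nat. lborel :: complex measure"
  by standard

lemma sigma_finite_LM: "finite I \<Longrightarrow> sigma_finite_measure (LM I)"
  by (rule LP.sigma_finite)

lemma measurable_shift [measurable]:
  assumes "I \<subseteq> N"
  shows "shift I \<zeta> \<in> measurable (LM N) (LM N)"
  unfolding shift_def
proof (rule measurable_PiM_single')
  show "(\<lambda>\<omega> k. if k \<in> I then \<omega> k + \<zeta> k else \<omega> k) \<in> space (LM N) \<rightarrow> (\<Pi>\<^sub>E i\<in>N. space lborel)"
    using assms by (auto simp: space_PiM extensional_def PiE_def)
  fix i assume i: "i \<in> N"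
  show "(\<lambda>\<omega>. if i \<in> I then \<omega> i + \<zeta> i else \<omega> i) \<in> LM N \<rightarrow>\<^sub>M lborel"
    using i by (cases "i \<in> I") auto
qed

lemma measurable_shift_pair:
  assumes "I \<subseteq> N"
  shows "(\<lambda>(\<zeta>, x). shift I \<zeta> x) \<in> measurable (LM I \<Otimes>\<^sub>M LM N) (LM N)"
  unfolding shift_def case_prod_beta
proof (rule measurable_PiM_single')
  show "(\<lambda>\<omega> k. if k \<in> I then snd \<omega> k + fst \<omega> k else snd \<omega> k)
      \<in> space (LM I \<Otimes>\<^sub>M LM N) \<rightarrow> (\<Pi>\<^sub>E i\<in>N. space lborel)"
    using assms by (auto simp: space_PiM extensional_def PiE_def space_pair_measure)
  fix i assume i: "i \<in> N"
  show "(\<lambda>\<omega>. if i \<in> I then snd \<omega> i + fst \<omega> i else snd \<omega> i) \<in> LM I \<Otimes>\<^sub>M LM N \<rightarrow>\<^sub>M lborel"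
    using i by (cases "i \<in> I") auto
qed

lemma distr_shift:
  assumes N: "finite N" and "I \<subseteq> N"
  shows "distr (LM N) (LM N) (shift I \<zeta>) = LM N"
proof (rule LP.PiM_eqI[OF N])
  show "sets (distr (LM N) (LM N) (shift I \<zeta>)) = sets (LM N)" by simp
  fix A :: "nat \<Rightarrow> complex set" assume A: "\<And>i. i \<in> N \<Longrightarrow> A i \<in> sets lborel"
  define B where "B i = (if i \<in> I then (\<lambda>z. z + \<zeta> i) -` A i else A i)" for i
  have B: "B i \<in> sets lborel \<and> emeasure lborel (B i) = emeasure lborel (A i)" if "i \<in> N" for i
  proof (cases "i \<in> I")
    case True
    have m: "(\<lambda>z. z + \<zeta> i) \<in> measurable lborel lborel" by simp
    have "emeasure lborel (A i) = emeasure (distr lborel lborel (\<lambda>z. \<zeta> i + z)) (A i)"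
      using lborel_distr_plus[of "\<zeta> i"] by (simp cong: distr_cong)
    also have "\<dots> = emeasure lborel (B i)"
      using A[OF that] True by (subst emeasure_distr) (auto simp: B_def add.commute[of _ "\<zeta> i"])
    finally show ?thesis
      using measurable_sets[OF m A[OF that]] True by (simp add: B_def)
  qed (use A[OF that] in \<open>auto simp: B_def\<close>)
  have "shift I \<zeta> -` Pi\<^sub>E N A \<inter> space (LM N) = Pi\<^sub>E N B"
    using \<open>I \<subseteq> N\<close> by (auto simp: space_LM B_def shift_def PiE_iff extensional_def; force)
  moreover have "Pi\<^sub>E N A \<in> sets (LM N)" using A N by (auto intro!: sets_PiM_I_finite)
  ultimately have "emeasure (distr (LM N) (LM N) (shift I \<zeta>)) (Pi\<^sub>E N A) = emeasure (LM N) (Pi\<^sub>E N B)"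
    by (subst emeasure_distr) (use assms in \<open>auto intro!: measurable_shift\<close>)
  also have "\<dots> = (\<Prod>i\<in>N. emeasure lborel (A i))"
    using B N by (subst LP.emeasure_PiM) (auto intro!: prod.cong)
  finally show "emeasure (distr (LM N) (LM N) (shift I \<zeta>)) (Pi\<^sub>E N A) = (\<Prod>i\<in>N. emeasure lborel (A i))" .
qed

lemma integral_shift:
  fixes f :: "(nat \<Rightarrow> complex) \<Rightarrow> 'b::{banach, second_countable_topology}"
  assumes "finite N" "I \<subseteq> N" and f: "f \<in> borel_measurable (LM N)"
  shows "(LINT x|LM N. f (shift I \<zeta> x)) = (LINT x|LM N. f x)"
  using integral_distr[where f = f, OF measurable_shift[OF assms(2)] f] distr_shift[OF assms(1,2)] by simp

lemma integrable_shift: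
  fixes f :: "(nat \<Rightarrow> complex) \<Rightarrow> 'b::{banach, second_countable_topology}"
  assumes "finite N" "I \<subseteq> N" and f: "integrable (LM N) f"
  shows "integrable (LM N) (\<lambda>x. f (shift I \<zeta> x))"
  using integrable_distr[where f = f, OF measurable_shift[OF assms(2)]] distr_shift[OF assms(1,2)] f by simp

lemma nn_integral_shift:
  assumes "finite N" "I \<subseteq> N" and f: "f \<in> borel_measurable (LM N)"
  shows "(\<integral>\<^sup>+x. f (shift I \<zeta> x) \<partial>LM N) = (\<integral>\<^sup>+x. f x \<partial>LM N)"
  using nn_integral_distr[where f = f, OF measurable_shift[OF assms(2)]] distr_shift[OF assms(1,2)] f by simp

definition polydisc :: "nat set \<Rightarrow> (nat \<Rightarrow> complex) \<Rightarrow> real \<Rightarrow> (nat \<Rightarrow> complex) set" where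
  "polydisc N c r = {x \<in> extensional N. \<forall>k\<in>N. cmod (x k - c k) < r}"

lemma polydisc_PiE: "polydisc N c r = PiE N (\<lambda>k. ball (c k) r)"
  by (auto simp: polydisc_def PiE_def Pi_def ball_def dist_norm norm_minus_commute)

lemma polydisc_sets: "finite N \<Longrightarrow> polydisc N c r \<in> sets (LM N)"
  unfolding polydisc_PiE by (rule sets_PiM_I_finite) auto

lemma openin_PT_polydisc:
  assumes N: "finite N" and U: "openin (PT N) U" and x: "x \<in> U"
  obtains r where "r > 0" "polydisc N x r \<subseteq> U"
proof -
  obtain W where W: "finite {i \<in> N. W i \<noteq> UNIV}" "\<forall>i\<in>N. open (W i)" "x \<in> PiE N W" "PiE N W \<subseteq> U"
    using U x unfolding openin_product_topology_alt by auto
  have "\<exists>e>0. ball (x i) e \<subseteq> W i" if "i \<in> N" for i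
    using W that by (meson PiE_mem openE)
  then obtain e where e: "\<And>i. i \<in> N \<Longrightarrow> e i > 0 \<and> ball (x i) (e i) \<subseteq> W i" by metis
  define r where "r = Min (insert 1 (e ` N))"
  have "r > 0" "\<And>i. i \<in> N \<Longrightarrow> r \<le> e i" using N e by (auto simp: r_def)
  moreover have "polydisc N x r \<subseteq> PiE N W"
    unfolding polydisc_PiE using calculation e
    by (intro PiE_mono) (metis dual_order.trans subset_ball)
  ultimately show ?thesis using that W by blast
qed

text \<open>Second countability in the form that is used below: an open set is a countable union of
  polydiscs whose closed concentric versions still lie in it.\<close>

lemma openin_PT_countable_cover:
  assumes N: "finite N" and U: "openin (PT N) U"
  obtains P :: "((nat \<Rightarrow> complex) \<times> real) set" where "countable P"
    "\<And>c r. (c, r) \<in> P \<Longrightarrow> r > 0 \<and> c \<in> U \<and> {x \<in> extensional N. \<forall>k\<in>N. cmod (x k - c k) \<le> r} \<subseteq> U"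
    "U = (\<Union>(c, r)\<in>P. polydisc N c r)"
proof -
  obtain D :: "complex set" where D: "countable D" "\<And>W. open W \<Longrightarrow> W \<noteq> {} \<Longrightarrow> \<exists>d\<in>D. d \<in> W"
    using countable_dense_setE by blast
  define P where "P = {(c, r). c \<in> PiE N (\<lambda>_. D) \<and> r \<in> range (\<lambda>n::nat. 1 / real (Suc n)) \<and> c \<in> U \<and>
      {x \<in> extensional N. \<forall>k\<in>N. cmod (x k - c k) \<le> r} \<subseteq> U}"
  have "P \<subseteq> PiE N (\<lambda>_. D) \<times> range (\<lambda>n::nat. 1 / real (Suc n))" by (auto simp: P_def)
  moreover have "countable (PiE N (\<lambda>_. D) \<times> range (\<lambda>n::nat. 1 / real (Suc n)))"
    using N D by (intro countable_SIGMA countable_PiE) auto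
  ultimately have "countable P" by (rule countable_subset)
  moreover have "r > 0 \<and> c \<in> U \<and> {x \<in> extensional N. \<forall>k\<in>N. cmod (x k - c k) \<le> r} \<subseteq> U" if "(c, r) \<in> P" for c r
    using that by (auto simp: P_def)
  moreover have "U \<subseteq> (\<Union>(c, r)\<in>P. polydisc N c r)"
  proof
    fix x assume x: "x \<in> U"
    obtain r where r: "r > 0" "polydisc N x r \<subseteq> U" using openin_PT_polydisc[OF N U x] .
    have xe: "x \<in> extensional N" using openin_subset[OF U] x by (auto simp: PiE_def)
    \<comment> \<open>Half of \<open>r\<close>: the centre moves by less than \<open>s\<close>, and the polydisc adds another \<open>s\<close>.\<close>
    obtain n where n: "1 / real (Suc n) < r / 2" using r by (metis half_gt_zero nat_approx_posE)
    define s where "s = 1 / real (Suc n)"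
    have s: "s > 0" "s < r / 2" using n by (auto simp: s_def)
    have "\<exists>d\<in>D. cmod (d - x k) < s" for k
      using D(2)[of "ball (x k) s"] s by (auto simp: dist_norm norm_minus_commute)
    then obtain d where d: "\<And>k. d k \<in> D \<and> cmod (d k - x k) < s" by metis
    define c where "c = restrict d N"
    have cc: "cmod (c k - x k) < s" if "k \<in> N" for k using d that by (simp add: c_def)
    have "{y \<in> extensional N. \<forall>k\<in>N. cmod (y k - c k) \<le> s} \<subseteq> polydisc N x r"
    proof -
      have "cmod (y k - x k) < r" if "cmod (y k - c k) \<le> s" "k \<in> N" for y k
      proof -
        have "cmod (y k - x k) \<le> cmod (y k - c k) + cmod (c k - x k)"
          using norm_triangle_ineq[of "y k - c k" "c k - x k"] by simp
        then show ?thesis using cc[OF that(2)] that s by linarith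
      qed
      then show ?thesis by (auto simp: polydisc_def)
    qed
    moreover have "c \<in> polydisc N x r" using cc s r by (force simp: polydisc_def c_def)
    ultimately have "(c, s) \<in> P" using r d by (auto simp: P_def c_def s_def)
    moreover have "x \<in> polydisc N c s" using xe cc by (auto simp: polydisc_def norm_minus_commute)
    ultimately show "x \<in> (\<Union>(c, r)\<in>P. polydisc N c r)" by auto
  qed
  moreover have "(\<Union>(c, r)\<in>P. polydisc N c r) \<subseteq> U"
    by (force simp: P_def polydisc_def intro: less_imp_le)
  ultimately show ?thesis using that[of P] by blast
qed

lemma openin_PT_sets:
  assumes N: "finite N" and U: "openin (PT N) U"
  shows "U \<in> sets (LM N)"
proof -
  obtain P where P: "countable P" "U = (\<Union>(c, r)\<in>P. polydisc N c r)"
    using openin_PT_countable_cover[OF assms] by metis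
  show ?thesis unfolding P(2) using P(1) polydisc_sets[OF N]
    by (intro sets.countable_UN') auto
qed

lemma continuous_map_PT_measurable:
  assumes N: "finite N" and f: "continuous_map (PT N) euclidean f"
  shows "f \<in> borel_measurable (LM N)"
proof (rule borel_measurableI)
  fix S :: "'a set" assume "open S"
  then have "openin (PT N) {x \<in> topspace (PT N). f x \<in> S}"
    using f by (auto simp: continuous_map_def)
  then have "{x \<in> topspace (PT N). f x \<in> S} \<in> sets (LM N)" by (rule openin_PT_sets[OF N])
  also have "{x \<in> topspace (PT N). f x \<in> S} = f -` S \<inter> space (LM N)"
    by (auto simp: space_LM PiE_def)
  finally show "f -` S \<inter> space (LM N) \<in> sets (LM N)" .
qed

text \<open>Continuity can be tested on sequences, because a point has the countable neighbourhood base of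
  polydiscs with radii \<open>1 / (n + 1)\<close>. The limit theorems for integrals then yield continuity of integrals
  with a parameter.\<close>

lemma continuous_map_PT_seqI:
  fixes f :: "(nat \<Rightarrow> complex) \<Rightarrow> 'b::metric_space"
  assumes N: "finite N"
    and f: "\<And>X x. (\<And>n. X n \<in> extensional N) \<Longrightarrow> x \<in> extensional N \<Longrightarrow>
              (\<And>k. k \<in> N \<Longrightarrow> (\<lambda>n. X n k) \<longlonglongrightarrow> x k) \<Longrightarrow> (\<lambda>n. f (X n)) \<longlonglongrightarrow> f x"
  shows "continuous_map (PT N) euclidean f"
  unfolding continuous_map_def
proof (intro conjI allI impI)
  show "f \<in> topspace (PT N) \<rightarrow> topspace euclidean" by simp
  fix S :: "'b set" assume "openin euclidean S"
  then have S: "open S" by simp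
  have "\<exists>r>0. polydisc N x r \<subseteq> {y \<in> extensional N. f y \<in> S}" if x: "x \<in> extensional N" "f x \<in> S" for x
  proof (rule ccontr)
    assume "\<not> ?thesis"
    then have "\<exists>y. y \<in> polydisc N x (1 / real (Suc n)) \<and> f y \<notin> S" for n
      by (auto simp: polydisc_def dest!: spec[of _ "1 / real (Suc n)"])
    then obtain X where X: "\<And>n. X n \<in> polydisc N x (1 / real (Suc n)) \<and> f (X n) \<notin> S" by metis
    have "(\<lambda>n. X n k) \<longlonglongrightarrow> x k" if "k \<in> N" for k
    proof -
      have "(\<lambda>n. X n k - x k) \<longlonglongrightarrow> 0"
        by (rule Lim_null_comparison[OF _ LIMSEQ_inverse_real_of_nat])
          (use X that in \<open>auto simp: polydisc_def inverse_eq_divide less_imp_le\<close>)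
      then show ?thesis by (simp add: LIM_zero_iff)
    qed
    then have "(\<lambda>n. f (X n)) \<longlonglongrightarrow> f x"
      using X x by (intro f) (auto simp: polydisc_def)
    then have "eventually (\<lambda>n. f (X n) \<in> S) sequentially"
      using S x(2) by (rule topological_tendstoD)
    then show False using X by simp
  qed
  then have *: "\<exists>r>0. polydisc N x r \<subseteq> {y \<in> extensional N. f y \<in> S}" if "x \<in> extensional N" "f x \<in> S" for x
    using that by blast
  show "openin (PT N) {x \<in> topspace (PT N). f x \<in> S}"
    unfolding topspace_PT
  proof (subst openin_subopen, intro ballI)
    fix x assume x: "x \<in> {x \<in> extensional N. f x \<in> S}"
    then obtain r where "r > 0" "polydisc N x r \<subseteq> {y \<in> extensional N. f y \<in> S}" using * by blast
    moreover have "openin (PT N) (polydisc N x r)"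
      unfolding polydisc_PiE using N by (simp add: openin_PiE_gen)
    moreover have "x \<in> polydisc N x r" using x \<open>r > 0\<close> by (auto simp: polydisc_def)
    ultimately show "\<exists>T. openin (PT N) T \<and> x \<in> T \<and> T \<subseteq> {x \<in> extensional N. f x \<in> S}" by blast
  qed
qed

lemma continuous_map_PT_seqD:
  fixes f :: "(nat \<Rightarrow> complex) \<Rightarrow> 'b::metric_space"
  assumes N: "finite N" and f: "continuous_map (PT N) euclidean f"
    and X: "\<And>n. X n \<in> extensional N" and x: "x \<in> extensional N"
    and lim: "\<And>k. k \<in> N \<Longrightarrow> (\<lambda>n. X n k) \<longlonglongrightarrow> x k"
  shows "(\<lambda>n. f (X n)) \<longlonglongrightarrow> f x"
proof (rule topological_tendstoI)
  fix S assume S: "open S" "f x \<in> S"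
  then have "openin (PT N) {y \<in> topspace (PT N). f y \<in> S}"
    using f by (auto simp: continuous_map_def)
  then obtain r where r: "r > 0" "polydisc N x r \<subseteq> {y \<in> topspace (PT N). f y \<in> S}"
    by (rule openin_PT_polydisc[OF N]) (use S x in \<open>auto simp: PiE_def\<close>)
  have "eventually (\<lambda>n. \<forall>k\<in>N. dist (X n k) (x k) < r) sequentially"
    using N r lim by (intro eventually_ball_finite) (auto dest: tendstoD)
  then show "eventually (\<lambda>n. f (X n) \<in> S) sequentially"
  proof eventually_elim
    case (elim n)
    then have "X n \<in> polydisc N x r" using X by (auto simp: polydisc_def dist_norm)
    then show ?case using r by auto
  qed
qed

lemma continuous_map_PT_coord: "k \<in> N \<Longrightarrow> continuous_map (PT N) euclidean (\<lambda>x. x k)"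
  by (rule continuous_map_product_projection)

lemma continuous_map_PT_bounded:
  fixes f :: "(nat \<Rightarrow> complex) \<Rightarrow> 'b::real_normed_vector"
  assumes N: "finite N" and f: "continuous_map (PT N) euclidean f"
  obtains C where "C \<ge> 0" "\<And>x. x \<in> extensional N \<Longrightarrow> (\<forall>k\<in>N. cmod (x k) \<le> R) \<Longrightarrow> norm (f x) \<le> C"
proof -
  have "compactin (PT N) (PiE N (\<lambda>_. cball 0 R))" by (simp add: compactin_PiE)
  then have "compact (f ` PiE N (\<lambda>_. cball 0 R))"
    using image_compactin f compactin_euclidean_iff by blast
  then obtain C where "\<forall>y\<in>f ` PiE N (\<lambda>_. cball 0 R). norm y \<le> C"
    using compact_imp_bounded bounded_iff by metis
  then show ?thesis by (intro that[of "max C 0"]) (force simp: PiE_def Pi_def)+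
qed

section \<open>Smooth functions\<close>

lemma Cn_top_eq: "Cn_top n = PT {..<n}"
  by (simp add: Cn_top_def)

lemma PiE_UNIV_extensional [simp]: "PiE I (\<lambda>_. UNIV) = extensional I"
  by (auto simp: PiE_def)

lemma Ck_Suc_iff:
  "Ck n (Suc r) f \<longleftrightarrow> continuous_map (PT {..<n}) euclidean f \<and>
     (\<forall>k<n. \<forall>v\<in>{1, \<i>}.
        (\<forall>z\<in>extensional {..<n}. (\<lambda>t::real. f (z(k := z k + t *\<^sub>R v))) differentiable (at 0)) \<and>
        Ck n r (partial k v f))"
  by (simp only: Ck.simps Cn_top_eq topspace_PT)

declare Ck.simps(2) [simp del]

lemma continuous_map_PT_mult:
  fixes f g :: "(nat \<Rightarrow> complex) \<Rightarrow> complex"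
  assumes "finite N" "continuous_map (PT N) euclidean f" "continuous_map (PT N) euclidean g"
  shows "continuous_map (PT N) euclidean (\<lambda>x. f x * g x)"
  by (rule continuous_map_PT_seqI[OF assms(1)])
    (intro tendsto_mult continuous_map_PT_seqD[OF assms(1,2)] continuous_map_PT_seqD[OF assms(1,3)])

lemma fun_upd_extensional: "k < n \<Longrightarrow> z \<in> extensional {..<n} \<Longrightarrow> z(k := c) \<in> extensional {..<n}"
  by (auto simp: extensional_def)

lemma partial_cong:
  assumes "\<And>z. z \<in> extensional {..<n} \<Longrightarrow> f z = g z" "k < n" "z \<in> extensional {..<n}"
  shows "partial k v f z = partial k v g z"
  unfolding partial_def using assms(1)[OF fun_upd_extensional[OF assms(2,3)]] by simp

lemma Ck_cong:
  assumes "\<And>z. z \<in> extensional {..<n} \<Longrightarrow> f z = g z"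
  shows "Ck n r f = Ck n r g"
  using assms
proof (induction r arbitrary: f g)
  case 0
  have "continuous_map (PT {..<n}) euclidean f = continuous_map (PT {..<n}) euclidean g"
    using 0 by (auto simp: PiE_def intro: continuous_map_eq)
  then show ?case by (simp add: Cn_top_eq)
next
  case (Suc r)
  have "continuous_map (PT {..<n}) euclidean f = continuous_map (PT {..<n}) euclidean g"
    using Suc.prems by (auto simp: PiE_def intro: continuous_map_eq)
  moreover have "Ck n r (partial k v f) = Ck n r (partial k v g)" if "k < n" for k v
    by (rule Suc.IH) (rule partial_cong[OF Suc.prems that])
  moreover have "(\<lambda>t. f (z(k := z k + t *\<^sub>R v))) = (\<lambda>t. g (z(k := z k + t *\<^sub>R v)))"
    if "k < n" "z \<in> extensional {..<n}" for k v z
    by (intro ext Suc.prems fun_upd_extensional that)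
  ultimately show ?case unfolding Ck_Suc_iff by (metis (no_types, lifting))
qed

lemma Ck_cont: "Ck n r f \<Longrightarrow> continuous_map (PT {..<n}) euclidean f"
  by (cases r) (auto simp: Cn_top_eq Ck_Suc_iff)

lemma Ck_SucI:
  assumes "continuous_map (PT {..<n}) euclidean f"
    and "\<And>k v z. k < n \<Longrightarrow> v \<in> {1, \<i>} \<Longrightarrow> z \<in> extensional {..<n} \<Longrightarrow>
           ((\<lambda>t. f (z(k := z k + t *\<^sub>R v))) has_vector_derivative D k v z) (at 0)"
    and "\<And>k v. k < n \<Longrightarrow> v \<in> {1, \<i>} \<Longrightarrow> Ck n r (D k v)"
  shows "Ck n (Suc r) f"
proof -
  have p: "partial k v f z = D k v z" if "k < n" "v \<in> {1, \<i>}" "z \<in> extensional {..<n}" for k v z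
    unfolding partial_def using assms(2)[OF that] by (rule vector_derivative_at)
  have "Ck n r (partial k v f)" if "k < n" "v \<in> {1, \<i>}" for k v
    using assms(3)[OF that] Ck_cong[of n "partial k v f" "D k v"] p[OF that] by blast
  then show ?thesis
    using assms(1,2) unfolding Ck_Suc_iff by (blast intro: differentiableI_vector)
qed

lemma Ck_deriv0:
  assumes "Ck n (Suc r) f" "k < n" "v \<in> {1, \<i>}" "z \<in> extensional {..<n}"
  shows "((\<lambda>t. f (z(k := z k + t *\<^sub>R v))) has_vector_derivative partial k v f z) (at 0)"
  using assms unfolding partial_def vector_derivative_works[symmetric] Ck_Suc_iff by blast

lemma Ck_mono: "Ck n (Suc r) f \<Longrightarrow> Ck n r f"
proof (induction r arbitrary: f)
  case (Suc r)
  have "Ck n r (partial k v f)" if "k < n" "v \<in> {1, \<i>}" for k v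
    using Suc.prems that unfolding Ck_Suc_iff[of n "Suc r"] by (intro Suc.IH) blast
  then show ?case using Suc.prems by (simp add: Ck_Suc_iff)
qed (simp add: Ck_Suc_iff Cn_top_eq)

lemma Ck_const: "Ck n r (\<lambda>_. c)"
proof (induction r arbitrary: c)
  case (Suc r)
  have "partial k v (\<lambda>_. c) = (\<lambda>_. 0)" for k v by (rule ext) (simp add: partial_def)
  then show ?case using Suc by (simp add: Ck_Suc_iff)
qed simp

lemma Ck_add:
  assumes "Ck n r f" "Ck n r g" shows "Ck n r (\<lambda>x. f x + g x)"
  using assms
proof (induction r arbitrary: f g)
  case 0
  then show ?case by (simp add: continuous_map_add)
next
  case (Suc r)
  show ?case
  proof (rule Ck_SucI[where D = "\<lambda>k v z. partial k v f z + partial k v g z"])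
    show "continuous_map (PT {..<n}) euclidean (\<lambda>x. f x + g x)"
      using Suc.prems by (intro continuous_map_add) (auto dest: Ck_cont)
    fix k :: nat and v :: complex assume k: "k < n" "v \<in> {1, \<i>}"
    show "Ck n r (\<lambda>z. partial k v f z + partial k v g z)"
      using Suc.prems k by (intro Suc.IH) (auto simp: Ck_Suc_iff)
    fix z :: "nat \<Rightarrow> complex" assume z: "z \<in> extensional {..<n}"
    show "((\<lambda>t. f (z(k := z k + t *\<^sub>R v)) + g (z(k := z k + t *\<^sub>R v))) has_vector_derivative
           partial k v f z + partial k v g z) (at 0)"
      by (intro has_vector_derivative_add Ck_deriv0[OF Suc.prems(1) k z] Ck_deriv0[OF Suc.prems(2) k z])
  qed
qed

lemma Ck_mult:
  assumes "Ck n r f" "Ck n r g" shows "Ck n r (\<lambda>x. f x * g x)"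
  using assms
proof (induction r arbitrary: f g)
  case 0
  then show ?case by (simp add: Cn_top_eq continuous_map_PT_mult)
next
  case (Suc r)
  show ?case
  proof (rule Ck_SucI[where D = "\<lambda>k v z. f z * partial k v g z + partial k v f z * g z"])
    show "continuous_map (PT {..<n}) euclidean (\<lambda>x. f x * g x)"
      using Suc.prems by (intro continuous_map_PT_mult) (auto dest: Ck_cont)
    fix k :: nat and v :: complex assume k: "k < n" "v \<in> {1, \<i>}"
    show "Ck n r (\<lambda>z. f z * partial k v g z + partial k v f z * g z)"
      using Suc.prems k by (intro Ck_add Suc.IH) (auto simp: Ck_Suc_iff intro: Ck_mono)
    fix z :: "nat \<Rightarrow> complex" assume z: "z \<in> extensional {..<n}"
    show "((\<lambda>t. f (z(k := z k + t *\<^sub>R v)) * g (z(k := z k + t *\<^sub>R v))) has_vector_derivative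
           f z * partial k v g z + partial k v f z * g z) (at 0)"
      using has_vector_derivative_mult[OF Ck_deriv0[OF Suc.prems(1) k z] Ck_deriv0[OF Suc.prems(2) k z]]
      by (simp only: scaleR_zero_left add_0_right fun_upd_triv)
  qed
qed

lemma Ck_prod: "finite A \<Longrightarrow> (\<And>a. a \<in> A \<Longrightarrow> Ck n r (f a)) \<Longrightarrow> Ck n r (\<lambda>x. \<Prod>a\<in>A. f a x)"
  by (induction A rule: finite_induct) (auto simp: Ck_const Ck_mult)

lemma Ck_power: "Ck n r f \<Longrightarrow> Ck n r (\<lambda>x. f x ^ m)"
  by (induction m) (auto simp: Ck_const Ck_mult)

lemma continuous_map_PT_comp:
  "k \<in> N \<Longrightarrow> continuous_on UNIV g \<Longrightarrow> continuous_map (PT N) euclidean (\<lambda>x. g (x k))"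
  using continuous_map_compose[OF continuous_map_PT_coord[of k N], of euclidean g]
  by (simp add: o_def)

lemma Ck_affine:
  assumes "k < n"
  shows "Ck n r (\<lambda>x. of_real (v \<bullet> (x k - c)))"
proof (cases r)
  case 0
  then show ?thesis using assms
    by (auto simp: Cn_top_eq intro!: continuous_map_PT_comp[where g = "\<lambda>y. of_real (v \<bullet> (y - c))"] continuous_intros)
next
  case (Suc r')
  have "Ck n (Suc r') (\<lambda>x. of_real (v \<bullet> (x k - c)))"
  proof (rule Ck_SucI[where D = "\<lambda>k' w z. if k' = k then of_real (v \<bullet> w) else 0"])
    show "continuous_map (PT {..<n}) euclidean (\<lambda>x. complex_of_real (v \<bullet> (x k - c)))"
      using assms by (intro continuous_map_PT_comp[where g = "\<lambda>y. of_real (v \<bullet> (y - c))"] continuous_intros) auto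
    fix k' :: nat and w :: complex and z :: "nat \<Rightarrow> complex"
    have "((\<lambda>t. v \<bullet> (z k + t *\<^sub>R w - c)) has_derivative (\<lambda>t. t * (v \<bullet> w))) (at 0)"
      by (auto intro!: derivative_eq_intros)
    then have "((\<lambda>t. complex_of_real (v \<bullet> (z k + t *\<^sub>R w - c))) has_vector_derivative
        complex_of_real (v \<bullet> w)) (at 0)"
      by (intro has_vector_derivative_of_real) (simp add: has_field_derivative_def mult_commute_abs)
    then show "((\<lambda>t. of_real (v \<bullet> ((z(k' := z k' + t *\<^sub>R w)) k - c))) has_vector_derivative
            (if k' = k then complex_of_real (v \<bullet> w) else 0)) (at 0)"
      by (cases "k' = k") auto
  qed (auto simp: Ck_const)
  then show ?thesis using Suc by simp
qed

subsection \<open>A smooth bump\<close>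

text \<open>For \<open>j = 0\<close> the usual function that is flat at \<open>0\<close>. The derivatives of every \<open>flat j\<close> are combinations of
  members of the family (\<open>flat_DERIV\<close>), so that smoothness is an induction over the order for all \<open>j\<close> at once.\<close>

definition flat :: "nat \<Rightarrow> real \<Rightarrow> real" where
  "flat j t = (if t \<le> 0 then 0 else exp (- 1 / t) / t ^ j)"

lemma power_le_exp: "0 \<le> y \<Longrightarrow> y ^ m \<le> fact m * exp (y::real)"
proof (induction m arbitrary: y)
  case (Suc m)
  define F where "F y = fact (Suc m) * exp y - y ^ Suc m" for y :: real
  have "F 0 \<le> F y"
  proof (rule DERIV_nonneg_imp_nondecreasing[OF \<open>0 \<le> y\<close>])
    fix x :: real assume x: "0 \<le> x" "x \<le> y"
    have "(F has_real_derivative fact (Suc m) * exp x - real (Suc m) * x ^ m) (at x)"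
      unfolding F_def by (auto intro!: derivative_eq_intros simp del: power_Suc)
    moreover have "fact (Suc m) * exp x - real (Suc m) * x ^ m = real (Suc m) * (fact m * exp x - x ^ m)"
      by (simp add: algebra_simps)
    moreover have "\<dots> \<ge> 0" using Suc.IH[of x] x by (intro mult_nonneg_nonneg) auto
    ultimately show "\<exists>d. (F has_real_derivative d) (at x) \<and> 0 \<le> d" by metis
  qed
  moreover have "0 \<le> F 0" by (simp add: F_def)
  ultimately have "0 \<le> F y" by linarith
  then show ?case by (simp only: F_def diff_ge_0_iff_ge)
qed simp

text \<open>Quadratic decay at \<open>0\<close>, which makes all \<open>flat j\<close> differentiable there with derivative \<open>0\<close>.\<close>

lemma flat_bound: "\<bar>flat j t\<bar> \<le> fact (j + 2) * t\<^sup>2"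
proof (cases "t \<le> 0")
  case False
  have "exp (- 1 / t) * (1 / t) ^ (j + 2) \<le> exp (- 1 / t) * (fact (j + 2) * exp (1 / t))"
    using False by (intro mult_left_mono power_le_exp) auto
  also have "\<dots> = fact (j + 2)" by (simp add: exp_minus)
  finally have "exp (- 1 / t) * (1 / t) ^ (j + 2) * t\<^sup>2 \<le> fact (j + 2) * t\<^sup>2"
    by (rule mult_right_mono) simp
  moreover have "exp (- 1 / t) * (1 / t) ^ (j + 2) * t\<^sup>2 = flat j t"
    using False by (simp add: flat_def power_divide power_add power2_eq_square)
  moreover have "flat j t \<ge> 0" using False by (simp add: flat_def)
  ultimately show ?thesis by simp
qed (simp add: flat_def)

lemma flat_DERIV: "(flat j has_real_derivative flat (j + 2) t - real j * flat (j + 1) t) (at t)"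
proof -
  consider "t > 0" | "t < 0" | "t = 0" by linarith
  then show ?thesis
  proof cases
    case 1
    have "((\<lambda>t. exp (- 1 / t)) has_real_derivative exp (- 1 / t) / t\<^sup>2) (at t)"
      using 1 by (auto intro!: derivative_eq_intros simp: power2_eq_square)
    moreover have "((\<lambda>t. inverse t ^ j) has_real_derivative real j * (- 1 / t\<^sup>2 * inverse t ^ (j - 1))) (at t)"
      using 1 by (auto intro!: derivative_eq_intros simp: power2_eq_square divide_inverse)
    ultimately have "((\<lambda>t. exp (- 1 / t) * inverse t ^ j) has_real_derivative
        exp (- 1 / t) / t\<^sup>2 * inverse t ^ j + real j * (- 1 / t\<^sup>2 * inverse t ^ (j - 1)) * exp (- 1 / t)) (at t)"
      by (rule DERIV_mult)
    moreover have "exp (- 1 / t) / t\<^sup>2 * inverse t ^ j + real j * (- 1 / t\<^sup>2 * inverse t ^ (j - 1)) * exp (- 1 / t)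
        = flat (j + 2) t - real j * flat (j + 1) t"
      using 1 by (cases j) (simp_all add: flat_def power_inverse field_simps power2_eq_square)
    ultimately have "((\<lambda>t. exp (- 1 / t) / t ^ j) has_real_derivative flat (j + 2) t - real j * flat (j + 1) t) (at t)"
      by (simp add: divide_inverse power_inverse)
    then show ?thesis
      by (rule has_field_derivative_transform_within_open[of _ _ _ "{0<..}"]) (use 1 in \<open>auto simp: flat_def\<close>)
  next
    case 2
    have "((\<lambda>t. 0) has_real_derivative flat (j + 2) t - real j * flat (j + 1) t) (at t)"
      using 2 by (auto simp: flat_def)
    then show ?thesis
      by (rule has_field_derivative_transform_within_open[of _ _ _ "{..<0}"]) (use 2 in \<open>auto simp: flat_def\<close>)
  next
    case 3
    have "((\<lambda>h. flat j h / h) \<longlongrightarrow> 0) (at 0)"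
    proof (rule Lim_null_comparison)
      show "\<forall>\<^sub>F h in at 0. norm (flat j h / h) \<le> fact (j + 2) * \<bar>h\<bar>"
        unfolding eventually_at_filter
      proof (intro always_eventually allI impI)
        fix h :: real assume "h \<noteq> 0"
        then show "norm (flat j h / h) \<le> fact (j + 2) * \<bar>h\<bar>"
          using flat_bound[of j h] unfolding power2_abs[of h, symmetric]
          by (simp add: divide_le_eq power2_eq_square ac_simps del: abs_mult_self_eq)
      qed
      show "((\<lambda>h::real. fact (j + 2) * \<bar>h\<bar>) \<longlongrightarrow> 0) (at 0)"
        by (auto intro!: tendsto_eq_intros)
    qed
    then show ?thesis using 3 by (simp add: DERIV_def flat_def)
  qed
qed

lemma flat0: "0 \<le> flat 0 t" "flat 0 t \<le> 1" "t > 0 \<Longrightarrow> 0 < flat 0 t" "t \<le> 0 \<Longrightarrow> flat 0 t = 0"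
  by (auto simp: flat_def)

lemma flat0_mono: "s \<le> t \<Longrightarrow> flat 0 s \<le> flat 0 t"
  by (auto simp: flat_def frac_le)

lemma flat_sq_deriv:
  "((\<lambda>t. flat j (\<rho> - (cmod (w + t *\<^sub>R v - c))\<^sup>2)) has_real_derivative
     (flat (j + 2) (\<rho> - (cmod (w - c))\<^sup>2) - real j * flat (j + 1) (\<rho> - (cmod (w - c))\<^sup>2)) * (- 2 * (v \<bullet> (w - c)))) (at 0)"
proof -
  have "((\<lambda>t::real. \<rho> - ((w + t *\<^sub>R v - c) \<bullet> (w + t *\<^sub>R v - c))) has_derivative (\<lambda>h. h * (- 2 * (v \<bullet> (w - c))))) (at 0)"
    by (auto intro!: derivative_eq_intros simp: inner_commute)
  then have "((\<lambda>t::real. \<rho> - (cmod (w + t *\<^sub>R v - c))\<^sup>2) has_real_derivative (- 2 * (v \<bullet> (w - c)))) (at 0)"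
    unfolding mult_commute_abs power2_norm_eq_inner[symmetric] has_field_derivative_def .
  from DERIV_chain2[OF flat_DERIV this] show ?thesis by simp
qed

lemma Ck_flat:
  assumes k: "k < n"
  shows "Ck n r (\<lambda>x. of_real (flat j (\<rho> - (cmod (x k - c))\<^sup>2)))"
proof (induction r arbitrary: j)
  have cf: "continuous_on UNIV (flat j)" for j
    using flat_DERIV by (meson DERIV_isCont continuous_at_imp_continuous_on)
  have cont: "continuous_map (PT {..<n}) euclidean (\<lambda>x. complex_of_real (flat j (\<rho> - (cmod (x k - c))\<^sup>2)))" for j
    using k by (intro continuous_map_PT_comp[where g = "\<lambda>y. of_real (flat j (\<rho> - (cmod (y - c))\<^sup>2))"]
        continuous_intros continuous_on_compose2[OF cf]) auto
  case 0
  then show ?case using cont by (simp add: Cn_top_eq)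
next
  have cf: "continuous_on UNIV (flat j)" for j
    using flat_DERIV by (meson DERIV_isCont continuous_at_imp_continuous_on)
  have cont: "continuous_map (PT {..<n}) euclidean (\<lambda>x. complex_of_real (flat j (\<rho> - (cmod (x k - c))\<^sup>2)))" for j
    using k by (intro continuous_map_PT_comp[where g = "\<lambda>y. of_real (flat j (\<rho> - (cmod (y - c))\<^sup>2))"]
        continuous_intros continuous_on_compose2[OF cf]) auto
  case (Suc r)
  let ?q = "\<lambda>x. \<rho> - (cmod (x k - c))\<^sup>2"
  show ?case
  proof (rule Ck_SucI[where D = "\<lambda>k' v x. if k' = k then (of_real (flat (j + 2) (?q x)) + of_real (- real j) * of_real (flat (j + 1) (?q x))) * (-2 * of_real (v \<bullet> (x k - c))) else 0", OF cont])
    fix k' :: nat and v :: complex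
    have "Ck n r (\<lambda>x. (of_real (flat (j + 2) (?q x)) + of_real (- real j) * of_real (flat (j + 1) (?q x))) * (-2 * of_real (v \<bullet> (x k - c))))"
      by (intro Ck_add Ck_mult Ck_const Ck_affine[OF k] Suc.IH)
    then show "Ck n r (\<lambda>x. if k' = k then (of_real (flat (j + 2) (?q x)) + of_real (- real j) * of_real (flat (j + 1) (?q x))) * (-2 * of_real (v \<bullet> (x k - c))) else 0)"
      by (cases "k' = k") (auto simp: Ck_const)
    fix z :: "nat \<Rightarrow> complex"
    have "((\<lambda>t. complex_of_real (flat j (\<rho> - (cmod (z k + t *\<^sub>R v - c))\<^sup>2))) has_vector_derivative
        of_real ((flat (j + 2) (?q z) - real j * flat (j + 1) (?q z)) * (- 2 * (v \<bullet> (z k - c))))) (at 0)"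
      using flat_sq_deriv[of j \<rho> "z k" v c] by (rule has_vector_derivative_of_real)
    then show "((\<lambda>t. complex_of_real (flat j (?q (z(k' := z k' + t *\<^sub>R v))))) has_vector_derivative
         (if k' = k then (of_real (flat (j + 2) (?q z)) + of_real (- real j) * of_real (flat (j + 1) (?q z))) * (-2 * of_real (v \<bullet> (z k - c))) else 0)) (at 0)"
      by (cases "k' = k") auto
  qed
qed

text \<open>A product over the coordinates instead of a radial bump: it does not depend on the coordinates outside
  \<open>J\<close>, and its support is a polydisc, the shape of the covers above.\<close>

definition bump :: "nat set \<Rightarrow> (nat \<Rightarrow> complex) \<Rightarrow> real \<Rightarrow> (nat \<Rightarrow> complex) \<Rightarrow> real" where
  "bump J c r x = (\<Prod>k\<in>J. flat 0 (r\<^sup>2 - (cmod (x k - c k))\<^sup>2))"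

lemma Ck_bump: "J \<subseteq> {..<n} \<Longrightarrow> Ck n m (\<lambda>x. of_real (bump J c r x))"
  unfolding bump_def of_real_prod using finite_subset[of J "{..<n}"]
  by (intro Ck_prod Ck_flat) auto

lemma bump_01: "0 \<le> bump J c r x" "bump J c r x \<le> 1"
  by (auto simp: bump_def flat0 intro!: prod_nonneg prod_le_1)

lemma bump_pos: "0 < r \<Longrightarrow> (\<And>k. k \<in> J \<Longrightarrow> cmod (x k - c k) < r) \<Longrightarrow> 0 < bump J c r x"
  unfolding bump_def by (intro prod_pos flat0) (auto simp: power_strict_mono)

lemma bump_zero: "finite J \<Longrightarrow> k \<in> J \<Longrightarrow> 0 \<le> r \<Longrightarrow> r \<le> cmod (x k - c k) \<Longrightarrow> bump J c r x = 0"
  unfolding bump_def by (rule prod_zero) (auto intro!: bexI[of _ k] flat0)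

section \<open>Smooth functions with bounded support\<close>

text \<open>Supports are bounded coordinatewise, so that the bounds of a kernel and of a function add up under
  convolution.\<close>

definition box_supp :: "nat set \<Rightarrow> real \<Rightarrow> ((nat \<Rightarrow> complex) \<Rightarrow> complex) \<Rightarrow> bool" where
  "box_supp I R f \<longleftrightarrow> (\<forall>x \<in> extensional I. f x \<noteq> 0 \<longrightarrow> (\<forall>k\<in>I. cmod (x k) \<le> R))"

text \<open>The smooth functions of bounded support on the whole space. Test functions of an open set are among them,
  and so are their convolutions in a block, whose support leaves the open set.\<close>

definition Cc_inf :: "nat \<Rightarrow> ((nat \<Rightarrow> complex) \<Rightarrow> complex) set" where
  "Cc_inf n = {\<phi>. (\<forall>r. Ck n r \<phi>) \<and> (\<exists>R. box_supp {..<n} R \<phi>)}"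

lemma box_sets: "finite N \<Longrightarrow> J \<subseteq> N \<Longrightarrow> {x \<in> extensional N. \<forall>k\<in>J. cmod (x k) \<le> R} \<in> sets (LM N)"
proof -
  assume N: "finite N" "J \<subseteq> N"
  have "{x \<in> extensional N. \<forall>k\<in>J. cmod (x k) \<le> R} = PiE N (\<lambda>k. if k \<in> J then cball 0 R else UNIV)"
    using N by (auto simp: PiE_def Pi_def split: if_splits)
  then show ?thesis using N by (auto intro!: sets_PiM_I_finite)
qed

lemma box_finite: "finite N \<Longrightarrow> emeasure (LM N) {x \<in> extensional N. \<forall>k\<in>N. cmod (x k) \<le> R} < \<infinity>"
proof -
  assume N: "finite N"
  have "{x \<in> extensional N. \<forall>k\<in>N. cmod (x k) \<le> R} = PiE N (\<lambda>k. cball 0 R)"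
    by (auto simp: PiE_def Pi_def)
  then show ?thesis using N
    using emeasure_lborel_cball_finite[of "0::complex" R]
    by (auto simp: LP.emeasure_PiM less_top[symmetric] power_eq_top_ennreal)
qed

lemma integrable_box_supp:
  fixes f :: "(nat \<Rightarrow> complex) \<Rightarrow> 'b::{banach, second_countable_topology}"
  assumes N: "finite N" and f: "f \<in> borel_measurable (LM N)"
    and C: "\<And>x. x \<in> extensional N \<Longrightarrow> norm (f x) \<le> C"
    and s: "\<And>x. x \<in> extensional N \<Longrightarrow> f x \<noteq> 0 \<Longrightarrow> \<forall>k\<in>N. cmod (x k) \<le> R"
  shows "integrable (LM N) f"
proof -
  let ?B = "{x \<in> extensional N. \<forall>k\<in>N. cmod (x k) \<le> R}"
  have "integrable (LM N) (\<lambda>x. C * indicator ?B x)"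
    using box_sets[OF N, of N R] box_finite[OF N, of R] by (intro integrable_mult_right integrable_real_indicator) auto
  then show ?thesis
    by (rule Bochner_Integration.integrable_bound[OF _ f])
      (use C s in \<open>force simp: space_LM indicator_def intro!: AE_I2 order_trans[OF C]\<close>)
qed

lemma Cc_inf_cont: "\<phi> \<in> Cc_inf n \<Longrightarrow> continuous_map (PT {..<n}) euclidean \<phi>"
  by (auto simp: Cc_inf_def dest: Ck_cont)

lemma Cc_inf_Ck: "\<phi> \<in> Cc_inf n \<Longrightarrow> Ck n r \<phi>"
  by (auto simp: Cc_inf_def)

lemma Cc_inf_meas [measurable_dest]: "\<phi> \<in> Cc_inf n \<Longrightarrow> \<phi> \<in> borel_measurable (LM {..<n})"
  by (auto intro: continuous_map_PT_measurable Cc_inf_cont)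

lemma cont_box_supp_bounded:
  assumes "continuous_map (PT {..<n}) euclidean f" "box_supp {..<n} R f"
  obtains C where "C \<ge> 0" "\<And>x. x \<in> extensional {..<n} \<Longrightarrow> cmod (f x) \<le> C"
proof -
  obtain C where C: "C \<ge> 0" "\<And>x. x \<in> extensional {..<n} \<Longrightarrow> (\<forall>k\<in>{..<n}. cmod (x k) \<le> R) \<Longrightarrow> cmod (f x) \<le> C"
    by (rule continuous_map_PT_bounded[OF _ assms(1)]) auto
  show ?thesis
  proof (rule that[OF C(1)])
    fix x :: "nat \<Rightarrow> complex" assume x: "x \<in> extensional {..<n}"
    show "cmod (f x) \<le> C"
      using C(2)[OF x] assms(2) x C(1) by (cases "f x = 0") (auto simp: box_supp_def)
  qed
qed

lemma Cc_inf_bounded: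
  assumes "\<phi> \<in> Cc_inf n"
  obtains C where "C \<ge> 0" "\<And>x. x \<in> extensional {..<n} \<Longrightarrow> cmod (\<phi> x) \<le> C"
  using assms cont_box_supp_bounded[OF Cc_inf_cont[OF assms]] by (auto simp: Cc_inf_def)

lemma integrable_cont_box_supp:
  assumes "continuous_map (PT {..<n}) euclidean f" "box_supp {..<n} R f"
  shows "integrable (LM {..<n}) f"
proof -
  obtain C where C: "\<And>x. x \<in> extensional {..<n} \<Longrightarrow> cmod (f x) \<le> C"
    using cont_box_supp_bounded[OF assms] by metis
  show ?thesis
    by (rule integrable_box_supp[where C = C and R = R])
      (use C assms in \<open>auto simp: box_supp_def intro: continuous_map_PT_measurable\<close>)
qed

lemma Cc_inf_integrable: "\<phi> \<in> Cc_inf n \<Longrightarrow> integrable (LM {..<n}) \<phi>"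
  using integrable_cont_box_supp[OF Cc_inf_cont] by (auto simp: Cc_inf_def)

lemma integrable_sq_cont_box_supp:
  assumes "continuous_map (PT {..<n}) euclidean f" "box_supp {..<n} R f"
  shows "integrable (LM {..<n}) (\<lambda>x. (cmod (f x))\<^sup>2)"
proof -
  obtain C where C: "\<And>x. x \<in> extensional {..<n} \<Longrightarrow> cmod (f x) \<le> C"
    using cont_box_supp_bounded[OF assms] by metis
  have [measurable]: "f \<in> borel_measurable (LM {..<n})" using assms by (auto intro: continuous_map_PT_measurable)
  show ?thesis
    by (rule integrable_box_supp[where C = "C\<^sup>2" and R = R])
      (use C assms in \<open>auto simp: box_supp_def power_mono\<close>)
qed

lemma Cc_inf_sq_integrable: "\<phi> \<in> Cc_inf n \<Longrightarrow> integrable (LM {..<n}) (\<lambda>x. (cmod (\<phi> x))\<^sup>2)"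
  using integrable_sq_cont_box_supp[OF Cc_inf_cont] by (auto simp: Cc_inf_def)

lemma Cc_inf_add: "f \<in> Cc_inf n \<Longrightarrow> g \<in> Cc_inf n \<Longrightarrow> (\<lambda>x. f x + g x) \<in> Cc_inf n"
proof -
  assume f: "f \<in> Cc_inf n" and g: "g \<in> Cc_inf n"
  then obtain R S where R: "box_supp {..<n} R f" and S: "box_supp {..<n} S g" by (auto simp: Cc_inf_def)
  have "box_supp {..<n} (max R S) (\<lambda>x. f x + g x)"
    using R S unfolding box_supp_def by (force simp: le_max_iff_disj)
  then show ?thesis using f g by (auto simp: Cc_inf_def Ck_add)
qed

lemma Cc_inf_mult: "f \<in> Cc_inf n \<Longrightarrow> (\<And>r. Ck n r g) \<Longrightarrow> (\<lambda>x. g x * f x) \<in> Cc_inf n"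
  unfolding Cc_inf_def by (force simp: Ck_mult box_supp_def)

lemma Cc_inf_cmult: "f \<in> Cc_inf n \<Longrightarrow> (\<lambda>x. c * f x) \<in> Cc_inf n"
  by (rule Cc_inf_mult) (auto simp: Ck_const)

lemma Cc_inf_sum: "finite A \<Longrightarrow> (\<And>i. i \<in> A \<Longrightarrow> f i \<in> Cc_inf n) \<Longrightarrow> (\<lambda>x. \<Sum>i\<in>A. f i x) \<in> Cc_inf n"
proof (induction A rule: finite_induct)
  case empty
  show ?case by (auto simp: Cc_inf_def Ck_const box_supp_def)
next
  case (insert a A)
  then show ?case using Cc_inf_add[of "f a" n "\<lambda>x. \<Sum>i\<in>A. f i x"] by simp
qed

lemma Ck_partial: "Ck n (Suc r) f \<Longrightarrow> k < n \<Longrightarrow> v \<in> {1, \<i>} \<Longrightarrow> Ck n r (partial k v f)"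
  unfolding Ck_Suc_iff by blast

text \<open>Only the coordinates in \<open>I\<close> are bounded. Estimates in one block of variables have to be uniform in the
  others.\<close>

definition slab :: "nat \<Rightarrow> nat set \<Rightarrow> real \<Rightarrow> (nat \<Rightarrow> complex) set" where
  "slab n I R = {x \<in> extensional {..<n}. \<forall>k\<in>I. cmod (x k) \<le> R}"

definition slab_supp :: "nat \<Rightarrow> nat set \<Rightarrow> real \<Rightarrow> ((nat \<Rightarrow> complex) \<Rightarrow> complex) \<Rightarrow> bool" where
  "slab_supp n I R f \<longleftrightarrow> (\<forall>x \<in> extensional {..<n}. f x \<noteq> 0 \<longrightarrow> x \<in> slab n I R)"

lemma slab_supp_all: "slab_supp n {..<n} R f \<longleftrightarrow> box_supp {..<n} R f"
  by (auto simp: slab_supp_def box_supp_def slab_def)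

text \<open>The slab is closed: outside of it a function with this support vanishes on a whole piece of each
  coordinate line.\<close>

lemma slab_supp_partial:
  assumes "Ck n (Suc 0) f" "slab_supp n I R f" "k < n" "v \<in> {1, \<i>}"
  shows "slab_supp n I R (partial k v f)"
  unfolding slab_supp_def slab_def
proof (intro ballI impI CollectI conjI)
  fix x j assume x: "x \<in> extensional {..<n}" "partial k v f x \<noteq> 0" and j: "j \<in> I"
  show "cmod (x j) \<le> R"
  proof (rule ccontr)
    assume R: "\<not> cmod (x j) \<le> R"
    define u where "u t = x(k := x k + t *\<^sub>R v)" for t :: real
    define T where "T = {t. R < cmod (u t j)}"
    have "continuous_on UNIV (\<lambda>t. u t j)"
      unfolding u_def by (cases "j = k") (simp_all add: continuous_intros)
    then have "open T" unfolding T_def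
      by (intro open_Collect_less continuous_on_const continuous_on_norm)
    have "u 0 = x" by (simp add: u_def)
    then have "0 \<in> T" using R by (simp add: T_def)
    have f0: "f (u t) = 0" if "t \<in> T" for t
    proof (rule ccontr)
      assume "f (u t) \<noteq> 0"
      moreover have "u t \<in> extensional {..<n}" unfolding u_def by (rule fun_upd_extensional[OF assms(3) x(1)])
      ultimately have "cmod (u t j) \<le> R" using assms(2) j unfolding slab_supp_def slab_def by blast
      then show False using that unfolding T_def by simp
    qed
    have "((\<lambda>t. f (u t)) has_vector_derivative 0) (at 0)"
      by (rule has_vector_derivative_transform_within_open[OF _ \<open>open T\<close> \<open>0 \<in> T\<close>, of "\<lambda>_. 0"])
        (simp_all add: f0)
    then have "partial k v f x = 0" unfolding partial_def u_def by (rule vector_derivative_at)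
    then show False using x by simp
  qed
qed

lemma box_supp_partial:
  "Ck n (Suc 0) f \<Longrightarrow> box_supp {..<n} R f \<Longrightarrow> k < n \<Longrightarrow> v \<in> {1, \<i>} \<Longrightarrow> box_supp {..<n} R (partial k v f)"
  unfolding slab_supp_all[symmetric] by (rule slab_supp_partial)

lemma Cc_inf_partial:
  assumes "f \<in> Cc_inf n" "k < n" "v \<in> {1, \<i>}"
  shows "partial k v f \<in> Cc_inf n"
proof -
  obtain R where R: "box_supp {..<n} R f" using assms(1) by (auto simp: Cc_inf_def)
  have "box_supp {..<n} R (partial k v f)" by (rule box_supp_partial[OF Cc_inf_Ck[OF assms(1)] R assms(2,3)])
  moreover have "Ck n r (partial k v f)" for r by (rule Ck_partial[OF Cc_inf_Ck[OF assms(1)] assms(2,3)])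
  ultimately show ?thesis by (auto simp: Cc_inf_def)
qed

lemma partial_add:
  assumes "Ck n (Suc 0) f" "Ck n (Suc 0) g" "k < n" "v \<in> {1, \<i>}" "z \<in> extensional {..<n}"
  shows "partial k v (\<lambda>x. f x + g x) z = partial k v f z + partial k v g z"
  unfolding partial_def[of k v "\<lambda>x. f x + g x"]
  by (intro vector_derivative_at has_vector_derivative_add
      Ck_deriv0[OF assms(1,3,4,5)] Ck_deriv0[OF assms(2,3,4,5)])

lemma partial_mult:
  assumes "Ck n (Suc 0) f" "Ck n (Suc 0) g" "k < n" "v \<in> {1, \<i>}" "z \<in> extensional {..<n}"
  shows "partial k v (\<lambda>x. f x * g x) z = f z * partial k v g z + partial k v f z * g z"
  unfolding partial_def[of k v "\<lambda>x. f x * g x"]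
  using has_vector_derivative_mult[OF Ck_deriv0[OF assms(1,3,4,5)] Ck_deriv0[OF assms(2,3,4,5)]]
  by (intro vector_derivative_at) (simp only: scaleR_zero_left add_0_right fun_upd_triv)

lemma partial_cmult:
  assumes "Ck n (Suc 0) g" "k < n" "v \<in> {1, \<i>}" "z \<in> extensional {..<n}"
  shows "partial k v (\<lambda>x. c * g x) z = c * partial k v g z"
  using partial_mult[OF Ck_const assms, of c] by (simp add: partial_def)

lemma partial_cnj:
  assumes "Ck n (Suc 0) g" "k < n" "v \<in> {1, \<i>}" "z \<in> extensional {..<n}"
  shows "((\<lambda>t. cnj (g (z(k := z k + t *\<^sub>R v)))) has_vector_derivative cnj (partial k v g z)) (at 0)"
  using has_vector_derivative_cnj[OF Ck_deriv0[OF assms]] by simp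

subsection \<open>Difference quotients\<close>

text \<open>The mean value inequality along a coordinate line.\<close>

lemma line_bound:
  fixes F F' :: "(nat \<Rightarrow> complex) \<Rightarrow> complex"
  assumes "k \<in> I" "z \<in> extensional I"
    and deriv: "\<And>z. z \<in> extensional I \<Longrightarrow> ((\<lambda>t. F (z(k := z k + t *\<^sub>R v))) has_vector_derivative F' z) (at 0)"
    and C: "\<And>z. z \<in> extensional I \<Longrightarrow> cmod (F' z) \<le> C"
  shows "cmod (F (z(k := z k + t *\<^sub>R v)) - F z) \<le> C * \<bar>t\<bar>"
proof -
  let ?u = "\<lambda>t::real. z(k := z k + t *\<^sub>R v)"
  have u: "?u s \<in> extensional I" for s using assms by (auto simp: extensional_def)
  have d: "((\<lambda>t. F (?u t)) has_vector_derivative F' (?u s)) (at s)" for s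
  proof -
    have "((\<lambda>t. F (z(k := z k + (s + t) *\<^sub>R v))) has_vector_derivative F' (?u s)) (at 0)"
      using deriv[OF u[of s]] by (simp add: algebra_simps)
    then have "((\<lambda>t. F (z(k := z k + (s + t) *\<^sub>R v))) \<circ> (\<lambda>t. t - s) has_vector_derivative
        1 *\<^sub>R F' (?u s)) (at s)"
      by (intro vector_diff_chain_at) (auto intro!: derivative_eq_intros)
    then show ?thesis by (simp add: o_def)
  qed
  have "C \<ge> 0" using C[OF u[of 0]] norm_ge_zero order_trans by blast
  have "cmod (F (?u t) - F (?u 0)) \<le> C * norm (t - 0)"
  proof (rule differentiable_bound[of UNIV "\<lambda>t. F (?u t)" "\<lambda>s h. h *\<^sub>R F' (?u s)"])
    show "((\<lambda>t. F (?u t)) has_derivative (\<lambda>h. h *\<^sub>R F' (?u s))) (at s within UNIV)" for s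
      using d[of s] by (simp add: has_vector_derivative_def)
    show "onorm (\<lambda>h. h *\<^sub>R F' (?u s)) \<le> C" for s
      by (rule onorm_bound) (use C[OF u[of s]] \<open>C \<ge> 0\<close> in \<open>auto simp: mult.commute[of C] intro!: mult_left_mono\<close>)
  qed auto
  then show ?thesis by simp
qed

lemma has_vector_derivative_quotient:
  fixes f :: "real \<Rightarrow> complex"
  shows "(f has_vector_derivative D) (at 0) \<longleftrightarrow> ((\<lambda>t. (f t - f 0) /\<^sub>R t) \<longlongrightarrow> D) (at 0)"
proof -
  have "(f t - f 0) /\<^sub>R t - D = (f t - f 0 - t *\<^sub>R D) /\<^sub>R t" if "t \<noteq> 0" for t
    using that by (simp add: scaleR_diff_right)
  then have eq: "norm (f t - f 0 - t *\<^sub>R D) / norm t = norm ((f t - f 0) /\<^sub>R t - D)" if "t \<noteq> 0" for t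
    using that by (simp add: divide_inverse mult.commute)
  have "(f has_vector_derivative D) (at 0) \<longleftrightarrow> ((\<lambda>t. norm (f t - f 0 - t *\<^sub>R D) / norm t) \<longlongrightarrow> 0) (at 0)"
    unfolding has_vector_derivative_def has_derivative_iff_norm by (simp add: bounded_linear_scaleR_left)
  also have "\<dots> \<longleftrightarrow> ((\<lambda>t. norm ((f t - f 0) /\<^sub>R t - D)) \<longlongrightarrow> 0) (at 0)"
    by (rule tendsto_cong, unfold eventually_at_filter, intro always_eventually allI impI eq)
  finally show ?thesis by (simp add: tendsto_norm_zero_iff LIM_zero_iff)
qed

lemma quotient_tendsto:
  fixes f :: "real \<Rightarrow> complex"
  assumes "(f has_vector_derivative D) (at 0)" "s \<longlonglongrightarrow> 0" "\<And>n. s n \<noteq> 0"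
  shows "(\<lambda>n. (f (s n) - f 0) /\<^sub>R s n) \<longlonglongrightarrow> D"
  using assms unfolding has_vector_derivative_quotient tendsto_at_iff_sequentially by (auto simp: o_def)

text \<open>The integrals of the difference quotients vanish by translation invariance and tend to the integral of
  the derivative. This is integration by parts without iterated integrals.\<close>

lemma integral_deriv_zero:
  fixes F F' :: "(nat \<Rightarrow> complex) \<Rightarrow> complex"
  assumes I: "finite I" "k \<in> I" and F: "F \<in> borel_measurable (LM I)"
    and deriv: "\<And>z. z \<in> extensional I \<Longrightarrow> ((\<lambda>t. F (z(k := z k + t *\<^sub>R v))) has_vector_derivative F' z) (at 0)"
    and C: "\<And>z. z \<in> extensional I \<Longrightarrow> cmod (F z) \<le> C" "\<And>z. z \<in> extensional I \<Longrightarrow> cmod (F' z) \<le> C"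
    and R: "box_supp I R F"
  shows "integrable (LM I) F'" "(LINT z|LM I. F' z) = 0"
proof -
  define s where "s n = 1 / real (Suc n)" for n
  have s: "s \<longlonglongrightarrow> 0" "\<And>n. s n \<noteq> 0" "\<And>n. 0 < s n \<and> s n \<le> 1"
    unfolding s_def using LIMSEQ_inverse_real_of_nat by (auto simp: inverse_eq_divide)
  let ?\<tau> = "\<lambda>n. shift {k} (\<lambda>_. s n *\<^sub>R v)"
  define G where "G n z = (F (?\<tau> n z) - F z) /\<^sub>R s n" for n z
  have \<tau>: "?\<tau> n z \<in> extensional I" if "z \<in> extensional I" for n z using that I by auto
  have [measurable]: "(\<lambda>z. F (?\<tau> n z)) \<in> borel_measurable (LM I)" for n
    using measurable_compose[OF measurable_shift[of "{k}" I] F] I by simp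
  have Gm [measurable]: "G n \<in> borel_measurable (LM I)" for n unfolding G_def using F by measurable
  have lim: "(\<lambda>n. G n z) \<longlonglongrightarrow> F' z" if "z \<in> extensional I" for z
    using quotient_tendsto[OF deriv[OF that] s(1,2)] by (simp add: G_def shift_singleton)
  have F'm: "F' \<in> borel_measurable (LM I)"
    by (rule borel_measurable_LIMSEQ_metric[OF Gm]) (use lim in \<open>auto simp: space_LM\<close>)
  \<comment> \<open>The support of all difference quotients: steps are at most \<open>1\<close>, so they move points by at most \<open>\<bar>v\<bar>\<close>.\<close>
  define w where "w z = C * indicator {x \<in> extensional I. \<forall>k\<in>I. cmod (x k) \<le> R + cmod v} z" for z
  have w: "integrable (LM I) w" unfolding w_def
    using box_sets[OF I(1), of I "R + cmod v"] box_finite[OF I(1), of "R + cmod v"] by (intro integrable_mult_right integrable_real_indicator) auto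
  have "(\<lambda>_. undefined) \<in> extensional I" by (auto simp: extensional_def)
  from order_trans[OF norm_ge_zero C(1)[OF this]] have C0: "C \<ge> 0" .
  have b: "cmod (G n z) \<le> w z" if z: "z \<in> extensional I" for n z
  proof (cases "F (?\<tau> n z) = 0 \<and> F z = 0")
    case True
    then show ?thesis using C0 by (simp add: G_def w_def)
  next
    case False
    have "cmod (z j) \<le> R + cmod v" if j: "j \<in> I" for j
    proof (cases "F z = 0")
      case True
      then have *: "cmod (?\<tau> n z j) \<le> R" using False R \<tau>[OF z] j by (auto simp: box_supp_def)
      have "z j = ?\<tau> n z j - (if j = k then s n *\<^sub>R v else 0)" by (auto simp: shift_def)
      then have "cmod (z j) \<le> cmod (?\<tau> n z j) + cmod (if j = k then s n *\<^sub>R v else 0)"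
        by (metis norm_triangle_ineq4)
      also have "cmod (if j = k then s n *\<^sub>R v else 0) \<le> cmod v"
        using s(3)[of n] by (auto simp: mult_left_le_one_le)
      finally show ?thesis using * by simp
    next
      case False
      then show ?thesis using R z j by (force simp: box_supp_def intro: add_increasing2)
    qed
    moreover have "cmod (G n z) = cmod (F (?\<tau> n z) - F z) / s n"
      using s(3)[of n] by (simp add: G_def divide_inverse mult.commute)
    then have "cmod (G n z) \<le> C"
      using line_bound[where F = F and F' = F' and v = v and t = "s n", OF I(2) z deriv C(2)] s(3)[of n]
      by (simp add: shift_singleton pos_divide_le_eq)
    ultimately show ?thesis using z by (simp add: w_def)
  qed
  show "integrable (LM I) F'"
    by (rule integrable_dominated_convergence[where s = G, OF F'm Gm w]) (use lim b in \<open>auto simp: space_LM\<close>)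
  have "(\<lambda>n. LINT z|LM I. G n z) \<longlonglongrightarrow> (LINT z|LM I. F' z)"
    by (rule integral_dominated_convergence[where s = G, OF F'm Gm w]) (use lim b in \<open>auto simp: space_LM\<close>)
  moreover have "(LINT z|LM I. G n z) = 0" for n
  proof -
    have Fi: "integrable (LM I) F" by (rule integrable_box_supp[OF I(1) F C(1)]) (use R in \<open>auto simp: box_supp_def\<close>)
    have "(LINT z|LM I. G n z) = ((LINT z|LM I. F (?\<tau> n z)) - (LINT z|LM I. F z)) /\<^sub>R s n"
      unfolding G_def using Fi integrable_shift[OF I(1) _ Fi, of "{k}"] I
      by (simp add: Bochner_Integration.integral_diff)
    also have "\<dots> = 0" using integral_shift[OF I(1) _ F, of "{k}"] I by simp
    finally show ?thesis .
  qed
  ultimately show "(LINT z|LM I. F' z) = 0" by (simp add: LIMSEQ_const_iff)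
qed

lemma box_supp_shift:
  assumes "box_supp {..<n} R f" "k < n" "cmod c \<le> 1" "x \<in> extensional {..<n}" "f (shift {k} (\<lambda>_. c) x) \<noteq> 0"
    and j: "j < n"
  shows "cmod (x j) \<le> R + 1"
proof -
  have "shift {k} (\<lambda>_. c) x \<in> extensional {..<n}" using assms by auto
  then have *: "cmod (shift {k} (\<lambda>_. c) x j) \<le> R" using assms by (auto simp: box_supp_def)
  show ?thesis
  proof (cases "j = k")
    case True
    have "cmod (x j) \<le> cmod (x j + c) + cmod c" using norm_triangle_ineq4[of "x j + c" c] by simp
    then show ?thesis using * assms(3) True by (simp add: shift_def)
  qed (use * in \<open>simp add: shift_def\<close>)
qed

text \<open>The two properties of difference quotients that dominated convergence asks for.\<close>

lemma C1_quotient: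
  assumes f: "Ck n (Suc 0) f" and R: "box_supp {..<n} R f" and k: "k < n" "v \<in> {1, \<i>}"
  obtains C where "C \<ge> 0"
    "\<And>s x. x \<in> extensional {..<n} \<Longrightarrow> s \<noteq> 0 \<Longrightarrow>
       cmod ((f (shift {k} (\<lambda>_. s *\<^sub>R v) x) - f x) /\<^sub>R s) \<le> C"
    "\<And>s x. x \<in> extensional {..<n} \<Longrightarrow> s \<longlonglongrightarrow> 0 \<Longrightarrow> (\<And>n::nat. s n \<noteq> 0) \<Longrightarrow>
       (\<lambda>n. (f (shift {k} (\<lambda>_. s n *\<^sub>R v) x) - f x) /\<^sub>R s n) \<longlonglongrightarrow> partial k v f x"
proof -
  have c: "Ck n 0 (partial k v f)" by (rule Ck_partial[OF f k])
  obtain C where C: "C \<ge> 0" "\<And>x. x \<in> extensional {..<n} \<Longrightarrow> cmod (partial k v f x) \<le> C"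
    using cont_box_supp_bounded[OF Ck_cont[OF c] box_supp_partial[OF f R k]] by metis
  note d = Ck_deriv0[OF f k]
  show ?thesis
  proof (rule that[OF C(1)])
    fix s :: real and x :: "nat \<Rightarrow> complex" assume x: "x \<in> extensional {..<n}" and s: "s \<noteq> 0"
    have "cmod (f (x(k := x k + s *\<^sub>R v)) - f x) \<le> C * \<bar>s\<bar>"
      by (rule line_bound[where F = f and F' = "partial k v f" and I = "{..<n}"])
        (use k in simp, rule x, rule d, assumption, rule C(2), assumption)
    moreover have "cmod ((f (shift {k} (\<lambda>_. s *\<^sub>R v) x) - f x) /\<^sub>R s)
        = cmod (f (shift {k} (\<lambda>_. s *\<^sub>R v) x) - f x) / \<bar>s\<bar>"
      by (simp add: divide_inverse mult.commute)
    ultimately show "cmod ((f (shift {k} (\<lambda>_. s *\<^sub>R v) x) - f x) /\<^sub>R s) \<le> C"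
      using s by (simp add: shift_singleton pos_divide_le_eq)
  next
    fix s :: "nat \<Rightarrow> real" and x :: "nat \<Rightarrow> complex" assume x: "x \<in> extensional {..<n}" "s \<longlonglongrightarrow> 0" "\<And>n. s n \<noteq> 0"
    show "(\<lambda>n. (f (shift {k} (\<lambda>_. s n *\<^sub>R v) x) - f x) /\<^sub>R s n) \<longlonglongrightarrow> partial k v f x"
      using quotient_tendsto[OF d[OF x(1)] x(2,3)] by (simp add: shift_singleton)
  qed
qed

lemma integrable_mult_bounded:
  fixes f g :: "'a \<Rightarrow> complex"
  assumes "integrable M f" "g \<in> borel_measurable M" "\<And>x. x \<in> space M \<Longrightarrow> cmod (g x) \<le> C"
  shows "integrable M (\<lambda>x. f x * g x)"
  by (rule Bochner_Integration.integrable_bound[where f = "\<lambda>x. C * cmod (f x)"])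
    (use assms in \<open>auto simp: norm_mult mult.commute[of C] intro!: mult_left_mono AE_I2 order_trans[OF _ abs_ge_self]\<close>)

text \<open>Integrating by parts twice would need mixed second derivatives; translating the difference
  quotients needs only first ones.\<close>

lemma integral_partials_swap:
  assumes f: "Ck n (Suc 0) f" "box_supp {..<n} R f" and g: "Ck n (Suc 0) g" "box_supp {..<n} S g"
    and k: "k < n" "v \<in> {1, \<i>}" and l: "l < n" "w \<in> {1, \<i>}"
  shows "(LINT x|LM {..<n}. partial k v f x * partial l w g x)
       = (LINT x|LM {..<n}. partial l w f x * partial k v g x)"
proof -
  let ?M = "LM {..<n}"
  let ?a = "\<lambda>s. shift {k} (\<lambda>_. s *\<^sub>R v)" and ?b = "\<lambda>s. shift {l} (\<lambda>_. s *\<^sub>R w)"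
  have sub: "{k} \<subseteq> {..<n}" "{l} \<subseteq> {..<n}" using k l by auto
  have v: "cmod v = 1" "cmod w = 1" using k l by auto
  note fm = continuous_map_PT_measurable[OF _ Ck_cont[OF f(1)], simplified]
  note gm = continuous_map_PT_measurable[OF _ Ck_cont[OF g(1)], simplified]
  note fi = integrable_cont_box_supp[OF Ck_cont[OF f(1)] f(2)]
  note gi = integrable_cont_box_supp[OF Ck_cont[OF g(1)] g(2)]
  obtain Bf where Bf: "\<And>x. x \<in> extensional {..<n} \<Longrightarrow> cmod (f x) \<le> Bf"
    using cont_box_supp_bounded[OF Ck_cont[OF f(1)] f(2)] by metis
  obtain Bg where Bg: "\<And>x. x \<in> extensional {..<n} \<Longrightarrow> cmod (g x) \<le> Bg"
    using cont_box_supp_bounded[OF Ck_cont[OF g(1)] g(2)] by metis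
  have abm: "?a s \<in> ?M \<rightarrow>\<^sub>M ?M" "?b s \<in> ?M \<rightarrow>\<^sub>M ?M" for s by (rule measurable_shift[OF sub(1)], rule measurable_shift[OF sub(2)])
  define Q where "Q h k u s x = (h (shift {k} (\<lambda>_. s *\<^sub>R u) x) - h x) /\<^sub>R s"
    for h :: "(nat \<Rightarrow> complex) \<Rightarrow> complex" and k :: nat and u :: complex and s :: real and x
  have Qm: "Q h j u s \<in> borel_measurable ?M" if "h \<in> borel_measurable ?M" "j < n" for h j u s
    using that measurable_compose[OF measurable_shift[of "{j}" "{..<n}"] that(1)] unfolding Q_def by simp
  have lim: "(\<lambda>m. LINT x|?M. Q f k v (s m) x * Q g l w (s m) x) \<longlonglongrightarrow> (LINT x|?M. partial k v f x * partial l w g x)"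
    if k: "k < n" "v \<in> {1, \<i>}" and l: "l < n" "w \<in> {1, \<i>}" and s: "s \<longlonglongrightarrow> 0" "\<And>m::nat. s m \<noteq> 0" "\<And>m. \<bar>s m\<bar> \<le> 1"
    for k v l w s
  proof -
    have v: "cmod v = 1" using k by auto
    obtain C where C: "C \<ge> 0" "\<And>s x. x \<in> extensional {..<n} \<Longrightarrow> s \<noteq> 0 \<Longrightarrow> cmod (Q f k v s x) \<le> C"
      "\<And>s x. x \<in> extensional {..<n} \<Longrightarrow> s \<longlonglongrightarrow> 0 \<Longrightarrow> (\<And>n::nat. s n \<noteq> 0) \<Longrightarrow> (\<lambda>n. Q f k v (s n) x) \<longlonglongrightarrow> partial k v f x"
      using C1_quotient[OF f k] unfolding Q_def by blast
    obtain D where D: "D \<ge> 0" "\<And>s x. x \<in> extensional {..<n} \<Longrightarrow> s \<noteq> 0 \<Longrightarrow> cmod (Q g l w s x) \<le> D"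
      "\<And>s x. x \<in> extensional {..<n} \<Longrightarrow> s \<longlonglongrightarrow> 0 \<Longrightarrow> (\<And>n::nat. s n \<noteq> 0) \<Longrightarrow> (\<lambda>n. Q g l w (s n) x) \<longlonglongrightarrow> partial l w g x"
      using C1_quotient[OF g l] unfolding Q_def by blast
    let ?B = "{x \<in> extensional {..<n}. \<forall>k\<in>{..<n}. cmod (x k) \<le> R + 1}"
    have wi: "integrable ?M (\<lambda>x. (C * D) * indicator ?B x)"
      using box_sets[of "{..<n}" "{..<n}" "R + 1"] box_finite[of "{..<n}" "R + 1"]
      by (intro integrable_mult_right integrable_real_indicator) auto
    have meas: "(\<lambda>x. Q f k v (s m) x * Q g l w (s m) x) \<in> borel_measurable ?M" for m
      using Qm[OF fm k(1)] Qm[OF gm l(1)] by measurable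
    have pt: "(\<lambda>m. Q f k v (s m) x * Q g l w (s m) x) \<longlonglongrightarrow> partial k v f x * partial l w g x"
      if "x \<in> extensional {..<n}" for x by (intro tendsto_mult C(3) D(3) s that)
    have bd: "cmod (Q f k v (s m) x * Q g l w (s m) x) \<le> (C * D) * indicator ?B x" if x: "x \<in> extensional {..<n}" for m x
    proof (cases "Q f k v (s m) x = 0")
      case False
      then have "f (shift {k} (\<lambda>_. s m *\<^sub>R v) x) \<noteq> 0 \<or> f x \<noteq> 0" by (auto simp: Q_def)
      moreover have "cmod (s m *\<^sub>R v) \<le> 1" using s(3) v by simp
      ultimately have "x \<in> ?B"
        using box_supp_shift[OF f(2) k(1) _ x] f(2) x unfolding box_supp_def by force
      then show ?thesis using C(2)[OF x s(2)] D(2)[OF x s(2)] C(1) by (simp add: norm_mult mult_mono)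
    qed (use C D in auto)
    show ?thesis
    proof (rule integral_dominated_convergence[where s = "\<lambda>m x. Q f k v (s m) x * Q g l w (s m) x", OF _ meas wi])
      show "(\<lambda>x. partial k v f x * partial l w g x) \<in> borel_measurable ?M"
        by (rule borel_measurable_LIMSEQ_metric[OF meas]) (use pt in \<open>auto simp: space_LM\<close>)
    qed (use pt bd in \<open>auto simp: space_LM\<close>)
  qed
  define s where "s m = 1 / real (Suc m)" for m
  have s: "s \<longlonglongrightarrow> 0" "\<And>n. s n \<noteq> 0" "\<And>n. \<bar>s n\<bar> \<le> 1"
    unfolding s_def using LIMSEQ_inverse_real_of_nat by (auto simp: inverse_eq_divide)
  have ms: "(\<lambda>m. - s m) \<longlonglongrightarrow> 0" using tendsto_minus[OF s(1)] by simp
  \<comment> \<open>Expand both products of quotients into four integrals. Translation by \<open>- t v - t w\<close>, by \<open>- t v\<close> and by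
    \<open>- t w\<close> matches them, at the price of a sign of the step.\<close>
  have eq: "(LINT x|?M. Q f k v t x * Q g l w t x) = (LINT x|?M. Q f l w (-t) x * Q g k v (-t) x)" if t: "t \<noteq> 0" for t
  proof -
    have ig: "integrable ?M (\<lambda>x. f (\<sigma> x) * g (\<tau> x))"
      if "integrable ?M (\<lambda>x. f (\<sigma> x))" "\<tau> \<in> ?M \<rightarrow>\<^sub>M ?M" for \<sigma> \<tau>
      by (rule integrable_mult_bounded[OF that(1) measurable_compose[OF that(2) gm], of Bg])
        (use measurable_space[OF that(2)] Bg in \<open>auto simp: space_LM\<close>)
    note fs = fi integrable_shift[OF finite_lessThan sub(1) fi] integrable_shift[OF finite_lessThan sub(2) fi]
    have idm: "(\<lambda>x. x) \<in> ?M \<rightarrow>\<^sub>M ?M" by simp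
    have sm: "(\<lambda>x. h (?a t x)) \<in> borel_measurable ?M" "(\<lambda>x. h (?b t x)) \<in> borel_measurable ?M"
      if "h \<in> borel_measurable ?M" for h :: "(nat \<Rightarrow> complex) \<Rightarrow> complex" and t
      using measurable_compose[OF abm(1) that] measurable_compose[OF abm(2) that] by auto
    note ii = ig[OF fs(2) abm(2)[of t]] ig[OF fs(2) idm] ig[OF fs(1) abm(2)[of t]] ig[OF fs(1) idm]
      ig[OF fs(3) abm(1)[of "-t"]] ig[OF fs(3) idm] ig[OF fs(1) abm(1)[of "-t"]]
    have e1: "(LINT x|?M. f (?a t x) * g (?b t x)) = (LINT x|?M. f (?b (-t) x) * g (?a (-t) x))"
    proof -
      let ?h = "\<lambda>y. f (?b (-t) y) * g (?a (-t) y)"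
      have hm: "?h \<in> borel_measurable ?M" by (intro borel_measurable_times sm fm gm)
      have "(LINT x|?M. ?h x) = (LINT x|?M. ?h (?a t (?b t x)))"
        using integral_shift[OF _ sub(1) hm, of "\<lambda>_. t *\<^sub>R v"] integral_shift[OF _ sub(2) sm(1)[OF hm, of t], of "\<lambda>_. t *\<^sub>R w"]
        by simp
      also have "(\<lambda>x. ?h (?a t (?b t x))) = (\<lambda>x. f (?a t x) * g (?b t x))"
      proof
        fix x
        have "?b (-t) (?a t (?b t x)) = ?a t x" "?a (-t) (?a t (?b t x)) = ?b t x"
          by (auto simp: shift_def fun_eq_iff)
        then show "?h (?a t (?b t x)) = f (?a t x) * g (?b t x)" by simp
      qed
      finally show ?thesis by simp
    qed
    have e2: "(LINT x|?M. f (?a t x) * g x) = (LINT x|?M. f x * g (?a (-t) x))"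
    proof -
      let ?h = "\<lambda>y. f y * g (?a (-t) y)"
      have hm: "?h \<in> borel_measurable ?M" by (intro borel_measurable_times sm fm gm)
      have "?a (-t) (?a t x) = x" for x by (auto simp: shift_def fun_eq_iff)
      then show ?thesis using integral_shift[OF _ sub(1) hm, of "\<lambda>_. t *\<^sub>R v"] by simp
    qed
    have e3: "(LINT x|?M. f x * g (?b t x)) = (LINT x|?M. f (?b (-t) x) * g x)"
    proof -
      let ?h = "\<lambda>y. f (?b (-t) y) * g y"
      have hm: "?h \<in> borel_measurable ?M" by (intro borel_measurable_times sm fm gm)
      have "?b (-t) (?b t x) = x" for x by (auto simp: shift_def fun_eq_iff)
      then show ?thesis using integral_shift[OF _ sub(2) hm, of "\<lambda>_. t *\<^sub>R w"] by simp
    qed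
    have "Q f k v t x * Q g l w t x = (f (?a t x) * g (?b t x) - f (?a t x) * g x - f x * g (?b t x) + f x * g x) /\<^sub>R (t * t)" for x
      unfolding Q_def by (simp add: algebra_simps)
    then have "(LINT x|?M. Q f k v t x * Q g l w t x) =
       ((LINT x|?M. f (?a t x) * g (?b t x)) - (LINT x|?M. f (?a t x) * g x) - (LINT x|?M. f x * g (?b t x)) + (LINT x|?M. f x * g x)) /\<^sub>R (t * t)"
      using ii by simp
    moreover have "Q f l w (-t) x * Q g k v (-t) x = (f (?b (-t) x) * g (?a (-t) x) - f (?b (-t) x) * g x - f x * g (?a (-t) x) + f x * g x) /\<^sub>R (t * t)" for x
      unfolding Q_def by (simp add: algebra_simps)
    then have "(LINT x|?M. Q f l w (-t) x * Q g k v (-t) x) =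
       ((LINT x|?M. f (?b (-t) x) * g (?a (-t) x)) - (LINT x|?M. f (?b (-t) x) * g x) - (LINT x|?M. f x * g (?a (-t) x)) + (LINT x|?M. f x * g x)) /\<^sub>R (t * t)"
      using ii by simp
    ultimately show ?thesis using e1 e2 e3 by simp
  qed
  have "(\<lambda>m. LINT x|?M. Q f k v (s m) x * Q g l w (s m) x) \<longlonglongrightarrow> (LINT x|?M. partial l w f x * partial k v g x)"
    using lim[OF l k ms] s by (simp add: eq)
  then show ?thesis using lim[OF k l s] LIMSEQ_unique by blast
qed

section \<open>Convolution in a block of variables\<close>

text \<open>Convolution in the variables of \<open>I\<close> with the reflection of \<open>\<kappa>\<close>. The reflection appears because the
  operators act on test functions, as transposes of convolutions with \<open>\<kappa>\<close>.\<close>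

definition conv :: "nat set \<Rightarrow> ((nat \<Rightarrow> complex) \<Rightarrow> complex) \<Rightarrow> ((nat \<Rightarrow> complex) \<Rightarrow> complex) \<Rightarrow> (nat \<Rightarrow> complex) \<Rightarrow> complex" where
  "conv I \<kappa> \<psi> x = (LINT \<zeta>|LM I. \<kappa> \<zeta> * \<psi> (shift I \<zeta> x))"

lemma shift_meas_\<zeta>:
  assumes "I \<subseteq> {..<n}" "x \<in> extensional {..<n}"
  shows "(\<lambda>\<zeta>. shift I \<zeta> x) \<in> LM I \<rightarrow>\<^sub>M LM {..<n}"
proof -
  have "(\<lambda>\<zeta>. (\<zeta>, x)) \<in> LM I \<rightarrow>\<^sub>M LM I \<Otimes>\<^sub>M LM {..<n}"
    using assms by (intro measurable_Pair2') (auto simp: space_LM)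
  from measurable_compose[OF this measurable_shift_pair[OF assms(1)]] show ?thesis by simp
qed

lemma conv_integrand:
  assumes I: "I \<subseteq> {..<n}" and \<kappa>: "integrable (LM I) \<kappa>" and c: "continuous_map (PT {..<n}) euclidean \<psi>"
    and C: "\<And>x. x \<in> extensional {..<n} \<Longrightarrow> cmod (\<psi> x) \<le> C" and x: "x \<in> extensional {..<n}"
  shows "integrable (LM I) (\<lambda>\<zeta>. \<kappa> \<zeta> * \<psi> (shift I \<zeta> x))"
  using shift_extensional[OF I x] C
  by (intro integrable_mult_bounded[OF \<kappa> measurable_compose[OF shift_meas_\<zeta>[OF I x] continuous_map_PT_measurable[OF _ c]], of C]) auto

lemma conv_continuous:
  assumes I: "I \<subseteq> {..<n}" and \<kappa>: "integrable (LM I) \<kappa>" and c: "continuous_map (PT {..<n}) euclidean \<psi>"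
    and C: "\<And>x. x \<in> extensional {..<n} \<Longrightarrow> cmod (\<psi> x) \<le> C"
  shows "continuous_map (PT {..<n}) euclidean (conv I \<kappa> \<psi>)"
proof (rule continuous_map_PT_seqI)
  fix X :: "nat \<Rightarrow> nat \<Rightarrow> complex" and x
  assume X: "\<And>m. X m \<in> extensional {..<n}" and x: "x \<in> extensional {..<n}"
    and lim: "\<And>k. k \<in> {..<n} \<Longrightarrow> (\<lambda>m. X m k) \<longlonglongrightarrow> x k"
  have ci: "integrable (LM I) (\<lambda>\<zeta>. \<kappa> \<zeta> * \<psi> (shift I \<zeta> x))" if "x \<in> extensional {..<n}" for x
    by (rule conv_integrand[OF I \<kappa> c _ that]) (rule C)
  show "(\<lambda>m. conv I \<kappa> \<psi> (X m)) \<longlonglongrightarrow> conv I \<kappa> \<psi> x"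
    unfolding conv_def
  proof (rule integral_dominated_convergence[where w = "\<lambda>\<zeta>. C * cmod (\<kappa> \<zeta>)"])
    show "AE \<zeta> in LM I. (\<lambda>m. \<kappa> \<zeta> * \<psi> (shift I \<zeta> (X m))) \<longlonglongrightarrow> \<kappa> \<zeta> * \<psi> (shift I \<zeta> x)"
    proof (intro AE_I2 tendsto_mult tendsto_const continuous_map_PT_seqD[OF _ c])
      fix \<zeta> k assume "k \<in> {..<n}"
      then show "(\<lambda>m. shift I \<zeta> (X m) k) \<longlonglongrightarrow> shift I \<zeta> x k"
        using lim[of k] by (auto simp: shift_def intro!: tendsto_intros)
    qed (use X x I in auto)
    show "AE \<zeta> in LM I. cmod (\<kappa> \<zeta> * \<psi> (shift I \<zeta> (X m))) \<le> C * cmod (\<kappa> \<zeta>)" for m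
      using C[OF shift_extensional[OF I X]] by (intro AE_I2) (simp add: norm_mult mult.commute[of C] mult_left_mono)
  qed (use \<kappa> ci X x in auto)
qed simp

text \<open>Derivatives in all directions, also in those of \<open>I\<close>, fall on \<open>\<psi>\<close>; an integrable kernel is enough.\<close>

lemma conv_deriv:
  assumes I: "I \<subseteq> {..<n}" and \<kappa>: "integrable (LM I) \<kappa>" and \<psi>: "Ck n (Suc 0) \<psi>" "box_supp {..<n} R \<psi>"
    and k: "k < n" "v \<in> {1, \<i>}" and x: "x \<in> extensional {..<n}"
  shows "((\<lambda>t. conv I \<kappa> \<psi> (x(k := x k + t *\<^sub>R v))) has_vector_derivative conv I \<kappa> (partial k v \<psi>) x) (at 0)"
proof -
  define u where "u t = x(k := x k + t *\<^sub>R v)" for t :: real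
  have u: "u t \<in> extensional {..<n}" for t unfolding u_def by (rule fun_upd_extensional[OF k(1) x])
  have u0: "u 0 = x" by (simp add: u_def)
  have su: "shift I \<zeta> (u t) = shift {k} (\<lambda>_. t *\<^sub>R v) (shift I \<zeta> x)" for \<zeta> t
    by (auto simp: u_def shift_def)
  obtain C where C: "C \<ge> 0"
    "\<And>s x. x \<in> extensional {..<n} \<Longrightarrow> s \<noteq> 0 \<Longrightarrow>
       cmod ((\<psi> (shift {k} (\<lambda>_. s *\<^sub>R v) x) - \<psi> x) /\<^sub>R s) \<le> C"
    "\<And>s x. x \<in> extensional {..<n} \<Longrightarrow> s \<longlonglongrightarrow> 0 \<Longrightarrow> (\<And>n::nat. s n \<noteq> 0) \<Longrightarrow>
       (\<lambda>n. (\<psi> (shift {k} (\<lambda>_. s n *\<^sub>R v) x) - \<psi> x) /\<^sub>R s n) \<longlonglongrightarrow> partial k v \<psi> x"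
    using C1_quotient[OF \<psi> k] by blast
  obtain B where B: "\<And>x. x \<in> extensional {..<n} \<Longrightarrow> cmod (\<psi> x) \<le> B"
    using cont_box_supp_bounded[OF Ck_cont[OF \<psi>(1)] \<psi>(2)] by metis
  have ci: "integrable (LM I) (\<lambda>\<zeta>. \<kappa> \<zeta> * \<psi> (shift I \<zeta> x))" if "x \<in> extensional {..<n}" for x
    by (rule conv_integrand[OF I \<kappa> Ck_cont[OF \<psi>(1)] _ that]) (rule B)
  have key: "(\<lambda>m. (conv I \<kappa> \<psi> (u (s m)) - conv I \<kappa> \<psi> x) /\<^sub>R s m) \<longlonglongrightarrow> conv I \<kappa> (partial k v \<psi>) x"
    if s: "s \<longlonglongrightarrow> 0" "\<And>m::nat. s m \<noteq> 0" for s
  proof -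
    define G where "G m \<zeta> = \<kappa> \<zeta> * ((\<psi> (shift I \<zeta> (u (s m))) - \<psi> (shift I \<zeta> x)) /\<^sub>R s m)" for m \<zeta>
    have G_eq: "G m \<zeta> = (\<kappa> \<zeta> * \<psi> (shift I \<zeta> (u (s m))) - \<kappa> \<zeta> * \<psi> (shift I \<zeta> x)) /\<^sub>R s m" for m \<zeta>
      unfolding G_def by (simp add: algebra_simps)
    have Gm: "G m \<in> borel_measurable (LM I)" for m
      unfolding G_eq using ci[OF u] ci[OF x] by simp
    have pt: "(\<lambda>m. G m \<zeta>) \<longlonglongrightarrow> \<kappa> \<zeta> * partial k v \<psi> (shift I \<zeta> x)" for \<zeta>
      unfolding G_def su by (intro tendsto_mult tendsto_const C(3) s shift_extensional[OF I x])
    have "(\<lambda>m. LINT \<zeta>|LM I. G m \<zeta>) \<longlonglongrightarrow> (LINT \<zeta>|LM I. \<kappa> \<zeta> * partial k v \<psi> (shift I \<zeta> x))"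
    proof (rule integral_dominated_convergence[where s = G, OF _ Gm, where w = "\<lambda>\<zeta>. C * cmod (\<kappa> \<zeta>)"])
      show "(\<lambda>\<zeta>. \<kappa> \<zeta> * partial k v \<psi> (shift I \<zeta> x)) \<in> borel_measurable (LM I)"
        by (rule borel_measurable_LIMSEQ_metric[OF Gm pt])
      show "AE \<zeta> in LM I. cmod (G m \<zeta>) \<le> C * cmod (\<kappa> \<zeta>)" for m
        unfolding G_def su using C(2)[OF shift_extensional[OF I x] s(2)]
        by (intro AE_I2, subst norm_mult, subst mult.commute[of C], intro mult_left_mono) auto
    qed (use \<kappa> pt in auto)
    moreover have "(LINT \<zeta>|LM I. G m \<zeta>) = (conv I \<kappa> \<psi> (u (s m)) - conv I \<kappa> \<psi> x) /\<^sub>R s m" for m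
      unfolding G_eq conv_def using ci[OF u] ci[OF x] by simp
    ultimately show ?thesis by (simp add: conv_def)
  qed
  have "((\<lambda>t. (conv I \<kappa> \<psi> (u t) - conv I \<kappa> \<psi> (u 0)) /\<^sub>R t) \<longlongrightarrow> conv I \<kappa> (partial k v \<psi>) x) (at 0)"
    unfolding tendsto_at_iff_sequentially using key by (auto simp: o_def u0)
  then have "((\<lambda>t. conv I \<kappa> \<psi> (u t)) has_vector_derivative conv I \<kappa> (partial k v \<psi>) x) (at 0)"
    by (simp only: has_vector_derivative_quotient)
  then show ?thesis by (simp only: u_def)
qed

lemma conv_box_supp:
  assumes I: "I \<subseteq> {..<n}" and \<kappa>: "box_supp I S \<kappa>" "S \<ge> 0" and \<psi>: "box_supp {..<n} R \<psi>"
  shows "box_supp {..<n} (R + S) (conv I \<kappa> \<psi>)"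
  unfolding box_supp_def
proof (intro ballI impI)
  fix x k assume x: "x \<in> extensional {..<n}" "conv I \<kappa> \<psi> x \<noteq> 0" and k: "k \<in> {..<n}"
  have "\<not> (\<forall>\<zeta>\<in>space (LM I). \<kappa> \<zeta> * \<psi> (shift I \<zeta> x) = 0)"
    using x(2) unfolding conv_def by (metis (no_types, lifting) Bochner_Integration.integral_cong integral_zero)
  then obtain \<zeta> where \<zeta>: "\<zeta> \<in> extensional I" "\<kappa> \<zeta> \<noteq> 0" "\<psi> (shift I \<zeta> x) \<noteq> 0" by (auto simp: space_LM)
  have *: "cmod (shift I \<zeta> x k) \<le> R" using \<psi> \<zeta>(3) shift_extensional[OF I x(1)] k by (auto simp: box_supp_def)
  show "cmod (x k) \<le> R + S"
  proof (cases "k \<in> I")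
    case True
    then have "cmod (\<zeta> k) \<le> S" using \<kappa> \<zeta> by (auto simp: box_supp_def)
    moreover have "cmod (x k) \<le> cmod (x k + \<zeta> k) + cmod (\<zeta> k)" using norm_triangle_ineq4[of "x k + \<zeta> k" "\<zeta> k"] by simp
    ultimately show ?thesis using * True by (simp add: shift_def)
  qed (use * \<kappa> in \<open>simp add: shift_def\<close>)
qed

lemma conv_cong:
  assumes "I \<subseteq> {..<n}" "x \<in> extensional {..<n}"
    and "\<And>\<zeta>. \<zeta> \<in> extensional I \<Longrightarrow> \<kappa> \<zeta> \<noteq> 0 \<Longrightarrow> f (shift I \<zeta> x) = g (shift I \<zeta> x)"
  shows "conv I \<kappa> f x = conv I \<kappa> g x"
  unfolding conv_def using assms(3) by (intro Bochner_Integration.integral_cong) (auto simp: space_LM)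

lemma conv_Ck:
  assumes I: "I \<subseteq> {..<n}" and \<kappa>: "integrable (LM I) \<kappa>"
  shows "\<psi> \<in> Cc_inf n \<Longrightarrow> Ck n r (conv I \<kappa> \<psi>)"
proof (induction r arbitrary: \<psi>)
  case 0
  obtain C where "\<And>x. x \<in> extensional {..<n} \<Longrightarrow> cmod (\<psi> x) \<le> C" using Cc_inf_bounded[OF 0] by metis
  then have "continuous_map (PT {..<n}) euclidean (conv I \<kappa> \<psi>)"
    by (rule conv_continuous[OF I \<kappa> Cc_inf_cont[OF 0]])
  then show ?case by (simp add: Cn_top_eq)
next
  case (Suc r)
  obtain C where C: "\<And>x. x \<in> extensional {..<n} \<Longrightarrow> cmod (\<psi> x) \<le> C" using Cc_inf_bounded[OF Suc.prems] by metis
  obtain R where R: "box_supp {..<n} R \<psi>" using Suc.prems by (auto simp: Cc_inf_def)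
  show ?case
  proof (rule Ck_SucI[where D = "\<lambda>k v. conv I \<kappa> (partial k v \<psi>)"])
    show "continuous_map (PT {..<n}) euclidean (conv I \<kappa> \<psi>)"
      by (rule conv_continuous[OF I \<kappa> Cc_inf_cont[OF Suc.prems] C])
    show "Ck n r (conv I \<kappa> (partial k v \<psi>))" if "k < n" "v \<in> {1, \<i>}" for k v
      by (rule Suc.IH[OF Cc_inf_partial[OF Suc.prems that]])
    show "((\<lambda>t. conv I \<kappa> \<psi> (z(k := z k + t *\<^sub>R v))) has_vector_derivative conv I \<kappa> (partial k v \<psi>) z) (at 0)"
      if "k < n" "v \<in> {1, \<i>}" "z \<in> extensional {..<n}" for k v z
      by (rule conv_deriv[OF I \<kappa> Cc_inf_Ck[OF Suc.prems] R that])
  qed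
qed

lemma conv_Cc_inf:
  assumes "I \<subseteq> {..<n}" "integrable (LM I) \<kappa>" "box_supp I S \<kappa>" "S \<ge> 0" "\<psi> \<in> Cc_inf n"
  shows "conv I \<kappa> \<psi> \<in> Cc_inf n"
  using conv_Ck[OF assms(1,2,5)] conv_box_supp[OF assms(1,3,4)] assms(5) by (auto simp: Cc_inf_def)

lemma partial_conv:
  assumes "I \<subseteq> {..<n}" "integrable (LM I) \<kappa>" "\<psi> \<in> Cc_inf n" "k < n" "v \<in> {1, \<i>}" "x \<in> extensional {..<n}"
  shows "partial k v (conv I \<kappa> \<psi>) x = conv I \<kappa> (partial k v \<psi>) x"
proof -
  obtain R where R: "box_supp {..<n} R \<psi>" using assms(3) by (auto simp: Cc_inf_def)
  show ?thesis unfolding partial_def[of k v "conv I \<kappa> \<psi>"]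
    by (rule vector_derivative_at[OF conv_deriv[OF assms(1,2) Cc_inf_Ck[OF assms(3)] R assms(4,5,6)]])
qed

text \<open>Young's inequality, restricted to a set \<open>S\<close> of points that is saturated in the variables of the block.
  For \<open>S\<close> a slab in the other variables it localises the norm there.\<close>

lemma conv_L2:
  assumes I: "I \<subseteq> {..<n}" and \<kappa>: "integrable (LM I) \<kappa>" and A: "A > 0" "(LINT \<zeta>|LM I. cmod (\<kappa> \<zeta>)) \<le> A"
    and \<psi>: "\<psi> \<in> Cc_inf n"
    and S: "S \<in> sets (LM {..<n})" "\<And>\<zeta> x. x \<in> extensional {..<n} \<Longrightarrow> shift I \<zeta> x \<in> S \<longleftrightarrow> x \<in> S"
  shows "integrable (LM {..<n}) (\<lambda>x. indicator S x * (cmod (conv I \<kappa> \<psi> x))\<^sup>2)"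
    and "(LINT x|LM {..<n}. indicator S x * (cmod (conv I \<kappa> \<psi> x))\<^sup>2)
          \<le> A\<^sup>2 * (LINT x|LM {..<n}. indicator S x * (cmod (\<psi> x))\<^sup>2)"
proof -
  let ?M = "LM {..<n}"
  have fI: "finite I" using I finite_subset by blast
  obtain C where C: "C \<ge> 0" "\<And>x. x \<in> extensional {..<n} \<Longrightarrow> cmod (\<psi> x) \<le> C" using Cc_inf_bounded[OF \<psi>] by metis
  note \<psi>c = Cc_inf_cont[OF \<psi>]
  have \<psi>m [measurable]: "\<psi> \<in> borel_measurable ?M" using \<psi> by (rule Cc_inf_meas)
  have \<kappa>m [measurable]: "\<kappa> \<in> borel_measurable (LM I)" using \<kappa> by auto
  have Sm [measurable]: "S \<in> sets ?M" by (rule S)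
  have cc: "continuous_map (PT {..<n}) euclidean (conv I \<kappa> \<psi>)" by (rule conv_continuous[OF I \<kappa> \<psi>c C(2)])
  have cm [measurable]: "conv I \<kappa> \<psi> \<in> borel_measurable ?M" by (rule continuous_map_PT_measurable[OF _ cc]) simp
  have pt: "(cmod (conv I \<kappa> \<psi> x))\<^sup>2 \<le> A * (LINT \<zeta>|LM I. cmod (\<kappa> \<zeta>) * (cmod (\<psi> (shift I \<zeta> x)))\<^sup>2)"
    and iB: "integrable (LM I) (\<lambda>\<zeta>. cmod (\<kappa> \<zeta>) * (cmod (\<psi> (shift I \<zeta> x)))\<^sup>2)"
    if x: "x \<in> extensional {..<n}" for x
  proof -
    have sm: "(\<lambda>\<zeta>. \<psi> (shift I \<zeta> x)) \<in> borel_measurable (LM I)"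
      by (rule measurable_compose[OF shift_meas_\<zeta>[OF I x] \<psi>m])
    note Cs = C(2)[OF shift_extensional[OF I x]]
    have im: "integrable (LM I) (\<lambda>\<zeta>. cmod (\<kappa> \<zeta>) * cmod (\<psi> (shift I \<zeta> x)))"
    proof (rule Bochner_Integration.integrable_bound[where f = "\<lambda>\<zeta>. C * cmod (\<kappa> \<zeta>)"])
      show "AE \<zeta> in LM I. norm (cmod (\<kappa> \<zeta>) * cmod (\<psi> (shift I \<zeta> x))) \<le> norm (C * cmod (\<kappa> \<zeta>))"
        using Cs C(1) by (intro AE_I2) (simp add: mult.commute[of C] mult_left_mono)
    qed (use \<kappa> sm in auto)
    show iB: "integrable (LM I) (\<lambda>\<zeta>. cmod (\<kappa> \<zeta>) * (cmod (\<psi> (shift I \<zeta> x)))\<^sup>2)"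
    proof (rule Bochner_Integration.integrable_bound[where f = "\<lambda>\<zeta>. C\<^sup>2 * cmod (\<kappa> \<zeta>)"])
      show "AE \<zeta> in LM I. norm (cmod (\<kappa> \<zeta>) * (cmod (\<psi> (shift I \<zeta> x)))\<^sup>2) \<le> norm (C\<^sup>2 * cmod (\<kappa> \<zeta>))"
        using Cs C(1) by (intro AE_I2) (simp add: mult.commute[of "C\<^sup>2"] mult_left_mono power_mono)
    qed (use \<kappa> sm in auto)
    define m where "m = (LINT \<zeta>|LM I. cmod (\<kappa> \<zeta>) * cmod (\<psi> (shift I \<zeta> x)))"
    define B where "B = (LINT \<zeta>|LM I. cmod (\<kappa> \<zeta>) * (cmod (\<psi> (shift I \<zeta> x)))\<^sup>2)"
    define t where "t = m / A"
    have m: "cmod (conv I \<kappa> \<psi> x) \<le> m"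
      unfolding conv_def m_def using integral_norm_bound[of "LM I" "\<lambda>\<zeta>. \<kappa> \<zeta> * \<psi> (shift I \<zeta> x)"] by (simp add: norm_mult)
    \<comment> \<open>Cauchy-Schwarz for the measure with density \<open>\<bar>\<kappa>\<bar>\<close>: the square at the optimal value \<open>t = m / A\<close>.\<close>
    have "0 \<le> (LINT \<zeta>|LM I. cmod (\<kappa> \<zeta>) * (cmod (\<psi> (shift I \<zeta> x)) - t)\<^sup>2)" by simp
    also have "(\<lambda>\<zeta>. cmod (\<kappa> \<zeta>) * (cmod (\<psi> (shift I \<zeta> x)) - t)\<^sup>2) =
      (\<lambda>\<zeta>. cmod (\<kappa> \<zeta>) * (cmod (\<psi> (shift I \<zeta> x)))\<^sup>2 - 2 * t * (cmod (\<kappa> \<zeta>) * cmod (\<psi> (shift I \<zeta> x))) + t\<^sup>2 * cmod (\<kappa> \<zeta>))"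
      by (auto simp: power2_eq_square algebra_simps)
    also have "(LINT \<zeta>|LM I. \<dots> \<zeta>) = B - 2 * t * m + t\<^sup>2 * (LINT \<zeta>|LM I. cmod (\<kappa> \<zeta>))"
      unfolding B_def m_def using im iB \<kappa> by simp
    also have "\<dots> \<le> B - 2 * t * m + t\<^sup>2 * A" using A by (simp add: mult_left_mono)
    also have "\<dots> = B - m\<^sup>2 / A" using A by (simp add: t_def power2_eq_square field_simps)
    finally have "m\<^sup>2 \<le> A * B" using A by (simp add: field_simps)
    moreover have "(cmod (conv I \<kappa> \<psi> x))\<^sup>2 \<le> m\<^sup>2" using m by (intro power_mono) auto
    ultimately show "(cmod (conv I \<kappa> \<psi> x))\<^sup>2 \<le> A * (LINT \<zeta>|LM I. cmod (\<kappa> \<zeta>) * (cmod (\<psi> (shift I \<zeta> x)))\<^sup>2)"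
      by (simp add: B_def)
  qed
  define W where "W = (LINT x|?M. indicator S x * (cmod (\<psi> x))\<^sup>2)"
  have iW: "integrable ?M (\<lambda>x. indicator S x * (cmod (\<psi> x))\<^sup>2)"
    by (rule Bochner_Integration.integrable_bound[OF Cc_inf_sq_integrable[OF \<psi>]]) (auto simp: indicator_def)
  have W: "(\<integral>\<^sup>+x. ennreal (indicator S x * (cmod (\<psi> x))\<^sup>2) \<partial>?M) = ennreal W"
    unfolding W_def by (rule nn_integral_eq_integral[OF iW]) (auto simp: indicator_def)
  interpret p: pair_sigma_finite "LM I" ?M
    unfolding pair_sigma_finite_def using sigma_finite_LM fI by auto
  have pm: "(\<lambda>(\<zeta>, x). ennreal (cmod (\<kappa> \<zeta>) * (indicator S x * (cmod (\<psi> (shift I \<zeta> x)))\<^sup>2))) \<in> borel_measurable (LM I \<Otimes>\<^sub>M ?M)"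
  proof -
    have [measurable]: "(\<lambda>z. \<psi> (shift I (fst z) (snd z))) \<in> borel_measurable (LM I \<Otimes>\<^sub>M ?M)"
      using measurable_compose[OF measurable_shift_pair[OF I] \<psi>m] by (simp add: case_prod_beta)
    show ?thesis unfolding case_prod_beta by measurable
  qed
  have "(\<integral>\<^sup>+x. ennreal (indicator S x * (cmod (conv I \<kappa> \<psi> x))\<^sup>2) \<partial>?M)
     \<le> (\<integral>\<^sup>+x. ennreal A * (\<integral>\<^sup>+\<zeta>. ennreal (cmod (\<kappa> \<zeta>) * (indicator S x * (cmod (\<psi> (shift I \<zeta> x)))\<^sup>2)) \<partial>LM I) \<partial>?M)"
  proof (rule nn_integral_mono)
    fix x assume "x \<in> space ?M"
    then have x: "x \<in> extensional {..<n}" by (simp add: space_LM)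
    have "(\<integral>\<^sup>+\<zeta>. ennreal (cmod (\<kappa> \<zeta>) * (indicator S x * (cmod (\<psi> (shift I \<zeta> x)))\<^sup>2)) \<partial>LM I)
        = (\<integral>\<^sup>+\<zeta>. ennreal (indicator S x * (cmod (\<kappa> \<zeta>) * (cmod (\<psi> (shift I \<zeta> x)))\<^sup>2)) \<partial>LM I)"
      by (simp add: ac_simps)
    also have "\<dots> = ennreal (LINT \<zeta>|LM I. indicator S x * (cmod (\<kappa> \<zeta>) * (cmod (\<psi> (shift I \<zeta> x)))\<^sup>2))"
      by (rule nn_integral_eq_integral) (use iB[OF x] in auto)
    finally show "ennreal (indicator S x * (cmod (conv I \<kappa> \<psi> x))\<^sup>2) \<le>
      ennreal A * (\<integral>\<^sup>+\<zeta>. ennreal (cmod (\<kappa> \<zeta>) * (indicator S x * (cmod (\<psi> (shift I \<zeta> x)))\<^sup>2)) \<partial>LM I)"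
      using pt[OF x] A by (auto simp: ennreal_mult'[symmetric] indicator_def intro!: ennreal_leI)
  qed
  also have "\<dots> = ennreal A * (\<integral>\<^sup>+x. (\<integral>\<^sup>+\<zeta>. ennreal (cmod (\<kappa> \<zeta>) * (indicator S x * (cmod (\<psi> (shift I \<zeta> x)))\<^sup>2)) \<partial>LM I) \<partial>?M)"
    by (rule nn_integral_cmult, rule p.M1.borel_measurable_nn_integral_fst[of "\<lambda>(x, \<zeta>). _ \<zeta> x", simplified])
      (use pm in \<open>measurable\<close>)
  also have "(\<integral>\<^sup>+x. (\<integral>\<^sup>+\<zeta>. ennreal (cmod (\<kappa> \<zeta>) * (indicator S x * (cmod (\<psi> (shift I \<zeta> x)))\<^sup>2)) \<partial>LM I) \<partial>?M)
      = (\<integral>\<^sup>+\<zeta>. (\<integral>\<^sup>+x. ennreal (cmod (\<kappa> \<zeta>) * (indicator S x * (cmod (\<psi> (shift I \<zeta> x)))\<^sup>2)) \<partial>?M) \<partial>LM I)"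
    using p.Fubini[OF pm] by simp
  also have "\<dots> = (\<integral>\<^sup>+\<zeta>. ennreal (cmod (\<kappa> \<zeta>)) * ennreal W \<partial>LM I)"
  proof (rule nn_integral_cong)
    fix \<zeta> assume "\<zeta> \<in> space (LM I)"
    have "(\<integral>\<^sup>+x. ennreal (cmod (\<kappa> \<zeta>) * (indicator S x * (cmod (\<psi> (shift I \<zeta> x)))\<^sup>2)) \<partial>?M)
       = (\<integral>\<^sup>+x. (\<lambda>y. ennreal (cmod (\<kappa> \<zeta>)) * ennreal (indicator S y * (cmod (\<psi> y))\<^sup>2)) (shift I \<zeta> x) \<partial>?M)"
      using S(2) by (intro nn_integral_cong) (simp add: ennreal_mult' space_LM indicator_def)
    also have "\<dots> = (\<integral>\<^sup>+y. ennreal (cmod (\<kappa> \<zeta>)) * ennreal (indicator S y * (cmod (\<psi> y))\<^sup>2) \<partial>?M)"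
      by (rule nn_integral_shift[OF _ I]) auto
    also have "\<dots> = ennreal (cmod (\<kappa> \<zeta>)) * ennreal W" by (subst nn_integral_cmult) (auto simp: W)
    finally show "(\<integral>\<^sup>+x. ennreal (cmod (\<kappa> \<zeta>) * (indicator S x * (cmod (\<psi> (shift I \<zeta> x)))\<^sup>2)) \<partial>?M)
        = ennreal (cmod (\<kappa> \<zeta>)) * ennreal W" .
  qed
  also have "\<dots> = ennreal (LINT \<zeta>|LM I. cmod (\<kappa> \<zeta>)) * ennreal W"
    using \<kappa> by (subst nn_integral_multc) (auto simp: nn_integral_eq_integral)
  also have "\<dots> \<le> ennreal A * ennreal W" using A by (intro mult_right_mono ennreal_leI) auto
  finally have "(\<integral>\<^sup>+x. ennreal (indicator S x * (cmod (conv I \<kappa> \<psi> x))\<^sup>2) \<partial>?M) \<le> ennreal A * (ennreal A * ennreal W)"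
    by (simp add: mult_left_mono)
  then have fin: "(\<integral>\<^sup>+x. ennreal (indicator S x * (cmod (conv I \<kappa> \<psi> x))\<^sup>2) \<partial>?M) \<le> ennreal (A\<^sup>2 * W)"
    using A by (simp add: ennreal_mult' power2_eq_square mult.assoc)
  show int: "integrable ?M (\<lambda>x. indicator S x * (cmod (conv I \<kappa> \<psi> x))\<^sup>2)"
  proof (rule integrableI_bounded)
    have "(\<integral>\<^sup>+x. ennreal (norm (indicator S x * (cmod (conv I \<kappa> \<psi> x))\<^sup>2)) \<partial>?M) \<le> ennreal (A\<^sup>2 * W)"
      using fin by (simp add: abs_mult)
    then show "(\<integral>\<^sup>+x. ennreal (norm (indicator S x * (cmod (conv I \<kappa> \<psi> x))\<^sup>2)) \<partial>?M) < \<infinity>"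
      by (rule order_le_less_trans) simp
  qed measurable
  have "ennreal (LINT x|?M. indicator S x * (cmod (conv I \<kappa> \<psi> x))\<^sup>2) \<le> ennreal (A\<^sup>2 * W)"
    using fin nn_integral_eq_integral[OF int] by simp
  moreover have "W \<ge> 0" unfolding W_def by simp
  ultimately show "(LINT x|?M. indicator S x * (cmod (conv I \<kappa> \<psi> x))\<^sup>2)
          \<le> A\<^sup>2 * (LINT x|?M. indicator S x * (cmod (\<psi> x))\<^sup>2)"
    by (simp add: W_def ennreal_le_iff)
qed

section \<open>Integrals of radial functions\<close>

text \<open>The function is dominated by the sum of the functions \<open>c k\<close> on the balls of radius \<open>r k\<close>, whose areas
  are proportional to \<open>(r k)\<^sup>2\<close>. With dyadic radii this takes the place of polar coordinates.\<close>

lemma integrable_by_balls: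
  fixes f :: "complex \<Rightarrow> real"
  assumes f: "f \<in> borel_measurable borel" "\<And>z. 0 \<le> f z"
    and c: "\<And>k::nat. 0 \<le> c k" "\<And>k. 0 \<le> r k" "summable (\<lambda>k. c k * (r k)\<^sup>2)"
    and cover: "\<And>z. f z \<noteq> 0 \<Longrightarrow> \<exists>k. cmod z \<le> r k \<and> f z \<le> c k"
  shows "integrable lborel f"
proof (rule integrableI_nonneg)
  have [measurable]: "cball (0::complex) (r k) \<in> sets borel" for k by simp
  have "(\<integral>\<^sup>+z. ennreal (f z) \<partial>lborel) \<le> (\<integral>\<^sup>+(z::complex). (\<Sum>k. ennreal (c k) * indicator (cball 0 (r k)) z) \<partial>lborel)"
  proof (rule nn_integral_mono)
    fix z :: complex
    show "ennreal (f z) \<le> (\<Sum>k. ennreal (c k) * indicator (cball 0 (r k)) z)"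
    proof (cases "f z = 0")
      case False
      then obtain k where k: "cmod z \<le> r k" "f z \<le> c k" using cover by blast
      then have "ennreal (f z) \<le> (\<Sum>j\<in>{k}. ennreal (c j) * indicator (cball 0 (r j)) z)" by (simp add: ennreal_leI)
      also have "\<dots> \<le> (\<Sum>k. ennreal (c k) * indicator (cball 0 (r k)) z)" by (rule sum_le_suminf) auto
      finally show ?thesis .
    qed simp
  qed
  also have "\<dots> = (\<Sum>k. \<integral>\<^sup>+(z::complex). ennreal (c k) * indicator (cball 0 (r k)) z \<partial>lborel)"
    by (rule nn_integral_suminf) measurable
  also have "\<dots> = (\<Sum>k. ennreal (unit_ball_vol 2 * (c k * (r k)\<^sup>2)))"
    using c by (intro suminf_cong) (simp add: nn_integral_cmult emeasure_cball ennreal_mult'[symmetric] ac_simps)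
  also have "\<dots> = ennreal (\<Sum>k. unit_ball_vol 2 * (c k * (r k)\<^sup>2))"
    using c by (intro suminf_ennreal2 summable_mult) auto
  finally show "(\<integral>\<^sup>+z. ennreal (f z) \<partial>lborel) < \<infinity>" by (rule order_le_less_trans) simp
qed (use f in auto)

lemma integrable_norm_powr:
  assumes s: "0 < s" "s < 2" and R: "R > 0"
  shows "integrable lborel (\<lambda>z::complex. indicator (cball 0 R) z * cmod z powr (- s))"
proof (rule integrable_by_balls[where c = "\<lambda>k. (R / 2 ^ Suc k) powr (- s)" and r = "\<lambda>k. R / 2 ^ k"])
  \<comment> \<open>The shell \<open>R / 2 ^ (k + 1) < \<bar>z\<bar> \<le> R / 2 ^ k\<close> contributes a term of a geometric series of ratio
    \<open>2 powr (s - 2)\<close>.\<close>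
  have "(R / 2 ^ Suc k) powr (- s) * (R / 2 ^ k)\<^sup>2 = (R / 2) powr (- s) * R\<^sup>2 * (2 powr (s - 2)) ^ k" for k
  proof -
    have "(R / 2 ^ Suc k) powr (- s) = (R / 2) powr (- s) * (2 powr s) ^ k"
      using R by (simp add: powr_divide powr_minus powr_power powr_realpow[symmetric] powr_powr powr_mult field_simps)
    moreover have "(2 powr (s - 2)) ^ k = (2 powr s) ^ k / (2 ^ k)\<^sup>2"
      by (simp add: powr_diff power_divide power2_eq_square power_mult_distrib[symmetric])
    ultimately show ?thesis by (simp add: power_divide)
  qed
  moreover have "2 powr (s - 2) < 1" using s by (simp add: powr_less_one)
  ultimately show "summable (\<lambda>k. (R / 2 ^ Suc k) powr (- s) * (R / 2 ^ k)\<^sup>2)"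
    by (simp add: summable_mult summable_geometric)
  fix z :: complex assume z: "indicator (cball 0 R) z * cmod z powr (- s) \<noteq> 0"
  then have z: "z \<noteq> 0" "cmod z \<le> R" by (auto simp: indicator_def split: if_splits)
  define P where "P m \<longleftrightarrow> R / 2 ^ m < cmod z" for m
  have "\<exists>m. P m"
  proof -
    obtain m where "R / cmod z < 2 ^ m" using real_arch_pow[of 2 "R / cmod z"] by auto
    then show ?thesis using z by (auto simp: P_def field_simps)
  qed
  then have L: "P (LEAST m. P m)" by (rule LeastI_ex)
  moreover have "\<not> P 0" using z by (simp add: P_def)
  ultimately obtain k where k: "(LEAST m. P m) = Suc k" by (metis not0_implies_Suc)
  have "P (Suc k)" "\<not> P k" using L k not_less_Least[of k P] by auto
  then have *: "R / 2 ^ Suc k < cmod z" "cmod z \<le> R / 2 ^ k" by (auto simp: P_def)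
  have "cmod z powr (- s) \<le> (R / 2 ^ Suc k) powr (- s)"
    using * R s by (intro powr_mono2') auto
  then show "\<exists>k. cmod z \<le> R / 2 ^ k \<and> indicator (cball 0 R) z * cmod z powr (- s) \<le> (R / 2 ^ Suc k) powr (- s)"
    using * z by (intro exI[of _ k]) auto
next
  have [measurable]: "cball (0::complex) R \<in> sets borel" by simp
  show "(\<lambda>z. indicator (cball 0 R) z * cmod z powr (- s)) \<in> borel_measurable borel" by measurable
qed (use R in auto)

lemma integrable_one_plus_norm_powr:
  assumes \<sigma>: "\<sigma> > 1"
  shows "integrable lborel (\<lambda>z::complex. (1 + (cmod z)\<^sup>2) powr (- \<sigma>))"
proof (rule integrable_by_balls[where c = "\<lambda>k. 4 powr \<sigma> * (4 powr (- \<sigma>)) ^ k" and r = "\<lambda>k. 2 ^ k"])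
  \<comment> \<open>Dyadic shells towards infinity; the ratio is \<open>4 powr (1 - \<sigma>)\<close>.\<close>
  have eq: "4 powr \<sigma> * (4 powr (- \<sigma>)) ^ k * (2 ^ k)\<^sup>2 = 4 powr \<sigma> * (4 powr (1 - \<sigma>)) ^ k" for k
  proof -
    have "(4 powr (1 - \<sigma>)) ^ k = (4 powr (- \<sigma>)) ^ k * 4 ^ k"
      unfolding power_mult_distrib[symmetric] by (simp add: powr_diff powr_minus divide_inverse mult.commute)
    moreover have "(2 ^ k)\<^sup>2 = (2\<^sup>2::real) ^ k" by (simp only: power_mult[symmetric] mult.commute)
    ultimately show ?thesis by simp
  qed
  have "4 powr (1 - \<sigma>) < 1" using \<sigma> by (simp add: powr_less_one)
  then show "summable (\<lambda>k. 4 powr \<sigma> * (4 powr (- \<sigma>)) ^ k * (2 ^ k)\<^sup>2)"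
    unfolding eq by (intro summable_mult summable_geometric) simp
  fix z :: complex
  define P where "P m \<longleftrightarrow> cmod z \<le> 2 ^ m" for m
  obtain m where "cmod z < 2 ^ m" using real_arch_pow[of 2 "cmod z"] by auto
  then have "P m" by (simp add: P_def)
  then have "\<exists>m. P m" ..
  then have L: "P (LEAST m. P m)" by (rule LeastI_ex)
  define k where "k = (LEAST m. P m)"
  have "(1 + (cmod z)\<^sup>2) powr (- \<sigma>) \<le> 4 powr \<sigma> * (4 powr (- \<sigma>)) ^ k"
  proof (cases k)
    case 0
    have "(1 + (cmod z)\<^sup>2) powr (- \<sigma>) \<le> 1 powr (- \<sigma>)" using \<sigma> by (intro powr_mono2') auto
    also have "\<dots> \<le> 4 powr \<sigma>" using \<sigma> by (simp add: ge_one_powr_ge_zero)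
    finally show ?thesis using 0 by simp
  next
    case (Suc j)
    then have "\<not> P j" using not_less_Least[of j P] by (simp add: k_def)
    then have "2 ^ j < cmod z" by (simp add: P_def)
    then have "(2 ^ j)\<^sup>2 \<le> (cmod z)\<^sup>2" by (intro power_mono) auto
    moreover have "(2 ^ j)\<^sup>2 = (2\<^sup>2::real) ^ j" by (simp only: power_mult[symmetric] mult.commute)
    ultimately have "4 ^ j \<le> 1 + (cmod z)\<^sup>2" by simp
    then have "(1 + (cmod z)\<^sup>2) powr (- \<sigma>) \<le> (4 ^ j) powr (- \<sigma>)" using \<sigma> by (intro powr_mono2') auto
    also have "(4 ^ j) powr (- \<sigma>) = (4 powr real j) powr (- \<sigma>)" by (simp only: powr_realpow)
    also have "\<dots> = (4 powr (- \<sigma>)) powr real j" by (simp only: powr_powr mult.commute)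
    also have "\<dots> = (4 powr (- \<sigma>)) ^ j" by (rule powr_realpow) simp
    also have "\<dots> = 4 powr \<sigma> * (4 powr (- \<sigma>)) ^ k"
      using Suc by (simp add: powr_minus mult.assoc[symmetric])
    finally show ?thesis .
  qed
  then show "\<exists>k. cmod z \<le> 2 ^ k \<and> (1 + (cmod z)\<^sup>2) powr (- \<sigma>) \<le> 4 powr \<sigma> * (4 powr (- \<sigma>)) ^ k"
    using L by (auto simp: k_def P_def)
qed auto

section \<open>The Bochner-Martinelli kernel and its regularisations\<close>

definition nsq :: "nat set \<Rightarrow> (nat \<Rightarrow> complex) \<Rightarrow> real" where
  "nsq I \<zeta> = (\<Sum>k\<in>I. (cmod (\<zeta> k))\<^sup>2)"

text \<open>For \<open>e = 0\<close> this is the Bochner-Martinelli kernel up to a constant factor. A positive \<open>e\<close> makes it smooth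
  and keeps it a gradient.\<close>

definition bm_kernel :: "nat set \<Rightarrow> real \<Rightarrow> nat \<Rightarrow> (nat \<Rightarrow> complex) \<Rightarrow> complex" where
  "bm_kernel I e i \<zeta> = cnj (\<zeta> i) / of_real ((nsq I \<zeta> + e) ^ card I)"

text \<open>The divergence \<open>\<Sum>\<^sub>i dbar\<^sub>i\<close> of the regularised kernel (\<open>bm_kernel_div\<close>): a point mass smeared out over the
  scale \<open>sqrt e\<close>.\<close>

definition bm_density :: "nat set \<Rightarrow> real \<Rightarrow> (nat \<Rightarrow> complex) \<Rightarrow> real" where
  "bm_density I e \<zeta> = real (card I) * e / (nsq I \<zeta> + e) ^ (card I + 1)"

text \<open>The kernel cut off to a box, to make it integrable and to preserve bounded supports. The cut is not smooth,
  but it is invisible at points and functions that stay in a smaller slab (\<open>conv_bm_cut_eq_kernel\<close>).\<close>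

definition bm_cut :: "nat set \<Rightarrow> real \<Rightarrow> real \<Rightarrow> nat \<Rightarrow> (nat \<Rightarrow> complex) \<Rightarrow> complex" where
  "bm_cut I R e i \<zeta> = (if \<forall>k\<in>I. cmod (\<zeta> k) \<le> R then bm_kernel I e i \<zeta> else 0)"

text \<open>The kernel is homogeneous of degree \<open>1 - 2 card I\<close>. Distributing this degree evenly over the coordinates
  gives the exponents \<open>2 - 1 / card I < 2\<close>, for which every factor is integrable in the plane.\<close>

definition majorant :: "nat set \<Rightarrow> real \<Rightarrow> (nat \<Rightarrow> complex) \<Rightarrow> real" where
  "majorant I R \<zeta> = (\<Prod>k\<in>I. indicator (cball 0 R) (\<zeta> k) * cmod (\<zeta> k) powr (- (2 - 1 / real (card I))))"

lemma nsq_nonneg: "0 \<le> nsq I \<zeta>"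
  by (simp add: nsq_def sum_nonneg)

lemma nsq_ge: "finite I \<Longrightarrow> i \<in> I \<Longrightarrow> (cmod (\<zeta> i))\<^sup>2 \<le> nsq I \<zeta>"
  unfolding nsq_def by (rule member_le_sum) auto

lemma nsq_measurable [measurable]: "nsq I \<in> borel_measurable (LM I)"
  unfolding nsq_def by measurable

lemma bm_kernel_measurable [measurable]: "i \<in> I \<Longrightarrow> bm_kernel I e i \<in> borel_measurable (LM I)"
proof -
  assume [measurable]: "i \<in> I"
  have [measurable]: "cnj \<in> borel_measurable borel" by (intro borel_measurable_continuous_onI continuous_intros)
  show "bm_kernel I e i \<in> borel_measurable (LM I)" unfolding bm_kernel_def nsq_def by measurable
qed

lemma bm_density_measurable [measurable]: "bm_density I e \<in> borel_measurable (LM I)"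
  unfolding bm_density_def by measurable

lemma bm_cut_measurable [measurable]:
  assumes "finite I" "i \<in> I" shows "bm_cut I R e i \<in> borel_measurable (LM I)"
proof -
  have "bm_cut I R e i \<in> borel_measurable (LM I) \<longleftrightarrow>
    (\<lambda>\<zeta>. indicator {\<zeta> \<in> extensional I. \<forall>k\<in>I. cmod (\<zeta> k) \<le> R} \<zeta> *\<^sub>R bm_kernel I e i \<zeta>) \<in> borel_measurable (LM I)"
    by (intro measurable_cong) (auto simp: bm_cut_def space_LM indicator_def)
  then show ?thesis using box_sets[OF assms(1) subset_refl, of R] assms by simp
qed

lemma bm_cut_box_supp: "box_supp I R (bm_cut I R e i)"
  by (auto simp: box_supp_def bm_cut_def)

lemma majorant_integrable:
  assumes "finite I" "I \<noteq> {}" "R > 0"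
  shows "integrable (LM I) (majorant I R)"
  unfolding majorant_def
proof (rule LP.product_integrable_prod[OF assms(1)])
  have "card I \<ge> 1" using assms by (simp add: Suc_leI card_gt_0_iff)
  then have "0 < 2 - 1 / real (card I)" "2 - 1 / real (card I) < 2" by (auto simp: field_simps)
  then show "integrable lborel (\<lambda>z::complex. indicator (cball 0 R) z * cmod z powr (- (2 - 1 / real (card I))))"
    by (rule integrable_norm_powr[OF _ _ assms(3)])
qed

text \<open>The isotropic kernel is dominated by a product of functions of one variable, because each
  \<open>\<bar>\<zeta> k\<bar>\<^sup>2\<close> is at most \<open>nsq I \<zeta> + e\<close>; integrability is then a matter of one variable.\<close>

lemma bm_kernel_le_majorant:
  assumes I: "finite I" "i \<in> I" and e: "e \<ge> 0" and \<zeta>: "\<And>k. k \<in> I \<Longrightarrow> \<zeta> k \<noteq> 0"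
    and R: "\<And>k. k \<in> I \<Longrightarrow> cmod (\<zeta> k) \<le> R"
  shows "cmod (bm_kernel I e i \<zeta>) \<le> majorant I R \<zeta>"
proof -
  define a where "a = real (card I)"
  define \<rho> where "\<rho> = nsq I \<zeta> + e"
  have a: "a \<ge> 1" unfolding a_def using I by (metis One_nat_def Suc_leI card_gt_0_iff empty_iff of_nat_1 of_nat_le_iff)
  have le: "(cmod (\<zeta> k))\<^sup>2 \<le> \<rho>" if "k \<in> I" for k using nsq_ge[OF I(1) that, of \<zeta>] e by (simp add: \<rho>_def)
  then have \<rho>: "\<rho> > 0" using \<zeta>[OF I(2)] le[OF I(2)] by (meson less_le_trans zero_less_norm_iff zero_less_power)
  have "(\<Prod>k\<in>I. (cmod (\<zeta> k))\<^sup>2) \<le> (\<Prod>k\<in>I. \<rho>)" by (intro prod_mono) (use le in auto)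
  then have P: "(\<Prod>k\<in>I. (cmod (\<zeta> k))\<^sup>2) \<le> \<rho> powr a" using \<rho> by (simp add: a_def powr_realpow)
  have "cmod (\<zeta> i) \<le> \<rho> powr (1 / 2)"
    using le[OF I(2)] \<rho> by (simp add: powr_half_sqrt real_le_rsqrt)
  then have "cmod (bm_kernel I e i \<zeta>) \<le> \<rho> powr (1 / 2) / \<rho> powr a"
    using \<rho> unfolding bm_kernel_def \<rho>_def[symmetric] a_def
    by (simp add: norm_divide norm_power powr_realpow divide_right_mono)
  also have "\<dots> = (\<rho> powr a) powr (- (1 - 1 / (2 * a)))"
  proof -
    have "1 / 2 - a = a * (- (1 - 1 / (2 * a)))" using a by (simp add: field_simps)
    then show ?thesis by (simp only: powr_powr powr_diff[symmetric])
  qed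
  also have "\<dots> \<le> (\<Prod>k\<in>I. (cmod (\<zeta> k))\<^sup>2) powr (- (1 - 1 / (2 * a)))"
    using P a \<zeta> by (intro powr_mono2') (auto intro!: prod_pos simp: field_simps)
  also have "\<dots> = (\<Prod>k\<in>I. ((cmod (\<zeta> k))\<^sup>2) powr (- (1 - 1 / (2 * a))))"
    by (rule prod_powr_distrib)
  also have "\<dots> = majorant I R \<zeta>"
    unfolding majorant_def a_def[symmetric]
  proof (rule prod.cong[OF refl])
    fix k assume k: "k \<in> I"
    have "(cmod (\<zeta> k))\<^sup>2 = cmod (\<zeta> k) powr 2" using \<zeta>[OF k] by simp
    then have "((cmod (\<zeta> k))\<^sup>2) powr (- (1 - 1 / (2 * a))) = cmod (\<zeta> k) powr (2 * (- (1 - 1 / (2 * a))))"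
      by (simp only: powr_powr)
    also have "2 * (- (1 - 1 / (2 * a))) = - (2 - 1 / a)" using a by (simp add: field_simps)
    finally show "((cmod (\<zeta> k))\<^sup>2) powr (- (1 - 1 / (2 * a)))
        = indicator (cball 0 R) (\<zeta> k) * cmod (\<zeta> k) powr (- (2 - 1 / a))"
      using R[OF k] by simp
  qed
  finally show ?thesis .
qed

lemma AE_nonzero:
  assumes "finite I"
  shows "AE \<zeta> in LM I. \<forall>k\<in>I. \<zeta> k \<noteq> 0"
proof -
  have "AE \<zeta> in LM I. \<zeta> k \<noteq> 0" if k: "k \<in> I" for k
  proof (rule AE_I)
    let ?Z = "PiE I (\<lambda>j. if j = k then {0} else UNIV) :: (nat \<Rightarrow> complex) set"
    show "{\<zeta> \<in> space (LM I). \<not> \<zeta> k \<noteq> 0} \<subseteq> ?Z" by (auto simp: space_LM PiE_iff extensional_def)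
    show "?Z \<in> sets (LM I)" using assms by (auto intro!: sets_PiM_I_finite)
    show "emeasure (LM I) ?Z = 0"
      using assms k by (subst LP.emeasure_PiM) (auto intro!: prod_zero bexI[of _ k])
  qed
  then show ?thesis using assms by (simp add: AE_finite_all)
qed

lemma bm_cut_le_majorant:
  assumes I: "finite I" "i \<in> I" and e: "e \<ge> 0"
  shows "AE \<zeta> in LM I. cmod (bm_cut I R e i \<zeta>) \<le> majorant I R \<zeta>"
  using AE_nonzero[OF I(1)]
proof eventually_elim
  case (elim \<zeta>)
  have "0 \<le> majorant I R \<zeta>" unfolding majorant_def by (intro prod_nonneg) auto
  then show ?case using bm_kernel_le_majorant[OF I e] elim by (auto simp: bm_cut_def)
qed

lemma bm_cut_integrable:
  assumes "finite I" "i \<in> I" "e \<ge> 0" "R > 0"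
  shows "integrable (LM I) (bm_cut I R e i)"
    and "(LINT \<zeta>|LM I. cmod (bm_cut I R e i \<zeta>)) \<le> (LINT \<zeta>|LM I. majorant I R \<zeta>)"
proof -
  have d: "integrable (LM I) (majorant I R)" using assms by (intro majorant_integrable) auto
  show i: "integrable (LM I) (bm_cut I R e i)"
    by (rule Bochner_Integration.integrable_bound[OF d])
      (use bm_cut_le_majorant[OF assms(1,2,3), of R] assms in \<open>auto elim!: eventually_mono\<close>)
  show "(LINT \<zeta>|LM I. cmod (bm_cut I R e i \<zeta>)) \<le> (LINT \<zeta>|LM I. majorant I R \<zeta>)"
    by (rule integral_mono_AE) (use i d bm_cut_le_majorant[OF assms(1,2,3)] in auto)
qed

lemma bm_cut_tendsto:
  assumes I: "finite I" "i \<in> I" and s: "s \<longlonglongrightarrow> 0"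
  shows "AE \<zeta> in LM I. (\<lambda>m. bm_cut I R (s m) i \<zeta>) \<longlonglongrightarrow> bm_cut I R 0 i \<zeta>"
  using AE_nonzero[OF I(1)]
proof eventually_elim
  case (elim \<zeta>)
  then have "nsq I \<zeta> > 0" using nsq_ge[OF I, of \<zeta>] I by (meson less_le_trans zero_less_norm_iff zero_less_power)
  then have "(\<lambda>m. bm_kernel I (s m) i \<zeta>) \<longlonglongrightarrow> bm_kernel I 0 i \<zeta>"
    unfolding bm_kernel_def using s by (auto intro!: tendsto_eq_intros)
  then show ?case
  proof (cases "\<forall>k\<in>I. cmod (\<zeta> k) \<le> R")
    case False
    then have "bm_cut I R e i \<zeta> = 0" for e unfolding bm_cut_def by (rule if_not_P)
    then show ?thesis by simp
  qed (simp add: bm_cut_def)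
qed

text \<open>Again a product bound: \<open>nsq I \<zeta> + 1\<close> is at least each \<open>1 + \<bar>\<zeta> k\<bar>\<^sup>2\<close>, hence at least their geometric
  mean.\<close>

lemma bm_density_integrable:
  assumes I: "finite I" "I \<noteq> {}"
  shows "integrable (LM I) (bm_density I 1)"
proof -
  define a where "a = real (card I)"
  have a: "a \<ge> 1" unfolding a_def using I by (metis One_nat_def Suc_leI card_gt_0_iff of_nat_1 of_nat_le_iff)
  let ?g = "\<lambda>\<zeta>. a * (\<Prod>k\<in>I. (1 + (cmod (\<zeta> k))\<^sup>2) powr (- (1 + 1 / a)))"
  have "integrable (LM I) (\<lambda>\<zeta>::nat \<Rightarrow> complex. \<Prod>k\<in>I. (1 + (cmod (\<zeta> k))\<^sup>2) powr (- (1 + 1 / a)))"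
    using a by (intro LP.product_integrable_prod[OF I(1)] integrable_one_plus_norm_powr) auto
  then have "integrable (LM I) ?g" by simp
  then show ?thesis
  proof (rule Bochner_Integration.integrable_bound)
    show "AE \<zeta> in LM I. norm (bm_density I 1 \<zeta>) \<le> norm (?g \<zeta>)"
    proof (rule AE_I2)
      fix \<zeta> :: "nat \<Rightarrow> complex"
      define \<rho> where "\<rho> = nsq I \<zeta> + 1"
      have \<rho>: "\<rho> \<ge> 1" using nsq_nonneg[of I \<zeta>] by (simp add: \<rho>_def)
      have "(\<Prod>k\<in>I. 1 + (cmod (\<zeta> k))\<^sup>2) \<le> (\<Prod>k\<in>I. \<rho>)"
        by (intro prod_mono) (use nsq_ge[OF I(1), of _ \<zeta>] in \<open>auto simp: \<rho>_def\<close>)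
      then have P: "(\<Prod>k\<in>I. 1 + (cmod (\<zeta> k))\<^sup>2) \<le> \<rho> powr a" using \<rho> by (simp add: a_def powr_realpow)
      have "bm_density I 1 \<zeta> = a / \<rho> powr (a + 1)"
        using \<rho> by (simp add: bm_density_def \<rho>_def a_def powr_realpow powr_add)
      also have "\<dots> = a * (\<rho> powr a) powr (- (1 + 1 / a))"
      proof -
        have "- (a + 1) = a * (- (1 + 1 / a))" using a by (simp add: field_simps)
        then show ?thesis by (simp only: powr_powr divide_inverse powr_minus[symmetric])
      qed
      also have "\<dots> \<le> a * (\<Prod>k\<in>I. 1 + (cmod (\<zeta> k))\<^sup>2) powr (- (1 + 1 / a))"
      proof (intro mult_left_mono powr_mono2')
        have "0 \<le> 1 / a" using a by simp
        then show "- (1 + 1 / a) \<le> 0" by linarith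
      qed (use P a in \<open>auto intro!: prod_pos simp: add_pos_nonneg\<close>)
      also have "(\<Prod>k\<in>I. 1 + (cmod (\<zeta> k))\<^sup>2) powr (- (1 + 1 / a)) = (\<Prod>k\<in>I. (1 + (cmod (\<zeta> k))\<^sup>2) powr (- (1 + 1 / a)))"
        by (rule prod_powr_distrib)
      finally have "bm_density I 1 \<zeta> \<le> ?g \<zeta>" .
      moreover have "0 \<le> bm_density I 1 \<zeta>" using nsq_nonneg[of I \<zeta>] by (simp add: bm_density_def)
      ultimately show "norm (bm_density I 1 \<zeta>) \<le> norm (?g \<zeta>)" by simp
    qed
  qed simp
qed

subsection \<open>Scaling\<close>

definition scale_by :: "nat set \<Rightarrow> real \<Rightarrow> (nat \<Rightarrow> complex) \<Rightarrow> nat \<Rightarrow> complex" where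
  "scale_by I s \<zeta> = (\<lambda>k\<in>I. s *\<^sub>R \<zeta> k)"

lemma scale_by_measurable [measurable]: "scale_by I s \<in> LM I \<rightarrow>\<^sub>M LM I"
  unfolding scale_by_def by (rule measurable_restrict) auto

text \<open>The Jacobian of a dilation is read off from boxes.\<close>

lemma LM_scale:
  assumes I: "finite I" and s: "s > 0"
  shows "LM I = density (distr (LM I) (LM I) (scale_by I s)) (\<lambda>_. ennreal (s ^ (2 * card I)))"
proof (rule LP.PiM_eqI[OF I, symmetric])
  fix A :: "nat \<Rightarrow> complex set" assume A: "\<And>i. i \<in> I \<Longrightarrow> A i \<in> sets lborel"
  have B: "(\<lambda>z. s *\<^sub>R z) -` A i \<in> sets lborel" if "i \<in> I" for i
  proof -
    have "(\<lambda>z::complex. s *\<^sub>R z) \<in> lborel \<rightarrow>\<^sub>M lborel" by measurable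
    from measurable_sets[OF this A[OF that]] show ?thesis by simp
  qed
  have sc: "emeasure lborel (A i) = ennreal (s\<^sup>2) * emeasure lborel ((\<lambda>z. s *\<^sub>R z) -` A i)" if i: "i \<in> I" for i
  proof -
    have "emeasure lborel (A i) = emeasure (density (distr lborel borel (\<lambda>z::complex. 0 + s *\<^sub>R z)) (\<lambda>_. ennreal (\<bar>s\<bar> ^ DIM(complex)))) (A i)"
      using lborel_affine[of s "0::complex"] s by simp
    also have "\<dots> = ennreal (s\<^sup>2) * emeasure lborel ((\<lambda>z. s *\<^sub>R z) -` A i)"
      using s A[OF i] by (simp add: emeasure_density_const emeasure_distr)
    finally show ?thesis .
  qed
  have PA: "Pi\<^sub>E I A \<in> sets (LM I)" using A I by (auto intro!: sets_PiM_I_finite)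
  have "scale_by I s -` Pi\<^sub>E I A \<inter> space (LM I) = Pi\<^sub>E I (\<lambda>i. (\<lambda>z. s *\<^sub>R z) -` A i)"
    by (auto simp: scale_by_def space_LM PiE_iff extensional_def)
  then have "emeasure (density (distr (LM I) (LM I) (scale_by I s)) (\<lambda>_. ennreal (s ^ (2 * card I)))) (Pi\<^sub>E I A)
     = ennreal (s ^ (2 * card I)) * emeasure (LM I) (Pi\<^sub>E I (\<lambda>i. (\<lambda>z. s *\<^sub>R z) -` A i))"
    using PA by (simp add: emeasure_density_const emeasure_distr)
  also have "\<dots> = (\<Prod>i\<in>I. ennreal (s\<^sup>2)) * (\<Prod>i\<in>I. emeasure lborel ((\<lambda>z. s *\<^sub>R z) -` A i))"
    using B I s by (simp add: LP.emeasure_PiM ennreal_power power_mult)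
  also have "\<dots> = (\<Prod>i\<in>I. emeasure lborel (A i))"
    unfolding prod.distrib[symmetric] using sc by (intro prod.cong) auto
  finally show "emeasure (density (distr (LM I) (LM I) (scale_by I s)) (\<lambda>_. ennreal (s ^ (2 * card I)))) (Pi\<^sub>E I A) = (\<Prod>i\<in>I. emeasure lborel (A i))" .
qed simp

text \<open>Dilation by \<open>s\<close> turns the density with parameter \<open>1\<close> into the one with parameter \<open>s\<^sup>2\<close>, so the total mass
  does not depend on the parameter.\<close>

lemma bm_density_scale:
  assumes I: "finite I" "I \<noteq> {}" and s: "s > 0"
  shows "s ^ (2 * card I) * bm_density I (s\<^sup>2) (scale_by I s \<zeta>) = bm_density I 1 \<zeta>"
proof -
  have "nsq I (scale_by I s \<zeta>) = s\<^sup>2 * nsq I \<zeta>"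
    unfolding nsq_def scale_by_def sum_distrib_left using s by (intro sum.cong) (auto simp: power_mult_distrib)
  then have "nsq I (scale_by I s \<zeta>) + s\<^sup>2 = s\<^sup>2 * (nsq I \<zeta> + 1)" by (simp add: algebra_simps)
  moreover define q where "q = nsq I \<zeta> + 1"
  moreover have "q > 0" using nsq_nonneg[of I \<zeta>] by (simp add: q_def)
  moreover have "(s\<^sup>2 * q) ^ (card I + 1) = s ^ (2 * card I) * s\<^sup>2 * q ^ (card I + 1)"
    by (simp add: power_mult_distrib power_mult)
  ultimately show ?thesis using s by (simp add: bm_density_def del: power_Suc)
qed

lemma bm_density_integral_scale:
  fixes f :: "(nat \<Rightarrow> complex) \<Rightarrow> complex"
  assumes I: "finite I" "I \<noteq> {}" and s: "s > 0" and f: "f \<in> borel_measurable (LM I)"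
  shows "(LINT \<zeta>|LM I. of_real (bm_density I (s\<^sup>2) \<zeta>) * f \<zeta>) = (LINT \<zeta>|LM I. of_real (bm_density I 1 \<zeta>) * f (scale_by I s \<zeta>))"
proof -
  let ?h = "\<lambda>\<zeta>. complex_of_real (bm_density I (s\<^sup>2) \<zeta>) * f \<zeta>"
  have hm: "?h \<in> borel_measurable (LM I)" using f by measurable
  have "(LINT \<zeta>|LM I. ?h \<zeta>) = (LINT \<zeta>|density (distr (LM I) (LM I) (scale_by I s)) (\<lambda>_. ennreal (s ^ (2 * card I))). ?h \<zeta>)"
    using LM_scale[OF I(1) s] by simp
  also have "\<dots> = (LINT \<zeta>|LM I. (s ^ (2 * card I)) *\<^sub>R ?h (scale_by I s \<zeta>))"
    using hm s by (subst integral_density) (auto simp: integral_distr)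
  also have "\<dots> = (LINT \<zeta>|LM I. of_real (bm_density I 1 \<zeta>) * f (scale_by I s \<zeta>))"
    unfolding bm_density_scale[OF I s, symmetric] by (simp add: scaleR_conv_of_real mult.assoc)
  finally show ?thesis .
qed

lemma bm_density_integrable_eps:
  assumes I: "finite I" "I \<noteq> {}" and e: "e > 0"
  shows "integrable (LM I) (bm_density I e)" "(LINT \<zeta>|LM I. bm_density I e \<zeta>) = (LINT \<zeta>|LM I. bm_density I 1 \<zeta>)"
proof -
  define s where "s = sqrt e"
  have s: "s > 0" "s\<^sup>2 = e" using e by (auto simp: s_def)
  have m: "bm_density I e \<in> borel_measurable (LM I)" by measurable
  have "integrable (LM I) (\<lambda>\<zeta>. s ^ (2 * card I) *\<^sub>R bm_density I e (scale_by I s \<zeta>))"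
    using bm_density_integrable[OF I] bm_density_scale[OF I s(1)] by (simp add: s(2))
  then show "integrable (LM I) (bm_density I e)"
    using s m by (subst LM_scale[OF I(1) s(1)], subst integrable_density) (auto simp: integrable_distr_eq)
  have "complex_of_real (LINT \<zeta>|LM I. bm_density I e \<zeta>) = complex_of_real (LINT \<zeta>|LM I. bm_density I 1 \<zeta>)"
    using bm_density_integral_scale[OF I s(1), of "\<lambda>_. 1"] by (simp add: s(2))
  then show "(LINT \<zeta>|LM I. bm_density I e \<zeta>) = (LINT \<zeta>|LM I. bm_density I 1 \<zeta>)" by (simp only: of_real_eq_iff)
qed

text \<open>The mass is the constant by which the kernel is divided to normalise it.\<close>

lemma bm_density_integral_pos:
  assumes I: "finite I" "I \<noteq> {}"
  shows "(LINT \<zeta>|LM I. bm_density I 1 \<zeta>) > 0"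
proof -
  have pos: "bm_density I 1 \<zeta> > 0" for \<zeta>
    using nsq_nonneg[of I \<zeta>] I by (simp add: bm_density_def card_gt_0_iff add_nonneg_pos)
  have "emeasure (LM I) (space (LM I)) \<noteq> 0"
    unfolding space_PiM using I by (subst LP.emeasure_PiM) auto
  then have "\<not> (AE \<zeta> in LM I. bm_density I 1 \<zeta> = 0)"
    using pos by (simp add: AE_iff_null null_sets_def less_le)
  then show ?thesis
    using integral_nonneg_eq_0_iff_AE[OF bm_density_integrable[OF I]] pos
      Bochner_Integration.integral_nonneg[of "LM I" "bm_density I 1"]
    by (auto simp: less_le)
qed

subsection \<open>Divergence and curl of the regularised kernel\<close>

text \<open>The derivative of \<open>bm_kernel I e i\<close> in the real direction \<open>v\<close> of the coordinate \<open>l\<close>, by the quotient rule;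
  the derivative of \<open>nsq I\<close> in this direction is \<open>2 (v \<bullet> \<zeta> l)\<close>.\<close>

definition bm_kernel_deriv :: "nat set \<Rightarrow> real \<Rightarrow> nat \<Rightarrow> nat \<Rightarrow> complex \<Rightarrow> (nat \<Rightarrow> complex) \<Rightarrow> complex" where
  "bm_kernel_deriv I e i l v \<zeta> = (if l = i then cnj v else 0) / of_real ((nsq I \<zeta> + e) ^ card I)
     - cnj (\<zeta> i) * of_real (real (card I) * (2 * (v \<bullet> \<zeta> l)) / (nsq I \<zeta> + e) ^ (card I + 1))"

lemma bm_kernel_has_derivative:
  assumes I: "finite I" "i \<in> I" "l \<in> I" and e: "e > 0"
  shows "((\<lambda>t. bm_kernel I e i (\<zeta>(l := \<zeta> l + t *\<^sub>R v))) has_vector_derivative bm_kernel_deriv I e i l v \<zeta>) (at 0)"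
proof -
  define a where "a = card I"
  define c where "c = (\<Sum>k\<in>I - {l}. (cmod (\<zeta> k))\<^sup>2) + e"
  define \<rho> where "\<rho> t = (\<zeta> l + t *\<^sub>R v) \<bullet> (\<zeta> l + t *\<^sub>R v) + c" for t
  define w where "w t = (if l = i then \<zeta> i + t *\<^sub>R v else \<zeta> i)" for t
  have c: "c > 0" using e by (auto simp: c_def intro!: add_nonneg_pos sum_nonneg)
  have \<rho>pos: "\<rho> t > 0" for t using c by (simp add: \<rho>_def add_nonneg_pos)
  have ns: "nsq I (\<zeta>(l := z)) + e = (cmod z)\<^sup>2 + c" for z
  proof -
    have "nsq I (\<zeta>(l := z)) = (cmod z)\<^sup>2 + (\<Sum>k\<in>I - {l}. (cmod ((\<zeta>(l := z)) k))\<^sup>2)"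
      unfolding nsq_def using I by (subst sum.remove[OF I(1,3)]) simp
    also have "(\<Sum>k\<in>I - {l}. (cmod ((\<zeta>(l := z)) k))\<^sup>2) = (\<Sum>k\<in>I - {l}. (cmod (\<zeta> k))\<^sup>2)"
      by (intro sum.cong) auto
    finally show ?thesis by (simp only: c_def add.assoc)
  qed
  have keq: "bm_kernel I e i (\<zeta>(l := \<zeta> l + t *\<^sub>R v)) = cnj (w t) * of_real (1 / \<rho> t ^ a)" for t
    unfolding bm_kernel_def ns \<rho>_def power2_norm_eq_inner a_def w_def by (cases "l = i") (simp_all add: divide_inverse)
  have \<rho>0: "\<rho> 0 = nsq I \<zeta> + e" using ns[of "\<zeta> l"] by (simp add: \<rho>_def power2_norm_eq_inner)
  have "(\<rho> has_derivative (\<lambda>h. h * (2 * (v \<bullet> \<zeta> l)))) (at 0)"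
    unfolding \<rho>_def by (auto intro!: derivative_eq_intros simp: inner_commute)
  then have d\<rho>: "(\<rho> has_real_derivative 2 * (v \<bullet> \<zeta> l)) (at 0)"
    unfolding has_field_derivative_def mult_commute_abs .
  have a: "a \<ge> 1" unfolding a_def using I by (metis One_nat_def Suc_leI card_gt_0_iff empty_iff)
  have "((\<lambda>t. 1 / \<rho> t ^ a) has_real_derivative
      - (real a * (2 * (v \<bullet> \<zeta> l) * \<rho> 0 ^ (a - Suc 0))) / (\<rho> 0 ^ a * \<rho> 0 ^ a)) (at 0)"
    using \<rho>pos[of 0] by (auto intro!: derivative_eq_intros d\<rho>)
  moreover have "- (real a * (2 * (v \<bullet> \<zeta> l) * \<rho> 0 ^ (a - Suc 0))) / (\<rho> 0 ^ a * \<rho> 0 ^ a)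
     = - (real a * (2 * (v \<bullet> \<zeta> l)) / \<rho> 0 ^ (a + 1))"
    using \<rho>pos[of 0] a by (cases a) (simp_all add: field_simps)
  ultimately have dr: "((\<lambda>t. complex_of_real (1 / \<rho> t ^ a)) has_vector_derivative
      of_real (- (real a * (2 * (v \<bullet> \<zeta> l)) / \<rho> 0 ^ (a + 1)))) (at 0)"
    by (intro has_vector_derivative_of_real) simp
  have "(w has_vector_derivative (if l = i then v else 0)) (at 0)"
    unfolding w_def has_vector_derivative_def by (cases "l = i") (auto intro!: derivative_eq_intros)
  from has_vector_derivative_mult[OF has_vector_derivative_cnj[OF this] dr]
  have "((\<lambda>t. cnj (w t) * of_real (1 / \<rho> t ^ a)) has_vector_derivative bm_kernel_deriv I e i l v \<zeta>) (at 0)"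
    by (rule back_subst[where P = "\<lambda>d. (_ has_vector_derivative d) _"])
      (simp add: bm_kernel_deriv_def \<rho>0 a_def w_def divide_inverse)
  then show ?thesis by (simp only: keq)
qed

lemma bm_kernel_bound:
  assumes I: "finite I" "i \<in> I" and e: "e > 0" and R: "cmod (\<zeta> i) \<le> R"
  shows "cmod (bm_kernel I e i \<zeta>) \<le> R / e ^ card I"
proof -
  have "e ^ card I \<le> (nsq I \<zeta> + e) ^ card I" using e nsq_nonneg[of I \<zeta>] by (intro power_mono) auto
  then show ?thesis unfolding bm_kernel_def norm_divide norm_of_real complex_mod_cnj
    using e R order_trans[OF norm_ge_zero R] by (intro frac_le) auto
qed

lemma bm_kernel_deriv_bound:
  assumes I: "finite I" "i \<in> I" "l \<in> I" and e: "e > 0" and R: "cmod (\<zeta> i) \<le> R" "cmod (\<zeta> l) \<le> R" and v: "cmod v = 1"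
  shows "cmod (bm_kernel_deriv I e i l v \<zeta>) \<le> 1 / e ^ card I + R * (real (card I) * (2 * R) / e ^ (card I + 1))"
proof -
  have R0: "R \<ge> 0" using R norm_ge_zero order_trans by blast
  have le: "e ^ m \<le> (nsq I \<zeta> + e) ^ m" for m using e nsq_nonneg[of I \<zeta>] by (intro power_mono) auto
  have pos: "0 < e ^ m" for m using e by simp
  have "\<bar>v \<bullet> \<zeta> l\<bar> \<le> R" using Cauchy_Schwarz_ineq2[of v "\<zeta> l"] v R(2) by simp
  then have "\<bar>real (card I) * (2 * (v \<bullet> \<zeta> l)) / (nsq I \<zeta> + e) ^ (card I + 1)\<bar> \<le> real (card I) * (2 * R) / e ^ (card I + 1)"
    using le[of "card I + 1"] pos[of "card I + 1"] R0 nsq_nonneg[of I \<zeta>] e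
    unfolding abs_divide by (intro frac_le) (auto simp: abs_mult mult_left_mono)
  then have 2: "cmod (cnj (\<zeta> i) * of_real (real (card I) * (2 * (v \<bullet> \<zeta> l)) / (nsq I \<zeta> + e) ^ (card I + 1)))
      \<le> R * (real (card I) * (2 * R) / e ^ (card I + 1))"
    unfolding norm_mult norm_of_real complex_mod_cnj using R R0 by (intro mult_mono) auto
  have 1: "cmod ((if l = i then cnj v else 0) / of_real ((nsq I \<zeta> + e) ^ card I)) \<le> 1 / e ^ card I"
    unfolding norm_divide norm_of_real using le[of "card I"] pos[of "card I"] v
    by (intro frac_le) (auto simp: abs_of_pos[OF less_le_trans[OF pos le]])
  show ?thesis unfolding bm_kernel_deriv_def by (rule order_trans[OF norm_triangle_ineq4 add_mono[OF 1 2]])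
qed

lemma translate_bounded:
  assumes I: "I \<subseteq> {..<n}" and \<psi>: "\<psi> \<in> Cc_inf n" and x: "x \<in> extensional {..<n}"
  obtains C R where "C \<ge> 0" "R \<ge> 0" "\<And>\<zeta>. cmod (\<psi> (shift I \<zeta> x)) \<le> C"
    "\<And>\<zeta>. \<psi> (shift I \<zeta> x) \<noteq> 0 \<Longrightarrow> \<forall>k\<in>I. cmod (\<zeta> k) \<le> R"
proof -
  obtain R where R: "box_supp {..<n} R \<psi>" using \<psi> by (auto simp: Cc_inf_def)
  obtain C where C: "C \<ge> 0" "\<And>x. x \<in> extensional {..<n} \<Longrightarrow> cmod (\<psi> x) \<le> C" using Cc_inf_bounded[OF \<psi>] by metis
  define B where "B = (\<Sum>k\<in>I. cmod (x k))"
  have fI: "finite I" using I finite_subset by blast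
  show ?thesis
  proof (rule that[of C "max 0 (R + B)"])
    fix \<zeta>
    show "cmod (\<psi> (shift I \<zeta> x)) \<le> C" by (rule C(2)[OF shift_extensional[OF I x]])
    assume nz: "\<psi> (shift I \<zeta> x) \<noteq> 0"
    show "\<forall>k\<in>I. cmod (\<zeta> k) \<le> max 0 (R + B)"
    proof
      fix k assume k: "k \<in> I"
      have "k < n" using k I by auto
      then have "cmod (shift I \<zeta> x k) \<le> R" using R nz shift_extensional[OF I x] unfolding box_supp_def by simp
      moreover have "cmod (x k) \<le> B" unfolding B_def using fI k by (intro member_le_sum) auto
      moreover have "cmod (\<zeta> k) \<le> cmod (x k + \<zeta> k) + cmod (x k)" using norm_triangle_ineq4[of "x k + \<zeta> k" "x k"] by simp
      ultimately show "cmod (\<zeta> k) \<le> max 0 (R + B)" using k by (simp add: shift_def)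
    qed
  qed (use C in auto)
qed

lemma bm_kernel_integrable:
  assumes I: "I \<subseteq> {..<n}" "i \<in> I" and e: "e > 0" and \<psi>: "\<psi> \<in> Cc_inf n" and x: "x \<in> extensional {..<n}"
  shows "integrable (LM I) (\<lambda>\<zeta>. bm_kernel I e i \<zeta> * \<psi> (shift I \<zeta> x))"
proof -
  have fI: "finite I" using I finite_subset by blast
  obtain C R where C: "C \<ge> 0" "R \<ge> 0" "\<And>\<zeta>. cmod (\<psi> (shift I \<zeta> x)) \<le> C"
    "\<And>\<zeta>. \<psi> (shift I \<zeta> x) \<noteq> 0 \<Longrightarrow> \<forall>k\<in>I. cmod (\<zeta> k) \<le> R"
    using translate_bounded[OF I(1) \<psi> x] by metis
  show ?thesis
  proof (rule integrable_box_supp[OF fI, where C = "R / e ^ card I * C" and R = R])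
    show "(\<lambda>\<zeta>. bm_kernel I e i \<zeta> * \<psi> (shift I \<zeta> x)) \<in> borel_measurable (LM I)"
      by (intro borel_measurable_times bm_kernel_measurable I(2) measurable_compose[OF shift_meas_\<zeta>[OF I(1) x] Cc_inf_meas[OF \<psi>]])
    fix \<zeta>
    show "cmod (bm_kernel I e i \<zeta> * \<psi> (shift I \<zeta> x)) \<le> R / e ^ card I * C"
    proof (cases "\<psi> (shift I \<zeta> x) = 0")
      case False
      then have "cmod (\<zeta> i) \<le> R" using C(4) I(2) by blast
      then show ?thesis unfolding norm_mult using bm_kernel_bound[OF fI I(2) e] C e by (intro mult_mono) auto
    qed (use C e in auto)
    show "bm_kernel I e i \<zeta> * \<psi> (shift I \<zeta> x) \<noteq> 0 \<Longrightarrow> \<forall>k\<in>I. cmod (\<zeta> k) \<le> R" using C(4) by auto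
  qed
qed

text \<open>The product of the kernel and a translate of \<open>\<psi>\<close> has bounded support, so the integral of its
  derivative is \<open>0\<close>.\<close>

lemma bm_kernel_by_parts:
  assumes I: "I \<subseteq> {..<n}" "i \<in> I" "l \<in> I" and e: "e > 0" and v: "v \<in> {1, \<i>}"
    and \<psi>: "\<psi> \<in> Cc_inf n" and x: "x \<in> extensional {..<n}"
  shows "integrable (LM I) (\<lambda>\<zeta>. bm_kernel_deriv I e i l v \<zeta> * \<psi> (shift I \<zeta> x))"
    and "(LINT \<zeta>|LM I. bm_kernel I e i \<zeta> * partial l v \<psi> (shift I \<zeta> x))
        = - (LINT \<zeta>|LM I. bm_kernel_deriv I e i l v \<zeta> * \<psi> (shift I \<zeta> x))"
proof -
  have fI: "finite I" using I finite_subset by blast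
  have l: "l < n" using I by auto
  have v1: "cmod v = 1" using v by auto
  have p\<psi>: "partial l v \<psi> \<in> Cc_inf n" by (rule Cc_inf_partial[OF \<psi> l v])
  obtain C R where C: "C \<ge> 0" "R \<ge> 0" "\<And>\<zeta>. cmod (\<psi> (shift I \<zeta> x)) \<le> C"
    "\<And>\<zeta>. \<psi> (shift I \<zeta> x) \<noteq> 0 \<Longrightarrow> \<forall>k\<in>I. cmod (\<zeta> k) \<le> R"
    using translate_bounded[OF I(1) \<psi> x] by metis
  obtain C' R' where C': "C' \<ge> 0" "R' \<ge> 0" "\<And>\<zeta>. cmod (partial l v \<psi> (shift I \<zeta> x)) \<le> C'"
    "\<And>\<zeta>. partial l v \<psi> (shift I \<zeta> x) \<noteq> 0 \<Longrightarrow> \<forall>k\<in>I. cmod (\<zeta> k) \<le> R'"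
    using translate_bounded[OF I(1) p\<psi> x] by metis
  define F where "F \<zeta> = bm_kernel I e i \<zeta> * \<psi> (shift I \<zeta> x)" for \<zeta>
  define F' where "F' \<zeta> = bm_kernel I e i \<zeta> * partial l v \<psi> (shift I \<zeta> x) + bm_kernel_deriv I e i l v \<zeta> * \<psi> (shift I \<zeta> x)" for \<zeta>
  have Fi: "integrable (LM I) F" unfolding F_def by (rule bm_kernel_integrable[OF I(1,2) e \<psi> x])
  define D where "D = 1 / e ^ card I + R * (real (card I) * (2 * R) / e ^ (card I + 1))"
  have D0: "D \<ge> 0" unfolding D_def using e C by (intro add_nonneg_nonneg mult_nonneg_nonneg divide_nonneg_nonneg) auto
  have b1: "cmod (F \<zeta>) \<le> R / e ^ card I * C" for \<zeta>
  proof (cases "\<psi> (shift I \<zeta> x) = 0")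
    case False
    then have "cmod (\<zeta> i) \<le> R" using C(4) I(2) by blast
    then show ?thesis unfolding norm_mult F_def using bm_kernel_bound[OF fI I(2) e] C e by (intro mult_mono) auto
  qed (use C e in \<open>auto simp: F_def\<close>)
  have b2: "cmod (bm_kernel I e i \<zeta> * partial l v \<psi> (shift I \<zeta> x)) \<le> R' / e ^ card I * C'" for \<zeta>
  proof (cases "partial l v \<psi> (shift I \<zeta> x) = 0")
    case False
    then have "cmod (\<zeta> i) \<le> R'" using C'(4) I(2) by blast
    then show ?thesis unfolding norm_mult using bm_kernel_bound[OF fI I(2) e] C' e by (intro mult_mono) auto
  qed (use C' e in auto)
  have b3: "cmod (bm_kernel_deriv I e i l v \<zeta> * \<psi> (shift I \<zeta> x)) \<le> D * C" for \<zeta>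
  proof (cases "\<psi> (shift I \<zeta> x) = 0")
    case False
    then have "cmod (\<zeta> i) \<le> R" "cmod (\<zeta> l) \<le> R" using C(4) I(2,3) by blast+
    then show ?thesis unfolding norm_mult D_def using bm_kernel_deriv_bound[OF fI I(2,3) e _ _ v1] C D0
      by (intro mult_mono) (auto simp: D_def)
  qed (use C D0 in auto)
  define M where "M = max (R / e ^ card I * C) (R' / e ^ card I * C' + D * C)"
  have d: "((\<lambda>t. F (\<zeta>(l := \<zeta> l + t *\<^sub>R v))) has_vector_derivative F' \<zeta>) (at 0)" for \<zeta>
  proof -
    define y where "y = shift I \<zeta> x"
    have y: "y \<in> extensional {..<n}" unfolding y_def by (rule shift_extensional[OF I(1) x])
    have "shift I (\<zeta>(l := \<zeta> l + t *\<^sub>R v)) x = y(l := y l + t *\<^sub>R v)" for t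
      using I(3) by (auto simp: y_def shift_def fun_eq_iff)
    then have Fe: "F (\<zeta>(l := \<zeta> l + t *\<^sub>R v)) = bm_kernel I e i (\<zeta>(l := \<zeta> l + t *\<^sub>R v)) * \<psi> (y(l := y l + t *\<^sub>R v))" for t
      by (simp only: F_def)
    from has_vector_derivative_mult[OF bm_kernel_has_derivative[OF fI I(2,3) e] Ck_deriv0[OF Cc_inf_Ck[OF \<psi>] l v y]]
    show ?thesis unfolding Fe F'_def y_def[symmetric] by (simp only: scaleR_zero_left add_0_right fun_upd_triv)
  qed
  have bs: "box_supp I R F" using C(4) by (auto simp: box_supp_def F_def)
  have FM: "cmod (F \<zeta>) \<le> M" "cmod (F' \<zeta>) \<le> M" for \<zeta>
    using b1[of \<zeta>] order_trans[OF norm_triangle_ineq add_mono[OF b2[of \<zeta>] b3[of \<zeta>]]] by (auto simp: M_def F'_def)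
  note z = integral_deriv_zero[where F = F and F' = F' and v = v and C = M and R = R, OF fI I(3) _ d FM bs]
  have Fm: "F \<in> borel_measurable (LM I)" using Fi by auto
  have i1: "integrable (LM I) (\<lambda>\<zeta>. bm_kernel I e i \<zeta> * partial l v \<psi> (shift I \<zeta> x))"
    by (rule bm_kernel_integrable[OF I(1,2) e p\<psi> x])
  have "integrable (LM I) (\<lambda>\<zeta>. F' \<zeta> - bm_kernel I e i \<zeta> * partial l v \<psi> (shift I \<zeta> x))"
    using z(1)[OF Fm] i1 by (rule Bochner_Integration.integrable_diff)
  then show i2: "integrable (LM I) (\<lambda>\<zeta>. bm_kernel_deriv I e i l v \<zeta> * \<psi> (shift I \<zeta> x))" by (simp add: F'_def)
  have "(LINT \<zeta>|LM I. F' \<zeta>) = (LINT \<zeta>|LM I. bm_kernel I e i \<zeta> * partial l v \<psi> (shift I \<zeta> x)) + (LINT \<zeta>|LM I. bm_kernel_deriv I e i l v \<zeta> * \<psi> (shift I \<zeta> x))"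
    unfolding F'_def by (rule Bochner_Integration.integral_add[OF i1 i2])
  then show "(LINT \<zeta>|LM I. bm_kernel I e i \<zeta> * partial l v \<psi> (shift I \<zeta> x)) = - (LINT \<zeta>|LM I. bm_kernel_deriv I e i l v \<zeta> * \<psi> (shift I \<zeta> x))"
    using z(2)[OF Fm] by (simp add: eq_neg_iff_add_eq_0)
qed

definition partial_z :: "nat \<Rightarrow> ((nat \<Rightarrow> complex) \<Rightarrow> complex) \<Rightarrow> (nat \<Rightarrow> complex) \<Rightarrow> complex" where
  "partial_z k f z = (partial k 1 f z - \<i> * partial k \<i> f z) / 2"

text \<open>With \<open>\<rho> = nsq I \<zeta> + e\<close> and \<open>a = card I\<close>, the \<open>a\<close> diagonal terms of the divergence of the kernel add up to
  \<open>a / \<rho>\<^sup>a - a (\<rho> - e) / \<rho>\<^sup>a\<^sup>+\<^sup>1\<close>. Only the part with \<open>e\<close> survives.\<close>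

lemma bm_kernel_div:
  assumes I: "I \<subseteq> {..<n}" and e: "e > 0" and \<psi>: "\<psi> \<in> Cc_inf n" and x: "x \<in> extensional {..<n}"
  shows "(\<Sum>i\<in>I. LINT \<zeta>|LM I. bm_kernel I e i \<zeta> * partial_zbar i \<psi> (shift I \<zeta> x))
       = - (LINT \<zeta>|LM I. of_real (bm_density I e \<zeta>) * \<psi> (shift I \<zeta> x))"
proof -
  have fI: "finite I" using I finite_subset by blast
  define dk where "dk i \<zeta> = (bm_kernel_deriv I e i i 1 \<zeta> + \<i> * bm_kernel_deriv I e i i \<i> \<zeta>) / 2" for i \<zeta>
  have int: "integrable (LM I) (\<lambda>\<zeta>. dk i \<zeta> * \<psi> (shift I \<zeta> x))"
    and eq: "(LINT \<zeta>|LM I. bm_kernel I e i \<zeta> * partial_zbar i \<psi> (shift I \<zeta> x)) = - (LINT \<zeta>|LM I. dk i \<zeta> * \<psi> (shift I \<zeta> x))"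
    if i: "i \<in> I" for i
  proof -
    have n: "i < n" using I i by auto
    note b1 = bm_kernel_by_parts[OF I i i e _ \<psi> x, of 1, simplified] and b2 = bm_kernel_by_parts[OF I i i e _ \<psi> x, of \<i>, simplified]
    have k1: "integrable (LM I) (\<lambda>\<zeta>. bm_kernel I e i \<zeta> * partial i 1 \<psi> (shift I \<zeta> x))"
      and k2: "integrable (LM I) (\<lambda>\<zeta>. bm_kernel I e i \<zeta> * partial i \<i> \<psi> (shift I \<zeta> x))"
      using bm_kernel_integrable[OF I i e Cc_inf_partial[OF \<psi> n] x] by auto
    have e1: "dk i \<zeta> * \<psi> (shift I \<zeta> x) = (1/2) * (bm_kernel_deriv I e i i 1 \<zeta> * \<psi> (shift I \<zeta> x)) + (\<i>/2) * (bm_kernel_deriv I e i i \<i> \<zeta> * \<psi> (shift I \<zeta> x))" for \<zeta>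
      by (simp add: dk_def field_simps)
    have e2: "bm_kernel I e i \<zeta> * partial_zbar i \<psi> (shift I \<zeta> x) = (1/2) * (bm_kernel I e i \<zeta> * partial i 1 \<psi> (shift I \<zeta> x)) + (\<i>/2) * (bm_kernel I e i \<zeta> * partial i \<i> \<psi> (shift I \<zeta> x))" for \<zeta>
      by (simp add: partial_zbar_def field_simps)
    show "integrable (LM I) (\<lambda>\<zeta>. dk i \<zeta> * \<psi> (shift I \<zeta> x))" unfolding e1 using b1(1) b2(1) by simp
    show "(LINT \<zeta>|LM I. bm_kernel I e i \<zeta> * partial_zbar i \<psi> (shift I \<zeta> x)) = - (LINT \<zeta>|LM I. dk i \<zeta> * \<psi> (shift I \<zeta> x))"
      unfolding e1 e2 using b1 b2 k1 k2 by simp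
  qed
  have "(\<Sum>i\<in>I. dk i \<zeta>) = of_real (bm_density I e \<zeta>)" for \<zeta>
  proof -
    define \<rho> where "\<rho> = nsq I \<zeta> + e"
    have \<rho>: "\<rho> > 0" using nsq_nonneg[of I \<zeta>] e by (simp add: \<rho>_def)
    have "dk i \<zeta> = of_real (1 / \<rho> ^ card I - real (card I) * (cmod (\<zeta> i))\<^sup>2 / \<rho> ^ (card I + 1))" for i
    proof -
      have "cnj (\<zeta> i) * complex_of_real (1 \<bullet> \<zeta> i) + \<i> * (cnj (\<zeta> i) * complex_of_real (\<i> \<bullet> \<zeta> i)) = cnj (\<zeta> i) * \<zeta> i"
        by (simp add: complex_eq_iff inner_complex_def algebra_simps)
      also have "\<dots> = of_real ((cmod (\<zeta> i))\<^sup>2)" by (metis complex_norm_square mult.commute of_real_power)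
      finally have c: "cnj (\<zeta> i) * complex_of_real (1 \<bullet> \<zeta> i) + \<i> * (cnj (\<zeta> i) * complex_of_real (\<i> \<bullet> \<zeta> i)) = of_real ((cmod (\<zeta> i))\<^sup>2)" .
      have "dk i \<zeta> = 1 / of_real (\<rho> ^ card I)
         - (cnj (\<zeta> i) * complex_of_real (1 \<bullet> \<zeta> i) + \<i> * (cnj (\<zeta> i) * complex_of_real (\<i> \<bullet> \<zeta> i))) * of_real (real (card I) / \<rho> ^ (card I + 1))"
        unfolding dk_def bm_kernel_deriv_def \<rho>_def[symmetric] using \<rho> by (simp add: field_simps)
      then show ?thesis unfolding c by simp
    qed
    then have "(\<Sum>i\<in>I. dk i \<zeta>) = of_real (\<Sum>i\<in>I. 1 / \<rho> ^ card I - real (card I) * (cmod (\<zeta> i))\<^sup>2 / \<rho> ^ (card I + 1))" by simp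
    also have "(\<Sum>i\<in>I. 1 / \<rho> ^ card I - real (card I) * (cmod (\<zeta> i))\<^sup>2 / \<rho> ^ (card I + 1))
       = real (card I) / \<rho> ^ card I - real (card I) * nsq I \<zeta> / \<rho> ^ (card I + 1)"
      by (simp add: sum_subtractf nsq_def sum_distrib_left sum_divide_distrib)
    also have "\<dots> = bm_density I e \<zeta>" using \<rho> unfolding bm_density_def \<rho>_def[symmetric]
      by (simp add: field_simps) (simp add: \<rho>_def algebra_simps)
    finally show ?thesis .
  qed
  then have s: "(\<Sum>i\<in>I. dk i \<zeta> * \<psi> (shift I \<zeta> x)) = of_real (bm_density I e \<zeta>) * \<psi> (shift I \<zeta> x)" for \<zeta>
    by (simp add: sum_distrib_right[symmetric])
  have "(\<Sum>i\<in>I. LINT \<zeta>|LM I. bm_kernel I e i \<zeta> * partial_zbar i \<psi> (shift I \<zeta> x)) = - (\<Sum>i\<in>I. LINT \<zeta>|LM I. dk i \<zeta> * \<psi> (shift I \<zeta> x))"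
    unfolding sum_negf[symmetric] by (intro sum.cong eq) auto
  also have "(\<Sum>i\<in>I. LINT \<zeta>|LM I. dk i \<zeta> * \<psi> (shift I \<zeta> x)) = (LINT \<zeta>|LM I. (\<Sum>i\<in>I. dk i \<zeta> * \<psi> (shift I \<zeta> x)))"
    using int by (intro Bochner_Integration.integral_sum[symmetric]) auto
  finally show ?thesis by (simp only: s)
qed

text \<open>The field of the kernels is a \<open>\<partial>\<close>-gradient, of a function of \<open>nsq I\<close>; its \<open>\<partial>\<close>-derivatives are therefore
  symmetric.\<close>

lemma bm_kernel_curl:
  assumes I: "I \<subseteq> {..<n}" "i \<in> I" "l \<in> I" and e: "e > 0" and \<psi>: "\<psi> \<in> Cc_inf n" and x: "x \<in> extensional {..<n}"
  shows "(LINT \<zeta>|LM I. bm_kernel I e i \<zeta> * partial_z l \<psi> (shift I \<zeta> x)) = (LINT \<zeta>|LM I. bm_kernel I e l \<zeta> * partial_z i \<psi> (shift I \<zeta> x))"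
proof -
  have fI: "finite I" using I finite_subset by blast
  define dk where "dk i l \<zeta> = (bm_kernel_deriv I e i l 1 \<zeta> - \<i> * bm_kernel_deriv I e i l \<i> \<zeta>) / 2" for i l \<zeta>
  have eq: "(LINT \<zeta>|LM I. bm_kernel I e i \<zeta> * partial_z l \<psi> (shift I \<zeta> x)) = - (LINT \<zeta>|LM I. dk i l \<zeta> * \<psi> (shift I \<zeta> x))"
    if i: "i \<in> I" and l: "l \<in> I" for i l
  proof -
    have n: "l < n" using I l by auto
    note b1 = bm_kernel_by_parts[OF I(1) i l e _ \<psi> x, of 1, simplified] and b2 = bm_kernel_by_parts[OF I(1) i l e _ \<psi> x, of \<i>, simplified]
    have k1: "integrable (LM I) (\<lambda>\<zeta>. bm_kernel I e i \<zeta> * partial l 1 \<psi> (shift I \<zeta> x))"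
      and k2: "integrable (LM I) (\<lambda>\<zeta>. bm_kernel I e i \<zeta> * partial l \<i> \<psi> (shift I \<zeta> x))"
      using bm_kernel_integrable[OF I(1) i e Cc_inf_partial[OF \<psi> n] x] by auto
    have e1: "dk i l \<zeta> * \<psi> (shift I \<zeta> x) = (1/2) * (bm_kernel_deriv I e i l 1 \<zeta> * \<psi> (shift I \<zeta> x)) - (\<i>/2) * (bm_kernel_deriv I e i l \<i> \<zeta> * \<psi> (shift I \<zeta> x))" for \<zeta>
      by (simp add: dk_def field_simps)
    have e2: "bm_kernel I e i \<zeta> * partial_z l \<psi> (shift I \<zeta> x) = (1/2) * (bm_kernel I e i \<zeta> * partial l 1 \<psi> (shift I \<zeta> x)) - (\<i>/2) * (bm_kernel I e i \<zeta> * partial l \<i> \<psi> (shift I \<zeta> x))" for \<zeta>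
      by (simp add: partial_z_def field_simps)
    show ?thesis unfolding e1 e2 using b1 b2 k1 k2 by simp
  qed
  have "dk i l \<zeta> = dk l i \<zeta>" for \<zeta>
  proof (cases "l = i")
    case False
    have c: "complex_of_real (1 \<bullet> \<zeta> l) - \<i> * complex_of_real (\<i> \<bullet> \<zeta> l) = cnj (\<zeta> l)" for l
      by (simp add: complex_eq_iff inner_complex_def)
    define K where "K = 2 * real (card I) / (nsq I \<zeta> + e) ^ (card I + 1)"
    have "real (card I) * (2 * t) / (nsq I \<zeta> + e) ^ (card I + 1) = t * K" for t by (simp add: K_def)
    then have "bm_kernel_deriv I e i l v \<zeta> = - (cnj (\<zeta> i) * (complex_of_real (v \<bullet> \<zeta> l) * of_real K))"
      if "l \<noteq> i" for i l v using that unfolding bm_kernel_deriv_def by (simp only: if_False of_real_mult) simp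
    then have "dk i l \<zeta> = - (cnj (\<zeta> i) * (complex_of_real (1 \<bullet> \<zeta> l) - \<i> * complex_of_real (\<i> \<bullet> \<zeta> l))) * of_real K / 2"
      if "l \<noteq> i" for i l using that unfolding dk_def by (simp only: not_False_eq_True) (simp add: algebra_simps)
    then show ?thesis using False unfolding c by (simp add: mult.commute)
  qed simp
  then show ?thesis using eq I by simp
qed

subsection \<open>Convolution with the kernel\<close>

lemma Cc_inf_partial_z:
  assumes "f \<in> Cc_inf n" "k < n" shows "partial_z k f \<in> Cc_inf n" "partial_zbar k f \<in> Cc_inf n"
proof -
  have 1: "partial_z k f = (\<lambda>x. (1/2) * partial k 1 f x + (- \<i>/2) * partial k \<i> f x)"
    by (rule ext) (simp add: partial_z_def field_simps)
  have 2: "partial_zbar k f = (\<lambda>x. (1/2) * partial k 1 f x + (\<i>/2) * partial k \<i> f x)"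
    by (rule ext) (simp add: partial_zbar_def field_simps)
  show "partial_z k f \<in> Cc_inf n" unfolding 1 using assms by (intro Cc_inf_add Cc_inf_cmult Cc_inf_partial) auto
  show "partial_zbar k f \<in> Cc_inf n" unfolding 2 using assms by (intro Cc_inf_add Cc_inf_cmult Cc_inf_partial) auto
qed

lemma slab_supp_partial_z:
  assumes "f \<in> Cc_inf n" "k < n" "slab_supp n I R f"
  shows "slab_supp n I R (partial_z k f)" "slab_supp n I R (partial_zbar k f)"
proof -
  have "slab_supp n I R (partial k v f)" if "v \<in> {1, \<i>}" for v
    by (rule slab_supp_partial[OF Cc_inf_Ck[OF assms(1)] assms(3,2) that])
  then have "slab_supp n I R (partial k 1 f)" "slab_supp n I R (partial k \<i> f)" by auto
  then show "slab_supp n I R (partial_z k f)" "slab_supp n I R (partial_zbar k f)"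
    unfolding slab_supp_def partial_z_def partial_zbar_def by fastforce+
qed

lemma Cc_inf_conv_integrand:
  assumes I: "I \<subseteq> {..<n}" and \<kappa>: "integrable (LM I) \<kappa>" and \<psi>: "\<psi> \<in> Cc_inf n" and x: "x \<in> extensional {..<n}"
  shows "integrable (LM I) (\<lambda>\<zeta>. \<kappa> \<zeta> * \<psi> (shift I \<zeta> x))"
proof -
  obtain C where "\<And>x. x \<in> extensional {..<n} \<Longrightarrow> cmod (\<psi> x) \<le> C" using Cc_inf_bounded[OF \<psi>] by metis
  then show ?thesis by (rule conv_integrand[OF I \<kappa> Cc_inf_cont[OF \<psi>] _ x])
qed

lemma conv_lin:
  assumes "I \<subseteq> {..<n}" "integrable (LM I) \<kappa>" "f \<in> Cc_inf n" "g \<in> Cc_inf n" "x \<in> extensional {..<n}"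
  shows "conv I \<kappa> (\<lambda>x. a * f x + b * g x) x = a * conv I \<kappa> f x + b * conv I \<kappa> g x"
proof -
  note i = Cc_inf_conv_integrand[OF assms(1,2,3,5)] Cc_inf_conv_integrand[OF assms(1,2,4,5)]
  have "\<kappa> \<zeta> * (a * f (shift I \<zeta> x) + b * g (shift I \<zeta> x)) = a * (\<kappa> \<zeta> * f (shift I \<zeta> x)) + b * (\<kappa> \<zeta> * g (shift I \<zeta> x))" for \<zeta>
    by (simp add: algebra_simps)
  then show ?thesis unfolding conv_def using i by simp
qed

lemma partial_z_conv:
  assumes "I \<subseteq> {..<n}" "integrable (LM I) \<kappa>" "\<psi> \<in> Cc_inf n" "k < n" "x \<in> extensional {..<n}"
  shows "partial_z k (conv I \<kappa> \<psi>) x = conv I \<kappa> (partial_z k \<psi>) x"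
    "partial_zbar k (conv I \<kappa> \<psi>) x = conv I \<kappa> (partial_zbar k \<psi>) x"
proof -
  have 1: "partial_z k \<psi> = (\<lambda>x. (1/2) * partial k 1 \<psi> x + (- \<i>/2) * partial k \<i> \<psi> x)"
    by (rule ext) (simp add: partial_z_def field_simps)
  have 2: "partial_zbar k \<psi> = (\<lambda>x. (1/2) * partial k 1 \<psi> x + (\<i>/2) * partial k \<i> \<psi> x)"
    by (rule ext) (simp add: partial_zbar_def field_simps)
  have D: "partial k 1 \<psi> \<in> Cc_inf n" "partial k \<i> \<psi> \<in> Cc_inf n" using Cc_inf_partial[OF assms(3,4)] by auto
  have p: "partial k 1 (conv I \<kappa> \<psi>) x = conv I \<kappa> (partial k 1 \<psi>) x" "partial k \<i> (conv I \<kappa> \<psi>) x = conv I \<kappa> (partial k \<i> \<psi>) x"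
    using partial_conv[OF assms(1-4) _ assms(5)] by auto
  show "partial_z k (conv I \<kappa> \<psi>) x = conv I \<kappa> (partial_z k \<psi>) x"
    unfolding 1 conv_lin[OF assms(1,2) D assms(5)] partial_z_def p by (simp add: field_simps)
  show "partial_zbar k (conv I \<kappa> \<psi>) x = conv I \<kappa> (partial_zbar k \<psi>) x"
    unfolding 2 conv_lin[OF assms(1,2) D assms(5)] partial_zbar_def p by (simp add: field_simps)
qed

text \<open>If \<open>x\<close> and \<open>x + \<zeta>\<close> are bounded by \<open>R1\<close> and by \<open>R0\<close> in the block, then \<open>\<zeta>\<close> lies in the box of the cut.\<close>

lemma conv_bm_cut_eq_kernel:
  assumes I: "I \<subseteq> {..<n}" and s: "slab_supp n I R0 \<phi>" and x: "x \<in> slab n I R1" and R: "R0 + R1 \<le> R"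
  shows "conv I (bm_cut I R e i) \<phi> x = (LINT \<zeta>|LM I. bm_kernel I e i \<zeta> * \<phi> (shift I \<zeta> x))"
  unfolding conv_def
proof (rule Bochner_Integration.integral_cong[OF refl])
  fix \<zeta>
  have xe: "x \<in> extensional {..<n}" using x by (simp add: slab_def)
  show "bm_cut I R e i \<zeta> * \<phi> (shift I \<zeta> x) = bm_kernel I e i \<zeta> * \<phi> (shift I \<zeta> x)"
  proof (cases "\<phi> (shift I \<zeta> x) = 0")
    case False
    then have y: "shift I \<zeta> x \<in> slab n I R0" using s shift_extensional[OF I xe] by (auto simp: slab_supp_def)
    have "cmod (\<zeta> k) \<le> R" if k: "k \<in> I" for k
    proof -
      have "cmod (x k + \<zeta> k) \<le> R0" using y k by (auto simp: slab_def shift_def)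
      moreover have "cmod (x k) \<le> R1" using x k by (simp add: slab_def)
      moreover have "cmod (\<zeta> k) \<le> cmod (x k + \<zeta> k) + cmod (x k)" using norm_triangle_ineq4[of "x k + \<zeta> k" "x k"] by simp
      ultimately show ?thesis using R by linarith
    qed
    then show ?thesis by (simp add: bm_cut_def)
  qed simp
qed

lemma conv_bm_cut_div_eps:
  assumes I: "I \<subseteq> {..<n}" and e: "e > 0" and \<psi>: "\<psi> \<in> Cc_inf n" "slab_supp n I R0 \<psi>" and x: "x \<in> slab n I R1" and R: "R0 + R1 \<le> R"
  shows "(\<Sum>i\<in>I. conv I (bm_cut I R e i) (partial_zbar i \<psi>) x) = - conv I (\<lambda>\<zeta>. of_real (bm_density I e \<zeta>)) \<psi> x"
proof -
  have xe: "x \<in> extensional {..<n}" using x by (simp add: slab_def)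
  have "conv I (bm_cut I R e i) (partial_zbar i \<psi>) x = (LINT \<zeta>|LM I. bm_kernel I e i \<zeta> * partial_zbar i \<psi> (shift I \<zeta> x))" if "i \<in> I" for i
    using conv_bm_cut_eq_kernel[OF I slab_supp_partial_z(2)[OF \<psi>(1) _ \<psi>(2)] x R] that I by auto
  then show ?thesis using bm_kernel_div[OF I e \<psi>(1) xe] by (simp add: conv_def)
qed

lemma conv_bm_cut_curl_eps:
  assumes I: "I \<subseteq> {..<n}" "i \<in> I" "l \<in> I" and e: "e > 0" and \<psi>: "\<psi> \<in> Cc_inf n" "slab_supp n I R0 \<psi>" and x: "x \<in> slab n I R1" and R: "R0 + R1 \<le> R"
  shows "conv I (bm_cut I R e i) (partial_z l \<psi>) x = conv I (bm_cut I R e l) (partial_z i \<psi>) x"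
proof -
  have xe: "x \<in> extensional {..<n}" using x by (simp add: slab_def)
  have "conv I (bm_cut I R e i) (partial_z l \<psi>) x = (LINT \<zeta>|LM I. bm_kernel I e i \<zeta> * partial_z l \<psi> (shift I \<zeta> x))" if "l \<in> I" for i l
    using conv_bm_cut_eq_kernel[OF I(1) slab_supp_partial_z(1)[OF \<psi>(1) _ \<psi>(2)] x R] that I by auto
  then show ?thesis using bm_kernel_curl[OF I e \<psi>(1) xe] I by simp
qed

lemma conv_bm_cut_tendsto:
  assumes I: "I \<subseteq> {..<n}" "i \<in> I" and R: "R > 0" and \<phi>: "\<phi> \<in> Cc_inf n" and x: "x \<in> extensional {..<n}"
    and s: "s \<longlonglongrightarrow> 0" "\<And>m::nat. s m \<ge> 0"
  shows "(\<lambda>m. conv I (bm_cut I R (s m) i) \<phi> x) \<longlonglongrightarrow> conv I (bm_cut I R 0 i) \<phi> x"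
  unfolding conv_def
proof -
  have fI: "finite I" using I finite_subset by blast
  obtain C where C: "C \<ge> 0" "\<And>x. x \<in> extensional {..<n} \<Longrightarrow> cmod (\<phi> x) \<le> C" using Cc_inf_bounded[OF \<phi>] by metis
  have d: "integrable (LM I) (majorant I R)" using fI I R by (intro majorant_integrable) auto
  show "(\<lambda>m. LINT \<zeta>|LM I. bm_cut I R (s m) i \<zeta> * \<phi> (shift I \<zeta> x)) \<longlonglongrightarrow> (LINT \<zeta>|LM I. bm_cut I R 0 i \<zeta> * \<phi> (shift I \<zeta> x))"
  proof (rule integral_dominated_convergence[where w = "\<lambda>\<zeta>. majorant I R \<zeta> * C"])
    show "AE \<zeta> in LM I. (\<lambda>m. bm_cut I R (s m) i \<zeta> * \<phi> (shift I \<zeta> x)) \<longlonglongrightarrow> bm_cut I R 0 i \<zeta> * \<phi> (shift I \<zeta> x)"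
      using bm_cut_tendsto[OF fI I(2) s(1), of R] by eventually_elim (intro tendsto_mult tendsto_const)
    show "AE \<zeta> in LM I. cmod (bm_cut I R (s m) i \<zeta> * \<phi> (shift I \<zeta> x)) \<le> majorant I R \<zeta> * C" for m
      using bm_cut_le_majorant[OF fI I(2) s(2), of R m]
    proof eventually_elim
      case (elim \<zeta>)
      then show ?case unfolding norm_mult using C(2)[OF shift_extensional[OF I(1) x]] order_trans[OF norm_ge_zero elim]
        by (intro mult_mono) auto
    qed
    show "integrable (LM I) (\<lambda>\<zeta>. majorant I R \<zeta> * C)" using d by simp
    show "(\<lambda>\<zeta>. bm_cut I R 0 i \<zeta> * \<phi> (shift I \<zeta> x)) \<in> borel_measurable (LM I)"
      using Cc_inf_conv_integrand[OF I(1) bm_cut_integrable(1)[OF fI I(2) order_refl R] \<phi> x] by auto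
    show "(\<lambda>\<zeta>. bm_cut I R (s m) i \<zeta> * \<phi> (shift I \<zeta> x)) \<in> borel_measurable (LM I)" for m
      using Cc_inf_conv_integrand[OF I(1) bm_cut_integrable(1)[OF fI I(2) s(2) R] \<phi> x] by auto
  qed
qed

text \<open>An approximate identity, by dilating the variable of integration.\<close>

lemma conv_bm_density_tendsto:
  assumes I: "I \<subseteq> {..<n}" "I \<noteq> {}" and \<psi>: "\<psi> \<in> Cc_inf n" and x: "x \<in> extensional {..<n}"
    and s: "s \<longlonglongrightarrow> 0" "\<And>m::nat. s m > 0"
  shows "(\<lambda>m. conv I (\<lambda>\<zeta>. of_real (bm_density I ((s m)\<^sup>2) \<zeta>)) \<psi> x) \<longlonglongrightarrow> of_real (LINT \<zeta>|LM I. bm_density I 1 \<zeta>) * \<psi> x"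
proof -
  have fI: "finite I" using I finite_subset by blast
  obtain C where C: "C \<ge> 0" "\<And>x. x \<in> extensional {..<n} \<Longrightarrow> cmod (\<psi> x) \<le> C" using Cc_inf_bounded[OF \<psi>] by metis
  have m: "(\<lambda>\<zeta>. \<psi> (shift I \<zeta> x)) \<in> borel_measurable (LM I)"
    by (rule measurable_compose[OF shift_meas_\<zeta>[OF I(1) x] Cc_inf_meas[OF \<psi>]])
  have ei: "integrable (LM I) (bm_density I 1)" by (rule bm_density_integrable[OF fI I(2)])
  have "(\<lambda>m. LINT \<zeta>|LM I. of_real (bm_density I 1 \<zeta>) * \<psi> (shift I (scale_by I (s m) \<zeta>) x)) \<longlonglongrightarrow> (LINT \<zeta>|LM I. of_real (bm_density I 1 \<zeta>) * \<psi> x)"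
  proof (rule integral_dominated_convergence[where w = "\<lambda>\<zeta>. \<bar>bm_density I 1 \<zeta>\<bar> * C"])
    show "(\<lambda>\<zeta>. of_real (bm_density I 1 \<zeta>) * \<psi> (shift I (scale_by I (s k) \<zeta>) x)) \<in> borel_measurable (LM I)" for k
      using measurable_compose[OF scale_by_measurable m] by measurable
    show "AE \<zeta> in LM I. (\<lambda>m. of_real (bm_density I 1 \<zeta>) * \<psi> (shift I (scale_by I (s m) \<zeta>) x)) \<longlonglongrightarrow> of_real (bm_density I 1 \<zeta>) * \<psi> x"
    proof (intro AE_I2 tendsto_mult tendsto_const continuous_map_PT_seqD[OF _ Cc_inf_cont[OF \<psi>]])
      fix \<zeta> k
      have "(\<lambda>m. x k + s m *\<^sub>R \<zeta> k) \<longlonglongrightarrow> x k + 0 *\<^sub>R \<zeta> k" by (intro tendsto_intros s(1))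
      then show "(\<lambda>m. shift I (scale_by I (s m) \<zeta>) x k) \<longlonglongrightarrow> x k"
        by (cases "k \<in> I") (simp_all add: shift_def scale_by_def)
    qed (use x I in auto)
    show "AE \<zeta> in LM I. cmod (of_real (bm_density I 1 \<zeta>) * \<psi> (shift I (scale_by I (s m) \<zeta>) x)) \<le> \<bar>bm_density I 1 \<zeta>\<bar> * C" for m
      using C(2)[OF shift_extensional[OF I(1) x]] by (intro AE_I2) (simp add: norm_mult mult_left_mono)
    show "integrable (LM I) (\<lambda>\<zeta>. \<bar>bm_density I 1 \<zeta>\<bar> * C)" using ei by simp
  qed simp
  moreover have "(LINT \<zeta>|LM I. of_real (bm_density I 1 \<zeta>) * \<psi> (shift I (scale_by I (s k) \<zeta>) x)) = conv I (\<lambda>\<zeta>. of_real (bm_density I ((s k)\<^sup>2) \<zeta>)) \<psi> x" for k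
    unfolding conv_def by (rule bm_density_integral_scale[OF fI I(2) s(2) m, symmetric])
  moreover have "(LINT \<zeta>|LM I. complex_of_real (bm_density I 1 \<zeta>) * \<psi> x) = of_real (LINT \<zeta>|LM I. bm_density I 1 \<zeta>) * \<psi> x"
    using ei by simp
  ultimately show ?thesis by simp
qed

text \<open>The Bochner-Martinelli formula for functions of bounded support: let the parameter tend to \<open>0\<close> in the
  regularised identity.\<close>

lemma conv_bm_cut_div:
  assumes I: "I \<subseteq> {..<n}" "I \<noteq> {}" and \<psi>: "\<psi> \<in> Cc_inf n" "slab_supp n I R0 \<psi>" and x: "x \<in> slab n I R1"
    and R: "R0 + R1 \<le> R" "R > 0"
  shows "(\<Sum>i\<in>I. conv I (bm_cut I R 0 i) (partial_zbar i \<psi>) x) = - of_real (LINT \<zeta>|LM I. bm_density I 1 \<zeta>) * \<psi> x"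
proof -
  have xe: "x \<in> extensional {..<n}" using x by (simp add: slab_def)
  define s where "s m = 1 / real (Suc m)" for m
  have s: "s \<longlonglongrightarrow> 0" "\<And>n. s n > 0"
    unfolding s_def using LIMSEQ_inverse_real_of_nat by (auto simp: inverse_eq_divide)
  have s2: "(\<lambda>m. (s m)\<^sup>2) \<longlonglongrightarrow> 0" using tendsto_power[OF s(1), of 2] by simp
  have "(\<lambda>m. \<Sum>i\<in>I. conv I (bm_cut I R ((s m)\<^sup>2) i) (partial_zbar i \<psi>) x) \<longlonglongrightarrow> (\<Sum>i\<in>I. conv I (bm_cut I R 0 i) (partial_zbar i \<psi>) x)"
    by (intro tendsto_sum conv_bm_cut_tendsto[OF I(1) _ R(2) Cc_inf_partial_z(2)[OF \<psi>(1)] xe s2]) (use I in auto)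
  moreover have "(\<Sum>i\<in>I. conv I (bm_cut I R ((s m)\<^sup>2) i) (partial_zbar i \<psi>) x) = - conv I (\<lambda>\<zeta>. of_real (bm_density I ((s m)\<^sup>2) \<zeta>)) \<psi> x" for m
    using s(2)[of m] by (intro conv_bm_cut_div_eps[OF I(1) _ \<psi> x R(1)]) auto
  moreover have "(\<lambda>m. - conv I (\<lambda>\<zeta>. of_real (bm_density I ((s m)\<^sup>2) \<zeta>)) \<psi> x) \<longlonglongrightarrow> - (of_real (LINT \<zeta>|LM I. bm_density I 1 \<zeta>) * \<psi> x)"
    by (intro tendsto_minus conv_bm_density_tendsto[OF I \<psi>(1) xe s])
  ultimately show ?thesis using LIMSEQ_unique by auto
qed

section \<open>The energy identity\<close>

definition l2_inner :: "nat \<Rightarrow> ((nat \<Rightarrow> complex) \<Rightarrow> complex) \<Rightarrow> ((nat \<Rightarrow> complex) \<Rightarrow> complex) \<Rightarrow> complex" where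
  "l2_inner n f g = (LINT x|LM {..<n}. f x * cnj (g x))"

definition sq_norm :: "nat \<Rightarrow> ((nat \<Rightarrow> complex) \<Rightarrow> complex) \<Rightarrow> real" where
  "sq_norm n f = (LINT x|LM {..<n}. (cmod (f x))\<^sup>2)"

lemma sq_norm_nonneg: "0 \<le> sq_norm n f"
  by (simp add: sq_norm_def)

lemma l2_inner_self: "f \<in> Cc_inf n \<Longrightarrow> l2_inner n f f = of_real (sq_norm n f)"
  using Cc_inf_sq_integrable[of f n] unfolding l2_inner_def sq_norm_def
  by (simp add: complex_norm_square[symmetric] del: of_real_power)

lemma Cc_inf_cnj:
  assumes "f \<in> Cc_inf n" shows "(\<lambda>x. cnj (f x)) \<in> Cc_inf n"
proof -
  have "Ck n r (\<lambda>x. cnj (f x))" if "f \<in> Cc_inf n" for r f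
    using that
  proof (induction r arbitrary: f)
    case 0
    have "continuous_map (PT {..<n}) euclidean (\<lambda>x. cnj (f x))"
      by (rule continuous_map_PT_seqI) (auto intro!: tendsto_cnj continuous_map_PT_seqD[OF _ Cc_inf_cont[OF 0]])
    then show ?case by (simp add: Cn_top_eq)
  next
    case (Suc r)
    show ?case
    proof (rule Ck_SucI[where D = "\<lambda>k v x. cnj (partial k v f x)"])
      show "continuous_map (PT {..<n}) euclidean (\<lambda>x. cnj (f x))"
        by (rule continuous_map_PT_seqI) (auto intro!: tendsto_cnj continuous_map_PT_seqD[OF _ Cc_inf_cont[OF Suc.prems]])
      show "((\<lambda>t. cnj (f (z(k := z k + t *\<^sub>R v)))) has_vector_derivative cnj (partial k v f z)) (at 0)"
        if "k < n" "v \<in> {1, \<i>}" "z \<in> extensional {..<n}" for k v z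
        by (rule partial_cnj[OF Cc_inf_Ck[OF Suc.prems] that])
      show "Ck n r (\<lambda>x. cnj (partial k v f x))" if "k < n" "v \<in> {1, \<i>}" for k v
        by (rule Suc.IH[OF Cc_inf_partial[OF Suc.prems that]])
    qed
  qed
  then show ?thesis using assms by (auto simp: Cc_inf_def box_supp_def)
qed

lemma l2_inner_integrable: "f \<in> Cc_inf n \<Longrightarrow> g \<in> Cc_inf n \<Longrightarrow> integrable (LM {..<n}) (\<lambda>x. f x * cnj (g x))"
  using Cc_inf_integrable[OF Cc_inf_mult[OF Cc_inf_cnj[of g n] Cc_inf_Ck[of f n]]] by simp

lemma l2_inner_partial_swap:
  assumes f: "f \<in> Cc_inf n" and g: "g \<in> Cc_inf n" and k: "k < n" "v \<in> {1, \<i>}" and l: "l < n" "w \<in> {1, \<i>}"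
  shows "l2_inner n (partial k v f) (partial l w g) = l2_inner n (partial l w f) (partial k v g)"
proof -
  have e: "partial k v (\<lambda>x. cnj (g x)) x = cnj (partial k v g x)" if "x \<in> extensional {..<n}" "k < n" "v \<in> {1, \<i>}" for k v x
    unfolding partial_def[of k v "\<lambda>x. cnj (g x)"] by (rule vector_derivative_at[OF partial_cnj[OF Cc_inf_Ck[OF g] that(2,3,1)]])
  obtain R S where RS: "box_supp {..<n} R f" "box_supp {..<n} S (\<lambda>x. cnj (g x))" using f Cc_inf_cnj[OF g] by (auto simp: Cc_inf_def)
  have "(LINT x|LM {..<n}. partial k v f x * partial l w (\<lambda>x. cnj (g x)) x) = (LINT x|LM {..<n}. partial l w f x * partial k v (\<lambda>x. cnj (g x)) x)"
    by (rule integral_partials_swap[OF Cc_inf_Ck[OF f] RS(1) Cc_inf_Ck[OF Cc_inf_cnj[OF g]] RS(2) k l])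
  moreover have "(LINT x|LM {..<n}. h x * partial l w (\<lambda>x. cnj (g x)) x) = l2_inner n h (partial l w g)" if "l < n" "w \<in> {1, \<i>}" for h l w
    unfolding l2_inner_def by (rule Bochner_Integration.integral_cong) (use e that in \<open>auto simp: space_LM\<close>)
  ultimately show ?thesis using k l by simp
qed

lemma l2_inner_lin:
  assumes "f \<in> Cc_inf n" "g \<in> Cc_inf n" "f' \<in> Cc_inf n" "g' \<in> Cc_inf n"
  shows "l2_inner n (\<lambda>x. a * f x + b * f' x) (\<lambda>x. c * g x + d * g' x)
    = a * cnj c * l2_inner n f g + a * cnj d * l2_inner n f g' + b * cnj c * l2_inner n f' g + b * cnj d * l2_inner n f' g'"
proof -
  note i = l2_inner_integrable[OF assms(1,2)] l2_inner_integrable[OF assms(1,4)] l2_inner_integrable[OF assms(3,2)] l2_inner_integrable[OF assms(3,4)]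
  have "(a * f x + b * f' x) * cnj (c * g x + d * g' x) = a * cnj c * (f x * cnj (g x)) + a * cnj d * (f x * cnj (g' x))
      + b * cnj c * (f' x * cnj (g x)) + b * cnj d * (f' x * cnj (g' x))" for x
    by (simp add: algebra_simps)
  then show ?thesis unfolding l2_inner_def using i by simp
qed

lemma l2_inner_sum:
  assumes "finite A" "\<And>i. i \<in> A \<Longrightarrow> f i \<in> Cc_inf n" "\<And>i. i \<in> A \<Longrightarrow> g i \<in> Cc_inf n"
  shows "l2_inner n (\<lambda>x. \<Sum>i\<in>A. f i x) (\<lambda>x. \<Sum>i\<in>A. g i x) = (\<Sum>i\<in>A. \<Sum>l\<in>A. l2_inner n (f i) (g l))"
proof -
  have i: "integrable (LM {..<n}) (\<lambda>x. f i x * cnj (g l x))" if "i \<in> A" "l \<in> A" for i l using assms that by (intro l2_inner_integrable) auto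
  have "(\<Sum>i\<in>A. f i x) * cnj (\<Sum>i\<in>A. g i x) = (\<Sum>i\<in>A. \<Sum>l\<in>A. f i x * cnj (g l x))" for x
    by (simp add: sum_product)
  then show ?thesis unfolding l2_inner_def using i by (simp add: Bochner_Integration.integral_sum)
qed

text \<open>Exchanging the derivatives trades each \<open>\<partial>\<close> for a \<open>dbar\<close>, since conjugation of the second factor turns
  \<open>\<partial>\<^sub>k g\<close> into \<open>dbar\<^sub>k\<close> of the conjugate.\<close>

lemma l2_inner_z_zbar:
  assumes f: "f \<in> Cc_inf n" and g: "g \<in> Cc_inf n" and k: "k < n" and l: "l < n"
  shows "l2_inner n (partial_z l f) (partial_z k g) = l2_inner n (partial_zbar k f) (partial_zbar l g)"
proof -
  have z: "partial_z k f = (\<lambda>x. (1/2) * partial k 1 f x + (- \<i>/2) * partial k \<i> f x)" for k f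
    by (rule ext) (simp add: partial_z_def field_simps)
  have zb: "partial_zbar k f = (\<lambda>x. (1/2) * partial k 1 f x + (\<i>/2) * partial k \<i> f x)" for k f
    by (rule ext) (simp add: partial_zbar_def field_simps)
  have D: "partial k v f \<in> Cc_inf n" "partial l v g \<in> Cc_inf n" "partial l v f \<in> Cc_inf n" "partial k v g \<in> Cc_inf n" if "v \<in> {1, \<i>}" for v
    using Cc_inf_partial[OF f] Cc_inf_partial[OF g] k l that by auto
  note s = l2_inner_partial_swap[OF f g l _ k]
  have v: "1 \<in> {1, \<i>}" "\<i> \<in> {1, \<i>}" by auto
  show ?thesis
    unfolding z zb
    by (subst l2_inner_lin; (intro D v)?; subst l2_inner_lin; (intro D v)?)
      (simp add: s[OF v(1) v(1)] s[OF v(1) v(2)] s[OF v(2) v(1)] s[OF v(2) v(2)] algebra_simps)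
qed

text \<open>Expand the square of the antisymmetric part of the matrix \<open>\<partial>\<^sub>l q\<^sub>i\<close>. The mixed terms
  \<open>\<langle>\<partial>\<^sub>l q\<^sub>i, \<partial>\<^sub>i q\<^sub>l\<rangle>\<close> become \<open>\<langle>dbar\<^sub>i q\<^sub>i, dbar\<^sub>l q\<^sub>l\<rangle>\<close> by exchanging derivatives, and their sum is the square of the
  divergence.\<close>

lemma div_curl_identity:
  assumes I: "I \<subseteq> {..<n}" and q: "\<And>i. i \<in> I \<Longrightarrow> q i \<in> Cc_inf n"
  shows "(\<Sum>i\<in>I. \<Sum>l\<in>I. sq_norm n (partial_z l (q i)))
       = sq_norm n (\<lambda>x. \<Sum>i\<in>I. partial_zbar i (q i) x)
         + (\<Sum>i\<in>I. \<Sum>l\<in>I. sq_norm n (\<lambda>x. partial_z l (q i) x - partial_z i (q l) x)) / 2"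
proof -
  have fI: "finite I" using I finite_subset by blast
  have n: "i < n" if "i \<in> I" for i using I that by auto
  have z: "partial_z l (q i) \<in> Cc_inf n" "partial_zbar l (q i) \<in> Cc_inf n" if "i \<in> I" "l \<in> I" for i l
    using Cc_inf_partial_z[OF q[OF that(1)] n[OF that(2)]] by auto
  have w: "(\<lambda>x. partial_z l (q i) x - partial_z i (q l) x) = (\<lambda>x. 1 * partial_z l (q i) x + (-1) * partial_z i (q l) x)" for i l by simp
  have wD: "(\<lambda>x. partial_z l (q i) x - partial_z i (q l) x) \<in> Cc_inf n" if "i \<in> I" "l \<in> I" for i l
    unfolding w using z that by (intro Cc_inf_add Cc_inf_cmult) auto
  have sD: "(\<lambda>x. \<Sum>i\<in>I. partial_zbar i (q i) x) \<in> Cc_inf n" using fI z by (intro Cc_inf_sum) auto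
  have "of_real (sq_norm n (\<lambda>x. partial_z l (q i) x - partial_z i (q l) x))
      = of_real (sq_norm n (partial_z l (q i))) + of_real (sq_norm n (partial_z i (q l)))
        - l2_inner n (partial_zbar i (q i)) (partial_zbar l (q l)) - l2_inner n (partial_zbar l (q l)) (partial_zbar i (q i))"
    if il: "i \<in> I" "l \<in> I" for i l
  proof -
    have "of_real (sq_norm n (\<lambda>x. partial_z l (q i) x - partial_z i (q l) x))
      = l2_inner n (\<lambda>x. partial_z l (q i) x - partial_z i (q l) x) (\<lambda>x. partial_z l (q i) x - partial_z i (q l) x)"
      by (rule l2_inner_self[OF wD[OF il], symmetric])
    also have "\<dots> = l2_inner n (partial_z l (q i)) (partial_z l (q i))
        - l2_inner n (partial_z l (q i)) (partial_z i (q l)) - l2_inner n (partial_z i (q l)) (partial_z l (q i)) + l2_inner n (partial_z i (q l)) (partial_z i (q l))"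
      unfolding w by (subst l2_inner_lin) (use z il in auto)
    also have "l2_inner n (partial_z l (q i)) (partial_z i (q l)) = l2_inner n (partial_zbar i (q i)) (partial_zbar l (q l))"
      using il q n by (intro l2_inner_z_zbar) auto
    also have "l2_inner n (partial_z i (q l)) (partial_z l (q i)) = l2_inner n (partial_zbar l (q l)) (partial_zbar i (q i))"
      using il q n by (intro l2_inner_z_zbar) auto
    finally show ?thesis using z il by (simp add: l2_inner_self)
  qed
  then have "(\<Sum>i\<in>I. \<Sum>l\<in>I. complex_of_real (sq_norm n (\<lambda>x. partial_z l (q i) x - partial_z i (q l) x)))
    = (\<Sum>i\<in>I. \<Sum>l\<in>I. of_real (sq_norm n (partial_z l (q i)))) + (\<Sum>i\<in>I. \<Sum>l\<in>I. of_real (sq_norm n (partial_z i (q l))))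
      - (\<Sum>i\<in>I. \<Sum>l\<in>I. l2_inner n (partial_zbar i (q i)) (partial_zbar l (q l))) - (\<Sum>i\<in>I. \<Sum>l\<in>I. l2_inner n (partial_zbar l (q l)) (partial_zbar i (q i)))"
    by (simp add: sum.distrib sum_subtractf)
  moreover have "(\<Sum>i\<in>I. \<Sum>l\<in>I. complex_of_real (sq_norm n (partial_z i (q l)))) = (\<Sum>i\<in>I. \<Sum>l\<in>I. of_real (sq_norm n (partial_z l (q i))))"
    by (rule sum.swap)
  moreover have "(\<Sum>i\<in>I. \<Sum>l\<in>I. l2_inner n (partial_zbar l (q l)) (partial_zbar i (q i))) = (\<Sum>i\<in>I. \<Sum>l\<in>I. l2_inner n (partial_zbar i (q i)) (partial_zbar l (q l)))"
    by (rule sum.swap)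
  moreover have "(\<Sum>i\<in>I. \<Sum>l\<in>I. l2_inner n (partial_zbar i (q i)) (partial_zbar l (q l))) = of_real (sq_norm n (\<lambda>x. \<Sum>i\<in>I. partial_zbar i (q i) x))"
    unfolding l2_inner_self[OF sD, symmetric] by (rule l2_inner_sum[symmetric]) (use fI z in auto)
  ultimately have "complex_of_real (\<Sum>i\<in>I. \<Sum>l\<in>I. sq_norm n (\<lambda>x. partial_z l (q i) x - partial_z i (q l) x))
    = of_real (2 * (\<Sum>i\<in>I. \<Sum>l\<in>I. sq_norm n (partial_z l (q i))) - 2 * sq_norm n (\<lambda>x. \<Sum>i\<in>I. partial_zbar i (q i) x))"
    by (simp del: of_real_sum add: of_real_sum[symmetric])
  then show ?thesis unfolding of_real_eq_iff by linarith
qed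

lemma sq_norm_zbar: "f \<in> Cc_inf n \<Longrightarrow> l < n \<Longrightarrow> sq_norm n (partial_zbar l f) = sq_norm n (partial_z l f)"
  using l2_inner_z_zbar[of f n f l l] l2_inner_self[OF Cc_inf_partial_z(1), of f n l] l2_inner_self[OF Cc_inf_partial_z(2), of f n l]
  by (metis of_real_eq_iff)

section \<open>The kernel gains one derivative in the variables of its block\<close>

lemma sq_norm_conv:
  assumes I: "I \<subseteq> {..<n}" and \<kappa>: "integrable (LM I) \<kappa>" and A: "A > 0" "(LINT \<zeta>|LM I. cmod (\<kappa> \<zeta>)) \<le> A"
    and \<psi>: "\<psi> \<in> Cc_inf n"
  shows "integrable (LM {..<n}) (\<lambda>x. (cmod (conv I \<kappa> \<psi> x))\<^sup>2)" "sq_norm n (conv I \<kappa> \<psi>) \<le> A\<^sup>2 * sq_norm n \<psi>"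
proof -
  have S: "extensional {..<n} \<in> sets (LM {..<n})" using sets.top[of "LM {..<n}"] by (simp add: space_LM)
  have s: "shift I \<zeta> x \<in> extensional {..<n} \<longleftrightarrow> x \<in> extensional {..<n}" if "x \<in> extensional {..<n}" for \<zeta> x
    using that shift_extensional[OF I] by simp
  have e: "integrable (LM {..<n}) (\<lambda>x. indicator (extensional {..<n}) x * f x) \<longleftrightarrow> integrable (LM {..<n}) f"
    "(LINT x|LM {..<n}. indicator (extensional {..<n}) x * f x) = (LINT x|LM {..<n}. f x)" for f :: "_ \<Rightarrow> real"
    by (intro Bochner_Integration.integrable_cong Bochner_Integration.integral_cong; simp add: space_LM)+
  show "integrable (LM {..<n}) (\<lambda>x. (cmod (conv I \<kappa> \<psi> x))\<^sup>2)" "sq_norm n (conv I \<kappa> \<psi>) \<le> A\<^sup>2 * sq_norm n \<psi>"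
    using conv_L2[OF I \<kappa> A \<psi> S s] unfolding e sq_norm_def by auto
qed

lemma norm_add_sq: "(cmod (a + b))\<^sup>2 \<le> 2 * (cmod a)\<^sup>2 + 2 * (cmod b)\<^sup>2"
proof -
  have "(cmod (a + b))\<^sup>2 \<le> (cmod a + cmod b)\<^sup>2" by (intro power_mono norm_triangle_ineq) auto
  also have "\<dots> \<le> 2 * (cmod a)\<^sup>2 + 2 * (cmod b)\<^sup>2"
    using sum_squares_bound[of "cmod a" "cmod b"] by (simp add: power2_sum)
  finally show ?thesis .
qed

lemma norm_diff_sq: "(cmod (a - b))\<^sup>2 \<le> 2 * (cmod a)\<^sup>2 + 2 * (cmod b)\<^sup>2"
  using norm_add_sq[of a "- b"] by simp

lemma sq_norm_mono:
  assumes "f \<in> Cc_inf n" "integrable (LM {..<n}) h" "\<And>x. x \<in> extensional {..<n} \<Longrightarrow> (cmod (f x))\<^sup>2 \<le> h x"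
  shows "sq_norm n f \<le> (LINT x|LM {..<n}. h x)"
  unfolding sq_norm_def by (rule integral_mono[OF Cc_inf_sq_integrable[OF assms(1)] assms(2)]) (use assms(3) in \<open>auto simp: space_LM\<close>)

text \<open>A function of the coordinates in \<open>I\<close> with bounded support in these coordinates is
  bounded, although its support is unbounded in the others.\<close>

lemma block_bounded:
  fixes f :: "(nat \<Rightarrow> complex) \<Rightarrow> complex"
  assumes f: "continuous_map (PT {..<n}) euclidean f" and I: "I \<subseteq> {..<n}" and s: "slab_supp n I R f"
    and dep: "\<And>x. x \<in> extensional {..<n} \<Longrightarrow> f x = f (\<lambda>k\<in>{..<n}. if k \<in> I then x k else 0)"
  obtains B where "B \<ge> 0" "\<And>x. x \<in> extensional {..<n} \<Longrightarrow> cmod (f x) \<le> B"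
proof -
  obtain C where C: "C \<ge> 0" "\<And>x. x \<in> extensional {..<n} \<Longrightarrow> (\<forall>k\<in>{..<n}. cmod (x k) \<le> max R 0) \<Longrightarrow> cmod (f x) \<le> C"
    by (rule continuous_map_PT_bounded[OF _ f]) auto
  show ?thesis
  proof (rule that[OF C(1)])
    fix x :: "nat \<Rightarrow> complex" assume x: "x \<in> extensional {..<n}"
    show "cmod (f x) \<le> C"
    proof (cases "f x = 0")
      case False
      then have "x \<in> slab n I R" using s x by (auto simp: slab_supp_def)
      then have "cmod (f (\<lambda>k\<in>{..<n}. if k \<in> I then x k else 0)) \<le> C"
        by (intro C(2)) (auto simp: slab_def le_max_iff_disj)
      then show ?thesis using dep[OF x] by simp
    qed (use C in simp)
  qed
qed

text \<open>A cutoff in the coordinates of \<open>I\<close>. Instead of being \<open>1\<close> on the inner slab it is bounded below there, which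
  serves the same purpose in an estimate and is what a plain bump offers.\<close>

lemma cutoff_exists:
  assumes I: "I \<subseteq> {..<n}" and R: "0 < R0" "R0 < R1"
  obtains \<theta> B c where "\<And>r. Ck n r \<theta>" "slab_supp n I R1 \<theta>" "B \<ge> 0" "c > 0"
    "\<And>x. x \<in> extensional {..<n} \<Longrightarrow> cmod (\<theta> x) \<le> 1"
    "\<And>x. x \<in> slab n I R0 \<Longrightarrow> c \<le> (cmod (\<theta> x))\<^sup>2"
    "\<And>x k v. x \<in> extensional {..<n} \<Longrightarrow> k \<in> I \<Longrightarrow> v \<in> {1, \<i>} \<Longrightarrow> cmod (partial k v \<theta> x) \<le> B"
proof -
  have fI: "finite I" using I finite_subset by blast
  define \<theta> where "\<theta> x = complex_of_real (bump I (\<lambda>_. 0) R1 x)" for x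
  have smooth: "Ck n r \<theta>" for r unfolding \<theta>_def by (rule Ck_bump[OF I])
  have supp: "slab_supp n I R1 \<theta>"
    unfolding slab_supp_def slab_def \<theta>_def
  proof (intro ballI impI CollectI conjI)
    fix x k assume x: "complex_of_real (bump I (\<lambda>_. 0) R1 x) \<noteq> 0" and k: "k \<in> I"
    show "cmod (x k) \<le> R1" using bump_zero[OF fI k, of R1 x "\<lambda>_. 0"] x R by force
  qed
  have dep: "\<theta> x = \<theta> y" if "\<And>k. k \<in> I \<Longrightarrow> x k = y k" for x y
    unfolding \<theta>_def bump_def using that by (simp cong: prod.cong)
  have "\<exists>B\<ge>0. \<forall>x\<in>extensional {..<n}. cmod (partial k v \<theta> x) \<le> B" if k: "k \<in> I" and v: "v \<in> {1, \<i>}" for k v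
  proof -
    have kn: "k < n" using k I by auto
    have 1: "continuous_map (PT {..<n}) euclidean (partial k v \<theta>)" by (rule Ck_cont[OF Ck_partial[OF smooth kn v]])
    have 2: "slab_supp n I R1 (partial k v \<theta>)" by (rule slab_supp_partial[OF smooth supp kn v])
    have 3: "partial k v \<theta> x = partial k v \<theta> (\<lambda>k\<in>{..<n}. if k \<in> I then x k else 0)" for x
    proof -
      have "\<theta> (x(k := x k + t *\<^sub>R v)) = \<theta> ((\<lambda>k\<in>{..<n}. if k \<in> I then x k else 0)(k := (\<lambda>k\<in>{..<n}. if k \<in> I then x k else 0) k + t *\<^sub>R v))" for t
        by (rule dep) (use I k in auto)
      then show ?thesis unfolding partial_def by presburger
    qed
    obtain B where "B \<ge> 0" "\<And>x. x \<in> extensional {..<n} \<Longrightarrow> cmod (partial k v \<theta> x) \<le> B"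
      using block_bounded[OF 1 I 2 3] by metis
    then show ?thesis by blast
  qed
  then obtain b where b: "\<And>k v. k \<in> I \<Longrightarrow> v \<in> {1, \<i>} \<Longrightarrow> b k v \<ge> 0 \<and> (\<forall>x\<in>extensional {..<n}. cmod (partial k v \<theta> x) \<le> b k v)"
    by metis
  define B where "B = (\<Sum>k\<in>I. b k 1 + b k \<i>)"
  have b0: "0 \<le> b k 1 + b k \<i>" if "k \<in> I" for k using b[OF that, of 1] b[OF that, of \<i>] by simp
  define c where "c = (flat 0 (R1\<^sup>2 - R0\<^sup>2)) ^ card I"
  have c: "c > 0" unfolding c_def using R by (intro zero_less_power flat0(3)) (simp add: power_strict_mono)
  show ?thesis
  proof (rule that[OF smooth supp])
    show "B \<ge> 0" unfolding B_def using b0 by (intro sum_nonneg) auto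
    show "c\<^sup>2 > 0" using c by simp
    show "cmod (\<theta> x) \<le> 1" for x unfolding \<theta>_def norm_of_real using bump_01[of I "\<lambda>_. 0" R1 x] by simp
    show "c\<^sup>2 \<le> (cmod (\<theta> x))\<^sup>2" if x: "x \<in> slab n I R0" for x
    proof -
      have "c = (\<Prod>k\<in>I. flat 0 (R1\<^sup>2 - R0\<^sup>2))" by (simp add: c_def)
      also have "\<dots> \<le> bump I (\<lambda>_. 0) R1 x"
        unfolding bump_def by (intro prod_mono) (use x R in \<open>auto simp: slab_def flat0 intro!: flat0_mono power_mono\<close>)
      finally show ?thesis using c unfolding \<theta>_def norm_of_real by (intro power_mono) auto
    qed
    show "cmod (partial k v \<theta> x) \<le> B" if x: "x \<in> extensional {..<n}" and k: "k \<in> I" and v: "v \<in> {1, \<i>}" for x k v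
    proof -
      have "cmod (partial k v \<theta> x) \<le> b k v" using b[OF k v] x by blast
      also have "\<dots> \<le> b k 1 + b k \<i>" using v b[OF k, of 1] b[OF k, of \<i>] by auto
      also have "\<dots> \<le> B" unfolding B_def using b0 fI k by (intro member_le_sum) auto
      finally show ?thesis .
    qed
  qed
qed

lemma partial_z_mult:
  assumes "Ck n (Suc 0) f" "Ck n (Suc 0) g" "k < n" "z \<in> extensional {..<n}"
  shows "partial_z k (\<lambda>x. f x * g x) z = f z * partial_z k g z + partial_z k f z * g z"
    "partial_zbar k (\<lambda>x. f x * g x) z = f z * partial_zbar k g z + partial_zbar k f z * g z"
  using partial_mult[OF assms(1,2,3) _ assms(4), of 1] partial_mult[OF assms(1,2,3) _ assms(4), of \<i>]
  by (simp_all add: partial_z_def partial_zbar_def field_simps)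

lemma partial_via_z:
  "(cmod (partial k v f x))\<^sup>2 \<le> 2 * (cmod (partial_z k f x))\<^sup>2 + 2 * (cmod (partial_zbar k f x))\<^sup>2" if "v \<in> {1, \<i>}"
proof -
  have "partial k 1 f x = partial_z k f x + partial_zbar k f x"
    by (simp add: partial_z_def partial_zbar_def field_simps)
  moreover have "partial k \<i> f x = \<i> * (partial_z k f x - partial_zbar k f x)"
    by (simp add: partial_z_def partial_zbar_def field_simps)
  ultimately show ?thesis
    using that norm_add_sq[of "partial_z k f x" "partial_zbar k f x"] norm_diff_sq[of "partial_z k f x" "partial_zbar k f x"]
    by (auto simp: norm_mult)
qed

text \<open>The energy estimate behind the gain of a derivative. Let \<open>u\<^sub>i\<close> be the convolution of \<open>\<phi>\<close> with the
  regularised kernel and \<open>\<theta>\<close> a cutoff in the block. The field \<open>\<theta> u\<^sub>i\<close> has bounded support, its divergence is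
  \<open>- \<theta>\<close> times a convolution of \<open>\<phi>\<close> with a density of fixed mass, up to terms \<open>u\<^sub>i dbar\<^sub>i \<theta>\<close>, and its curl consists of terms
  \<open>u\<^sub>i \<partial>\<^sub>l \<theta>\<close>. None of these differentiates \<open>u\<^sub>i\<close>, so \<open>div_curl_identity\<close> bounds all derivatives of \<open>\<theta> u\<^sub>i\<close> by the
  norm of \<open>\<phi>\<close>, uniformly in \<open>e\<close>.\<close>

lemma conv_bm_cut_gain_eps:
  assumes I: "I \<subseteq> {..<n}" "I \<noteq> {}" and R0: "R0 > 0"
  obtains C where "C \<ge> 0"
    "\<And>e \<phi> i l v. e > 0 \<Longrightarrow> \<phi> \<in> Cc_inf n \<Longrightarrow> slab_supp n I R0 \<phi> \<Longrightarrow> i \<in> I \<Longrightarrow> l \<in> I \<Longrightarrow> v \<in> {1, \<i>} \<Longrightarrow>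
       (LINT x|LM {..<n}. indicator (slab n I R0) x * (cmod (conv I (bm_cut I (2 * R0 + 1) e i) (partial l v \<phi>) x))\<^sup>2) \<le> C * sq_norm n \<phi>"
proof -
  let ?M = "LM {..<n}"
  have fI: "finite I" using I finite_subset by blast
  \<comment> \<open>The cutoff lives between \<open>R0\<close> and \<open>R1\<close>; the box of size \<open>R0 + R1\<close> is invisible on its support.\<close>
  define R where "R = 2 * R0 + 1"
  define R1 where "R1 = R0 + 1"
  have R: "R > 0" "R0 + R1 \<le> R" "R0 < R1" using R0 by (auto simp: R_def R1_def)
  define a where "a = real (card I)"
  define A where "A = max 1 (LINT \<zeta>|LM I. majorant I R \<zeta>)"
  define c0 where "c0 = (LINT \<zeta>|LM I. bm_density I 1 \<zeta>)"
  have c0: "c0 > 0" unfolding c0_def by (rule bm_density_integral_pos[OF fI I(2)])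
  obtain \<theta> B c where \<theta>: "\<And>r. Ck n r \<theta>" "slab_supp n I R1 \<theta>" and B: "B \<ge> 0" and c: "c > 0"
    and \<theta>1: "\<And>x. x \<in> extensional {..<n} \<Longrightarrow> cmod (\<theta> x) \<le> 1"
    and \<theta>c: "\<And>x. x \<in> slab n I R0 \<Longrightarrow> c \<le> (cmod (\<theta> x))\<^sup>2"
    and \<theta>B: "\<And>x k v. x \<in> extensional {..<n} \<Longrightarrow> k \<in> I \<Longrightarrow> v \<in> {1, \<i>} \<Longrightarrow> cmod (partial k v \<theta> x) \<le> B"
    using cutoff_exists[OF I(1) R0 R(3)] by metis
  have \<theta>z: "cmod (partial_z k \<theta> x) \<le> B" "cmod (partial_zbar k \<theta> x) \<le> B" if "x \<in> extensional {..<n}" "k \<in> I" for x k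
  proof -
    have b: "cmod (partial k 1 \<theta> x) \<le> B" "cmod (partial k \<i> \<theta> x) \<le> B" using \<theta>B[OF that] by auto
    have "cmod (partial k 1 \<theta> x - \<i> * partial k \<i> \<theta> x) \<le> 2 * B" "cmod (partial k 1 \<theta> x + \<i> * partial k \<i> \<theta> x) \<le> 2 * B"
      using b norm_triangle_ineq4[of "partial k 1 \<theta> x" "\<i> * partial k \<i> \<theta> x"] norm_triangle_ineq[of "partial k 1 \<theta> x" "\<i> * partial k \<i> \<theta> x"]
      by (simp_all add: norm_mult)
    then show "cmod (partial_z k \<theta> x) \<le> B" "cmod (partial_zbar k \<theta> x) \<le> B"
      by (simp_all add: partial_z_def partial_zbar_def norm_divide)
  qed
  define C1 where "C1 = 2 * c0\<^sup>2 + 2 * a * B\<^sup>2 * (a * A\<^sup>2) + 2 * a\<^sup>2 * B\<^sup>2 * A\<^sup>2"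
  define C where "C = (8 * C1 + 2 * B\<^sup>2 * A\<^sup>2) / c"
  have C10: "C1 \<ge> 0" unfolding C1_def a_def by (intro add_nonneg_nonneg mult_nonneg_nonneg) auto
  show ?thesis
  proof (rule that[of C])
    show "C \<ge> 0" unfolding C_def using C10 c by simp
    fix e \<phi> i l v assume e: "(e::real) > 0" and \<phi>: "\<phi> \<in> Cc_inf n" "slab_supp n I R0 \<phi>" and i: "i \<in> I" and l: "l \<in> I" and v: "v \<in> {1, \<i>}"
    define W where "W = sq_norm n \<phi>"
    have W0: "W \<ge> 0" unfolding W_def by (rule sq_norm_nonneg)
    define u where "u i = conv I (bm_cut I R e i) \<phi>" for i
    define q where "q i x = \<theta> x * u i x" for i x
    have n: "i < n" if "i \<in> I" for i using that I by auto
    note ki = bm_cut_integrable(1)[OF fI _ less_imp_le[OF e] R(1)]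
    have uD: "u i \<in> Cc_inf n" if "i \<in> I" for i
      unfolding u_def using conv_Cc_inf[OF I(1) ki[OF that] bm_cut_box_supp _ \<phi>(1)] R(1) by simp
    have qD: "q i \<in> Cc_inf n" if "i \<in> I" for i
      unfolding q_def by (rule Cc_inf_mult[OF uD[OF that] \<theta>(1)])
    have uW: "sq_norm n (u i) \<le> A\<^sup>2 * W" if "i \<in> I" for i
    proof -
      have "(LINT \<zeta>|LM I. cmod (bm_cut I R e i \<zeta>)) \<le> A"
        using bm_cut_integrable(2)[OF fI that less_imp_le[OF e] R(1)] by (simp add: A_def)
      then show ?thesis unfolding u_def W_def by (intro sq_norm_conv[OF I(1) ki[OF that] _ _ \<phi>(1)]) (auto simp: A_def)
    qed
    define \<eta> where "\<eta> \<zeta> = complex_of_real (bm_density I e \<zeta>)" for \<zeta>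
    have \<eta>i: "integrable (LM I) \<eta>" "(LINT \<zeta>|LM I. cmod (\<eta> \<zeta>)) \<le> c0"
    proof -
      show "integrable (LM I) \<eta>"
        unfolding \<eta>_def[abs_def] by (rule integrable_of_real[OF bm_density_integrable_eps(1)[OF fI I(2) e]])
      have "bm_density I e \<zeta> \<ge> 0" for \<zeta> using nsq_nonneg[of I \<zeta>] e by (simp add: bm_density_def)
      then show "(LINT \<zeta>|LM I. cmod (\<eta> \<zeta>)) \<le> c0"
        using bm_density_integrable_eps(2)[OF fI I(2) e] by (simp add: \<eta>_def c0_def)
    qed
    note \<eta>c = sq_norm_conv[OF I(1) \<eta>i(1) c0 \<eta>i(2) \<phi>(1)]
    have usq: "integrable ?M (\<lambda>x. (cmod (u i x))\<^sup>2)" if "i \<in> I" for i by (rule Cc_inf_sq_integrable[OF uD[OF that]])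
    have zu: "partial_z k (u i) x = conv I (bm_cut I R e i) (partial_z k \<phi>) x"
      "partial_zbar k (u i) x = conv I (bm_cut I R e i) (partial_zbar k \<phi>) x"
      if "i \<in> I" "k \<in> I" "x \<in> extensional {..<n}" for i k x
      unfolding u_def using partial_z_conv[OF I(1) ki[OF that(1)] \<phi>(1) n[OF that(2)] that(3)] by auto
    have zq: "partial_z k (q i) x = \<theta> x * partial_z k (u i) x + partial_z k \<theta> x * u i x"
      "partial_zbar k (q i) x = \<theta> x * partial_zbar k (u i) x + partial_zbar k \<theta> x * u i x"
      if "i \<in> I" "k \<in> I" "x \<in> extensional {..<n}" for i k x
      using partial_z_mult[OF \<theta>(1) Cc_inf_Ck[OF uD[OF that(1)]] n[OF that(2)] that(3)] unfolding q_def[abs_def] by auto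
    have E: "sq_norm n (\<lambda>x. \<Sum>i\<in>I. partial_zbar i (q i) x) \<le> (2 * c0\<^sup>2 + 2 * a * B\<^sup>2 * (a * A\<^sup>2)) * W"
    proof -
      let ?h = "\<lambda>x. 2 * (cmod (conv I \<eta> \<phi> x))\<^sup>2 + 2 * a * B\<^sup>2 * (\<Sum>i\<in>I. (cmod (u i x))\<^sup>2)"
      have bd: "(cmod (\<Sum>i\<in>I. partial_zbar i (q i) x))\<^sup>2 \<le> ?h x" if x: "x \<in> extensional {..<n}" for x
      proof -
        have "(\<Sum>i\<in>I. partial_zbar i (q i) x) = \<theta> x * (\<Sum>i\<in>I. conv I (bm_cut I R e i) (partial_zbar i \<phi>) x) + (\<Sum>i\<in>I. partial_zbar i \<theta> x * u i x)"
          using zq(2)[OF _ _ x] zu(2)[OF _ _ x] by (simp add: sum.distrib sum_distrib_left)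
        \<comment> \<open>Only where \<open>\<theta>\<close> does not vanish are the cut kernels as good as the kernels.\<close>
        also have "\<theta> x * (\<Sum>i\<in>I. conv I (bm_cut I R e i) (partial_zbar i \<phi>) x) = - \<theta> x * conv I \<eta> \<phi> x"
        proof (cases "\<theta> x = 0")
          case False
          then have "x \<in> slab n I R1" using \<theta>(2) x by (auto simp: slab_supp_def)
          then show ?thesis using conv_bm_cut_div_eps[OF I(1) e \<phi> _ R(2)] by (simp add: \<eta>_def[abs_def])
        qed simp
        finally have eq: "(\<Sum>i\<in>I. partial_zbar i (q i) x) = - \<theta> x * conv I \<eta> \<phi> x + (\<Sum>i\<in>I. partial_zbar i \<theta> x * u i x)" .
        have h1: "cmod (- \<theta> x * conv I \<eta> \<phi> x) \<le> 1 * cmod (conv I \<eta> \<phi> x)"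
          unfolding norm_mult norm_minus_cancel by (intro mult_right_mono \<theta>1[OF x]) auto
        have h2: "cmod (\<Sum>i\<in>I. partial_zbar i \<theta> x * u i x) \<le> (\<Sum>i\<in>I. B * cmod (u i x))"
        proof -
          have "cmod (\<Sum>i\<in>I. partial_zbar i \<theta> x * u i x) \<le> (\<Sum>i\<in>I. cmod (partial_zbar i \<theta> x * u i x))" by (rule norm_sum)
          also have "\<dots> \<le> (\<Sum>i\<in>I. B * cmod (u i x))" unfolding norm_mult by (intro sum_mono mult_right_mono \<theta>z(2)[OF x]) auto
          finally show ?thesis .
        qed
        have h3: "(\<Sum>i\<in>I. B * cmod (u i x))\<^sup>2 \<le> a * B\<^sup>2 * (\<Sum>i\<in>I. (cmod (u i x))\<^sup>2)"
        proof -
          have "(\<Sum>i\<in>I. B * cmod (u i x))\<^sup>2 \<le> (\<Sum>i\<in>I. (B * cmod (u i x))\<^sup>2) * a"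
            unfolding a_def by (rule sum_squared_le_sum_of_squares)
          also have "\<dots> = a * B\<^sup>2 * (\<Sum>i\<in>I. (cmod (u i x))\<^sup>2)"
            by (simp add: power_mult_distrib sum_distrib_left sum_distrib_right ac_simps)
          finally show ?thesis .
        qed
        have "(cmod (\<Sum>i\<in>I. partial_zbar i (q i) x))\<^sup>2
            \<le> 2 * (cmod (- \<theta> x * conv I \<eta> \<phi> x))\<^sup>2 + 2 * (cmod (\<Sum>i\<in>I. partial_zbar i \<theta> x * u i x))\<^sup>2"
          unfolding eq by (rule norm_add_sq)
        also have "\<dots> \<le> 2 * (1 * cmod (conv I \<eta> \<phi> x))\<^sup>2 + 2 * (\<Sum>i\<in>I. B * cmod (u i x))\<^sup>2"
          using h1 h2 by (intro add_mono mult_left_mono power_mono) auto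
        also have "\<dots> \<le> 2 * (1 * cmod (conv I \<eta> \<phi> x))\<^sup>2 + 2 * (a * B\<^sup>2 * (\<Sum>i\<in>I. (cmod (u i x))\<^sup>2))"
          using h3 by simp
        finally show ?thesis by simp
      qed
      have sD: "(\<lambda>x. \<Sum>i\<in>I. partial_zbar i (q i) x) \<in> Cc_inf n"
        using fI Cc_inf_partial_z(2)[OF qD n] by (intro Cc_inf_sum) auto
      have "sq_norm n (\<lambda>x. \<Sum>i\<in>I. partial_zbar i (q i) x) \<le> (LINT x|?M. ?h x)"
        by (rule sq_norm_mono[OF sD _ bd]) (use \<eta>c(1) usq in auto)
      also have "\<dots> = 2 * sq_norm n (conv I \<eta> \<phi>) + 2 * a * B\<^sup>2 * (\<Sum>i\<in>I. sq_norm n (u i))"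
        unfolding sq_norm_def using \<eta>c(1) usq by simp
      also have "\<dots> \<le> 2 * (c0\<^sup>2 * W) + 2 * a * B\<^sup>2 * (\<Sum>i\<in>I. A\<^sup>2 * W)"
        using \<eta>c(2) uW unfolding W_def a_def by (intro add_mono mult_left_mono sum_mono) auto
      also have "\<dots> = (2 * c0\<^sup>2 + 2 * a * B\<^sup>2 * (a * A\<^sup>2)) * W" by (simp add: a_def algebra_simps)
      finally show ?thesis .
    qed
    have w: "sq_norm n (\<lambda>x. partial_z l (q i) x - partial_z i (q l) x) \<le> 4 * B\<^sup>2 * A\<^sup>2 * W" if il: "i \<in> I" "l \<in> I" for i l
    proof -
      let ?h = "\<lambda>x. 2 * B\<^sup>2 * (cmod (u i x))\<^sup>2 + 2 * B\<^sup>2 * (cmod (u l x))\<^sup>2"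
      have bd: "(cmod (partial_z l (q i) x - partial_z i (q l) x))\<^sup>2 \<le> ?h x" if x: "x \<in> extensional {..<n}" for x
      proof -
        \<comment> \<open>The field \<open>u\<close> has no curl on the support of \<open>\<theta>\<close>.\<close>
        have "\<theta> x * partial_z l (u i) x = \<theta> x * partial_z i (u l) x"
        proof (cases "\<theta> x = 0")
          case False
          then have "x \<in> slab n I R1" using \<theta>(2) x by (auto simp: slab_supp_def)
          then show ?thesis using conv_bm_cut_curl_eps[OF I(1) il e \<phi> _ R(2)] zu(1)[OF il x] zu(1)[OF il(2,1) x] by simp
        qed simp
        then have "partial_z l (q i) x - partial_z i (q l) x = partial_z l \<theta> x * u i x - partial_z i \<theta> x * u l x"
          using zq(1)[OF il x] zq(1)[OF il(2,1) x] by simp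
        then have "(cmod (partial_z l (q i) x - partial_z i (q l) x))\<^sup>2 \<le> 2 * (cmod (partial_z l \<theta> x * u i x))\<^sup>2 + 2 * (cmod (partial_z i \<theta> x * u l x))\<^sup>2"
          using norm_diff_sq by simp
        also have "\<dots> \<le> 2 * (B * cmod (u i x))\<^sup>2 + 2 * (B * cmod (u l x))\<^sup>2"
          unfolding norm_mult by (intro add_mono mult_left_mono power_mono mult_right_mono \<theta>z(1)[OF x] il) auto
        finally show ?thesis by (simp add: power_mult_distrib)
      qed
      have D: "(\<lambda>x. partial_z l (q i) x - partial_z i (q l) x) \<in> Cc_inf n"
        using Cc_inf_add[OF Cc_inf_partial_z(1)[OF qD[OF il(1)] n[OF il(2)]] Cc_inf_cmult[OF Cc_inf_partial_z(1)[OF qD[OF il(2)] n[OF il(1)]], of "-1"]] by simp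
      have "sq_norm n (\<lambda>x. partial_z l (q i) x - partial_z i (q l) x) \<le> (LINT x|?M. ?h x)"
        by (rule sq_norm_mono[OF D _ bd]) (use usq il in auto)
      also have "\<dots> = 2 * B\<^sup>2 * sq_norm n (u i) + 2 * B\<^sup>2 * sq_norm n (u l)"
        unfolding sq_norm_def using usq il by simp
      also have "\<dots> \<le> 2 * B\<^sup>2 * (A\<^sup>2 * W) + 2 * B\<^sup>2 * (A\<^sup>2 * W)"
        using uW il by (intro add_mono mult_left_mono) auto
      also have "\<dots> = 4 * B\<^sup>2 * A\<^sup>2 * W" by (simp add: algebra_simps)
      finally show ?thesis .
    qed
    have "(\<Sum>i\<in>I. \<Sum>l\<in>I. sq_norm n (\<lambda>x. partial_z l (q i) x - partial_z i (q l) x)) \<le> (\<Sum>i\<in>I. \<Sum>l\<in>I. 4 * B\<^sup>2 * A\<^sup>2 * W)"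
      by (intro sum_mono w)
    also have "\<dots> = 4 * a\<^sup>2 * B\<^sup>2 * A\<^sup>2 * W" by (simp add: a_def power2_eq_square)
    finally have T: "(\<Sum>i\<in>I. \<Sum>l\<in>I. sq_norm n (partial_z l (q i))) \<le> C1 * W"
      using div_curl_identity[OF I(1) qD] E unfolding C1_def by (simp add: algebra_simps)
    have zW: "sq_norm n (partial_z l (q i)) \<le> C1 * W"
    proof -
      have "sq_norm n (partial_z l (q i)) \<le> (\<Sum>l\<in>I. sq_norm n (partial_z l (q i)))"
        using fI l by (intro member_le_sum) (auto simp: sq_norm_nonneg)
      also have "\<dots> \<le> (\<Sum>i\<in>I. \<Sum>l\<in>I. sq_norm n (partial_z l (q i)))"
        using fI i by (intro member_le_sum[of i I "\<lambda>i. \<Sum>l\<in>I. sq_norm n (partial_z l (q i))"]) (auto simp: sq_norm_nonneg sum_nonneg)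
      finally show ?thesis using T by linarith
    qed
    have zbW: "sq_norm n (partial_zbar l (q i)) \<le> C1 * W" using zW sq_norm_zbar[OF qD[OF i] n[OF l]] by simp
    let ?g = "\<lambda>x. (4 * (cmod (partial_z l (q i) x))\<^sup>2 + 4 * (cmod (partial_zbar l (q i) x))\<^sup>2 + 2 * B\<^sup>2 * (cmod (u i x))\<^sup>2) / c"
    have bd: "indicator (slab n I R0) x * (cmod (conv I (bm_cut I R e i) (partial l v \<phi>) x))\<^sup>2 \<le> ?g x" if x: "x \<in> extensional {..<n}" for x
    proof (cases "x \<in> slab n I R0")
      case True
      have pu: "partial l v (u i) x = conv I (bm_cut I R e i) (partial l v \<phi>) x"
        unfolding u_def by (rule partial_conv[OF I(1) ki[OF i] \<phi>(1) n[OF l] v x])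
      have "partial l v (q i) x = \<theta> x * partial l v (u i) x + partial l v \<theta> x * u i x"
        unfolding q_def[abs_def] by (rule partial_mult[OF \<theta>(1) Cc_inf_Ck[OF uD[OF i]] n[OF l] v x])
      then have "\<theta> x * partial l v (u i) x = partial l v (q i) x - partial l v \<theta> x * u i x" by simp
      then have "(cmod (\<theta> x * partial l v (u i) x))\<^sup>2 \<le> 2 * (cmod (partial l v (q i) x))\<^sup>2 + 2 * (cmod (partial l v \<theta> x * u i x))\<^sup>2"
        using norm_diff_sq by simp
      also have "\<dots> \<le> 2 * (2 * (cmod (partial_z l (q i) x))\<^sup>2 + 2 * (cmod (partial_zbar l (q i) x))\<^sup>2) + 2 * (B * cmod (u i x))\<^sup>2"
        unfolding norm_mult[of "partial l v \<theta> x"]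
        by (intro add_mono mult_left_mono partial_via_z[OF v] power_mono mult_right_mono \<theta>B[OF x l v]) auto
      finally have *: "(cmod (\<theta> x))\<^sup>2 * (cmod (partial l v (u i) x))\<^sup>2 \<le> 4 * (cmod (partial_z l (q i) x))\<^sup>2 + 4 * (cmod (partial_zbar l (q i) x))\<^sup>2 + 2 * B\<^sup>2 * (cmod (u i x))\<^sup>2"
        by (simp add: norm_mult power_mult_distrib)
      have "c * (cmod (partial l v (u i) x))\<^sup>2 \<le> (cmod (\<theta> x))\<^sup>2 * (cmod (partial l v (u i) x))\<^sup>2"
        by (intro mult_right_mono \<theta>c[OF True]) auto
      then show ?thesis using * c True by (simp add: pu pos_le_divide_eq mult.commute[of _ c])
    qed (use c B in \<open>auto intro!: divide_nonneg_pos add_nonneg_nonneg\<close>)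
    have gi: "integrable ?M ?g"
      using Cc_inf_sq_integrable[OF Cc_inf_partial_z(1)[OF qD[OF i] n[OF l]]] Cc_inf_sq_integrable[OF Cc_inf_partial_z(2)[OF qD[OF i] n[OF l]]] usq[OF i] by simp
    have "(LINT x|?M. indicator (slab n I R0) x * (cmod (conv I (bm_cut I R e i) (partial l v \<phi>) x))\<^sup>2) \<le> (LINT x|?M. ?g x)"
      by (rule integral_mono'[OF gi]) (use bd c in \<open>auto simp: space_LM intro!: divide_nonneg_pos add_nonneg_nonneg\<close>)
    also have "\<dots> = (4 * sq_norm n (partial_z l (q i)) + 4 * sq_norm n (partial_zbar l (q i)) + 2 * B\<^sup>2 * sq_norm n (u i)) / c"
      unfolding sq_norm_def using Cc_inf_sq_integrable[OF Cc_inf_partial_z(1)[OF qD[OF i] n[OF l]]] Cc_inf_sq_integrable[OF Cc_inf_partial_z(2)[OF qD[OF i] n[OF l]]] usq[OF i] by simp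
    also have "\<dots> \<le> (4 * (C1 * W) + 4 * (C1 * W) + 2 * B\<^sup>2 * (A\<^sup>2 * W)) / c"
      using zW zbW uW[OF i] c by (intro divide_right_mono add_mono mult_left_mono) auto
    also have "\<dots> = C * W" by (simp add: C_def algebra_simps)
    finally show "(LINT x|?M. indicator (slab n I R0) x * (cmod (conv I (bm_cut I (2 * R0 + 1) e i) (partial l v \<phi>) x))\<^sup>2) \<le> C * sq_norm n \<phi>"
      by (simp add: R_def W_def)
  qed
qed

lemma slab_sets: "I \<subseteq> {..<n} \<Longrightarrow> slab n I R \<in> sets (LM {..<n})"
  unfolding slab_def by (rule box_sets) auto

text \<open>The bound for the regularised kernels does not depend on the parameter and passes to the limit
  \<open>e \<rightarrow> 0\<close>.\<close>

lemma conv_bm_cut_gain: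
  assumes I: "I \<subseteq> {..<n}" "I \<noteq> {}" and R0: "R0 > 0"
  obtains C where "C \<ge> 0"
    "\<And>\<phi> i l v. \<phi> \<in> Cc_inf n \<Longrightarrow> slab_supp n I R0 \<phi> \<Longrightarrow> i \<in> I \<Longrightarrow> l \<in> I \<Longrightarrow> v \<in> {1, \<i>} \<Longrightarrow>
       (LINT x|LM {..<n}. indicator (slab n I R0) x * (cmod (conv I (bm_cut I (2 * R0 + 1) 0 i) (partial l v \<phi>) x))\<^sup>2) \<le> C * sq_norm n \<phi>"
proof -
  let ?M = "LM {..<n}"
  have fI: "finite I" using I finite_subset by blast
  define R where "R = 2 * R0 + 1"
  have R: "R > 0" using R0 by (simp add: R_def)
  obtain C where C: "C \<ge> 0"
    "\<And>e \<phi> i l v. e > 0 \<Longrightarrow> \<phi> \<in> Cc_inf n \<Longrightarrow> slab_supp n I R0 \<phi> \<Longrightarrow> i \<in> I \<Longrightarrow> l \<in> I \<Longrightarrow> v \<in> {1, \<i>} \<Longrightarrow>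
       (LINT x|?M. indicator (slab n I R0) x * (cmod (conv I (bm_cut I R e i) (partial l v \<phi>) x))\<^sup>2) \<le> C * sq_norm n \<phi>"
    unfolding R_def using conv_bm_cut_gain_eps[OF I R0] by blast
  show ?thesis
  proof (rule that[OF C(1)])
    fix \<phi> i l v assume \<phi>: "\<phi> \<in> Cc_inf n" "slab_supp n I R0 \<phi>" and i: "i \<in> I" and l: "l \<in> I" and v: "v \<in> {1, \<i>}"
    define s where "s m = 1 / real (Suc m)" for m
    have s: "s \<longlonglongrightarrow> 0" "\<And>n. s n > 0" "\<And>n. s n \<ge> 0"
      unfolding s_def using LIMSEQ_inverse_real_of_nat by (auto simp: inverse_eq_divide)
    have pD: "partial l v \<phi> \<in> Cc_inf n" using Cc_inf_partial[OF \<phi>(1) _ v] l I by auto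
    obtain S where S: "box_supp {..<n} S (partial l v \<phi>)" using pD by (auto simp: Cc_inf_def)
    obtain K where K: "K \<ge> 0" "\<And>x. x \<in> extensional {..<n} \<Longrightarrow> cmod (partial l v \<phi> x) \<le> K" using Cc_inf_bounded[OF pD] by metis
    define A where "A = (LINT \<zeta>|LM I. majorant I R \<zeta>)"
    define G where "G e x = conv I (bm_cut I R e i) (partial l v \<phi>) x" for e x
    have GD: "G e \<in> Cc_inf n" if "e \<ge> 0" for e
      unfolding G_def using conv_Cc_inf[OF I(1) bm_cut_integrable(1)[OF fI i that R] bm_cut_box_supp _ pD] R by simp
    have Gs: "box_supp {..<n} (S + R) (G e)" for e unfolding G_def using conv_box_supp[OF I(1) bm_cut_box_supp _ S] R by simp
    have Gb: "cmod (G e x) \<le> A * K" if e: "e \<ge> 0" and x: "x \<in> extensional {..<n}" for e x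
    proof -
      note ki = bm_cut_integrable[OF fI i e R]
      have "cmod (G e x) \<le> (LINT \<zeta>|LM I. cmod (bm_cut I R e i \<zeta> * partial l v \<phi> (shift I \<zeta> x)))"
        unfolding G_def conv_def by (rule integral_norm_bound)
      also have "\<dots> \<le> (LINT \<zeta>|LM I. cmod (bm_cut I R e i \<zeta>) * K)"
        by (rule integral_mono[OF integrable_norm[OF Cc_inf_conv_integrand[OF I(1) ki(1) pD x]]])
          (use ki(1) K(2)[OF shift_extensional[OF I(1) x]] in \<open>auto simp: norm_mult mult_left_mono\<close>)
      also have "\<dots> = (LINT \<zeta>|LM I. cmod (bm_cut I R e i \<zeta>)) * K" by simp
      also have "\<dots> \<le> A * K" using ki(2) K by (simp add: A_def mult_right_mono)
      finally show ?thesis .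
    qed
    let ?B = "{x \<in> extensional {..<n}. \<forall>k\<in>{..<n}. cmod (x k) \<le> S + R}"
    have [measurable]: "slab n I R0 \<in> sets ?M" by (rule slab_sets[OF I(1)])
    have [measurable]: "G e \<in> borel_measurable ?M" if "e \<ge> 0" for e by (rule Cc_inf_meas[OF GD[OF that]])
    have "(\<lambda>m. LINT x|?M. indicator (slab n I R0) x * (cmod (G (s m) x))\<^sup>2) \<longlonglongrightarrow> (LINT x|?M. indicator (slab n I R0) x * (cmod (G 0 x))\<^sup>2)"
    proof (rule integral_dominated_convergence[where w = "\<lambda>x. (A * K)\<^sup>2 * indicator ?B x"])
      show "integrable ?M (\<lambda>x. (A * K)\<^sup>2 * indicator ?B x)"
        using box_sets[of "{..<n}" "{..<n}" "S + R"] box_finite[of "{..<n}" "S + R"]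
        by (intro integrable_mult_right integrable_real_indicator) auto
      show "AE x in ?M. (\<lambda>m. indicator (slab n I R0) x * (cmod (G (s m) x))\<^sup>2) \<longlonglongrightarrow> indicator (slab n I R0) x * (cmod (G 0 x))\<^sup>2"
        unfolding G_def
        by (intro AE_I2 tendsto_intros conv_bm_cut_tendsto[OF I(1) i R pD _ s(1,3)]) (simp add: space_LM)
      show "AE x in ?M. norm (indicator (slab n I R0) x * (cmod (G (s m) x))\<^sup>2) \<le> (A * K)\<^sup>2 * indicator ?B x" for m
      proof (rule AE_I2)
        fix x assume "x \<in> space ?M"
        then have x: "x \<in> extensional {..<n}" by (simp add: space_LM)
        show "norm (indicator (slab n I R0) x * (cmod (G (s m) x))\<^sup>2) \<le> (A * K)\<^sup>2 * indicator ?B x"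
        proof (cases "G (s m) x = 0")
          case False
          then have "x \<in> ?B" using Gs[of "s m"] x unfolding box_supp_def by simp
          then show ?thesis using power_mono[OF Gb[OF s(3)[of m] x], of 2] by (auto simp: indicator_def)
        qed (simp add: indicator_def)
      qed
      show "(\<lambda>x. indicator (slab n I R0) x * (cmod (G 0 x))\<^sup>2) \<in> borel_measurable ?M" by measurable
      show "(\<lambda>x. indicator (slab n I R0) x * (cmod (G (s m) x))\<^sup>2) \<in> borel_measurable ?M" for m
        using s(3)[of m] by measurable
    qed
    then have "(LINT x|?M. indicator (slab n I R0) x * (cmod (G 0 x))\<^sup>2) \<le> C * sq_norm n \<phi>"
      by (rule LIMSEQ_le_const2) (use C(2)[OF s(2) \<phi> i l v] in \<open>auto simp: G_def\<close>)
    then show "(LINT x|?M. indicator (slab n I R0) x * (cmod (conv I (bm_cut I (2 * R0 + 1) 0 i) (partial l v \<phi>) x))\<^sup>2) \<le> C * sq_norm n \<phi>"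
      by (simp add: G_def R_def)
  qed
qed

section \<open>The Riesz representation theorem for square integrable functions\<close>

text \<open>Riesz-Fischer: a subsequence with summable increments converges almost everywhere, and Fatou's lemma
  shows that its limit is the limit in the mean of the whole sequence.\<close>

lemma L2_complete:
  fixes F :: "nat \<Rightarrow> 'a \<Rightarrow> complex"
  assumes F [measurable]: "\<And>n. F n \<in> borel_measurable M"
    and Fi: "\<And>n. integrable M (\<lambda>x. (cmod (F n x))\<^sup>2)"
    and cauchy: "\<And>e. e > 0 \<Longrightarrow> \<exists>N. \<forall>m\<ge>N. \<forall>n\<ge>N. (\<integral>\<^sup>+x. ennreal ((cmod (F m x - F n x))\<^sup>2) \<partial>M) \<le> ennreal e"
  obtains g where "g \<in> borel_measurable M" "integrable M (\<lambda>x. (cmod (g x))\<^sup>2)"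
    "\<And>e. e > 0 \<Longrightarrow> \<exists>N. \<forall>n\<ge>N. (LINT x|M. (cmod (F n x - g x))\<^sup>2) \<le> e"
proof -
  have "\<exists>N. \<forall>m\<ge>N. \<forall>n\<ge>N. (\<integral>\<^sup>+x. ennreal ((cmod (F m x - F n x))\<^sup>2) \<partial>M) \<le> ennreal ((1/4) ^ k)" for k
    by (rule cauchy) simp
  then obtain N0 where N0: "\<And>k m n. m \<ge> N0 k \<Longrightarrow> n \<ge> N0 k \<Longrightarrow> (\<integral>\<^sup>+x. ennreal ((cmod (F m x - F n x))\<^sup>2) \<partial>M) \<le> ennreal ((1/4) ^ k)"
    by metis
  define N where "N k = (\<Sum>j\<le>k. N0 j) + k" for k
  have NN0: "N0 k \<le> N k" for k unfolding N_def by (simp add: member_le_sum trans_le_add1)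
  have Nmono: "N k \<le> N (Suc k)" for k by (simp add: N_def)
  have Nk: "k \<le> N k" for k by (simp add: N_def)
  define G where "G k = F (N k)" for k
  have [measurable]: "G k \<in> borel_measurable M" for k by (simp add: G_def)
  have GG: "(\<integral>\<^sup>+x. ennreal ((cmod (G (Suc k) x - G k x))\<^sup>2) \<partial>M) \<le> ennreal ((1/4) ^ k)" for k
    unfolding G_def using N0[of k "N (Suc k)" "N k"] NN0[of k] Nmono[of k] by linarith
  \<comment> \<open>The weights \<open>2 ^ k\<close> turn finiteness of the sum into geometric decay of the increments at almost every
    point.\<close>
  have "(\<integral>\<^sup>+x. (\<Sum>k. ennreal (2 ^ k) * ennreal ((cmod (G (Suc k) x - G k x))\<^sup>2)) \<partial>M)
      = (\<Sum>k. \<integral>\<^sup>+x. ennreal (2 ^ k) * ennreal ((cmod (G (Suc k) x - G k x))\<^sup>2) \<partial>M)"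
    by (rule nn_integral_suminf) measurable
  also have "\<dots> = (\<Sum>k. ennreal (2 ^ k) * (\<integral>\<^sup>+x. ennreal ((cmod (G (Suc k) x - G k x))\<^sup>2) \<partial>M))"
    by (intro suminf_cong nn_integral_cmult) measurable
  also have "\<dots> \<le> (\<Sum>k. ennreal ((1/2) ^ k))"
  proof (intro suminf_le summableI allI)
    fix k
    have "ennreal (2 ^ k) * (\<integral>\<^sup>+x. ennreal ((cmod (G (Suc k) x - G k x))\<^sup>2) \<partial>M) \<le> ennreal (2 ^ k) * ennreal ((1/4) ^ k)"
      by (intro mult_left_mono GG) simp
    also have "\<dots> = ennreal ((2 * (1/4)) ^ k)" unfolding power_mult_distrib by (simp add: ennreal_mult')
    finally show "ennreal (2 ^ k) * (\<integral>\<^sup>+x. ennreal ((cmod (G (Suc k) x - G k x))\<^sup>2) \<partial>M) \<le> ennreal ((1/2) ^ k)" by simp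
  qed
  also have "\<dots> = ennreal (\<Sum>k. (1/2) ^ k)" by (intro suminf_ennreal2 summable_geometric) auto
  also have "\<dots> < \<infinity>" by simp
  finally have "(\<integral>\<^sup>+x. (\<Sum>k. ennreal (2 ^ k) * ennreal ((cmod (G (Suc k) x - G k x))\<^sup>2)) \<partial>M) \<noteq> \<infinity>" by simp
  then have AEfin: "AE x in M. (\<Sum>k. ennreal (2 ^ k) * ennreal ((cmod (G (Suc k) x - G k x))\<^sup>2)) \<noteq> \<infinity>"
    by (intro nn_integral_PInf_AE) measurable
  have conv: "AE x in M. convergent (\<lambda>k. G k x)"
    using AEfin
  proof eventually_elim
    case (elim x)
    define S where "S = (\<Sum>k. ennreal (2 ^ k) * ennreal ((cmod (G (Suc k) x - G k x))\<^sup>2))"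
    obtain s where s: "S = ennreal s" "s \<ge> 0" using elim unfolding S_def[symmetric] by (cases S) auto
    have bd: "cmod (G (Suc k) x - G k x) \<le> sqrt s * (sqrt (1/2)) ^ k" for k
    proof -
      have "(\<Sum>j\<in>{k}. ennreal (2 ^ j) * ennreal ((cmod (G (Suc j) x - G j x))\<^sup>2)) \<le> S"
        unfolding S_def by (rule sum_le_suminf) auto
      then have "ennreal (2 ^ k * (cmod (G (Suc k) x - G k x))\<^sup>2) \<le> ennreal s" by (simp add: s(1) ennreal_mult')
      then have "2 ^ k * (cmod (G (Suc k) x - G k x))\<^sup>2 \<le> s" using s(2) by (simp add: ennreal_le_iff)
      then have "(cmod (G (Suc k) x - G k x))\<^sup>2 \<le> s * (1/2) ^ k" by (simp add: power_divide field_simps)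
      then have "cmod (G (Suc k) x - G k x) \<le> sqrt (s * (1/2) ^ k)" by (rule real_le_rsqrt)
      then show ?thesis by (simp add: real_sqrt_mult real_sqrt_power)
    qed
    have "sqrt (1/2) < 1" by (simp add: real_sqrt_lt_1_iff)
    then have "summable (\<lambda>k. sqrt s * (sqrt (1/2)) ^ k)" by (intro summable_mult summable_geometric) simp
    then have "summable (\<lambda>k. G (Suc k) x - G k x)"
      by (rule summable_comparison_test'[where N = 0]) (use bd in auto)
    then obtain L where "(\<lambda>n. \<Sum>k<n. G (Suc k) x - G k x) \<longlonglongrightarrow> L" by (auto simp: summable_def sums_def)
    moreover have "(\<Sum>k<n. G (Suc k) x - G k x) = G n x - G 0 x" for n
      by (rule sum_lessThan_telescope)
    ultimately have "(\<lambda>n. (G n x - G 0 x) + G 0 x) \<longlonglongrightarrow> L + G 0 x"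
      by (intro tendsto_add tendsto_const) simp
    then show "convergent (\<lambda>k. G k x)" by (auto simp: convergent_def)
  qed
  define g where "g x = lim (\<lambda>k. G k x)" for x
  have gm [measurable]: "g \<in> borel_measurable M" unfolding g_def by (rule borel_measurable_lim_metric) simp
  have glim: "AE x in M. (\<lambda>k. G k x) \<longlonglongrightarrow> g x"
    using conv by eventually_elim (simp add: g_def convergent_LIMSEQ_iff)
  have fatou: "(\<integral>\<^sup>+x. ennreal ((cmod (F n x - g x))\<^sup>2) \<partial>M) \<le> ennreal e"
    if e: "e > 0" and N: "\<And>m n. m \<ge> N1 \<Longrightarrow> n \<ge> N1 \<Longrightarrow> (\<integral>\<^sup>+x. ennreal ((cmod (F m x - F n x))\<^sup>2) \<partial>M) \<le> ennreal e" and n: "n \<ge> N1" for e N1 n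
  proof -
    have "(\<integral>\<^sup>+x. ennreal ((cmod (F n x - g x))\<^sup>2) \<partial>M) = (\<integral>\<^sup>+x. liminf (\<lambda>k. ennreal ((cmod (F n x - G k x))\<^sup>2)) \<partial>M)"
    proof (rule nn_integral_cong_AE)
      show "AE x in M. ennreal ((cmod (F n x - g x))\<^sup>2) = liminf (\<lambda>k. ennreal ((cmod (F n x - G k x))\<^sup>2))"
        using glim
      proof eventually_elim
        case (elim x)
        have "(\<lambda>k. ennreal ((cmod (F n x - G k x))\<^sup>2)) \<longlonglongrightarrow> ennreal ((cmod (F n x - g x))\<^sup>2)"
          by (intro tendsto_ennrealI tendsto_intros elim)
        then show ?case by (rule lim_imp_Liminf[OF sequentially_bot, symmetric])
      qed
    qed
    also have "\<dots> \<le> liminf (\<lambda>k. \<integral>\<^sup>+x. ennreal ((cmod (F n x - G k x))\<^sup>2) \<partial>M)"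
      by (rule nn_integral_liminf) measurable
    also have "\<dots> \<le> liminf (\<lambda>k. ennreal e)"
    proof (rule Liminf_mono)
      show "\<forall>\<^sub>F k in sequentially. (\<integral>\<^sup>+x. ennreal ((cmod (F n x - G k x))\<^sup>2) \<partial>M) \<le> ennreal e"
        using eventually_ge_at_top[of N1]
      proof eventually_elim
        case (elim k)
        then show ?case unfolding G_def using Nk[of k] n by (intro N) auto
      qed
    qed
    also have "\<dots> = ennreal e" by (rule Liminf_const) simp
    finally show ?thesis .
  qed
  have di: "integrable M (\<lambda>x. (cmod (F n x - g x))\<^sup>2)" if "(\<integral>\<^sup>+x. ennreal ((cmod (F n x - g x))\<^sup>2) \<partial>M) \<le> ennreal e" for n e
    by (rule integrableI_nonneg) (use that in \<open>auto intro: order_le_less_trans\<close>)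
  show ?thesis
  proof (rule that[OF gm])
    obtain N1 where N1: "\<And>m n. m \<ge> N1 \<Longrightarrow> n \<ge> N1 \<Longrightarrow> (\<integral>\<^sup>+x. ennreal ((cmod (F m x - F n x))\<^sup>2) \<partial>M) \<le> ennreal 1"
      using cauchy[of 1] by auto
    have i: "integrable M (\<lambda>x. (cmod (F N1 x - g x))\<^sup>2)" by (rule di[OF fatou[OF _ N1]]) auto
    show "integrable M (\<lambda>x. (cmod (g x))\<^sup>2)"
    proof (rule Bochner_Integration.integrable_bound)
      show "integrable M (\<lambda>x. 2 * (cmod (F N1 x))\<^sup>2 + 2 * (cmod (F N1 x - g x))\<^sup>2)" using i Fi by simp
      show "AE x in M. norm ((cmod (g x))\<^sup>2) \<le> norm (2 * (cmod (F N1 x))\<^sup>2 + 2 * (cmod (F N1 x - g x))\<^sup>2)"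
      proof (rule AE_I2)
        fix x
        show "norm ((cmod (g x))\<^sup>2) \<le> norm (2 * (cmod (F N1 x))\<^sup>2 + 2 * (cmod (F N1 x - g x))\<^sup>2)"
          using norm_diff_sq[of "F N1 x" "F N1 x - g x"] by simp
      qed
    qed measurable
    fix e :: real assume e: "e > 0"
    obtain N1 where N1: "\<And>m n. m \<ge> N1 \<Longrightarrow> n \<ge> N1 \<Longrightarrow> (\<integral>\<^sup>+x. ennreal ((cmod (F m x - F n x))\<^sup>2) \<partial>M) \<le> ennreal e"
      using cauchy[OF e] by auto
    show "\<exists>N. \<forall>n\<ge>N. (LINT x|M. (cmod (F n x - g x))\<^sup>2) \<le> e"
    proof (intro exI[of _ N1] allI impI)
      fix n assume n: "n \<ge> N1"
      have f: "(\<integral>\<^sup>+x. ennreal ((cmod (F n x - g x))\<^sup>2) \<partial>M) \<le> ennreal e" by (rule fatou[OF e N1 n])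
      then have "ennreal (LINT x|M. (cmod (F n x - g x))\<^sup>2) \<le> ennreal e"
        using nn_integral_eq_integral[OF di[OF f]] by simp
      then show "(LINT x|M. (cmod (F n x - g x))\<^sup>2) \<le> e" using e by (simp add: ennreal_le_iff)
    qed
  qed
qed

text \<open>The Cauchy-Schwarz inequality in the form with a parameter, \<open>2 \<bar>f g\<bar> \<le> s \<bar>f\<bar>\<^sup>2 + \<bar>g\<bar>\<^sup>2 / s\<close>.\<close>

lemma mult_sq_integrable:
  fixes f g :: "'a \<Rightarrow> complex"
  assumes [measurable]: "f \<in> borel_measurable M" "g \<in> borel_measurable M"
    and i: "integrable M (\<lambda>x. (cmod (f x))\<^sup>2)" "integrable M (\<lambda>x. (cmod (g x))\<^sup>2)"
  shows "integrable M (\<lambda>x. f x * g x)"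
    "s > 0 \<Longrightarrow> cmod (LINT x|M. f x * g x) \<le> s * (LINT x|M. (cmod (f x))\<^sup>2) + (LINT x|M. (cmod (g x))\<^sup>2) / s"
proof -
  have bd: "cmod (f x * g x) \<le> s * (cmod (f x))\<^sup>2 + (cmod (g x))\<^sup>2 / s" if s: "s > 0" for s x
  proof -
    define a b where "a = s * cmod (f x)" and "b = cmod (g x)"
    have "2 * (a * b) \<le> a\<^sup>2 + b\<^sup>2" using sum_squares_bound[of a b] by simp
    moreover have "a * b \<ge> 0" using s by (simp add: a_def b_def)
    ultimately have "a * b / s \<le> (a\<^sup>2 + b\<^sup>2) / s" using s by (intro divide_right_mono) auto
    moreover have "a * b / s = cmod (f x * g x)" using s by (simp add: a_def b_def norm_mult)
    moreover have "(a\<^sup>2 + b\<^sup>2) / s = s * (cmod (f x))\<^sup>2 + (cmod (g x))\<^sup>2 / s"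
      using s by (simp add: a_def b_def power_mult_distrib add_divide_distrib power2_eq_square)
    ultimately show ?thesis by simp
  qed
  have b: "integrable M (\<lambda>x. s * (cmod (f x))\<^sup>2 + (cmod (g x))\<^sup>2 / s)" for s using i by simp
  show int: "integrable M (\<lambda>x. f x * g x)"
  proof (rule Bochner_Integration.integrable_bound[OF b[of 1]])
    show "AE x in M. norm (f x * g x) \<le> norm (1 * (cmod (f x))\<^sup>2 + (cmod (g x))\<^sup>2 / 1)"
      using bd[of 1] by (intro AE_I2) simp
  qed measurable
  show "cmod (LINT x|M. f x * g x) \<le> s * (LINT x|M. (cmod (f x))\<^sup>2) + (LINT x|M. (cmod (g x))\<^sup>2) / s" if s: "s > 0"
  proof -
    have "cmod (LINT x|M. f x * g x) \<le> (LINT x|M. cmod (f x * g x))" by (rule integral_norm_bound)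
    also have "\<dots> \<le> (LINT x|M. s * (cmod (f x))\<^sup>2 + (cmod (g x))\<^sup>2 / s)"
      by (rule integral_mono[OF integrable_norm[OF int] b]) (use bd[OF s] in auto)
    also have "\<dots> = s * (LINT x|M. (cmod (f x))\<^sup>2) + (LINT x|M. (cmod (g x))\<^sup>2) / s" using i by simp
    finally show ?thesis .
  qed
qed

text \<open>A linear functional on a space of square integrable functions that is bounded in the \<open>L\<^sup>2\<close> norm
  has a density. The bound is stated in the affine form in which sums of estimates produce it; by scaling it is
  equivalent to the usual one. The density is the conjugate of the limit of a sequence that minimises
  \<open>\<parallel>\<phi>\<parallel>\<^sup>2 - 2 Re l(\<phi>)\<close>.\<close>

lemma Riesz_L2:
  fixes T :: "('a \<Rightarrow> complex) set" and l :: "('a \<Rightarrow> complex) \<Rightarrow> complex"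
  assumes T0: "(\<lambda>_. 0) \<in> T" and Tadd: "\<And>f g. f \<in> T \<Longrightarrow> g \<in> T \<Longrightarrow> (\<lambda>x. f x + g x) \<in> T"
    and Tmul: "\<And>c f. f \<in> T \<Longrightarrow> (\<lambda>x. c * f x) \<in> T"
    and Tm: "\<And>f. f \<in> T \<Longrightarrow> f \<in> borel_measurable M" and Ti: "\<And>f. f \<in> T \<Longrightarrow> integrable M (\<lambda>x. (cmod (f x))\<^sup>2)"
    and ladd: "\<And>f g. f \<in> T \<Longrightarrow> g \<in> T \<Longrightarrow> l (\<lambda>x. f x + g x) = l f + l g"
    and lmul: "\<And>c f. f \<in> T \<Longrightarrow> l (\<lambda>x. c * f x) = c * l f"
    and K: "K \<ge> 0" "\<And>f. f \<in> T \<Longrightarrow> cmod (l f) \<le> K * (1 + (LINT x|M. (cmod (f x))\<^sup>2))"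
  obtains g where "g \<in> borel_measurable M" "integrable M (\<lambda>x. (cmod (g x))\<^sup>2)"
    "\<And>f. f \<in> T \<Longrightarrow> (LINT x|M. g x * f x) = l f"
proof -
  define nr where "nr f = (LINT x|M. (cmod (f x))\<^sup>2)" for f :: "'a \<Rightarrow> complex"
  define Q where "Q f = nr f - 2 * Re (l f)" for f
  have nr0: "nr f \<ge> 0" for f by (simp add: nr_def)
  have nrmul: "nr (\<lambda>x. c * f x) = (cmod c)\<^sup>2 * nr f" for c f
    unfolding nr_def by (simp add: norm_mult power_mult_distrib)
  \<comment> \<open>Applied to \<open>f / t\<close>, the affine bound becomes \<open>\<bar>l f\<bar> \<le> K t + (K / t) \<parallel>f\<parallel>\<^sup>2\<close>, with \<open>K / t \<le> 1 / 4\<close>.\<close>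
  define t where "t = 4 * K + 1"
  have t: "t > 0" using K by (simp add: t_def)
  have Qlow: "- (2 * (K * t)) \<le> Q f" if f: "f \<in> T" for f
  proof -
    have "cmod (l (\<lambda>x. of_real (1 / t) * f x)) \<le> K * (1 + nr (\<lambda>x. of_real (1 / t) * f x))"
      unfolding nr_def by (rule K(2)[OF Tmul[OF f]])
    then have "cmod (l f) / t \<le> K * (1 + nr f / t\<^sup>2)"
      using t unfolding nrmul lmul[OF f] by (simp add: norm_mult norm_divide power_divide)
    then have "cmod (l f) \<le> K * t + K * nr f / t" using t by (simp add: field_simps power2_eq_square)
    moreover have "K * nr f / t \<le> nr f / 4"
      using t nr0[of f] K(1) by (simp add: t_def field_simps)
    moreover have "Re (l f) \<le> cmod (l f)" by (rule complex_Re_le_cmod)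
    ultimately show ?thesis using nr0[of f] unfolding Q_def by linarith
  qed
  define m where "m = Inf (Q ` T)"
  have bb: "bdd_below (Q ` T)" using Qlow by (intro bdd_belowI) auto
  have mle: "m \<le> Q f" if "f \<in> T" for f unfolding m_def using that bb by (intro cInf_lower) auto
  have "\<exists>f\<in>T. Q f < m + 1 / real (Suc k)" for k
  proof (rule ccontr)
    assume "\<not> ?thesis"
    then have "m + 1 / real (Suc k) \<le> Inf (Q ` T)" using T0 by (intro cInf_greatest) (auto simp: not_less)
    then show False by (simp add: m_def)
  qed
  then obtain F where F: "\<And>k. F k \<in> T" "\<And>k. Q (F k) < m + 1 / real (Suc k)" by metis
  \<comment> \<open>By the parallelogram law a minimising sequence is Cauchy.\<close>
  have par: "nr (\<lambda>x. f x - g x) \<le> 2 * (Q f - m) + 2 * (Q g - m)" if f: "f \<in> T" and g: "g \<in> T" for f g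
  proof -
    have s: "(\<lambda>x. f x + g x) \<in> T" by (rule Tadd[OF f g])
    have d: "(\<lambda>x. f x - g x) \<in> T" using Tadd[OF f Tmul[OF g, of "-1"]] by simp
    have "(cmod (f x - g x))\<^sup>2 = 2 * (cmod (f x))\<^sup>2 + 2 * (cmod (g x))\<^sup>2 - (cmod (f x + g x))\<^sup>2" for x
      unfolding cmod_power2 by (simp add: power2_eq_square algebra_simps)
    then have 1: "nr (\<lambda>x. f x - g x) = 2 * nr f + 2 * nr g - nr (\<lambda>x. f x + g x)"
      unfolding nr_def using Ti[OF f] Ti[OF g] Ti[OF s] by simp
    have "m \<le> Q (\<lambda>x. (1/2) * (f x + g x))" by (rule mle[OF Tmul[OF s]])
    also have "\<dots> = nr (\<lambda>x. f x + g x) / 4 - Re (l f) - Re (l g)"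
      unfolding Q_def nrmul lmul[OF s] ladd[OF f g] by (simp add: power2_eq_square norm_divide add_divide_distrib)
    finally show ?thesis unfolding 1 Q_def by simp
  qed
  have cauchy: "\<exists>N. \<forall>a\<ge>N. \<forall>b\<ge>N. (\<integral>\<^sup>+x. ennreal ((cmod (F a x - F b x))\<^sup>2) \<partial>M) \<le> ennreal e" if e: "e > 0" for e
  proof -
    obtain N where N: "1 / real (Suc N) < e / 4" using e by (metis nat_approx_posE divide_pos_pos zero_less_numeral)
    show ?thesis
    proof (intro exI[of _ N] allI impI)
      fix a b assume ab: "N \<le> a" "N \<le> b"
      have d: "(\<lambda>x. F a x - F b x) \<in> T" using Tadd[OF F(1) Tmul[OF F(1), of "-1"]] by simp
      have "Q (F k) - m \<le> e / 4" if "N \<le> k" for k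
      proof -
        have "Q (F k) - m \<le> 1 / real (Suc k)" using F(2)[of k] by simp
        also have "\<dots> \<le> 1 / real (Suc N)" using that by (simp add: frac_le)
        also have "\<dots> \<le> e / 4" using N by simp
        finally show ?thesis .
      qed
      then have "Q (F a) - m \<le> e / 4" "Q (F b) - m \<le> e / 4" using ab by auto
      then have "nr (\<lambda>x. F a x - F b x) \<le> e" using par[OF F(1)[of a] F(1)[of b]] by simp
      then show "(\<integral>\<^sup>+x. ennreal ((cmod (F a x - F b x))\<^sup>2) \<partial>M) \<le> ennreal e"
        using nn_integral_eq_integral[OF Ti[OF d]] by (simp add: nr_def ennreal_leI)
    qed
  qed
  obtain g0 where g0: "g0 \<in> borel_measurable M" "integrable M (\<lambda>x. (cmod (g0 x))\<^sup>2)"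
    "\<And>e. e > 0 \<Longrightarrow> \<exists>N. \<forall>n\<ge>N. (LINT x|M. (cmod (F n x - g0 x))\<^sup>2) \<le> e"
    using L2_complete[OF Tm[OF F(1)] Ti[OF F(1)] cauchy] by metis
  have cm: "(\<lambda>x. cnj (h x)) \<in> borel_measurable M" if "h \<in> borel_measurable M" for h :: "'a \<Rightarrow> complex"
    using that by (intro borel_measurable_continuous_on[OF _ that]) (auto intro!: continuous_intros)
  have key: "Re (LINT x|M. cnj (g0 x) * f x) = Re (l f)" if f: "f \<in> T" for f
  proof -
    define r where "r = Re (LINT x|M. cnj (g0 x) * f x) - Re (l f)"
    \<comment> \<open>The first variation at the minimiser, tested along the minimising sequence: the minimiser is a limit of
      members of \<open>T\<close> but need not be one itself.\<close>
    have ineq: "0 \<le> s\<^sup>2 * nr f + 2 * s * r" for s :: real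
    proof (rule field_le_epsilon)
      fix e :: real assume e: "e > 0"
      define d8 where "d8 = e / (8 * (\<bar>s\<bar> + 1))"
      have d8: "d8 > 0" using e by (simp add: d8_def add_nonneg_pos)
      define \<sigma> where "\<sigma> = e / (8 * (\<bar>s\<bar> + 1) * (nr f + 1))"
      have \<sigma>: "\<sigma> > 0" using e nr0[of f] by (simp add: \<sigma>_def)
      obtain N where N: "\<And>k. k \<ge> N \<Longrightarrow> (LINT x|M. (cmod (F k x - g0 x))\<^sup>2) \<le> \<sigma> * d8"
        using g0(3)[of "\<sigma> * d8"] d8 \<sigma> by auto
      obtain N' where N': "1 / real (Suc N') < e / 2" using e by (metis nat_approx_posE divide_pos_pos zero_less_numeral)
      define k where "k = max N N'"
      have k: "1 / real (Suc k) < e / 2" using N' by (intro order_le_less_trans[OF _ N']) (simp add: k_def frac_le)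
      define P where "P = (LINT x|M. cnj (F k x) * f x)"
      note ci = cm[OF Tm[OF F(1)[of k]]] cm[OF g0(1)]
      have i1: "integrable M (\<lambda>x. cnj (F k x) * f x)" by (rule mult_sq_integrable(1)[OF ci(1) Tm[OF f] _ Ti[OF f]]) (use Ti[OF F(1)] in simp)
      have i2: "integrable M (\<lambda>x. cnj (g0 x) * f x)" by (rule mult_sq_integrable(1)[OF ci(2) Tm[OF f] _ Ti[OF f]]) (use g0 in simp)
      have di: "integrable M (\<lambda>x. (cmod (F k x - g0 x))\<^sup>2)"
      proof (rule Bochner_Integration.integrable_bound)
        show "integrable M (\<lambda>x. 2 * (cmod (F k x))\<^sup>2 + 2 * (cmod (g0 x))\<^sup>2)" using Ti[OF F(1)] g0 by simp
        show "AE x in M. norm ((cmod (F k x - g0 x))\<^sup>2) \<le> norm (2 * (cmod (F k x))\<^sup>2 + 2 * (cmod (g0 x))\<^sup>2)"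
          using norm_diff_sq by (intro AE_I2) simp
      qed (use Tm[OF F(1)] g0 in measurable)
      have dm: "(\<lambda>x. cnj (F k x - g0 x)) \<in> borel_measurable M" using Tm[OF F(1)] g0(1) by (intro cm) measurable
      have eqP: "P - (LINT x|M. cnj (g0 x) * f x) = (LINT x|M. f x * cnj (F k x - g0 x))"
        unfolding P_def using i1 i2 by (subst Bochner_Integration.integral_diff[symmetric]) (auto intro!: Bochner_Integration.integral_cong simp: algebra_simps)
      have "cmod (LINT x|M. f x * cnj (F k x - g0 x)) \<le> \<sigma> * nr f + (LINT x|M. (cmod (F k x - g0 x))\<^sup>2) / \<sigma>"
        using mult_sq_integrable(2)[OF Tm[OF f] dm Ti[OF f] _ \<sigma>] di by (simp add: nr_def complex_mod_cnj del: complex_cnj_diff)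
      moreover have "(LINT x|M. (cmod (F k x - g0 x))\<^sup>2) / \<sigma> \<le> d8"
        using N[of k] \<sigma> by (simp add: k_def pos_divide_le_eq mult.commute)
      moreover have "\<sigma> * nr f \<le> d8"
      proof -
        have "\<sigma> * nr f = d8 * (nr f / (nr f + 1))" by (simp add: \<sigma>_def d8_def)
        also have "\<dots> \<le> d8 * 1" using d8 nr0[of f] by (intro mult_left_mono) (auto simp: divide_le_eq)
        finally show ?thesis by simp
      qed
      moreover have "e / (4 * (\<bar>s\<bar> + 1)) = d8 + d8"
        by (simp add: d8_def add_divide_distrib[symmetric] frac_eq_eq)
      ultimately have "cmod (P - (LINT x|M. cnj (g0 x) * f x)) \<le> e / (4 * (\<bar>s\<bar> + 1))"
        unfolding eqP by linarith
      then have P: "\<bar>Re P - Re (LINT x|M. cnj (g0 x) * f x)\<bar> \<le> e / (4 * (\<bar>s\<bar> + 1))"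
        using abs_Re_le_cmod[of "P - (LINT x|M. cnj (g0 x) * f x)"] by simp
      have "\<bar>2 * s * (Re P - Re (LINT x|M. cnj (g0 x) * f x))\<bar> \<le> 2 * (\<bar>s\<bar> + 1) * (e / (4 * (\<bar>s\<bar> + 1)))"
        unfolding abs_mult using P by (intro mult_mono) auto
      also have "\<dots> = e / 2"
      proof -
        have "\<bar>s\<bar> + 1 \<noteq> 0" by simp
        then show ?thesis by (simp add: field_simps)
      qed
      finally have "2 * s * (Re P - Re (LINT x|M. cnj (g0 x) * f x)) \<le> e / 2" by (rule abs_le_D1)
      then have P2: "2 * s * Re P \<le> 2 * s * Re (LINT x|M. cnj (g0 x) * f x) + e / 2" by (simp add: right_diff_distrib)
      have sT: "(\<lambda>x. of_real s * f x) \<in> T" by (rule Tmul[OF f])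
      have eT: "(\<lambda>x. F k x + of_real s * f x) \<in> T" by (rule Tadd[OF F(1) sT])
      define h where "h x = Re (cnj (F k x) * f x)" for x
      have h: "integrable M h" "(LINT x|M. h x) = Re P"
        unfolding h_def P_def using integrable_Re[OF i1] integral_Re[OF i1] by auto
      have "(cmod (F k x + of_real s * f x))\<^sup>2 = (cmod (F k x))\<^sup>2 + s\<^sup>2 * (cmod (f x))\<^sup>2 + 2 * s * h x" for x
        unfolding cmod_power2 h_def by (simp add: power2_eq_square algebra_simps)
      then have "nr (\<lambda>x. F k x + of_real s * f x) = nr (F k) + s\<^sup>2 * nr f + 2 * s * Re P"
        unfolding nr_def h(2)[symmetric] using Ti[OF F(1)[of k]] Ti[OF f] h(1) by simp
      moreover have "m \<le> Q (\<lambda>x. F k x + of_real s * f x)" by (rule mle[OF eT])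
      ultimately have "m \<le> Q (F k) + s\<^sup>2 * nr f + 2 * s * Re P - 2 * s * Re (l f)"
        unfolding Q_def ladd[OF F(1) sT] lmul[OF f] by simp
      moreover have "Q (F k) \<le> m + e / 2" using F(2)[of k] k by simp
      moreover have "2 * s * r = 2 * s * Re (LINT x|M. cnj (g0 x) * f x) - 2 * s * Re (l f)"
        unfolding r_def by (rule right_diff_distrib)
      ultimately show "0 \<le> s\<^sup>2 * nr f + 2 * s * r + e" using P2 by linarith
    qed
    have "r = 0"
    proof (rule ccontr)
      assume r: "r \<noteq> 0"
      define D where "D = nr f + 1"
      have D: "D > 0" "nr f < 2 * D" using nr0[of f] by (auto simp: D_def)
      define s where "s = - r / D"
      have "s\<^sup>2 * nr f = (r\<^sup>2 / D) * (nr f / D)" "2 * s * r = (r\<^sup>2 / D) * (- 2)"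
        by (simp_all add: s_def power2_eq_square)
      then have "s\<^sup>2 * nr f + 2 * s * r = (r\<^sup>2 / D) * (nr f / D - 2)"
        by (simp only: right_diff_distrib)
      also have "\<dots> < 0"
      proof (rule mult_pos_neg)
        show "r\<^sup>2 / D > 0" using r D by simp
        show "nr f / D - 2 < 0" using D by (simp add: divide_less_eq)
      qed
      finally have "s\<^sup>2 * nr f + 2 * s * r < 0" .
      then show False using ineq[of s] by simp
    qed
    then show ?thesis by (simp add: r_def)
  qed
  show ?thesis
  proof (rule that[of "\<lambda>x. cnj (g0 x)"])
    show "(\<lambda>x. cnj (g0 x)) \<in> borel_measurable M" by (rule cm[OF g0(1)])
    show "integrable M (\<lambda>x. (cmod (cnj (g0 x)))\<^sup>2)" using g0(2) by simp
    fix f assume f: "f \<in> T"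
    have i2: "integrable M (\<lambda>x. cnj (g0 x) * f x)" by (rule mult_sq_integrable(1)[OF cm[OF g0(1)] Tm[OF f] _ Ti[OF f]]) (use g0 in simp)
    have "(LINT x|M. cnj (g0 x) * (\<i> * f x)) = \<i> * (LINT x|M. cnj (g0 x) * f x)"
      using i2 by (subst integral_mult_right_zero[symmetric]) (simp add: ac_simps)
    then have "Im (LINT x|M. cnj (g0 x) * f x) = Im (l f)" using key[OF Tmul[OF f, of \<i>]] lmul[OF f, of \<i>] by simp
    then show "(LINT x|M. cnj (g0 x) * f x) = l f" using key[OF f] by (simp add: complex_eq_iff)
  qed
qed

section \<open>The solution operators of a block\<close>

lemma conv_sum:
  assumes "I \<subseteq> {..<n}" "integrable (LM I) \<kappa>" "\<And>j. j \<in> A \<Longrightarrow> h j \<in> Cc_inf n" "x \<in> extensional {..<n}"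
  shows "conv I \<kappa> (\<lambda>x. \<Sum>j\<in>A. h j x) x = (\<Sum>j\<in>A. conv I \<kappa> (h j) x)"
  unfolding conv_def sum_distrib_left
  by (rule Bochner_Integration.integral_sum) (rule Cc_inf_conv_integrand[OF assms(1,2) assms(3) assms(4)])

lemma conv_cmult: "conv I (\<lambda>\<zeta>. c * \<kappa> \<zeta>) \<psi> x = c * conv I \<kappa> \<psi> x"
  unfolding conv_def by (simp add: mult.assoc)

text \<open>The properties of the operators \<open>S\<^sub>i\<close>, normalised transposed convolutions in the variables of \<open>I\<close>, on which the
  solution rests. \<open>S_local\<close> says that only the variables of \<open>I\<close> are integrated, \<open>S_L2\<close> that norms over a
  slab in the other variables are respected, \<open>S_gain\<close> is the gain of a derivative and \<open>S_div\<close> the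
  Bochner-Martinelli formula. The sign in \<open>S_div\<close> comes from transposing \<open>dbar\<^sub>i\<close>.\<close>

locale block_op =
  fixes n :: nat and I :: "nat set" and R0 :: real and S :: "nat \<Rightarrow> ((nat \<Rightarrow> complex) \<Rightarrow> complex) \<Rightarrow> (nat \<Rightarrow> complex) \<Rightarrow> complex"
    and C :: real
  assumes I: "I \<subseteq> {..<n}" and C: "C \<ge> 0"
    and S_Cc_inf: "\<And>i \<phi>. i \<in> I \<Longrightarrow> \<phi> \<in> Cc_inf n \<Longrightarrow> S i \<phi> \<in> Cc_inf n"
    and S_lin: "\<And>i \<phi> \<psi> a b x. i \<in> I \<Longrightarrow> \<phi> \<in> Cc_inf n \<Longrightarrow> \<psi> \<in> Cc_inf n \<Longrightarrow> x \<in> extensional {..<n} \<Longrightarrow>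
        S i (\<lambda>x. a * \<phi> x + b * \<psi> x) x = a * S i \<phi> x + b * S i \<psi> x"
    and S_sum: "\<And>i (A :: nat set) h x. i \<in> I \<Longrightarrow> (\<And>j. j \<in> A \<Longrightarrow> h j \<in> Cc_inf n) \<Longrightarrow> x \<in> extensional {..<n} \<Longrightarrow>
        S i (\<lambda>x. \<Sum>j\<in>A. h j x) x = (\<Sum>j\<in>A. S i (h j) x)"
    and S_partial: "\<And>i \<phi> k v x. i \<in> I \<Longrightarrow> \<phi> \<in> Cc_inf n \<Longrightarrow> k < n \<Longrightarrow> v \<in> {1, \<i>} \<Longrightarrow> x \<in> extensional {..<n} \<Longrightarrow>
        partial k v (S i \<phi>) x = S i (partial k v \<phi>) x"
    and S_local: "\<And>i f g x. i \<in> I \<Longrightarrow> x \<in> extensional {..<n} \<Longrightarrow>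
        (\<And>y. y \<in> extensional {..<n} \<Longrightarrow> \<forall>k\<in>- I. y k = x k \<Longrightarrow> f y = g y) \<Longrightarrow> S i f x = S i g x"
    and S_L2: "\<And>i \<phi> J R. i \<in> I \<Longrightarrow> \<phi> \<in> Cc_inf n \<Longrightarrow> J \<subseteq> {..<n} - I \<Longrightarrow>
        (LINT x|LM {..<n}. indicator (slab n J R) x * (cmod (S i \<phi> x))\<^sup>2)
          \<le> C * (LINT x|LM {..<n}. indicator (slab n J R) x * (cmod (\<phi> x))\<^sup>2)"
    and S_gain: "\<And>i \<phi> l v. i \<in> I \<Longrightarrow> \<phi> \<in> Cc_inf n \<Longrightarrow> slab_supp n I R0 \<phi> \<Longrightarrow> l \<in> I \<Longrightarrow> v \<in> {1, \<i>} \<Longrightarrow>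
        (LINT x|LM {..<n}. indicator (slab n I R0) x * (cmod (S i (partial l v \<phi>) x))\<^sup>2) \<le> C * sq_norm n \<phi>"
    and S_div: "\<And>\<phi> x. \<phi> \<in> Cc_inf n \<Longrightarrow> slab_supp n I R0 \<phi> \<Longrightarrow> x \<in> slab n I R0 \<Longrightarrow> (\<Sum>i\<in>I. S i (partial_zbar i \<phi>) x) = - \<phi> x"
begin

lemma S_sq_norm: "i \<in> I \<Longrightarrow> \<phi> \<in> Cc_inf n \<Longrightarrow> sq_norm n (S i \<phi>) \<le> C * sq_norm n \<phi>"
proof -
  assume a: "i \<in> I" "\<phi> \<in> Cc_inf n"
  have e: "(LINT x|LM {..<n}. indicator (slab n {} 0) x * f x) = (LINT x|LM {..<n}. f x)" for f :: "_ \<Rightarrow> real"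
    by (intro Bochner_Integration.integral_cong) (auto simp: space_LM slab_def)
  show ?thesis using S_L2[OF a, of "{}" 0] unfolding e sq_norm_def by simp
qed

lemma S_zbar: "i \<in> I \<Longrightarrow> \<phi> \<in> Cc_inf n \<Longrightarrow> k < n \<Longrightarrow> x \<in> extensional {..<n} \<Longrightarrow>
    partial_zbar k (S i \<phi>) x = S i (partial_zbar k \<phi>) x"
proof -
  assume a: "i \<in> I" "\<phi> \<in> Cc_inf n" "k < n" "x \<in> extensional {..<n}"
  have 2: "partial_zbar k \<phi> = (\<lambda>x. (1/2) * partial k 1 \<phi> x + (\<i>/2) * partial k \<i> \<phi> x)"
    by (rule ext) (simp add: partial_zbar_def field_simps)
  have D: "partial k 1 \<phi> \<in> Cc_inf n" "partial k \<i> \<phi> \<in> Cc_inf n" using Cc_inf_partial[OF a(2,3)] by auto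
  have p: "partial k 1 (S i \<phi>) x = S i (partial k 1 \<phi>) x" "partial k \<i> (S i \<phi>) x = S i (partial k \<i> \<phi>) x"
    using S_partial[OF a(1-3) _ a(4)] by auto
  show ?thesis unfolding 2 S_lin[OF a(1) D a(4)] partial_zbar_def p by (simp add: field_simps)
qed

lemma S_neg: "i \<in> I \<Longrightarrow> \<phi> \<in> Cc_inf n \<Longrightarrow> x \<in> extensional {..<n} \<Longrightarrow> S i (\<lambda>x. - \<phi> x) x = - S i \<phi> x"
  using S_lin[of i \<phi> \<phi> x "-1" 0] by simp

lemma S_nonzero:
  assumes "i \<in> I" "x \<in> extensional {..<n}" "S i \<phi> x \<noteq> 0"
  obtains y where "y \<in> extensional {..<n}" "\<forall>k\<in>- I. y k = x k" "\<phi> y \<noteq> 0"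
proof -
  have Z: "(\<lambda>_. 0) \<in> Cc_inf n" by (auto simp: Cc_inf_def Ck_const box_supp_def)
  have "S i (\<lambda>_. 0) x = 0" using S_sum[OF assms(1), of "{}" "\<lambda>_ _. 0" x] assms(2) by simp
  then have "\<not> (\<forall>y\<in>extensional {..<n}. (\<forall>k\<in>- I. y k = x k) \<longrightarrow> \<phi> y = 0)"
    using S_local[OF assms(1,2), of \<phi> "\<lambda>_. 0"] assms(3) by auto
  then show ?thesis using that by blast
qed

lemma S_slab_supp:
  assumes "i \<in> I" "J \<inter> I = {}" "slab_supp n J R \<phi>" shows "slab_supp n J R (S i \<phi>)"
  unfolding slab_supp_def
proof (intro ballI impI)
  fix x assume x: "x \<in> extensional {..<n}" "S i \<phi> x \<noteq> 0"
  obtain y where y: "y \<in> extensional {..<n}" "\<forall>k\<in>- I. y k = x k" "\<phi> y \<noteq> 0"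
    using S_nonzero[OF assms(1) x] by blast
  then have "y \<in> slab n J R" using assms(3) by (auto simp: slab_supp_def)
  then show "x \<in> slab n J R" using x(1) y(2) assms(2) unfolding slab_def by force
qed

end

lemma block_op_exists:
  assumes I: "I \<subseteq> {..<n}" "I \<noteq> {}" and R0: "R0 > 0"
  obtains S C where "block_op n I R0 S C"
proof -
  have fI: "finite I" using I finite_subset by blast
  define R where "R = 2 * R0 + 1"
  have R: "R > 0" "R0 + R0 \<le> R" using R0 by (auto simp: R_def)
  define c where "c = (LINT \<zeta>|LM I. bm_density I 1 \<zeta>)"
  have c: "c > 0" unfolding c_def by (rule bm_density_integral_pos[OF fI I(2)])
  define \<kappa> where "\<kappa> i \<zeta> = of_real (1 / c) * bm_cut I R 0 i \<zeta>" for i \<zeta>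
  define A where "A = max 1 ((1 / c) * (LINT \<zeta>|LM I. majorant I R \<zeta>))"
  obtain C where C: "C \<ge> 0"
    "\<And>\<phi> i l v. \<phi> \<in> Cc_inf n \<Longrightarrow> slab_supp n I R0 \<phi> \<Longrightarrow> i \<in> I \<Longrightarrow> l \<in> I \<Longrightarrow> v \<in> {1, \<i>} \<Longrightarrow>
       (LINT x|LM {..<n}. indicator (slab n I R0) x * (cmod (conv I (bm_cut I R 0 i) (partial l v \<phi>) x))\<^sup>2) \<le> C * sq_norm n \<phi>"
    unfolding R_def using conv_bm_cut_gain[OF I R0] by blast
  have ki: "integrable (LM I) (\<kappa> i)" if "i \<in> I" for i
    unfolding \<kappa>_def[abs_def] using bm_cut_integrable(1)[OF fI that order_refl R(1)] by simp
  have kA: "(LINT \<zeta>|LM I. cmod (\<kappa> i \<zeta>)) \<le> A" if "i \<in> I" for i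
  proof -
    have "(LINT \<zeta>|LM I. cmod (\<kappa> i \<zeta>)) = (1 / c) * (LINT \<zeta>|LM I. cmod (bm_cut I R 0 i \<zeta>))"
      unfolding \<kappa>_def using c by (simp add: norm_mult norm_divide)
    also have "\<dots> \<le> (1 / c) * (LINT \<zeta>|LM I. majorant I R \<zeta>)"
      using bm_cut_integrable(2)[OF fI that order_refl R(1)] c by (intro mult_left_mono) auto
    finally show ?thesis by (simp add: A_def)
  qed
  have kb: "box_supp I R (\<kappa> i)" for i using bm_cut_box_supp[of I R 0 i] by (auto simp: box_supp_def \<kappa>_def)
  have Sk: "conv I (\<kappa> i) \<psi> x = of_real (1 / c) * conv I (bm_cut I R 0 i) \<psi> x" for i \<psi> x
    unfolding \<kappa>_def[abs_def] by (rule conv_cmult)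
  define K where "K = max (A\<^sup>2) ((1 / c)\<^sup>2 * C)"
  have "block_op n I R0 (\<lambda>i. conv I (\<kappa> i)) K"
  proof
    show "I \<subseteq> {..<n}" by (rule I)
    show "K \<ge> 0" by (simp add: K_def le_max_iff_disj)
    fix i assume i: "i \<in> I"
    show "conv I (\<kappa> i) \<phi> \<in> Cc_inf n" if "\<phi> \<in> Cc_inf n" for \<phi>
      using conv_Cc_inf[OF I(1) ki[OF i] kb _ that] R by simp
    show "conv I (\<kappa> i) (\<lambda>x. a * \<phi> x + b * \<psi> x) x = a * conv I (\<kappa> i) \<phi> x + b * conv I (\<kappa> i) \<psi> x"
      if "\<phi> \<in> Cc_inf n" "\<psi> \<in> Cc_inf n" "x \<in> extensional {..<n}" for \<phi> \<psi> a b x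
      by (rule conv_lin[OF I(1) ki[OF i] that])
    show "conv I (\<kappa> i) (\<lambda>x. \<Sum>j\<in>A. h j x) x = (\<Sum>j\<in>A. conv I (\<kappa> i) (h j) x)"
      if "\<And>j. j \<in> A \<Longrightarrow> h j \<in> Cc_inf n" "x \<in> extensional {..<n}" for A and h :: "nat \<Rightarrow> _" and x
      by (rule conv_sum[OF I(1) ki[OF i] that])
    show "partial k v (conv I (\<kappa> i) \<phi>) x = conv I (\<kappa> i) (partial k v \<phi>) x"
      if "\<phi> \<in> Cc_inf n" "k < n" "v \<in> {1, \<i>}" "x \<in> extensional {..<n}" for \<phi> k v x
      by (rule partial_conv[OF I(1) ki[OF i] that])
    show "conv I (\<kappa> i) f x = conv I (\<kappa> i) g x"
      if x: "x \<in> extensional {..<n}" and fg: "\<And>y. y \<in> extensional {..<n} \<Longrightarrow> \<forall>k\<in>- I. y k = x k \<Longrightarrow> f y = g y" for f g x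
      by (rule conv_cong[OF I(1) x], rule fg[OF shift_extensional[OF I(1) x]]) (auto simp: shift_def)
    show "(LINT x|LM {..<n}. indicator (slab n J R) x * (cmod (conv I (\<kappa> i) \<phi> x))\<^sup>2)
          \<le> K * (LINT x|LM {..<n}. indicator (slab n J R) x * (cmod (\<phi> x))\<^sup>2)"
      if \<phi>: "\<phi> \<in> Cc_inf n" and J: "J \<subseteq> {..<n} - I" for \<phi> J R
    proof -
      have s: "shift I \<zeta> x \<in> slab n J R \<longleftrightarrow> x \<in> slab n J R" if "x \<in> extensional {..<n}" for \<zeta> x
      proof -
        have "shift I \<zeta> x k = x k" if "k \<in> J" for k using that J by (auto simp: shift_def)
        then show ?thesis using that shift_extensional[OF I(1) that] by (simp add: slab_def)
      qed
      have J': "J \<subseteq> {..<n}" using J by auto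
      have "(LINT x|LM {..<n}. indicator (slab n J R) x * (cmod (conv I (\<kappa> i) \<phi> x))\<^sup>2)
          \<le> A\<^sup>2 * (LINT x|LM {..<n}. indicator (slab n J R) x * (cmod (\<phi> x))\<^sup>2)"
        by (rule conv_L2(2)[OF I(1) ki[OF i] _ kA[OF i] \<phi> slab_sets[OF J'] s]) (simp add: A_def)
      also have "\<dots> \<le> K * (LINT x|LM {..<n}. indicator (slab n J R) x * (cmod (\<phi> x))\<^sup>2)"
        by (intro mult_right_mono) (auto simp: K_def)
      finally show ?thesis .
    qed
    show "(LINT x|LM {..<n}. indicator (slab n I R0) x * (cmod (conv I (\<kappa> i) (partial l v \<phi>) x))\<^sup>2) \<le> K * sq_norm n \<phi>"
      if "\<phi> \<in> Cc_inf n" "slab_supp n I R0 \<phi>" "l \<in> I" "v \<in> {1, \<i>}" for \<phi> l v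
    proof -
      have "(LINT x|LM {..<n}. indicator (slab n I R0) x * (cmod (conv I (\<kappa> i) (partial l v \<phi>) x))\<^sup>2)
         = (LINT x|LM {..<n}. (1 / c)\<^sup>2 * (indicator (slab n I R0) x * (cmod (conv I (bm_cut I R 0 i) (partial l v \<phi>) x))\<^sup>2))"
        unfolding Sk by (intro Bochner_Integration.integral_cong refl) (simp add: norm_mult power_mult_distrib norm_divide power_divide)
      also have "\<dots> = (1 / c)\<^sup>2 * (LINT x|LM {..<n}. indicator (slab n I R0) x * (cmod (conv I (bm_cut I R 0 i) (partial l v \<phi>) x))\<^sup>2)" by simp
      also have "\<dots> \<le> (1 / c)\<^sup>2 * (C * sq_norm n \<phi>)" by (intro mult_left_mono C(2)[OF that(1,2) i that(3,4)]) simp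
      also have "\<dots> \<le> K * sq_norm n \<phi>" unfolding mult.assoc[symmetric] by (intro mult_right_mono sq_norm_nonneg) (simp add: K_def)
      finally show ?thesis .
    qed
  next
    fix \<phi> x assume \<phi>: "\<phi> \<in> Cc_inf n" "slab_supp n I R0 \<phi>" and x: "x \<in> slab n I R0"
    have "(\<Sum>i\<in>I. conv I (\<kappa> i) (partial_zbar i \<phi>) x) = of_real (1 / c) * (\<Sum>i\<in>I. conv I (bm_cut I R 0 i) (partial_zbar i \<phi>) x)"
      unfolding Sk sum_distrib_left ..
    also have "\<dots> = of_real (1 / c) * (- of_real c * \<phi> x)" using conv_bm_cut_div[OF I \<phi> x R(2,1)] by (simp add: c_def)
    also have "\<dots> = - \<phi> x" using c by simp
    finally show "(\<Sum>i\<in>I. conv I (\<kappa> i) (partial_zbar i \<phi>) x) = - \<phi> x" .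
  qed
  then show ?thesis by (rule that)
qed

section \<open>Test functions\<close>

lemma test_compact:
  assumes "\<phi> \<in> test_functions n U"
  obtains K where "compactin (PT {..<n}) K" "K \<subseteq> U" "\<And>x. x \<in> extensional {..<n} \<Longrightarrow> \<phi> x \<noteq> 0 \<Longrightarrow> x \<in> K"
  using assms unfolding test_functions_def Cn_top_eq topspace_PT by blast

lemma test_Ck: "\<phi> \<in> test_functions n U \<Longrightarrow> Ck n r \<phi>"
  by (auto simp: test_functions_def)

lemma testI:
  assumes "\<And>r. Ck n r \<phi>" "compactin (PT {..<n}) K" "K \<subseteq> U" "\<And>x. x \<in> extensional {..<n} \<Longrightarrow> \<phi> x \<noteq> 0 \<Longrightarrow> x \<in> K"
  shows "\<phi> \<in> test_functions n U"
  using assms unfolding test_functions_def Cn_top_eq topspace_PT by blast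

lemma test_Cc_inf:
  assumes "\<phi> \<in> test_functions n U" shows "\<phi> \<in> Cc_inf n"
proof -
  obtain K where K: "compactin (PT {..<n}) K" "\<And>x. x \<in> extensional {..<n} \<Longrightarrow> \<phi> x \<noteq> 0 \<Longrightarrow> x \<in> K"
    using test_compact[OF assms] by metis
  have "\<exists>r. \<forall>x\<in>K. cmod (x k) \<le> r" if "k < n" for k
  proof -
    have "compactin euclidean ((\<lambda>x. x k) ` K)"
      by (rule image_compactin[OF K(1) continuous_map_PT_coord]) (use that in simp)
    then have "bounded ((\<lambda>x. x k) ` K)" by (simp add: compact_imp_bounded)
    then show ?thesis unfolding bounded_iff by blast
  qed
  then obtain r where r: "\<And>k x. k < n \<Longrightarrow> x \<in> K \<Longrightarrow> cmod (x k) \<le> r k" by metis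
  have "box_supp {..<n} (\<Sum>k<n. \<bar>r k\<bar>) \<phi>"
    unfolding box_supp_def
  proof (intro ballI impI)
    fix x k assume x: "x \<in> extensional {..<n}" "\<phi> x \<noteq> 0" and k: "k \<in> {..<n}"
    have "cmod (x k) \<le> \<bar>r k\<bar>" using r[of k x] K(2)[OF x] k by simp
    also have "\<dots> \<le> (\<Sum>k<n. \<bar>r k\<bar>)" using k by (intro member_le_sum) auto
    finally show "cmod (x k) \<le> (\<Sum>k<n. \<bar>r k\<bar>)" .
  qed
  then show ?thesis using test_Ck[OF assms] by (auto simp: Cc_inf_def)
qed

lemma test_add:
  assumes "\<phi> \<in> test_functions n U" "\<psi> \<in> test_functions n U"
  shows "(\<lambda>x. \<phi> x + \<psi> x) \<in> test_functions n U"
proof -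
  obtain K where K: "compactin (PT {..<n}) K" "K \<subseteq> U" "\<And>x. x \<in> extensional {..<n} \<Longrightarrow> \<phi> x \<noteq> 0 \<Longrightarrow> x \<in> K"
    using test_compact[OF assms(1)] by metis
  obtain L where L: "compactin (PT {..<n}) L" "L \<subseteq> U" "\<And>x. x \<in> extensional {..<n} \<Longrightarrow> \<psi> x \<noteq> 0 \<Longrightarrow> x \<in> L"
    using test_compact[OF assms(2)] by metis
  show ?thesis
  proof (rule testI[where K = "K \<union> L"])
    show "Ck n r (\<lambda>x. \<phi> x + \<psi> x)" for r by (intro Ck_add test_Ck[OF assms(1)] test_Ck[OF assms(2)])
    show "compactin (PT {..<n}) (K \<union> L)" using K L by (simp add: compactin_Un)
    fix x assume "x \<in> extensional {..<n}" "\<phi> x + \<psi> x \<noteq> 0"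
    then show "x \<in> K \<union> L" using K(3)[of x] L(3)[of x] by (cases "\<phi> x = 0") auto
  qed (use K L in auto)
qed

lemma test_mult:
  assumes "\<phi> \<in> test_functions n U" "\<And>r. Ck n r f"
  shows "(\<lambda>x. f x * \<phi> x) \<in> test_functions n U"
proof -
  obtain K where K: "compactin (PT {..<n}) K" "K \<subseteq> U" "\<And>x. x \<in> extensional {..<n} \<Longrightarrow> \<phi> x \<noteq> 0 \<Longrightarrow> x \<in> K"
    using test_compact[OF assms(1)] by metis
  show ?thesis
    by (rule testI[OF _ K(1,2)]) (use K(3) in \<open>auto intro!: Ck_mult assms(2) test_Ck[OF assms(1)]\<close>)
qed

lemma test_zero: "(\<lambda>_. 0) \<in> test_functions n U"
  by (rule testI[where K = "{}"]) (auto simp: Ck_const)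

text \<open>A compact set is closed, so off it a test function vanishes along short pieces of coordinate lines.\<close>

lemma test_partial:
  assumes "\<phi> \<in> test_functions n U" "k < n" "v \<in> {1, \<i>}"
  shows "partial k v \<phi> \<in> test_functions n U"
proof -
  obtain K where K: "compactin (PT {..<n}) K" "K \<subseteq> U" "\<And>x. x \<in> extensional {..<n} \<Longrightarrow> \<phi> x \<noteq> 0 \<Longrightarrow> x \<in> K"
    using test_compact[OF assms(1)] by metis
  have cl: "closedin (PT {..<n}) K"
    by (rule compactin_imp_closedin[OF _ K(1)]) (simp add: Hausdorff_space_product_topology)
  show ?thesis
  proof (rule testI[OF _ K(1,2)])
    show "Ck n r (partial k v \<phi>)" for r by (rule Ck_partial[OF test_Ck[OF assms(1)] assms(2,3)])
    fix x assume x: "x \<in> extensional {..<n}" "partial k v \<phi> x \<noteq> 0"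
    show "x \<in> K"
    proof (rule ccontr)
      assume nx: "x \<notin> K"
      have "openin (PT {..<n}) (extensional {..<n} - K)"
        using cl unfolding closedin_def topspace_PT by blast
      moreover have "x \<in> extensional {..<n} - K" using x nx by simp
      ultimately obtain r where r: "r > 0" "polydisc {..<n} x r \<subseteq> extensional {..<n} - K"
        using openin_PT_polydisc[of "{..<n}"] by blast
      have v: "cmod v = 1" using assms(3) by auto
      define u where "u t = x(k := x k + t *\<^sub>R v)" for t :: real
      have f0: "\<phi> (u t) = 0" if "t \<in> ball 0 r" for t
      proof -
        have "u t \<in> extensional {..<n}" unfolding u_def by (rule fun_upd_extensional[OF assms(2) x(1)])
        moreover have "cmod (u t j - x j) < r" for j
          using that r(1) v by (cases "j = k") (auto simp: u_def dist_norm)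
        ultimately have "u t \<in> polydisc {..<n} x r" by (simp add: polydisc_def)
        then have "u t \<notin> K" "u t \<in> extensional {..<n}" using r by auto
        then show ?thesis using K(3) by blast
      qed
      have "((\<lambda>t. \<phi> (u t)) has_vector_derivative 0) (at 0)"
        by (rule has_vector_derivative_transform_within_open[OF _ open_ball, of "\<lambda>_. 0" _ _ 0 r])
          (use r(1) f0 in simp_all)
      then have "partial k v \<phi> x = 0" unfolding partial_def u_def by (rule vector_derivative_at)
      then show False using x by simp
    qed
  qed
qed

lemma test_zbar:
  assumes "\<phi> \<in> test_functions n U" "k < n" shows "partial_zbar k \<phi> \<in> test_functions n U"
proof -
  have 2: "partial_zbar k \<phi> = (\<lambda>x. (1/2) * partial k 1 \<phi> x + (\<i>/2) * partial k \<i> \<phi> x)"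
    by (rule ext) (simp add: partial_zbar_def field_simps)
  show ?thesis unfolding 2 by (intro test_add test_mult test_partial assms Ck_const) auto
qed

section \<open>Cutoffs in the variables of one factor\<close>

text \<open>The support is compact in \<open>V\<close> as far as the coordinates of \<open>I\<close> are concerned. An operator that acts in the
  other coordinates spreads the support of a test function in just this way.\<close>

definition proj_supp :: "nat \<Rightarrow> nat set \<Rightarrow> (nat \<Rightarrow> complex) set \<Rightarrow> ((nat \<Rightarrow> complex) \<Rightarrow> complex) \<Rightarrow> bool" where
  "proj_supp n I V \<Phi> \<longleftrightarrow> (\<exists>K. compactin (PT {..<n}) K \<and> K \<subseteq> V \<and>
     (\<forall>x\<in>extensional {..<n}. \<Phi> x \<noteq> 0 \<longrightarrow> (\<exists>y\<in>K. \<forall>k\<in>I. x k = y k)))"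

text \<open>Smooth functions of the coordinates outside \<open>I\<close> that exhaust \<open>V\<close>. A product with such a function cuts down
  the support in the remaining coordinates, and is a test function as \<open>V\<close> is a product.\<close>

lemma cutoff_sequence:
  assumes V: "openin (PT {..<n}) V" and I: "I \<subseteq> {..<n}"
    and rect: "\<And>x y. x \<in> V \<Longrightarrow> y \<in> V \<Longrightarrow> (\<lambda>k. if k \<in> I then x k else y k) \<in> V"
  obtains \<Theta> :: "nat \<Rightarrow> (nat \<Rightarrow> complex) \<Rightarrow> complex" where
    "\<And>m r. Ck n r (\<Theta> m)" "\<And>m x. cmod (\<Theta> m x) \<le> 1" "\<And>x. x \<in> V \<Longrightarrow> (\<lambda>m. \<Theta> m x) \<longlonglongrightarrow> 1"
    "\<And>m x k c. k \<in> I \<Longrightarrow> \<Theta> m (x(k := c)) = \<Theta> m x"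
    "\<And>m \<Phi>. \<Phi> \<in> Cc_inf n \<Longrightarrow> proj_supp n I V \<Phi> \<Longrightarrow> (\<lambda>x. \<Theta> m x * \<Phi> x) \<in> test_functions n V"
proof -
  obtain P where P: "countable P"
    "\<And>c r. (c, r) \<in> P \<Longrightarrow> r > 0 \<and> c \<in> V \<and> {x \<in> extensional {..<n}. \<forall>k\<in>{..<n}. cmod (x k - c k) \<le> r} \<subseteq> V"
    "V = (\<Union>(c, r)\<in>P. polydisc {..<n} c r)"
    using openin_PT_countable_cover[OF finite_lessThan V] by blast
  define J where "J = {..<n} - I"
  have J: "J \<subseteq> {..<n}" "finite J" by (auto simp: J_def)
  define Pm where "Pm m = {p \<in> P. to_nat_on P p < m}" for m
  have Pm: "finite (Pm m)" for m
  proof (rule finite_imageD)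
    show "finite (to_nat_on P ` Pm m)" by (rule finite_subset[of _ "{..<m}"]) (auto simp: Pm_def)
    show "inj_on (to_nat_on P) (Pm m)" by (rule inj_on_subset[OF inj_on_to_nat_on[OF P(1)]]) (auto simp: Pm_def)
  qed
  define \<psi> where "\<psi> p x = bump J (fst p) (snd p) x" for p x
  have \<psi>01: "0 \<le> \<psi> p x" "\<psi> p x \<le> 1" for p x unfolding \<psi>_def by (rule bump_01)+
  \<comment> \<open>At a point of \<open>V\<close> some factor is the \<open>m\<close>-th power of a number below \<open>1\<close> for all large \<open>m\<close>, so \<open>pr m\<close>
    tends to \<open>0\<close>. For a fixed \<open>m\<close> only finitely many polydiscs are involved.\<close>
  define pr where "pr m x = (\<Prod>p\<in>Pm m. (1 - \<psi> p x) ^ m)" for m x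
  have pr01: "0 \<le> pr m x" "pr m x \<le> 1" for m x
    unfolding pr_def using \<psi>01 by (auto intro!: prod_nonneg prod_le_1 power_le_one)
  define \<Theta> where "\<Theta> m x = complex_of_real (1 - pr m x)" for m x
  show ?thesis
  proof (rule that[of \<Theta>])
    have eq: "\<Theta> m = (\<lambda>x. 1 + (-1) * (\<Prod>p\<in>Pm m. (1 + (-1) * complex_of_real (\<psi> p x)) ^ m))" for m
      by (rule ext) (simp add: \<Theta>_def pr_def)
    show "Ck n r (\<Theta> m)" for r m
      unfolding eq \<psi>_def by (intro Ck_add Ck_mult Ck_const Ck_prod Ck_power Pm Ck_bump[OF J(1)])
    show "cmod (\<Theta> m x) \<le> 1" for m x unfolding \<Theta>_def norm_of_real using pr01[of m x] by simp
    show "\<Theta> m (x(k := c)) = \<Theta> m x" if k: "k \<in> I" for m x k c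
    proof -
      have "\<psi> p (x(k := c)) = \<psi> p x" for p
        unfolding \<psi>_def bump_def using k by (intro prod.cong) (auto simp: J_def)
      then show ?thesis by (simp add: \<Theta>_def pr_def)
    qed
    show "(\<lambda>m. \<Theta> m x) \<longlonglongrightarrow> 1" if x: "x \<in> V" for x
    proof -
      obtain c r where p: "(c, r) \<in> P" "x \<in> polydisc {..<n} c r" using x P(3) by auto
      define q where "q = 1 - \<psi> (c, r) x"
      have "\<psi> (c, r) x > 0" unfolding \<psi>_def fst_conv snd_conv using P(2)[OF p(1)] p(2) J(1)
        by (intro bump_pos) (auto simp: polydisc_def)
      then have q: "0 \<le> q" "q < 1" using \<psi>01[of "(c, r)" x] by (auto simp: q_def)
      have "(\<lambda>m. pr m x) \<longlonglongrightarrow> 0"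
      proof (rule Lim_null_comparison)
        show "(\<lambda>m. q ^ m) \<longlonglongrightarrow> 0" using q by (intro LIMSEQ_realpow_zero)
        show "\<forall>\<^sub>F m in sequentially. norm (pr m x) \<le> q ^ m"
          using eventually_gt_at_top[of "to_nat_on P (c, r)"]
        proof eventually_elim
          case (elim m)
          then have "(c, r) \<in> Pm m" using p(1) by (simp add: Pm_def)
          then have "pr m x = q ^ m * (\<Prod>p\<in>Pm m - {(c, r)}. (1 - \<psi> p x) ^ m)"
            unfolding pr_def q_def by (rule prod.remove[OF Pm])
          also have "\<dots> \<le> q ^ m * 1"
            using q \<psi>01 by (intro mult_left_mono prod_le_1) (auto intro: power_le_one)
          finally show ?case using pr01[of m x] by simp
        qed
      qed
      then have "(\<lambda>m. complex_of_real (1 - pr m x)) \<longlonglongrightarrow> complex_of_real (1 - 0)" by (intro tendsto_intros)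
      then show ?thesis by (simp add: \<Theta>_def)
    qed
    show "(\<lambda>x. \<Theta> m x * \<Phi> x) \<in> test_functions n V" if \<Phi>: "\<Phi> \<in> Cc_inf n" and s: "proj_supp n I V \<Phi>" for m \<Phi>
    proof -
      obtain K where K: "compactin (PT {..<n}) K" "K \<subseteq> V"
        "\<And>x. x \<in> extensional {..<n} \<Longrightarrow> \<Phi> x \<noteq> 0 \<Longrightarrow> \<exists>y\<in>K. \<forall>k\<in>I. x k = y k"
        using s unfolding proj_supp_def by blast
      have Ve: "V \<subseteq> extensional {..<n}" using openin_subset[OF V] by (simp add: topspace_PT)
      define mg where "mg z = (\<lambda>k. if k \<in> I then fst z k else snd z k)" for z :: "(nat \<Rightarrow> complex) \<times> (nat \<Rightarrow> complex)"
      define D where "D p = PiE {..<n} (\<lambda>k. cball (fst p k) (snd p))" for p :: "(nat \<Rightarrow> complex) \<times> real"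
      have DV: "D p \<subseteq> V" if p: "p \<in> P" for p
      proof -
        obtain c r where cr: "p = (c, r)" by (cases p)
        have "D p \<subseteq> {x \<in> extensional {..<n}. \<forall>k\<in>{..<n}. cmod (x k - c k) \<le> r}"
          unfolding D_def cr by (auto simp: PiE_def Pi_def dist_norm norm_minus_commute)
        then show ?thesis using P(2)[of c r] p cr by blast
      qed
      \<comment> \<open>Coordinates in \<open>I\<close> from the compact set for \<open>\<Phi>\<close>, the others from one of finitely many closed polydiscs.\<close>
      define K' where "K' = (\<Union>p\<in>Pm m. mg ` (K \<times> D p))"
      have mgc: "continuous_map (prod_topology (PT {..<n}) (PT {..<n})) (PT {..<n}) mg"
        unfolding continuous_map_componentwise
      proof (intro conjI ballI)
        show "mg ` topspace (prod_topology (PT {..<n}) (PT {..<n})) \<subseteq> extensional {..<n}"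
          using I by (auto simp: mg_def extensional_def)
        fix k assume k: "k \<in> {..<n}"
        have 1: "continuous_map (prod_topology (PT {..<n}) (PT {..<n})) euclidean (\<lambda>x. fst x k)"
          using continuous_map_compose[OF continuous_map_fst continuous_map_PT_coord[OF k]] by (simp add: o_def)
        have 2: "continuous_map (prod_topology (PT {..<n}) (PT {..<n})) euclidean (\<lambda>x. snd x k)"
          using continuous_map_compose[OF continuous_map_snd continuous_map_PT_coord[OF k]] by (simp add: o_def)
        show "continuous_map (prod_topology (PT {..<n}) (PT {..<n})) euclidean (\<lambda>x. mg x k)"
          using 1 2 by (cases "k \<in> I") (simp_all add: mg_def)
      qed
      have K'c: "compactin (PT {..<n}) K'"
        unfolding K'_def
      proof (rule compactin_Union)
        show "finite ((\<lambda>p. mg ` (K \<times> D p)) ` Pm m)" using Pm by simp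
        fix E assume "E \<in> (\<lambda>p. mg ` (K \<times> D p)) ` Pm m"
        then obtain p where E: "E = mg ` (K \<times> D p)" by blast
        have "compactin (PT {..<n}) (D p)" unfolding D_def by (simp add: compactin_PiE)
        then have "compactin (prod_topology (PT {..<n}) (PT {..<n})) (K \<times> D p)" using K(1) by (simp add: compactin_Times)
        then show "compactin (PT {..<n}) E" unfolding E by (rule image_compactin[OF _ mgc])
      qed
      have K'V: "K' \<subseteq> V"
      proof
        fix x assume "x \<in> K'"
        then obtain p y z where p: "p \<in> Pm m" "y \<in> K" "z \<in> D p" "x = mg (y, z)" by (auto simp: K'_def)
        then have "z \<in> V" "y \<in> V" using DV[of p] K(2) by (auto simp: Pm_def)
        then show "x \<in> V" using rect[of y z] unfolding p(4) mg_def fst_conv snd_conv by blast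
      qed
      show ?thesis
      proof (rule testI[OF _ K'c K'V])
        show "Ck n r (\<lambda>x. \<Theta> m x * \<Phi> x)" for r
          by (intro Ck_mult Cc_inf_Ck[OF \<Phi>]) (unfold eq \<psi>_def, intro Ck_add Ck_mult Ck_const Ck_prod Ck_power Pm Ck_bump[OF J(1)])
        fix x assume x: "x \<in> extensional {..<n}" "\<Theta> m x * \<Phi> x \<noteq> 0"
        then obtain y where y: "y \<in> K" "\<And>k. k \<in> I \<Longrightarrow> x k = y k" using K(3)[of x] by auto
        have "\<exists>p\<in>Pm m. \<psi> p x \<noteq> 0"
        proof (rule ccontr)
          assume "\<not> ?thesis"
          then have "pr m x = 1" unfolding pr_def by (intro prod.neutral) auto
          then show False using x by (simp add: \<Theta>_def)
        qed
        then obtain p where p: "p \<in> Pm m" "\<psi> p x \<noteq> 0" by blast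
        obtain c r where cr: "p = (c, r)" by (cases p)
        have r: "r > 0" and cV: "c \<in> V" using P(2)[of c r] p(1) cr by (auto simp: Pm_def)
        have xJ: "cmod (x k - c k) \<le> r" if "k \<in> J" for k
          using bump_zero[OF J(2) that, of r x c] p(2) r unfolding \<psi>_def cr by force
        define z where "z = (\<lambda>k. if k \<in> J then x k else c k)"
        have "z \<in> D p"
          unfolding D_def cr using xJ r cV Ve J(1) by (auto simp: z_def PiE_iff extensional_def dist_norm norm_minus_commute subset_iff)
        moreover have "mg (y, z) = x"
        proof
          fix k
          show "mg (y, z) k = x k"
          proof (cases "k < n")
            case True
            then show ?thesis using y(2)[of k] by (auto simp: mg_def z_def J_def)
          next
            case False
            then have "k \<notin> I" "k \<notin> J" using I J by auto
            then show ?thesis using False x(1) cV Ve by (auto simp: mg_def z_def extensional_def subset_iff)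
          qed
        qed
        ultimately show "x \<in> K'" unfolding K'_def using p(1) y(1) by (force simp: image_iff)
      qed
    qed
  qed
qed

section \<open>Square integrable functions on a bounded open set\<close>

text \<open>Extension by \<open>0\<close> turns integrals over \<open>V\<close> into integrals over the space, where translations act.\<close>

definition zero_ext :: "(nat \<Rightarrow> complex) set \<Rightarrow> ((nat \<Rightarrow> complex) \<Rightarrow> complex) \<Rightarrow> (nat \<Rightarrow> complex) \<Rightarrow> complex" where
  "zero_ext V f z = indicator V z *\<^sub>R f z"

locale bdd_open =
  fixes n :: nat and V :: "(nat \<Rightarrow> complex) set" and R0 :: real
  assumes open_V: "openin (PT {..<n}) V" and bdd_V: "V \<subseteq> slab n {..<n} R0" and R0: "R0 > 0"
begin

lemma V_sets [measurable]: "V \<in> sets (LM {..<n})"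
  by (rule openin_PT_sets[OF _ open_V]) simp

lemma V_ext: "V \<subseteq> extensional {..<n}"
  using bdd_V by (auto simp: slab_def)

lemma V_slab: "I \<subseteq> {..<n} \<Longrightarrow> V \<subseteq> slab n I R0"
  using bdd_V by (auto simp: slab_def)

lemma set_int: "(LINT z:V|Cn_measure n. f z * \<phi> z) = (LINT z|LM {..<n}. zero_ext V f z * \<phi> z)"
  unfolding set_lebesgue_integral_def Cn_measure_eq by (simp add: zero_ext_def)

lemma L2_iff: "f \<in> L2 n V \<longleftrightarrow> zero_ext V f \<in> borel_measurable (LM {..<n}) \<and> integrable (LM {..<n}) (\<lambda>z. (cmod (zero_ext V f z))\<^sup>2)"
proof -
  have "(\<lambda>z. indicator V z *\<^sub>R (cmod (f z))\<^sup>2) = (\<lambda>z. (cmod (zero_ext V f z))\<^sup>2)"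
    by (rule ext) (simp add: indicator_def zero_ext_def)
  moreover have "zero_ext V f = (\<lambda>z. indicator V z *\<^sub>R f z)" by (rule ext) (simp add: zero_ext_def)
  ultimately show ?thesis
    unfolding L2_def set_borel_measurable_def set_integrable_def Cn_measure_eq by auto
qed

lemma finite_V: "emeasure (LM {..<n}) V < \<infinity>"
proof -
  have "emeasure (LM {..<n}) V \<le> emeasure (LM {..<n}) {x \<in> extensional {..<n}. \<forall>k\<in>{..<n}. cmod (x k) \<le> R0}"
    using bdd_V box_sets[of "{..<n}" "{..<n}" R0] by (intro emeasure_mono) (auto simp: slab_def)
  then show ?thesis using box_finite[of "{..<n}" R0] by (simp add: order_le_less_trans)
qed

lemma L2_integrable:
  assumes "f \<in> L2 n V" shows "integrable (LM {..<n}) (zero_ext V f)"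
proof (rule Bochner_Integration.integrable_bound)
  show "integrable (LM {..<n}) (\<lambda>z. indicator V z + (cmod (zero_ext V f z))\<^sup>2)"
    using assms finite_V unfolding L2_iff by (intro Bochner_Integration.integrable_add integrable_real_indicator) auto
  show "AE z in LM {..<n}. norm (zero_ext V f z) \<le> norm (indicat_real V z + (cmod (zero_ext V f z))\<^sup>2)"
  proof (rule AE_I2)
    fix z
    have "t \<le> 1 + t\<^sup>2" if "t \<ge> 0" for t :: real
      using sum_squares_bound[of t 1] that by simp
    then show "norm (zero_ext V f z) \<le> norm (indicat_real V z + (cmod (zero_ext V f z))\<^sup>2)"
      by (simp add: indicator_def zero_ext_def)
  qed
qed (use assms in \<open>simp add: L2_iff\<close>)

lemma L2_mult_integrable:
  assumes f: "f \<in> L2 n V" and \<psi>: "\<psi> \<in> Cc_inf n" shows "integrable (LM {..<n}) (\<lambda>z. zero_ext V f z * \<psi> z)"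
proof -
  obtain C where "\<And>x. x \<in> extensional {..<n} \<Longrightarrow> cmod (\<psi> x) \<le> C" using Cc_inf_bounded[OF \<psi>] by metis
  then show ?thesis
    by (intro integrable_mult_bounded[OF L2_integrable[OF f] Cc_inf_meas[OF \<psi>]]) (simp add: space_LM)
qed

text \<open>The norm of \<open>\<psi>\<close> may be taken over any set that contains \<open>V\<close>; a slab is the set on which the gain of a
  derivative is available.\<close>

lemma L2_pairing:
  assumes f: "f \<in> L2 n V" and \<psi>: "\<psi> \<in> Cc_inf n" and X: "X \<in> sets (LM {..<n})" "V \<subseteq> X"
  shows "cmod (LINT z|LM {..<n}. zero_ext V f z * \<psi> z)
    \<le> (LINT z|LM {..<n}. (cmod (zero_ext V f z))\<^sup>2) + (LINT z|LM {..<n}. indicator X z * (cmod (\<psi> z))\<^sup>2)"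
proof -
  define \<psi>' where "\<psi>' z = indicator X z *\<^sub>R \<psi> z" for z
  have m: "\<psi>' \<in> borel_measurable (LM {..<n})" unfolding \<psi>'_def using X Cc_inf_meas[OF \<psi>] by measurable
  have e: "(cmod (\<psi>' z))\<^sup>2 = indicator X z * (cmod (\<psi> z))\<^sup>2" for z by (simp add: \<psi>'_def indicator_def)
  have i: "integrable (LM {..<n}) (\<lambda>z. (cmod (\<psi>' z))\<^sup>2)"
  proof (rule Bochner_Integration.integrable_bound[OF Cc_inf_sq_integrable[OF \<psi>]])
    show "(\<lambda>z. (cmod (\<psi>' z))\<^sup>2) \<in> borel_measurable (LM {..<n})" using m by measurable
    show "AE z in LM {..<n}. norm ((cmod (\<psi>' z))\<^sup>2) \<le> norm ((cmod (\<psi> z))\<^sup>2)"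
      by (intro AE_I2) (simp add: e indicator_def)
  qed
  have eq: "zero_ext V f z * \<psi> z = zero_ext V f z * \<psi>' z" for z using X by (auto simp: \<psi>'_def indicator_def zero_ext_def)
  show ?thesis
    using mult_sq_integrable(2)[OF _ m _ i, of "zero_ext V f" 1] f unfolding L2_iff eq by (simp add: e)
qed

lemma L2_lin:
  assumes "f \<in> L2 n V" "g \<in> L2 n V" shows "(\<lambda>z. a * f z + b * g z) \<in> L2 n V"
proof -
  have e: "zero_ext V (\<lambda>z. a * f z + b * g z) = (\<lambda>z. a * zero_ext V f z + b * zero_ext V g z)"
    by (rule ext) (simp add: zero_ext_def algebra_simps scaleR_conv_of_real)
  have m: "zero_ext V f \<in> borel_measurable (LM {..<n})" "zero_ext V g \<in> borel_measurable (LM {..<n})" using assms by (auto simp: L2_iff)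
  have i: "integrable (LM {..<n}) (\<lambda>z. (cmod (a * zero_ext V f z + b * zero_ext V g z))\<^sup>2)"
  proof (rule Bochner_Integration.integrable_bound)
    show "integrable (LM {..<n}) (\<lambda>z. 2 * ((cmod a)\<^sup>2 * (cmod (zero_ext V f z))\<^sup>2) + 2 * ((cmod b)\<^sup>2 * (cmod (zero_ext V g z))\<^sup>2))"
      using assms by (simp add: L2_iff)
    show "AE z in LM {..<n}. norm ((cmod (a * zero_ext V f z + b * zero_ext V g z))\<^sup>2)
        \<le> norm (2 * ((cmod a)\<^sup>2 * (cmod (zero_ext V f z))\<^sup>2) + 2 * ((cmod b)\<^sup>2 * (cmod (zero_ext V g z))\<^sup>2))"
    proof (rule AE_I2)
      fix z
      show "norm ((cmod (a * zero_ext V f z + b * zero_ext V g z))\<^sup>2)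
        \<le> norm (2 * ((cmod a)\<^sup>2 * (cmod (zero_ext V f z))\<^sup>2) + 2 * ((cmod b)\<^sup>2 * (cmod (zero_ext V g z))\<^sup>2))"
        using norm_add_sq[of "a * zero_ext V f z" "b * zero_ext V g z"] unfolding norm_mult power_mult_distrib by simp
    qed
  qed (use m in measurable)
  have "(\<lambda>z. a * zero_ext V f z + b * zero_ext V g z) \<in> borel_measurable (LM {..<n})"
    by (intro borel_measurable_add borel_measurable_times borel_measurable_const m)
  then show ?thesis unfolding L2_iff e using i by (rule conjI)
qed

lemma L2_sum:
  assumes "finite A" "\<And>k. k \<in> A \<Longrightarrow> f k \<in> L2 n V" shows "(\<lambda>z. \<Sum>k\<in>A. f k z) \<in> L2 n V"
  using assms
proof (induction A rule: finite_induct)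
  case empty
  have "zero_ext V (\<lambda>z. 0) = (\<lambda>z. 0)" by (rule ext) (simp add: zero_ext_def)
  then show ?case by (simp add: L2_iff)
next
  case (insert k A)
  then show ?case using L2_lin[of "f k" "\<lambda>z. \<Sum>k\<in>A. f k z" 1 1] by simp
qed

lemma L2_represent:
  assumes ladd: "\<And>f g. f \<in> test_functions n V \<Longrightarrow> g \<in> test_functions n V \<Longrightarrow> l (\<lambda>x. f x + g x) = l f + l g"
    and lmul: "\<And>c f. f \<in> test_functions n V \<Longrightarrow> l (\<lambda>x. c * f x) = c * l f"
    and K: "K \<ge> 0" "\<And>f. f \<in> test_functions n V \<Longrightarrow> cmod (l f) \<le> K * (1 + sq_norm n f)"
  shows "\<exists>u\<in>L2 n V. \<forall>\<phi>\<in>test_functions n V. (LINT z:V|Cn_measure n. u z * \<phi> z) = l \<phi>"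
proof -
  obtain g where g: "g \<in> borel_measurable (LM {..<n})" "integrable (LM {..<n}) (\<lambda>x. (cmod (g x))\<^sup>2)"
    "\<And>f. f \<in> test_functions n V \<Longrightarrow> (LINT x|LM {..<n}. g x * f x) = l f"
  proof (rule Riesz_L2[of "test_functions n V" "LM {..<n}" l K])
    show "(\<lambda>_. 0) \<in> test_functions n V" by (rule test_zero)
    show "(\<lambda>x. f x + g x) \<in> test_functions n V" if "f \<in> test_functions n V" "g \<in> test_functions n V" for f g by (rule test_add[OF that])
    show "(\<lambda>x. c * f x) \<in> test_functions n V" if "f \<in> test_functions n V" for c f by (rule test_mult[OF that Ck_const])
    show "f \<in> borel_measurable (LM {..<n})" if "f \<in> test_functions n V" for f by (rule Cc_inf_meas[OF test_Cc_inf[OF that]])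
    show "integrable (LM {..<n}) (\<lambda>x. (cmod (f x))\<^sup>2)" if "f \<in> test_functions n V" for f by (rule Cc_inf_sq_integrable[OF test_Cc_inf[OF that]])
    show "cmod (l f) \<le> K * (1 + (LINT x|LM {..<n}. (cmod (f x))\<^sup>2))" if "f \<in> test_functions n V" for f
      using K(2)[OF that] by (simp add: sq_norm_def)
  qed (use ladd lmul K in blast)+
  have gL: "g \<in> L2 n V"
  proof -
    have "integrable (LM {..<n}) (\<lambda>z. (cmod (zero_ext V g z))\<^sup>2)"
      unfolding zero_ext_def by (rule Bochner_Integration.integrable_bound[OF g(2)]) (use g(1) in \<open>auto simp: indicator_def\<close>)
    moreover have "zero_ext V g \<in> borel_measurable (LM {..<n})" unfolding zero_ext_def[abs_def] using g(1) by measurable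
    ultimately show ?thesis unfolding L2_iff by blast
  qed
  have "(LINT z:V|Cn_measure n. g z * \<phi> z) = l \<phi>" if \<phi>: "\<phi> \<in> test_functions n V" for \<phi>
  proof -
    obtain K where K: "K \<subseteq> V" "\<And>x. x \<in> extensional {..<n} \<Longrightarrow> \<phi> x \<noteq> 0 \<Longrightarrow> x \<in> K"
      using test_compact[OF \<phi>] by metis
    have "(LINT z:V|Cn_measure n. g z * \<phi> z) = (LINT z|LM {..<n}. g z * \<phi> z)"
      unfolding set_int
    proof (rule Bochner_Integration.integral_cong[OF refl])
      fix z assume "z \<in> space (LM {..<n})"
      then have "\<phi> z \<noteq> 0 \<Longrightarrow> z \<in> V" using K by (auto simp: space_LM)
      then show "zero_ext V g z * \<phi> z = g z * \<phi> z" by (cases "\<phi> z = 0") (auto simp: indicator_def zero_ext_def)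
    qed
    then show ?thesis using g(3)[OF \<phi>] by simp
  qed
  then show ?thesis using gL by blast
qed

end

lemma (in bdd_open) cutoff_limit:
  assumes \<Theta>: "\<And>m r. Ck n r (\<Theta> m)" "\<And>m x. cmod (\<Theta> m x) \<le> 1" "\<And>x. x \<in> V \<Longrightarrow> (\<lambda>m. \<Theta> m x) \<longlonglongrightarrow> 1"
    and f: "f \<in> L2 n V" and \<Phi>: "\<Phi> \<in> Cc_inf n"
  shows "(\<lambda>m. LINT z|LM {..<n}. zero_ext V f z * (\<Theta> m z * \<Phi> z)) \<longlonglongrightarrow> (LINT z|LM {..<n}. zero_ext V f z * \<Phi> z)"
proof (rule integral_dominated_convergence[where w = "\<lambda>z. cmod (zero_ext V f z * \<Phi> z)"])
  have fm: "zero_ext V f \<in> borel_measurable (LM {..<n})" using f by (simp add: L2_iff)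
  show "(\<lambda>z. zero_ext V f z * \<Phi> z) \<in> borel_measurable (LM {..<n})" by (intro borel_measurable_times fm Cc_inf_meas[OF \<Phi>])
  have \<Theta>m: "\<Theta> m \<in> borel_measurable (LM {..<n})" for m by (rule continuous_map_PT_measurable[OF _ Ck_cont[OF \<Theta>(1)[where r = 0]]]) simp
  show "(\<lambda>z. zero_ext V f z * (\<Theta> m z * \<Phi> z)) \<in> borel_measurable (LM {..<n})" for m
    by (intro borel_measurable_times fm Cc_inf_meas[OF \<Phi>] \<Theta>m)
  show "integrable (LM {..<n}) (\<lambda>z. cmod (zero_ext V f z * \<Phi> z))" by (rule integrable_norm[OF L2_mult_integrable[OF f \<Phi>]])
  show "AE z in LM {..<n}. cmod (zero_ext V f z * (\<Theta> m z * \<Phi> z)) \<le> cmod (zero_ext V f z * \<Phi> z)" for m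
    using \<Theta>(2) by (intro AE_I2) (simp add: norm_mult mult_left_mono mult_left_le_one_le)
  show "AE z in LM {..<n}. (\<lambda>m. zero_ext V f z * (\<Theta> m z * \<Phi> z)) \<longlonglongrightarrow> zero_ext V f z * \<Phi> z"
  proof (rule AE_I2)
    fix z
    show "(\<lambda>m. zero_ext V f z * (\<Theta> m z * \<Phi> z)) \<longlonglongrightarrow> zero_ext V f z * \<Phi> z"
    proof (cases "z \<in> V")
      case True
      have "(\<lambda>m. zero_ext V f z * (\<Theta> m z * \<Phi> z)) \<longlonglongrightarrow> zero_ext V f z * (1 * \<Phi> z)" by (intro tendsto_intros \<Theta>(3)[OF True])
      then show ?thesis by simp
    qed (simp add: zero_ext_def)
  qed
qed

locale rect_open = bdd_open +
  fixes I :: "nat set"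
  assumes I: "I \<subseteq> {..<n}"
    and rect: "\<And>x y. x \<in> V \<Longrightarrow> y \<in> V \<Longrightarrow> (\<lambda>k. if k \<in> I then x k else y k) \<in> V"
begin

text \<open>On a product, the defining property of a weak derivative in a direction of \<open>I\<close> extends to functions whose
  support is compact only in the variables of \<open>I\<close>: the cutoffs do not depend on these variables, so their
  derivatives do not appear.\<close>

lemma weak_partial_ext:
  assumes w: "weak_partial n V k v f g" and f: "f \<in> L2 n V" and g: "g \<in> L2 n V" and k: "k \<in> I" "v \<in> {1, \<i>}"
    and \<Phi>: "\<Phi> \<in> Cc_inf n" "proj_supp n I V \<Phi>"
  shows "(LINT z|LM {..<n}. zero_ext V g z * \<Phi> z) = - (LINT z|LM {..<n}. zero_ext V f z * partial k v \<Phi> z)"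
proof -
  obtain \<Theta> where \<Theta>: "\<And>m r. Ck n r (\<Theta> m)" "\<And>m x. cmod (\<Theta> m x) \<le> 1" "\<And>x. x \<in> V \<Longrightarrow> (\<lambda>m. \<Theta> m x) \<longlonglongrightarrow> 1"
    "\<And>m x k c. k \<in> I \<Longrightarrow> \<Theta> m (x(k := c)) = \<Theta> m x"
    "\<And>m \<Phi>. \<Phi> \<in> Cc_inf n \<Longrightarrow> proj_supp n I V \<Phi> \<Longrightarrow> (\<lambda>x. \<Theta> m x * \<Phi> x) \<in> test_functions n V"
  proof (rule cutoff_sequence[OF open_V I])
    show "(\<lambda>k. if k \<in> I then x k else y k) \<in> V" if "x \<in> V" "y \<in> V" for x y by (rule rect[OF that])
  qed (rule that)
  have kn: "k < n" using k I by auto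
  have p: "partial k v (\<lambda>x. \<Theta> m x * \<Phi> x) x = \<Theta> m x * partial k v \<Phi> x" if x: "x \<in> extensional {..<n}" for m x
  proof -
    have "partial k v (\<Theta> m) x = 0" unfolding partial_def by (simp add: \<Theta>(4)[OF k(1)])
    then show ?thesis using partial_mult[OF \<Theta>(1) Cc_inf_Ck[OF \<Phi>(1)] kn k(2) x] by simp
  qed
  have "(LINT z|LM {..<n}. zero_ext V g z * (\<Theta> m z * \<Phi> z)) = - (LINT z|LM {..<n}. zero_ext V f z * (\<Theta> m z * partial k v \<Phi> z))" for m
  proof -
    have "(LINT z|LM {..<n}. zero_ext V g z * (\<Theta> m z * \<Phi> z)) = - (LINT z|LM {..<n}. zero_ext V f z * partial k v (\<lambda>x. \<Theta> m x * \<Phi> x) z)"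
      by (rule w[unfolded weak_partial_def set_int, rule_format, OF \<Theta>(5)[OF \<Phi>]])
    also have "(LINT z|LM {..<n}. zero_ext V f z * partial k v (\<lambda>x. \<Theta> m x * \<Phi> x) z) = (LINT z|LM {..<n}. zero_ext V f z * (\<Theta> m z * partial k v \<Phi> z))"
      by (rule Bochner_Integration.integral_cong) (simp_all add: p space_LM)
    finally show ?thesis .
  qed
  moreover have "(\<lambda>m. LINT z|LM {..<n}. zero_ext V g z * (\<Theta> m z * \<Phi> z)) \<longlonglongrightarrow> (LINT z|LM {..<n}. zero_ext V g z * \<Phi> z)"
    by (rule cutoff_limit[OF \<Theta>(1-3) g \<Phi>(1)])
  moreover have "(\<lambda>m. - (LINT z|LM {..<n}. zero_ext V f z * (\<Theta> m z * partial k v \<Phi> z))) \<longlonglongrightarrow> - (LINT z|LM {..<n}. zero_ext V f z * partial k v \<Phi> z)"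
    by (intro tendsto_minus cutoff_limit[OF \<Theta>(1-3) f Cc_inf_partial[OF \<Phi>(1) kn k(2)]])
  ultimately show ?thesis using LIMSEQ_unique by auto
qed

lemma orthogonal_ext:
  assumes f: "f \<in> L2 n V" and o: "\<And>\<phi>. \<phi> \<in> test_functions n V \<Longrightarrow> (LINT z|LM {..<n}. zero_ext V f z * \<phi> z) = 0"
    and \<Phi>: "\<Phi> \<in> Cc_inf n" "proj_supp n I V \<Phi>"
  shows "(LINT z|LM {..<n}. zero_ext V f z * \<Phi> z) = 0"
proof -
  obtain \<Theta> where \<Theta>: "\<And>m r. Ck n r (\<Theta> m)" "\<And>m x. cmod (\<Theta> m x) \<le> 1" "\<And>x. x \<in> V \<Longrightarrow> (\<lambda>m. \<Theta> m x) \<longlonglongrightarrow> 1"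
    "\<And>m x k c. k \<in> I \<Longrightarrow> \<Theta> m (x(k := c)) = \<Theta> m x"
    "\<And>m \<Phi>. \<Phi> \<in> Cc_inf n \<Longrightarrow> proj_supp n I V \<Phi> \<Longrightarrow> (\<lambda>x. \<Theta> m x * \<Phi> x) \<in> test_functions n V"
  proof (rule cutoff_sequence[OF open_V I])
    show "(\<lambda>k. if k \<in> I then x k else y k) \<in> V" if "x \<in> V" "y \<in> V" for x y by (rule rect[OF that])
  qed (rule that)
  have "(LINT z|LM {..<n}. zero_ext V f z * (\<Theta> m z * \<Phi> z)) = 0" for m
    by (rule o[OF \<Theta>(5)[OF \<Phi>]])
  then have "(\<lambda>m::nat. 0) \<longlonglongrightarrow> (LINT z|LM {..<n}. zero_ext V f z * \<Phi> z)"
    using cutoff_limit[OF \<Theta>(1-3) f \<Phi>(1)] by simp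
  then show ?thesis by (simp add: LIMSEQ_const_iff)
qed

end

section \<open>Solving the equation on a product of two open sets\<close>

locale product_open = A: rect_open n V R0 I + B: rect_open n V R0 "{..<n} - I"
  for n V R0 I +
  assumes I_ne: "I \<noteq> {}" and J_ne: "{..<n} - I \<noteq> {}"
begin

abbreviation "J \<equiv> {..<n} - I"

lemma weak_zbar:
  assumes R: "rect_open n V R0 H" and f: "f \<in> W1 n V"
    and w: "\<And>v. v \<in> {1, \<i>} \<Longrightarrow> d v \<in> L2 n V" "\<And>v. v \<in> {1, \<i>} \<Longrightarrow> weak_partial n V k v f (d v)"
    and k: "k \<in> H" and \<Phi>: "\<Phi> \<in> Cc_inf n" "proj_supp n H V \<Phi>"
  shows "(LINT z|LM {..<n}. zero_ext V f z * partial_zbar k \<Phi> z) = - (LINT z|LM {..<n}. zero_ext V (\<lambda>z. (1/2) * d 1 z + (\<i>/2) * d \<i> z) z * \<Phi> z)"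
proof -
  interpret H: rect_open n V R0 H by (rule R)
  have fL: "f \<in> L2 n V" using f by (simp add: W1_def)
  have kn: "k < n" using k H.I by auto
  have e1: "zero_ext V f z * partial_zbar k \<Phi> z = (1/2) * (zero_ext V f z * partial k 1 \<Phi> z) + (\<i>/2) * (zero_ext V f z * partial k \<i> \<Phi> z)" for z
    by (simp add: partial_zbar_def field_simps)
  have e2: "zero_ext V (\<lambda>z. (1/2) * d 1 z + (\<i>/2) * d \<i> z) z * \<Phi> z = (1/2) * (zero_ext V (d 1) z * \<Phi> z) + (\<i>/2) * (zero_ext V (d \<i>) z * \<Phi> z)" for z
    by (simp add: zero_ext_def algebra_simps scaleR_conv_of_real)
  have i: "integrable (LM {..<n}) (\<lambda>z. zero_ext V f z * partial k v \<Phi> z)" "integrable (LM {..<n}) (\<lambda>z. zero_ext V (d v) z * \<Phi> z)"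
    if "v \<in> {1, \<i>}" for v
    using A.L2_mult_integrable[OF fL Cc_inf_partial[OF \<Phi>(1) kn that]] A.L2_mult_integrable[OF w(1)[OF that] \<Phi>(1)] by auto
  have v: "1 \<in> {1, \<i>}" "\<i> \<in> {1, \<i>}" by auto
  have p: "(LINT z|LM {..<n}. zero_ext V (d v) z * \<Phi> z) = - (LINT z|LM {..<n}. zero_ext V f z * partial k v \<Phi> z)" if "v \<in> {1, \<i>}" for v
    by (rule H.weak_partial_ext[OF w(2)[OF that] fL w(1)[OF that] k that \<Phi>])
  show ?thesis unfolding e1 e2 using i[OF v(1)] i[OF v(2)] p[OF v(1)] p[OF v(2)] by simp
qed

lemma proj_supp_test:
  assumes "\<phi> \<in> test_functions n V" shows "proj_supp n H V \<phi>"
proof -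
  obtain K where K: "compactin (PT {..<n}) K" "K \<subseteq> V" "\<And>x. x \<in> extensional {..<n} \<Longrightarrow> \<phi> x \<noteq> 0 \<Longrightarrow> x \<in> K"
    using test_compact[OF assms] by metis
  then show ?thesis unfolding proj_supp_def by blast
qed

text \<open>\<open>S i\<close> moves points only in the coordinates of \<open>H\<close>.\<close>

lemma proj_supp_S:
  assumes S: "block_op n H R0 S C" and i: "i \<in> H" and \<phi>: "\<phi> \<in> test_functions n V" and G: "G \<inter> H = {}"
  shows "proj_supp n G V (S i \<phi>)"
proof -
  interpret block_op n H R0 S C by (rule S)
  obtain K where K: "compactin (PT {..<n}) K" "K \<subseteq> V" "\<And>x. x \<in> extensional {..<n} \<Longrightarrow> \<phi> x \<noteq> 0 \<Longrightarrow> x \<in> K"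
    using test_compact[OF \<phi>] by metis
  show ?thesis
    unfolding proj_supp_def
  proof (intro exI[of _ K] conjI ballI impI K(1,2))
    fix x assume x: "x \<in> extensional {..<n}" "S i \<phi> x \<noteq> 0"
    obtain y where y: "y \<in> extensional {..<n}" "\<forall>k\<in>- H. y k = x k" "\<phi> y \<noteq> 0" using S_nonzero[OF i x] by blast
    then have "y \<in> K" using K(3) by blast
    moreover have "\<forall>k\<in>G. x k = y k"
    proof
      fix k assume "k \<in> G"
      then have "k \<in> - H" using G by blast
      then show "x k = y k" using y(2) by simp
    qed
    ultimately show "\<exists>y\<in>K. \<forall>k\<in>G. x k = y k" by blast
  qed
qed

lemma test_slab_supp: "\<phi> \<in> test_functions n V \<Longrightarrow> H \<subseteq> {..<n} \<Longrightarrow> slab_supp n H R0 \<phi>"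
proof -
  assume \<phi>: "\<phi> \<in> test_functions n V" and H: "H \<subseteq> {..<n}"
  obtain K where K: "K \<subseteq> V" "\<And>x. x \<in> extensional {..<n} \<Longrightarrow> \<phi> x \<noteq> 0 \<Longrightarrow> x \<in> K" using test_compact[OF \<phi>] by metis
  then show ?thesis unfolding slab_supp_def using A.V_slab[OF H] by blast
qed

text \<open>The functions \<open>U i j\<close> are defined through the functionals
  \<open>l i j \<phi> = \<integral> f\<^sub>i S\<^sub>j \<phi> - \<integral> f\<^sub>j S\<^sub>i \<phi> + \<integral> g S\<^sub>i S\<^sub>j \<phi>\<close>, where \<open>g\<close> is the divergence of the field in the
  directions of \<open>J\<close> and, as the field is closed, the negative of its divergence in the directions of \<open>I\<close>. Inserting
  \<open>dbar\<^sub>j \<phi>\<close> and summing over \<open>j\<close>, the first term gives \<open>- \<integral> f\<^sub>i \<phi>\<close> and the other two cancel. With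
  \<open>dbar\<^sub>i \<phi>\<close> and a sum over \<open>i\<close>, the second gives \<open>\<integral> f\<^sub>j \<phi>\<close> and the others cancel.\<close>

theorem field_decomposition:
  assumes f: "\<And>k. k < n \<Longrightarrow> f k \<in> W1 n V"
    and closed: "\<And>\<phi>. \<phi> \<in> test_functions n V \<Longrightarrow> (\<Sum>k<n. LINT z:V|Cn_measure n. f k z * partial_zbar k \<phi> z) = 0"
  shows "\<exists>U. \<forall>i\<in>I. \<forall>j\<in>J. U i j \<in> W1 n V \<and>
    (\<forall>\<phi>\<in>test_functions n V.
      (LINT z:V|Cn_measure n. f i z * \<phi> z) = - (\<Sum>j\<in>J. LINT z:V|Cn_measure n. U i j z * partial_zbar j \<phi> z) \<and>
      (LINT z:V|Cn_measure n. f j z * \<phi> z) = (\<Sum>i\<in>I. LINT z:V|Cn_measure n. U i j z * partial_zbar i \<phi> z))"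
proof -
  let ?M = "LM {..<n}"
  define T where "T = test_functions n V"
  have Isub: "I \<subseteq> {..<n}" by (rule A.I)
  have fI: "finite I" and fJ: "finite J" using Isub finite_subset by auto
  have un: "{..<n} = I \<union> J" using Isub by auto
  have RI: "rect_open n V R0 I" and RJ: "rect_open n V R0 J" by unfold_locales
  obtain SI CI where SI: "block_op n I R0 SI CI" using block_op_exists[OF Isub I_ne A.R0] by blast
  obtain SJ CJ where SJ: "block_op n J R0 SJ CJ" using block_op_exists[OF _ J_ne A.R0] by blast
  interpret SI: block_op n I R0 SI CI by (rule SI)
  interpret SJ: block_op n J R0 SJ CJ by (rule SJ)
  have fL: "f k \<in> L2 n V" if "k < n" for k using f[OF that] by (simp add: W1_def)
  have "\<exists>g\<in>L2 n V. weak_partial n V k v (f m) g" if "m < n" "k < n" "v \<in> {1, \<i>}" for m k v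
    using f[OF that(1)] that(2,3) unfolding W1_def by blast
  then obtain d where d: "\<And>m k v. m < n \<Longrightarrow> k < n \<Longrightarrow> v \<in> {1, \<i>} \<Longrightarrow> d m k v \<in> L2 n V \<and> weak_partial n V k v (f m) (d m k v)"
    by metis
  define db where "db k = (\<lambda>z. (1/2) * d k k 1 z + (\<i>/2) * d k k \<i> z)" for k
  have dbL: "db k \<in> L2 n V" if "k < n" for k unfolding db_def using d[OF that that] by (intro A.L2_lin) auto
  have dbw: "(LINT z|?M. zero_ext V (f k) z * partial_zbar k \<Phi> z) = - (LINT z|?M. zero_ext V (db k) z * \<Phi> z)"
    if "rect_open n V R0 H" "k \<in> H" "\<Phi> \<in> Cc_inf n" "proj_supp n H V \<Phi>" for H k \<Phi>
  proof -
    have kn: "k < n" using rect_open.I[OF that(1)] that(2) by auto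
    show ?thesis unfolding db_def using d[OF kn kn] by (intro weak_zbar[OF that(1) f[OF kn] _ _ that(2-4)]) auto
  qed
  define g where "g = (\<lambda>z. \<Sum>j\<in>J. db j z)"
  have gL: "g \<in> L2 n V" unfolding g_def using fJ dbL by (intro A.L2_sum) auto
  have sumL: "(LINT z|?M. zero_ext V (\<lambda>z. \<Sum>k\<in>H. db k z) z * \<Phi> z) = (\<Sum>k\<in>H. LINT z|?M. zero_ext V (db k) z * \<Phi> z)"
    if "H \<subseteq> {..<n}" "\<Phi> \<in> Cc_inf n" for H \<Phi>
  proof -
    have "zero_ext V (\<lambda>z. \<Sum>k\<in>H. db k z) z * \<Phi> z = (\<Sum>k\<in>H. zero_ext V (db k) z * \<Phi> z)" for z
      by (simp add: zero_ext_def scaleR_sum_right sum_distrib_right)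
    moreover have "integrable ?M (\<lambda>z. zero_ext V (db k) z * \<Phi> z)" if "k \<in> H" for k
      using that \<open>H \<subseteq> {..<n}\<close> \<open>\<Phi> \<in> Cc_inf n\<close> by (intro A.L2_mult_integrable dbL) auto
    ultimately show ?thesis by simp
  qed
  have gJ: "(\<Sum>j\<in>J. LINT z|?M. zero_ext V (f j) z * partial_zbar j \<Phi> z) = - (LINT z|?M. zero_ext V g z * \<Phi> z)"
    if "\<Phi> \<in> Cc_inf n" "proj_supp n J V \<Phi>" for \<Phi>
    using dbw[OF RJ _ that] sumL[OF _ that(1), of J] by (simp add: g_def sum_negf)
  \<comment> \<open>As the field is closed, \<open>g\<close> plus the divergence in the directions of \<open>I\<close> is orthogonal to the test
    functions. By \<open>orthogonal_ext\<close> it is so to all functions that occur here.\<close>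
  have gI: "(\<Sum>i\<in>I. LINT z|?M. zero_ext V (f i) z * partial_zbar i \<Phi> z) = (LINT z|?M. zero_ext V g z * \<Phi> z)"
    if \<Phi>: "\<Phi> \<in> Cc_inf n" "proj_supp n I V \<Phi>" for \<Phi>
  proof -
    define h where "h = (\<lambda>z. 1 * g z + 1 * (\<Sum>i\<in>I. db i z))"
    have hL: "h \<in> L2 n V" unfolding h_def using gL fI dbL Isub by (intro A.L2_lin A.L2_sum) auto
    have split: "(LINT z|?M. zero_ext V h z * \<Psi> z) = (LINT z|?M. zero_ext V g z * \<Psi> z) + (\<Sum>i\<in>I. LINT z|?M. zero_ext V (db i) z * \<Psi> z)"
      if \<Psi>: "\<Psi> \<in> Cc_inf n" for \<Psi>
    proof -
      have sL: "(\<lambda>z. \<Sum>i\<in>I. db i z) \<in> L2 n V" using fI dbL Isub by (intro A.L2_sum) auto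
      have "zero_ext V h z * \<Psi> z = zero_ext V g z * \<Psi> z + zero_ext V (\<lambda>z. \<Sum>i\<in>I. db i z) z * \<Psi> z" for z
        by (simp add: zero_ext_def h_def algebra_simps)
      then show ?thesis
        using A.L2_mult_integrable[OF gL \<Psi>] A.L2_mult_integrable[OF sL \<Psi>] sumL[OF Isub \<Psi>] by simp
    qed
    have "(LINT z|?M. zero_ext V h z * \<phi> z) = 0" if \<phi>: "\<phi> \<in> test_functions n V" for \<phi>
    proof -
      have D: "\<phi> \<in> Cc_inf n" by (rule test_Cc_inf[OF \<phi>])
      have "(\<Sum>k\<in>I \<union> J. LINT z|?M. zero_ext V (f k) z * partial_zbar k \<phi> z) = 0"
        using closed[OF \<phi>] unfolding A.set_int un[symmetric] .
      then have "(\<Sum>i\<in>I. LINT z|?M. zero_ext V (f i) z * partial_zbar i \<phi> z) + (\<Sum>j\<in>J. LINT z|?M. zero_ext V (f j) z * partial_zbar j \<phi> z) = 0"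
        using fI fJ by (subst (asm) sum.union_disjoint) auto
      moreover have "(\<Sum>i\<in>I. LINT z|?M. zero_ext V (f i) z * partial_zbar i \<phi> z) = - (\<Sum>i\<in>I. LINT z|?M. zero_ext V (db i) z * \<phi> z)"
        using dbw[OF RI _ D proj_supp_test[OF \<phi>]] by (simp add: sum_negf)
      ultimately have "- (\<Sum>i\<in>I. LINT z|?M. zero_ext V (db i) z * \<phi> z) + - (LINT z|?M. zero_ext V g z * \<phi> z) = 0"
        by (simp only: gJ[OF D proj_supp_test[OF \<phi>]])
      then show ?thesis unfolding split[OF D] add_eq_0_iff by simp
    qed
    then have "(LINT z|?M. zero_ext V h z * \<Phi> z) = 0" by (rule A.orthogonal_ext[OF hL _ \<Phi>])
    then have "(LINT z|?M. zero_ext V g z * \<Phi> z) = - (\<Sum>i\<in>I. LINT z|?M. zero_ext V (db i) z * \<Phi> z)"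
      unfolding split[OF \<Phi>(1)] by (simp add: eq_neg_iff_add_eq_0)
    then show ?thesis using dbw[OF RI _ \<Phi>] by (simp add: sum_negf)
  qed
  define pr where "pr h \<psi> = (LINT z|?M. zero_ext V h z * \<psi> z)" for h \<psi> :: "(nat \<Rightarrow> complex) \<Rightarrow> complex"
  have pr_lin: "pr h (\<lambda>x. a * \<phi> x + b * \<psi> x) = a * pr h \<phi> + b * pr h \<psi>" if "h \<in> L2 n V" "\<phi> \<in> Cc_inf n" "\<psi> \<in> Cc_inf n" for h \<phi> \<psi> a b
  proof -
    have "zero_ext V h z * (a * \<phi> z + b * \<psi> z) = a * (zero_ext V h z * \<phi> z) + b * (zero_ext V h z * \<psi> z)" for z by (simp add: algebra_simps)
    then show ?thesis unfolding pr_def using A.L2_mult_integrable[OF that(1,2)] A.L2_mult_integrable[OF that(1,3)] by simp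
  qed
  have pr_neg: "pr h (\<lambda>x. - \<psi> x) = - pr h \<psi>" for h \<psi> unfolding pr_def by simp
  have pr_cong: "pr h \<phi> = pr h \<psi>" if "\<And>x. x \<in> V \<Longrightarrow> \<phi> x = \<psi> x" for h \<phi> \<psi>
    unfolding pr_def by (rule Bochner_Integration.integral_cong[OF refl]) (auto simp: zero_ext_def indicator_def that)
  have pr_sum: "pr h (\<lambda>x. \<Sum>j\<in>H. \<psi> j x) = (\<Sum>j\<in>H. pr h (\<psi> j))" if "h \<in> L2 n V" "\<And>j. j \<in> H \<Longrightarrow> \<psi> j \<in> Cc_inf n" for h H and \<psi> :: "nat \<Rightarrow> _"
    unfolding pr_def sum_distrib_left using A.L2_mult_integrable[OF that(1) that(2)] by simp
  have pr_bound: "cmod (pr h \<psi>) \<le> (LINT z|?M. (cmod (zero_ext V h z))\<^sup>2) + (LINT z|?M. indicator (slab n H R0) z * (cmod (\<psi> z))\<^sup>2)"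
    if "h \<in> L2 n V" "\<psi> \<in> Cc_inf n" "H \<subseteq> {..<n}" for h \<psi> H
    unfolding pr_def by (rule A.L2_pairing[OF that(1,2) slab_sets[OF that(3)] A.V_slab[OF that(3)]])
  have slab_le: "(LINT z|?M. indicator (slab n H R0) z * (cmod (\<psi> z))\<^sup>2) \<le> sq_norm n \<psi>" if "\<psi> \<in> Cc_inf n" for H \<psi>
    unfolding sq_norm_def by (rule integral_mono'[OF Cc_inf_sq_integrable[OF that]]) (auto simp: indicator_def)
  have Vx: "x \<in> extensional {..<n}" if "x \<in> V" for x using A.V_ext that by auto
  define l where "l i j \<phi> = pr (f i) (SJ j \<phi>) - pr (f j) (SI i \<phi>) + pr g (SI i (SJ j \<phi>))" for i j \<phi>
  have main: "\<exists>u\<in>W1 n V. \<forall>\<phi>\<in>T. (LINT z:V|Cn_measure n. u z * \<phi> z) = l i j \<phi>" if i: "i \<in> I" and j: "j \<in> J" for i j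
  proof -
    have n: "i < n" "j < n" using i j Isub by auto
    note SID = SI.S_Cc_inf[OF i] and SJD = SJ.S_Cc_inf[OF j]
    have l_lin: "l i j (\<lambda>x. a * \<phi> x + b * \<psi> x) = a * l i j \<phi> + b * l i j \<psi>" if D: "\<phi> \<in> Cc_inf n" "\<psi> \<in> Cc_inf n" for a b \<phi> \<psi>
    proof -
      have 1: "pr (f i) (SJ j (\<lambda>x. a * \<phi> x + b * \<psi> x)) = a * pr (f i) (SJ j \<phi>) + b * pr (f i) (SJ j \<psi>)"
        unfolding pr_lin[OF fL[OF n(1)] SJD[OF D(1)] SJD[OF D(2)], symmetric]
        by (rule pr_cong) (rule SJ.S_lin[OF j D Vx])
      have 2: "pr (f j) (SI i (\<lambda>x. a * \<phi> x + b * \<psi> x)) = a * pr (f j) (SI i \<phi>) + b * pr (f j) (SI i \<psi>)"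
        unfolding pr_lin[OF fL[OF n(2)] SID[OF D(1)] SID[OF D(2)], symmetric]
        by (rule pr_cong) (rule SI.S_lin[OF i D Vx])
      have 3: "pr g (SI i (SJ j (\<lambda>x. a * \<phi> x + b * \<psi> x))) = a * pr g (SI i (SJ j \<phi>)) + b * pr g (SI i (SJ j \<psi>))"
        unfolding pr_lin[OF gL SID[OF SJD[OF D(1)]] SID[OF SJD[OF D(2)]], symmetric]
      proof (rule pr_cong)
        fix x assume x: "x \<in> V"
        have "SI i (SJ j (\<lambda>x. a * \<phi> x + b * \<psi> x)) x = SI i (\<lambda>x. a * SJ j \<phi> x + b * SJ j \<psi> x) x"
          by (rule SI.S_local[OF i Vx[OF x]]) (rule SJ.S_lin[OF j D])
        also have "\<dots> = a * SI i (SJ j \<phi>) x + b * SI i (SJ j \<psi>) x"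
          by (rule SI.S_lin[OF i SJD[OF D(1)] SJD[OF D(2)] Vx[OF x]])
        finally show "SI i (SJ j (\<lambda>x. a * \<phi> x + b * \<psi> x)) x = a * SI i (SJ j \<phi>) x + b * SI i (SJ j \<psi>) x" .
      qed
      show ?thesis unfolding l_def 1 2 3 by (simp add: algebra_simps)
    qed
    have l_cong: "l i j \<phi> = l i j \<psi>" if eq: "\<And>x. x \<in> extensional {..<n} \<Longrightarrow> \<phi> x = \<psi> x" for \<phi> \<psi>
    proof -
      have 1: "SJ j \<phi> x = SJ j \<psi> x" "SI i \<phi> x = SI i \<psi> x" if "x \<in> extensional {..<n}" for x
        by (rule SJ.S_local[OF j that], rule eq, assumption, rule SI.S_local[OF i that], rule eq)
      have "SI i (SJ j \<phi>) x = SI i (SJ j \<psi>) x" if "x \<in> extensional {..<n}" for x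
        by (rule SI.S_local[OF i that]) (rule 1(1))
      then have "pr g (SI i (SJ j \<phi>)) = pr g (SI i (SJ j \<psi>))" using Vx by (intro pr_cong) blast
      moreover have "pr (f i) (SJ j \<phi>) = pr (f i) (SJ j \<psi>)" by (rule pr_cong) (rule 1(1)[OF Vx])
      moreover have "pr (f j) (SI i \<phi>) = pr (f j) (SI i \<psi>)" by (rule pr_cong) (rule 1(2)[OF Vx])
      ultimately show ?thesis unfolding l_def by simp
    qed
    define Hb where "Hb h = (LINT z|?M. (cmod (zero_ext V h z))\<^sup>2)" for h
    have Hb0: "Hb h \<ge> 0" for h by (simp add: Hb_def)
    have b0: "cmod (pr h \<psi>) \<le> Hb h + sq_norm n \<psi>" if "h \<in> L2 n V" "\<psi> \<in> Cc_inf n" for h \<psi>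
      using pr_bound[OF that, of "{}"] slab_le[OF that(2), of "{}"] unfolding Hb_def by simp
    note CI = SI.C and CJ = SJ.C
    define Ct where "Ct = CI + CJ + CI * CJ"
    have Ct: "CI \<le> Ct" "CJ \<le> Ct" "CI * CJ \<le> Ct" "Ct \<ge> 0" using CI CJ by (auto simp: Ct_def)
    have scale: "c * sq_norm n \<phi> \<le> Ct * sq_norm n \<phi>" if "c \<le> Ct" for c \<phi> using that sq_norm_nonneg by (rule mult_right_mono)
    have comb: "\<exists>K\<ge>0. \<forall>\<phi>\<in>T. cmod (L \<phi>) \<le> K * (1 + sq_norm n \<phi>)"
      if L: "\<And>\<phi>. \<phi> \<in> T \<Longrightarrow> L \<phi> = a \<phi> - b \<phi> + c \<phi>" and H: "H1 \<ge> 0" "H2 \<ge> 0" "H3 \<ge> 0"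
        and bd: "\<And>\<phi>. \<phi> \<in> T \<Longrightarrow> cmod (a \<phi>) \<le> H1 + Ct * sq_norm n \<phi>" "\<And>\<phi>. \<phi> \<in> T \<Longrightarrow> cmod (b \<phi>) \<le> H2 + Ct * sq_norm n \<phi>"
          "\<And>\<phi>. \<phi> \<in> T \<Longrightarrow> cmod (c \<phi>) \<le> H3 + Ct * sq_norm n \<phi>" for L a b c and H1 H2 H3 :: real
    proof (intro exI[of _ "H1 + H2 + H3 + 3 * Ct"] conjI ballI)
      show "0 \<le> H1 + H2 + H3 + 3 * Ct" using H Ct by simp
      fix \<phi> assume \<phi>: "\<phi> \<in> T"
      have "cmod (L \<phi>) \<le> cmod (a \<phi>) + cmod (b \<phi>) + cmod (c \<phi>)"
        unfolding L[OF \<phi>] using norm_triangle_ineq[of "a \<phi> - b \<phi>" "c \<phi>"] norm_triangle_ineq4[of "a \<phi>" "b \<phi>"] by linarith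
      also have "\<dots> \<le> (H1 + H2 + H3) + 3 * Ct * sq_norm n \<phi>" using bd[OF \<phi>] by simp
      also have "\<dots> \<le> (H1 + H2 + H3 + 3 * Ct) * (1 + sq_norm n \<phi>)"
        using H Ct sq_norm_nonneg[of n \<phi>] by (simp add: algebra_simps)
      finally show "cmod (L \<phi>) \<le> (H1 + H2 + H3 + 3 * Ct) * (1 + sq_norm n \<phi>)" .
    qed
    have TD: "\<phi> \<in> Cc_inf n" if "\<phi> \<in> T" for \<phi> using that unfolding T_def by (rule test_Cc_inf)
    have cross: "sq_norm n (SI i (SJ j \<phi>)) \<le> Ct * sq_norm n \<phi>" if D: "\<phi> \<in> Cc_inf n" for \<phi>
    proof -
      have "sq_norm n (SI i (SJ j \<phi>)) \<le> CI * sq_norm n (SJ j \<phi>)" by (rule SI.S_sq_norm[OF i SJD[OF D]])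
      also have "\<dots> \<le> CI * (CJ * sq_norm n \<phi>)" by (intro mult_left_mono SJ.S_sq_norm[OF j D] CI)
      finally show ?thesis using scale[OF Ct(3), of \<phi>] by (simp add: mult.assoc)
    qed
    have bound: "\<exists>K\<ge>0. \<forall>\<phi>\<in>T. cmod (l i j \<phi>) \<le> K * (1 + sq_norm n \<phi>)"
    proof (rule comb[where a = "\<lambda>\<phi>. pr (f i) (SJ j \<phi>)" and b = "\<lambda>\<phi>. pr (f j) (SI i \<phi>)" and c = "\<lambda>\<phi>. pr g (SI i (SJ j \<phi>))"])
      fix \<phi> assume \<phi>: "\<phi> \<in> T"
      note D = TD[OF \<phi>]
      show "l i j \<phi> = pr (f i) (SJ j \<phi>) - pr (f j) (SI i \<phi>) + pr g (SI i (SJ j \<phi>))" by (rule l_def)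
      show "cmod (pr (f i) (SJ j \<phi>)) \<le> Hb (f i) + Ct * sq_norm n \<phi>"
        using b0[OF fL[OF n(1)] SJD[OF D]] SJ.S_sq_norm[OF j D] scale[OF Ct(2), of \<phi>] by linarith
      show "cmod (pr (f j) (SI i \<phi>)) \<le> Hb (f j) + Ct * sq_norm n \<phi>"
        using b0[OF fL[OF n(2)] SID[OF D]] SI.S_sq_norm[OF i D] scale[OF Ct(1), of \<phi>] by linarith
      show "cmod (pr g (SI i (SJ j \<phi>))) \<le> Hb g + Ct * sq_norm n \<phi>"
        using b0[OF gL SID[OF SJD[OF D]]] cross[OF D] by linarith
    qed (rule Hb0)+
    \<comment> \<open>A derivative in the variables of one block: the term in which the operator of that block is absent hands
      it to the field by \<open>weak_partial_ext\<close>, the others use \<open>S_gain\<close>.\<close>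
    have dbound: "\<exists>K\<ge>0. \<forall>\<phi>\<in>T. cmod (l i j (partial k v \<phi>)) \<le> K * (1 + sq_norm n \<phi>)" if k: "k < n" and v: "v \<in> {1, \<i>}" for k v
    proof (cases "k \<in> I")
      case kI: True
      show ?thesis
      proof (rule comb[where a = "\<lambda>\<phi>. - pr (d i k v) (SJ j \<phi>)" and b = "\<lambda>\<phi>. pr (f j) (SI i (partial k v \<phi>))" and c = "\<lambda>\<phi>. pr g (SI i (partial k v (SJ j \<phi>)))"])
        fix \<phi> assume \<phi>: "\<phi> \<in> T"
        note D = TD[OF \<phi>]
        have \<phi>t: "\<phi> \<in> test_functions n V" using \<phi> by (simp add: T_def)
        have ps: "proj_supp n I V (SJ j \<phi>)" by (rule proj_supp_S[OF SJ j \<phi>t]) auto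
        have e1: "pr (f i) (SJ j (partial k v \<phi>)) = pr (f i) (partial k v (SJ j \<phi>))"
          by (rule pr_cong) (rule SJ.S_partial[OF j D k v Vx, symmetric])
        have e2: "pr (f i) (partial k v (SJ j \<phi>)) = - pr (d i k v) (SJ j \<phi>)"
          using A.weak_partial_ext[OF _ fL[OF n(1)] _ kI v SJD[OF D] ps, of "d i k v"] d[OF n(1) k v] by (simp add: pr_def)
        have e3: "pr g (SI i (SJ j (partial k v \<phi>))) = pr g (SI i (partial k v (SJ j \<phi>)))"
          by (rule pr_cong, rule SI.S_local[OF i Vx]) (auto intro: SJ.S_partial[OF j D k v, symmetric])
        show "l i j (partial k v \<phi>) = - pr (d i k v) (SJ j \<phi>) - pr (f j) (SI i (partial k v \<phi>)) + pr g (SI i (partial k v (SJ j \<phi>)))"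
          unfolding l_def e1 e2 e3 ..
        show "cmod (- pr (d i k v) (SJ j \<phi>)) \<le> Hb (d i k v) + Ct * sq_norm n \<phi>"
          using b0[OF _ SJD[OF D], of "d i k v"] d[OF n(1) k v] SJ.S_sq_norm[OF j D] scale[OF Ct(2), of \<phi>] by simp
        have gain: "(LINT x|?M. indicator (slab n I R0) x * (cmod (SI i (partial k v \<psi>) x))\<^sup>2) \<le> CI * sq_norm n \<psi>"
          if "\<psi> \<in> Cc_inf n" "slab_supp n I R0 \<psi>" for \<psi> by (rule SI.S_gain[OF i that kI v])
        have "cmod (pr (f j) (SI i (partial k v \<phi>))) \<le> Hb (f j) + CI * sq_norm n \<phi>"
          using pr_bound[OF fL[OF n(2)] SID[OF Cc_inf_partial[OF D k v]] Isub] gain[OF D test_slab_supp[OF \<phi>t Isub]] unfolding Hb_def by linarith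
        then show "cmod (pr (f j) (SI i (partial k v \<phi>))) \<le> Hb (f j) + Ct * sq_norm n \<phi>" using scale[OF Ct(1), of \<phi>] by linarith
        have sJ: "slab_supp n I R0 (SJ j \<phi>)" by (rule SJ.S_slab_supp[OF j _ test_slab_supp[OF \<phi>t Isub]]) auto
        have "cmod (pr g (SI i (partial k v (SJ j \<phi>)))) \<le> Hb g + CI * sq_norm n (SJ j \<phi>)"
          using pr_bound[OF gL SID[OF Cc_inf_partial[OF SJD[OF D] k v]] Isub] gain[OF SJD[OF D] sJ] unfolding Hb_def by linarith
        moreover have "CI * sq_norm n (SJ j \<phi>) \<le> CI * (CJ * sq_norm n \<phi>)" by (intro mult_left_mono SJ.S_sq_norm[OF j D] CI)
        ultimately show "cmod (pr g (SI i (partial k v (SJ j \<phi>)))) \<le> Hb g + Ct * sq_norm n \<phi>"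
          using scale[OF Ct(3), of \<phi>] by (simp add: mult.assoc)
      qed (rule Hb0)+
    next
      case False
      then have kJ: "k \<in> J" using k by simp
      show ?thesis
      proof (rule comb[where a = "\<lambda>\<phi>. pr (f i) (SJ j (partial k v \<phi>))" and b = "\<lambda>\<phi>. - pr (d j k v) (SI i \<phi>)" and c = "\<lambda>\<phi>. pr g (SI i (SJ j (partial k v \<phi>)))"])
        fix \<phi> assume \<phi>: "\<phi> \<in> T"
        note D = TD[OF \<phi>]
        have \<phi>t: "\<phi> \<in> test_functions n V" using \<phi> by (simp add: T_def)
        have ps: "proj_supp n J V (SI i \<phi>)" by (rule proj_supp_S[OF SI i \<phi>t]) auto
        have e1: "pr (f j) (SI i (partial k v \<phi>)) = pr (f j) (partial k v (SI i \<phi>))"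
          by (rule pr_cong) (rule SI.S_partial[OF i D k v Vx, symmetric])
        have e2: "pr (f j) (partial k v (SI i \<phi>)) = - pr (d j k v) (SI i \<phi>)"
          using B.weak_partial_ext[OF _ fL[OF n(2)] _ kJ v SID[OF D] ps, of "d j k v"] d[OF n(2) k v] by (simp add: pr_def)
        show "l i j (partial k v \<phi>) = pr (f i) (SJ j (partial k v \<phi>)) - - pr (d j k v) (SI i \<phi>) + pr g (SI i (SJ j (partial k v \<phi>)))"
          unfolding l_def e1 e2 ..
        show "cmod (- pr (d j k v) (SI i \<phi>)) \<le> Hb (d j k v) + Ct * sq_norm n \<phi>"
          using b0[OF _ SID[OF D], of "d j k v"] d[OF n(2) k v] SI.S_sq_norm[OF i D] scale[OF Ct(1), of \<phi>] by simp
        have Jsub: "J \<subseteq> {..<n}" by auto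
        have gain: "(LINT x|?M. indicator (slab n J R0) x * (cmod (SJ j (partial k v \<phi>) x))\<^sup>2) \<le> CJ * sq_norm n \<phi>"
          by (rule SJ.S_gain[OF j D test_slab_supp[OF \<phi>t Jsub] kJ v])
        have "cmod (pr (f i) (SJ j (partial k v \<phi>))) \<le> Hb (f i) + CJ * sq_norm n \<phi>"
          using pr_bound[OF fL[OF n(1)] SJD[OF Cc_inf_partial[OF D k v]] Jsub] gain unfolding Hb_def by linarith
        then show "cmod (pr (f i) (SJ j (partial k v \<phi>))) \<le> Hb (f i) + Ct * sq_norm n \<phi>" using scale[OF Ct(2), of \<phi>] by linarith
        have "cmod (pr g (SI i (SJ j (partial k v \<phi>)))) \<le> Hb g + (LINT z|?M. indicator (slab n J R0) z * (cmod (SI i (SJ j (partial k v \<phi>)) z))\<^sup>2)"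
          using pr_bound[OF gL SID[OF SJD[OF Cc_inf_partial[OF D k v]]] Jsub] unfolding Hb_def .
        also have "\<dots> \<le> Hb g + CI * (LINT z|?M. indicator (slab n J R0) z * (cmod (SJ j (partial k v \<phi>) z))\<^sup>2)"
          by (intro add_left_mono SI.S_L2[OF i SJD[OF Cc_inf_partial[OF D k v]]]) auto
        also have "\<dots> \<le> Hb g + CI * (CJ * sq_norm n \<phi>)" by (intro add_left_mono mult_left_mono gain CI)
        also have "\<dots> \<le> Hb g + Ct * sq_norm n \<phi>" using scale[OF Ct(3), of \<phi>] by (simp add: mult.assoc)
        finally show "cmod (pr g (SI i (SJ j (partial k v \<phi>)))) \<le> Hb g + Ct * sq_norm n \<phi>" .
      qed (rule Hb0)+
    qed
    obtain K where K: "K \<ge> 0" "\<And>\<phi>. \<phi> \<in> T \<Longrightarrow> cmod (l i j \<phi>) \<le> K * (1 + sq_norm n \<phi>)" using bound by blast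
    have "\<exists>u\<in>L2 n V. \<forall>\<phi>\<in>test_functions n V. (LINT z:V|Cn_measure n. u z * \<phi> z) = l i j \<phi>"
    proof (rule A.L2_represent[OF _ _ K(1)])
      show "l i j (\<lambda>x. \<phi> x + \<psi> x) = l i j \<phi> + l i j \<psi>" if "\<phi> \<in> test_functions n V" "\<psi> \<in> test_functions n V" for \<phi> \<psi>
        using l_lin[OF test_Cc_inf[OF that(1)] test_Cc_inf[OF that(2)], of 1 1] by simp
      show "l i j (\<lambda>x. c * \<phi> x) = c * l i j \<phi>" if "\<phi> \<in> test_functions n V" for c \<phi>
        using l_lin[OF test_Cc_inf[OF that] test_Cc_inf[OF that], of c 0] by simp
    qed (use K(2) in \<open>simp add: T_def\<close>)
    then obtain u where u: "u \<in> L2 n V" "\<And>\<phi>. \<phi> \<in> test_functions n V \<Longrightarrow> (LINT z:V|Cn_measure n. u z * \<phi> z) = l i j \<phi>" by blast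
    have "\<exists>w\<in>L2 n V. weak_partial n V k v u w" if k: "k < n" and v: "v \<in> {1, \<i>}" for k v
    proof -
      obtain K where K: "K \<ge> 0" "\<And>\<phi>. \<phi> \<in> T \<Longrightarrow> cmod (l i j (partial k v \<phi>)) \<le> K * (1 + sq_norm n \<phi>)" using dbound[OF k v] by blast
      have pl: "l i j (partial k v (\<lambda>x. a * \<phi> x + b * \<psi> x)) = a * l i j (partial k v \<phi>) + b * l i j (partial k v \<psi>)"
        if D: "\<phi> \<in> Cc_inf n" "\<psi> \<in> Cc_inf n" for a b \<phi> \<psi>
      proof -
        have c: "Ck n (Suc 0) (\<lambda>x. a * \<phi> x)" "Ck n (Suc 0) (\<lambda>x. b * \<psi> x)" by (intro Ck_mult Ck_const Cc_inf_Ck[OF D(1)] Cc_inf_Ck[OF D(2)])+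
        have "l i j (partial k v (\<lambda>x. a * \<phi> x + b * \<psi> x)) = l i j (\<lambda>x. a * partial k v \<phi> x + b * partial k v \<psi> x)"
          by (rule l_cong) (simp add: partial_add[OF c k v] partial_cmult[OF Cc_inf_Ck[OF D(1)] k v] partial_cmult[OF Cc_inf_Ck[OF D(2)] k v])
        then show ?thesis using l_lin[OF Cc_inf_partial[OF D(1) k v] Cc_inf_partial[OF D(2) k v]] by simp
      qed
      have "\<exists>w\<in>L2 n V. \<forall>\<phi>\<in>test_functions n V. (LINT z:V|Cn_measure n. w z * \<phi> z) = - l i j (partial k v \<phi>)"
      proof (rule A.L2_represent[OF _ _ K(1)])
        show "- l i j (partial k v (\<lambda>x. \<phi> x + \<psi> x)) = - l i j (partial k v \<phi>) + - l i j (partial k v \<psi>)" if "\<phi> \<in> test_functions n V" "\<psi> \<in> test_functions n V" for \<phi> \<psi>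
          using pl[OF test_Cc_inf[OF that(1)] test_Cc_inf[OF that(2)], of 1 1] by simp
        show "- l i j (partial k v (\<lambda>x. c * \<phi> x)) = c * - l i j (partial k v \<phi>)" if "\<phi> \<in> test_functions n V" for c \<phi>
          using pl[OF test_Cc_inf[OF that] test_Cc_inf[OF that], of c 0] by simp
      qed (use K(2) in \<open>simp add: T_def\<close>)
      then obtain w where w: "w \<in> L2 n V" "\<And>\<phi>. \<phi> \<in> test_functions n V \<Longrightarrow> (LINT z:V|Cn_measure n. w z * \<phi> z) = - l i j (partial k v \<phi>)" by blast
      have "weak_partial n V k v u w"
        unfolding weak_partial_def using w(2) u(2)[OF test_partial[OF _ k v]] by simp
      then show ?thesis using w(1) by blast
    qed
    then have "u \<in> W1 n V" using u(1) unfolding W1_def by blast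
    then show ?thesis using u(2) unfolding T_def by blast
  qed
  then obtain U where U: "\<And>i j. i \<in> I \<Longrightarrow> j \<in> J \<Longrightarrow> U i j \<in> W1 n V"
    "\<And>i j \<phi>. i \<in> I \<Longrightarrow> j \<in> J \<Longrightarrow> \<phi> \<in> test_functions n V \<Longrightarrow> (LINT z:V|Cn_measure n. U i j z * \<phi> z) = l i j \<phi>"
    unfolding T_def by metis
  have id1: "pr (f i) \<phi> = - (\<Sum>j\<in>J. l i j (partial_zbar j \<phi>))" if i: "i \<in> I" and \<phi>: "\<phi> \<in> test_functions n V" for i \<phi>
  proof -
    have n: "i < n" using i Isub by auto
    have D: "\<phi> \<in> Cc_inf n" by (rule test_Cc_inf[OF \<phi>])
    have zD: "partial_zbar j \<phi> \<in> Cc_inf n" if "j \<in> J" for j using Cc_inf_partial_z(2)[OF D] that by auto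
    have Jsub: "J \<subseteq> {..<n}" by auto
    have div: "(\<Sum>j\<in>J. SJ j (partial_zbar j \<phi>) x) = - \<phi> x" if "x \<in> slab n J R0" for x
      by (rule SJ.S_div[OF D test_slab_supp[OF \<phi> Jsub] that])
    \<comment> \<open>\<open>1\<close> is \<open>S_div\<close> for \<open>J\<close>; in \<open>2\<close> the operator \<open>S\<^sub>i\<close> commutes with \<open>dbar\<^sub>j\<close> and the sum is \<open>g\<close>; \<open>3\<close> is \<open>S_div\<close>
      inside \<open>S\<^sub>i\<close>.\<close>
    have 1: "(\<Sum>j\<in>J. pr (f i) (SJ j (partial_zbar j \<phi>))) = - pr (f i) \<phi>"
    proof -
      have "(\<Sum>j\<in>J. pr (f i) (SJ j (partial_zbar j \<phi>))) = pr (f i) (\<lambda>x. \<Sum>j\<in>J. SJ j (partial_zbar j \<phi>) x)"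
        by (rule pr_sum[symmetric, OF fL[OF n]]) (rule SJ.S_Cc_inf[OF _ zD])
      also have "\<dots> = pr (f i) (\<lambda>x. - \<phi> x)" by (rule pr_cong, rule div) (use A.V_slab[OF Jsub] in blast)
      finally show ?thesis by (simp add: pr_neg)
    qed
    have ps: "proj_supp n J V (SI i \<phi>)" by (rule proj_supp_S[OF SI i \<phi>]) auto
    have 2: "(\<Sum>j\<in>J. pr (f j) (SI i (partial_zbar j \<phi>))) = - pr g (SI i \<phi>)"
    proof -
      have "pr (f j) (SI i (partial_zbar j \<phi>)) = pr (f j) (partial_zbar j (SI i \<phi>))" if "j \<in> J" for j
        by (rule pr_cong) (rule SI.S_zbar[OF i D _ Vx, symmetric], use that in auto)
      then show ?thesis using gJ[OF SI.S_Cc_inf[OF i D] ps] unfolding pr_def by simp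
    qed
    have 3: "(\<Sum>j\<in>J. pr g (SI i (SJ j (partial_zbar j \<phi>)))) = - pr g (SI i \<phi>)"
    proof -
      have "(\<Sum>j\<in>J. pr g (SI i (SJ j (partial_zbar j \<phi>)))) = pr g (\<lambda>x. \<Sum>j\<in>J. SI i (SJ j (partial_zbar j \<phi>)) x)"
        by (rule pr_sum[symmetric, OF gL]) (rule SI.S_Cc_inf[OF i SJ.S_Cc_inf[OF _ zD]])
      also have "\<dots> = pr g (\<lambda>x. - SI i \<phi> x)"
      proof (rule pr_cong)
        fix x assume x: "x \<in> V"
        have "(\<Sum>j\<in>J. SI i (SJ j (partial_zbar j \<phi>)) x) = SI i (\<lambda>x. \<Sum>j\<in>J. SJ j (partial_zbar j \<phi>) x) x"
          by (rule SI.S_sum[symmetric, OF i _ Vx[OF x]]) (rule SJ.S_Cc_inf[OF _ zD])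
        also have "\<dots> = SI i (\<lambda>x. - \<phi> x) x"
        proof (rule SI.S_local[OF i Vx[OF x]])
          fix y assume y: "y \<in> extensional {..<n}" "\<forall>k\<in>- I. y k = x k"
          have "x \<in> slab n J R0" using A.V_slab[OF Jsub] x by blast
          then have "y \<in> slab n J R0" using y by (auto simp: slab_def)
          then show "(\<Sum>j\<in>J. SJ j (partial_zbar j \<phi>) y) = - \<phi> y" by (rule div)
        qed
        also have "\<dots> = - SI i \<phi> x" by (rule SI.S_neg[OF i D Vx[OF x]])
        finally show "(\<Sum>j\<in>J. SI i (SJ j (partial_zbar j \<phi>)) x) = - SI i \<phi> x" .
      qed
      finally show ?thesis by (simp add: pr_neg)
    qed
    show ?thesis unfolding l_def sum.distrib sum_subtractf 1 2 3 by simp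
  qed
  have id2: "pr (f j) \<phi> = (\<Sum>i\<in>I. l i j (partial_zbar i \<phi>))" if j: "j \<in> J" and \<phi>: "\<phi> \<in> test_functions n V" for j \<phi>
  proof -
    have n: "j < n" using j by auto
    have D: "\<phi> \<in> Cc_inf n" by (rule test_Cc_inf[OF \<phi>])
    have zD: "partial_zbar i \<phi> \<in> Cc_inf n" "i < n" if "i \<in> I" for i using Cc_inf_partial_z(2)[OF D] that Isub by auto
    have ps: "proj_supp n I V (SJ j \<phi>)" by (rule proj_supp_S[OF SJ j \<phi>]) auto
    have sJ: "slab_supp n I R0 (SJ j \<phi>)" by (rule SJ.S_slab_supp[OF j _ test_slab_supp[OF \<phi> Isub]]) auto
    note SD = SJ.S_Cc_inf[OF j D]
    have xI: "x \<in> slab n I R0" if "x \<in> V" for x using A.V_slab[OF Isub] that by blast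
    have 1: "(\<Sum>i\<in>I. pr (f i) (SJ j (partial_zbar i \<phi>))) = pr g (SJ j \<phi>)"
    proof -
      have "pr (f i) (SJ j (partial_zbar i \<phi>)) = pr (f i) (partial_zbar i (SJ j \<phi>))" if "i \<in> I" for i
        by (rule pr_cong) (rule SJ.S_zbar[OF j D zD(2)[OF that] Vx, symmetric])
      then show ?thesis using gI[OF SD ps] unfolding pr_def by simp
    qed
    have 2: "(\<Sum>i\<in>I. pr (f j) (SI i (partial_zbar i \<phi>))) = - pr (f j) \<phi>"
    proof -
      have "(\<Sum>i\<in>I. pr (f j) (SI i (partial_zbar i \<phi>))) = pr (f j) (\<lambda>x. \<Sum>i\<in>I. SI i (partial_zbar i \<phi>) x)"
        by (rule pr_sum[symmetric, OF fL[OF n]]) (rule SI.S_Cc_inf[OF _ zD(1)])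
      also have "\<dots> = pr (f j) (\<lambda>x. - \<phi> x)"
        by (rule pr_cong) (rule SI.S_div[OF D test_slab_supp[OF \<phi> Isub] xI])
      finally show ?thesis by (simp add: pr_neg)
    qed
    have 3: "(\<Sum>i\<in>I. pr g (SI i (SJ j (partial_zbar i \<phi>)))) = - pr g (SJ j \<phi>)"
    proof -
      have "(\<Sum>i\<in>I. pr g (SI i (SJ j (partial_zbar i \<phi>)))) = pr g (\<lambda>x. \<Sum>i\<in>I. SI i (SJ j (partial_zbar i \<phi>)) x)"
        by (rule pr_sum[symmetric, OF gL]) (rule SI.S_Cc_inf[OF _ SJ.S_Cc_inf[OF j zD(1)]])
      also have "\<dots> = pr g (\<lambda>x. - SJ j \<phi> x)"
      proof (rule pr_cong)
        fix x assume x: "x \<in> V"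
        have "(\<Sum>i\<in>I. SI i (SJ j (partial_zbar i \<phi>)) x) = (\<Sum>i\<in>I. SI i (partial_zbar i (SJ j \<phi>)) x)"
          by (intro sum.cong refl SI.S_local Vx[OF x]) (auto intro!: SJ.S_zbar[OF j D zD(2), symmetric])
        also have "\<dots> = - SJ j \<phi> x" by (rule SI.S_div[OF SD sJ xI[OF x]])
        finally show "(\<Sum>i\<in>I. SI i (SJ j (partial_zbar i \<phi>)) x) = - SJ j \<phi> x" .
      qed
      finally show ?thesis by (simp add: pr_neg)
    qed
    show ?thesis unfolding l_def sum.distrib sum_subtractf 1 2 3 by simp
  qed
  show ?thesis
  proof (intro exI[of _ U] ballI conjI)
    fix i j \<phi> assume i: "i \<in> I" and j: "j \<in> J"
    show "U i j \<in> W1 n V" by (rule U(1)[OF i j])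
    assume \<phi>: "\<phi> \<in> test_functions n V"
    have "(\<Sum>j\<in>J. LINT z:V|Cn_measure n. U i j z * partial_zbar j \<phi> z) = (\<Sum>j\<in>J. l i j (partial_zbar j \<phi>))"
      by (intro sum.cong refl U(2)[OF i] test_zbar[OF \<phi>]) auto
    then show "(LINT z:V|Cn_measure n. f i z * \<phi> z) = - (\<Sum>j\<in>J. LINT z:V|Cn_measure n. U i j z * partial_zbar j \<phi> z)"
      using id1[OF i \<phi>] unfolding A.set_int pr_def by simp
    have "(\<Sum>i\<in>I. LINT z:V|Cn_measure n. U i j z * partial_zbar i \<phi> z) = (\<Sum>i\<in>I. l i j (partial_zbar i \<phi>))"
      using Isub by (intro sum.cong refl U(2)[OF _ j] test_zbar[OF \<phi>]) auto
    then show "(LINT z:V|Cn_measure n. f j z * \<phi> z) = (\<Sum>i\<in>I. LINT z:V|Cn_measure n. U i j z * partial_zbar i \<phi> z)"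
      using id2[OF j \<phi>] unfolding A.set_int pr_def by simp
  qed
qed

end

section \<open>The product domain\<close>

lemma block_index:
  fixes d :: "nat \<Rightarrow> nat"
  assumes "k < (\<Sum>j<N. d j)"
  obtains j i where "j < N" "i < d j" "k = (\<Sum>l<j. d l) + i"
  using assms
proof (induction N arbitrary: thesis)
  case (Suc N)
  show ?case
  proof (cases "k < (\<Sum>j<N. d j)")
    case True
    then obtain j i where "j < N" "i < d j" "k = (\<Sum>l<j. d l) + i" using Suc.IH by blast
    then show ?thesis using Suc.prems(1)[of j i] by simp
  next
    case False
    then show ?thesis using Suc.prems(1)[of N "k - (\<Sum>j<N. d j)"] Suc.prems(2) by simp
  qed
qed simp

lemma block_index_less:
  fixes d :: "nat \<Rightarrow> nat"
  assumes "j < N" "i < d j" shows "(\<Sum>l<j. d l) + i < (\<Sum>l<N. d l)"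
proof -
  have "(\<Sum>l<j. d l) + i < (\<Sum>l<Suc j. d l)" using assms by simp
  also have "\<dots> \<le> (\<Sum>l<N. d l)" using assms by (intro sum_mono2) auto
  finally show ?thesis .
qed

text \<open>The projection to each factor is continuous.\<close>

lemma product_domain_open:
  assumes V: "\<And>j. j < N \<Longrightarrow> openin (PT {..<d j}) (V j)"
  shows "openin (PT {..<(\<Sum>j<N. d j)}) (product_domain N d V)"
proof -
  define n where "n = (\<Sum>j<N. d j)"
  define \<pi> where "\<pi> j z = (\<lambda>i\<in>{..<d j}. z ((\<Sum>l<j. d l) + i))" for j and z :: "nat \<Rightarrow> complex"
  have o: "openin (PT {..<n}) {z \<in> topspace (PT {..<n}). \<pi> j z \<in> V j}" if j: "j < N" for j
  proof (rule openin_continuous_map_preimage[OF _ V[OF j]])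
    show "continuous_map (PT {..<n}) (PT {..<d j}) (\<pi> j)"
      unfolding continuous_map_componentwise
    proof (intro conjI ballI)
      show "\<pi> j ` topspace (PT {..<n}) \<subseteq> extensional {..<d j}" by (auto simp: \<pi>_def)
      fix i assume i: "i \<in> {..<d j}"
      then have "(\<Sum>l<j. d l) + i < n" using block_index_less[OF j, of i d] by (simp add: n_def)
      then show "continuous_map (PT {..<n}) euclidean (\<lambda>x. \<pi> j x i)"
        using i by (simp add: \<pi>_def continuous_map_PT_coord)
    qed
  qed
  have eq: "product_domain N d V = topspace (PT {..<n}) \<inter> (\<Inter>j\<in>{..<N}. {z \<in> topspace (PT {..<n}). \<pi> j z \<in> V j})"
    by (auto simp: product_domain_def Cn_eq n_def \<pi>_def)
  show ?thesis
    unfolding n_def[symmetric] eq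
    by (cases "N = 0") (auto intro!: openin_Int openin_Inter o[unfolded topspace_PT] openin_topspace[of "PT {..<n}", unfolded topspace_PT])
qed

context bdd_open
begin

lemma W1_cmult:
  assumes "f \<in> W1 n V" shows "(\<lambda>z. c * f z) \<in> W1 n V"
proof -
  have fL: "f \<in> L2 n V" using assms unfolding W1_def by blast
  have "(\<lambda>z. c * f z) \<in> L2 n V" using L2_lin[OF fL fL, of c 0] by simp
  moreover have "\<exists>g\<in>L2 n V. weak_partial n V k v (\<lambda>z. c * f z) g" if "k < n" "v \<in> {1, \<i>}" for k v
  proof -
    have "\<exists>g\<in>L2 n V. weak_partial n V k v f g" using assms that by (auto simp: W1_def)
    then obtain g where g: "g \<in> L2 n V" "weak_partial n V k v f g" by blast
    have "(\<lambda>z. c * g z) \<in> L2 n V" using L2_lin[OF g(1) g(1), of c 0] by simp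
    moreover have "weak_partial n V k v (\<lambda>z. c * f z) (\<lambda>z. c * g z)"
      using g(2) unfolding weak_partial_def by (simp add: mult.assoc)
    ultimately show ?thesis by blast
  qed
  ultimately show ?thesis unfolding W1_def by blast
qed

end

section \<open>From forms to fields\<close>

lemma multi_indices_zero: "multi_indices n 0 = {{}}"
  by (auto simp: multi_indices_def dest: finite_subset)

lemma multi_indices_full: "multi_indices n n = {{..<n}}"
proof -
  have "J = {..<n}" if "J \<subseteq> {..<n}" "card J = n" for J using that by (intro card_subset_eq) auto
  then show ?thesis by (auto simp: multi_indices_def)
qed

lemma multi_indices_codim1:
  assumes "0 < n" "H \<in> multi_indices n (n - 1)"
  obtains m where "m < n" "H = {..<n} - {m}"
proof -
  have H: "H \<subseteq> {..<n}" "card H = n - 1" using assms by (auto simp: multi_indices_def)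
  have "card ({..<n} - H) = 1" using H assms(1) by (subst card_Diff_subset) (auto dest: finite_subset)
  then obtain m where "{..<n} - H = {m}" by (rule card_1_singletonE)
  then have "m < n" "H = {..<n} - {m}" using H by auto
  then show ?thesis by (rule that)
qed

lemma card_below: "k < n \<Longrightarrow> card {l \<in> {..<n}. l < k} = k"
proof -
  assume "k < n"
  then have "{l \<in> {..<n}. l < k} = {..<k}" by auto
  then show ?thesis by simp
qed

lemma card_below_except:
  assumes "k < n" shows "card {l \<in> {..<n} - {m}. l < k} = (if m < k then k - 1 else k)"
proof -
  have "{l \<in> {..<n} - {m}. l < k} = {..<k} - {m}" using assms by auto
  then show ?thesis by simp
qed

text \<open>The coefficient of a form at the complement of \<open>m\<close> is, up to \<open>(-1)\<^sup>m\<close>, the \<open>m\<close>-th component of the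
  field, and the \<open>dbar\<close> operator becomes a divergence. In degree \<open>n - 2\<close> the coefficient at the complement of
  \<open>{i, j}\<close> is \<open>\<plusminus> U i j\<close> if the two indices belong to different blocks and \<open>0\<close> otherwise. That the indices of
  \<open>I\<close> precede those of \<open>J\<close> makes the signs depend on \<open>i + j\<close> only.\<close>

theorem (in product_open) dolbeault_vanishes:
  assumes below: "\<And>i j. i \<in> I \<Longrightarrow> j \<in> J \<Longrightarrow> i < j"
  shows "W1_dolbeault_vanishes n 0 (n - 1) V"
  unfolding W1_dolbeault_vanishes_def
proof
  fix f assume f: "f \<in> W1_closed_forms n 0 (n - 1) V"
  have Isub: "I \<subseteq> {..<n}" by (rule A.I)
  have n0: "0 < n" using I_ne Isub by auto
  have fW: "f \<in> W1_forms n 0 (n - 1) V" and fc: "is_dbar n 0 n V f (\<lambda>_ _ _. 0)"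
    using f n0 by (auto simp: W1_closed_forms_def)
  define c where "c m = f {} ({..<n} - {m})" for m
  define F where "F m z = (-1) ^ m * c m z" for m z
  have mi: "{..<n} - {m} \<in> multi_indices n (n - 1)" if "m < n" for m
    using that by (simp add: multi_indices_def)
  have cW: "c m \<in> W1 n V" if "m < n" for m
    using fW mi[OF that] unfolding c_def W1_forms_def multi_indices_zero by blast
  have FW: "F m \<in> W1 n V" if "m < n" for m
    unfolding F_def by (rule A.W1_cmult[OF cW[OF that]])
  have Fint: "(LINT z:V|Cn_measure n. F m z * \<phi> z) = (-1) ^ m * (LINT z:V|Cn_measure n. c m z * \<phi> z)" for m \<phi>
    unfolding F_def by (simp add: mult.assoc)
  have closed: "(\<Sum>k<n. LINT z:V|Cn_measure n. F k z * partial_zbar k \<phi> z) = 0" if \<phi>: "\<phi> \<in> test_functions n V" for \<phi>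
  proof -
    have "(0::complex) = (\<Sum>k<n. (-1) ^ card {l \<in> {..<n}. l < k} * - (LINT z:V|Cn_measure n. c k z * partial_zbar k \<phi> z))"
      using fc \<phi> unfolding is_dbar_def multi_indices_zero multi_indices_full c_def by (simp add: set_lebesgue_integral_def)
    also have "\<dots> = - (\<Sum>k<n. LINT z:V|Cn_measure n. F k z * partial_zbar k \<phi> z)"
      unfolding sum_negf[symmetric] Fint by (intro sum.cong refl) (simp only: lessThan_iff card_below[unfolded lessThan_iff], simp)
    finally show ?thesis by simp
  qed
  obtain U where U: "\<And>i j. i \<in> I \<Longrightarrow> j \<in> J \<Longrightarrow> U i j \<in> W1 n V"
    "\<And>i j \<phi>. i \<in> I \<Longrightarrow> j \<in> J \<Longrightarrow> \<phi> \<in> test_functions n V \<Longrightarrow>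
      (LINT z:V|Cn_measure n. F i z * \<phi> z) = - (\<Sum>j\<in>J. LINT z:V|Cn_measure n. U i j z * partial_zbar j \<phi> z)"
    "\<And>i j \<phi>. i \<in> I \<Longrightarrow> j \<in> J \<Longrightarrow> \<phi> \<in> test_functions n V \<Longrightarrow>
      (LINT z:V|Cn_measure n. F j z * \<phi> z) = (\<Sum>i\<in>I. LINT z:V|Cn_measure n. U i j z * partial_zbar i \<phi> z)"
    using field_decomposition[of F, OF FW closed] by blast
  obtain i0 j0 where ij0: "i0 \<in> I" "j0 \<in> J" using I_ne J_ne by blast
  \<comment> \<open>The smaller index not in \<open>H\<close> is the one from \<open>I\<close>. A multiple by \<open>0\<close> stands for the zero function because it
    is seen to be in \<open>W1\<close> by \<open>W1_cmult\<close>.\<close>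
  define u :: form where "u = (\<lambda>_ H. let i = Min ({..<n} - H); j = Max ({..<n} - H) in
      if i \<in> I \<and> j \<in> J then (\<lambda>z. (-1) ^ (i + j + 1) * U i j z) else (\<lambda>z. 0 * U i0 j0 z))"
  have uW: "u a H \<in> W1 n V" for a H
  proof (cases "Min ({..<n} - H) \<in> I \<and> Max ({..<n} - H) \<in> J")
    case True
    show ?thesis unfolding u_def Let_def if_P[OF True] by (intro A.W1_cmult U(1) True[THEN conjunct1] True[THEN conjunct2])
  next
    case False
    show ?thesis unfolding u_def Let_def if_not_P[OF False] by (intro A.W1_cmult U(1) ij0)
  qed
  have Dc: "{..<n} - ({..<n} - {i} - {j}) = {i, j}" if "i < n" "j < n" for i j using that by auto
  have u_IJ: "u a ({..<n} - {i} - {j}) = (\<lambda>z. (-1) ^ (i + j + 1) * U i j z)"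
    "u a ({..<n} - {j} - {i}) = (\<lambda>z. (-1) ^ (i + j + 1) * U i j z)"
    if "i \<in> I" "j \<in> J" for a i j
  proof -
    have ij: "i < j" "i < n" "j < n" using below[OF that] that Isub by auto
    have m: "Min {i, j} = i" "Max {i, j} = j" "Min {j, i} = i" "Max {j, i} = j" using ij(1) by auto
    show "u a ({..<n} - {i} - {j}) = (\<lambda>z. (-1) ^ (i + j + 1) * U i j z)"
      unfolding u_def Dc[OF ij(2,3)] m Let_def using that by simp
    show "u a ({..<n} - {j} - {i}) = (\<lambda>z. (-1) ^ (i + j + 1) * U i j z)"
      unfolding u_def Dc[OF ij(3,2)] m Let_def using that by simp
  qed
  have u_II: "u a ({..<n} - {i} - {k}) = (\<lambda>z. 0 * U i0 j0 z)"
    if "i < n" "k < n" "i \<in> I \<longleftrightarrow> k \<in> I" for a i k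
  proof -
    have "Min {i, k} \<in> {i, k}" "Max {i, k} \<in> {i, k}" using Min_in[of "{i, k}"] Max_in[of "{i, k}"] by blast+
    then have "\<not> (Min {i, k} \<in> I \<and> Max {i, k} \<in> J)" using that by auto
    then show ?thesis unfolding u_def Dc[OF that(1,2)] Let_def by (rule if_not_P)
  qed
  have "is_dbar n 0 (n - 1) V u f"
    unfolding is_dbar_def multi_indices_zero
  proof (intro ballI)
    fix a :: "nat set" and H \<phi> assume a: "a \<in> {{}}" and H: "H \<in> multi_indices n (n - 1)" and \<phi>: "\<phi> \<in> test_functions n V"
    obtain m where m: "m < n" "H = {..<n} - {m}" using multi_indices_codim1[OF n0 H] .
    define s where "s k = (-1) ^ (0 + card {l \<in> H. l < k}) * - (LINT z:V|Cn_measure n. u a (H - {k}) z * partial_zbar k \<phi> z)" for k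
    define v where "v i j k = (LINT z:V|Cn_measure n. U i j z * partial_zbar k \<phi> z)" for i j k
    have vc: "(LINT z:V|Cn_measure n. (c * U i j z) * partial_zbar k \<phi> z) = c * v i j k" for c i j k
      by (simp add: v_def mult.assoc)
    have zero: "s k = 0" if "k < n" "m \<in> I \<longleftrightarrow> k \<in> I" for k
      unfolding s_def m(2) u_II[OF m(1) that] by (simp add: set_lebesgue_integral_def)
    have lhs: "(LINT z:V|Cn_measure n. f a H z * \<phi> z) = (-1) ^ m * (LINT z:V|Cn_measure n. F m z * \<phi> z)"
      using a unfolding Fint m(2) c_def by (simp add: mult.assoc[symmetric] power_add[symmetric])
    have "(\<Sum>k\<in>H. s k) = (-1) ^ m * (LINT z:V|Cn_measure n. F m z * \<phi> z)"
    proof (cases "m \<in> I")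
      case mI: True
      have "s k = (-1) ^ m * - v m k k" if k: "k \<in> J" for k
      proof -
        have mk: "m < k" "k < n" using below[OF mI k] k by auto
        have "s k = (-1) ^ (k - 1) * - ((-1) ^ (m + k + 1) * v m k k)"
          unfolding s_def m(2) u_IJ(1)[OF mI k] vc card_below_except[OF mk(2)] using mk(1) by simp
        also have "\<dots> = (-1) ^ ((k - 1) + (m + k + 1)) * - v m k k" by (simp add: power_add)
        also have "(k - 1) + (m + k + 1) = m + 2 * k" using mk by simp
        also have "(-1) ^ (m + 2 * k) = ((-1) ^ m :: complex)" by (simp add: power_add)
        finally show ?thesis .
      qed
      moreover have "(\<Sum>k\<in>H. s k) = (\<Sum>k\<in>J. s k)"
        by (rule sum.mono_neutral_right) (use m mI zero in auto)
      ultimately have "(\<Sum>k\<in>H. s k) = (-1) ^ m * - (\<Sum>k\<in>J. v m k k)"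
        by (simp add: sum_distrib_left sum_negf)
      then show ?thesis using U(2)[OF mI ij0(2) \<phi>] by (simp add: v_def)
    next
      case False
      then have mJ: "m \<in> J" using m by simp
      have "s k = (-1) ^ m * v k m k" if k: "k \<in> I" for k
      proof -
        have mk: "k < m" "k < n" using below[OF k mJ] k Isub by auto
        have "s k = (-1) ^ k * - ((-1) ^ (k + m + 1) * v k m k)"
          unfolding s_def m(2) u_IJ(2)[OF k mJ] vc card_below_except[OF mk(2)] using mk(1) by simp
        also have "\<dots> = (-1) ^ (k + (k + m)) * v k m k" by (simp add: power_add)
        also have "k + (k + m) = m + 2 * k" by simp
        also have "(-1) ^ (m + 2 * k) = ((-1) ^ m :: complex)" by (simp add: power_add)
        finally show ?thesis .
      qed
      moreover have "(\<Sum>k\<in>H. s k) = (\<Sum>k\<in>I. s k)"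
        by (rule sum.mono_neutral_right) (use m False Isub zero in auto)
      ultimately have "(\<Sum>k\<in>H. s k) = (-1) ^ m * (\<Sum>k\<in>I. v k m k)"
        by (simp add: sum_distrib_left)
      then show ?thesis using U(3)[OF ij0(1) mJ \<phi>] by (simp add: v_def)
    qed
    then show "(LINT z:V|Cn_measure n. f a H z * \<phi> z) =
        (\<Sum>k\<in>H. (-1) ^ (0 + card {l \<in> H. l < k}) * - (LINT z:V|Cn_measure n. u a (H - {k}) z * partial_zbar k \<phi> z))"
      unfolding lhs s_def by simp
  qed
  then show "f \<in> W1_exact_forms n 0 (n - 1) V"
    using fW uW unfolding W1_exact_forms_def W1_forms_def by blast
qed

section \<open>The vanishing theorem\<close>

theorem theorem3:
  fixes N :: nat and d :: "nat \<Rightarrow> nat" and V :: "nat \<Rightarrow> (nat \<Rightarrow> complex) set"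
  assumes "N \<ge> 2"
    and "\<And>j. j < N \<Longrightarrow> d j \<ge> 1"
    and "\<And>j. j < N \<Longrightarrow> bounded_lipschitz_domain (d j) (V j)"
    and "\<And>j. j < N \<Longrightarrow> connectedin (Cn_top (d j)) (Cn (d j) - V j)"
    and "\<And>j. j < N \<Longrightarrow> d j \<ge> 2 \<Longrightarrow> W1_dolbeault_vanishes (d j) 0 (d j - 1) (V j)"
  shows "W1_dolbeault_vanishes (\<Sum>j<N. d j) 0 ((\<Sum>j<N. d j) - 1) (product_domain N d V)"
proof -
  define n where "n = (\<Sum>j<N. d j)"
  define W where "W = product_domain N d V"
  \<comment> \<open>The first factor against the product of the others, which have coordinates because \<open>N \<ge> 2\<close>.\<close>
  define I where "I = {..<d 0}"
  have le: "d 0 \<le> (\<Sum>l<j. d l)" if "0 < j" for j using that by (intro member_le_sum) auto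
  have "(\<Sum>l<1. d l) + 0 < n" unfolding n_def using assms(1,2) by (intro block_index_less) (auto simp: Suc_le_eq)
  then have d0: "d 0 < n" by simp
  have "\<exists>R. \<forall>z\<in>V j. Cn_norm (d j) z \<le> R" if "j < N" for j
    using assms(3)[OF that] by (simp add: bounded_lipschitz_domain_def)
  then obtain R where R: "\<And>j z. j < N \<Longrightarrow> z \<in> V j \<Longrightarrow> Cn_norm (d j) z \<le> R j" by metis
  \<comment> \<open>A common bound for all coordinates; the summand \<open>1\<close> keeps it positive.\<close>
  define R0 where "R0 = 1 + (\<Sum>j<N. \<bar>R j\<bar>)"
  have R0: "R0 > 0" unfolding R0_def by (intro add_pos_nonneg sum_nonneg) auto
  have Wx: "x \<in> extensional {..<n}" "\<And>j. j < N \<Longrightarrow> (\<lambda>i\<in>{..<d j}. x ((\<Sum>l<j. d l) + i)) \<in> V j" if "x \<in> W" for x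
    using that by (auto simp: W_def product_domain_def Cn_eq n_def)
  have open_W: "openin (PT {..<n}) W"
    unfolding n_def W_def using assms(3) by (intro product_domain_open) (auto simp: bounded_lipschitz_domain_def Cn_top_eq)
  have bdd_W: "W \<subseteq> slab n {..<n} R0"
  proof
    fix x assume x: "x \<in> W"
    have "cmod (x k) \<le> R0" if k: "k < n" for k
    proof -
      obtain j i where ji: "j < N" "i < d j" "k = (\<Sum>l<j. d l) + i" by (rule block_index[OF k[unfolded n_def]])
      define y where "y = (\<lambda>i\<in>{..<d j}. x ((\<Sum>l<j. d l) + i))"
      have "cmod (x k) = cmod (y i)" using ji by (simp add: y_def)
      also have "\<dots> \<le> Cn_norm (d j) y" unfolding Cn_norm_def using ji by (intro member_le_L2_set) auto
      also have "\<dots> \<le> R j" using R[OF ji(1)] Wx(2)[OF x ji(1)] by (simp add: y_def)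
      also have "\<dots> \<le> \<bar>R j\<bar>" by simp
      also have "\<dots> \<le> (\<Sum>j<N. \<bar>R j\<bar>)" using ji by (intro member_le_sum) auto
      finally show ?thesis by (simp add: R0_def)
    qed
    then show "x \<in> slab n {..<n} R0" using Wx(1)[OF x] by (simp add: slab_def)
  qed
  have rect: "(\<lambda>k. if k \<in> I then x k else y k) \<in> W" if x: "x \<in> W" and y: "y \<in> W" for x y
  proof -
    define z where "z = (\<lambda>k. if k \<in> I then x k else y k)"
    have "z \<in> extensional {..<n}" using Wx(1)[OF y] d0 by (auto simp: z_def I_def extensional_def)
    moreover have "(\<lambda>i\<in>{..<d j}. z ((\<Sum>l<j. d l) + i)) \<in> V j" if j: "j < N" for j
    proof (cases "j = 0")
      case True
      then have "(\<lambda>i\<in>{..<d j}. z ((\<Sum>l<j. d l) + i)) = (\<lambda>i\<in>{..<d j}. x ((\<Sum>l<j. d l) + i))"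
        by (auto simp: z_def I_def fun_eq_iff)
      then show ?thesis using Wx(2)[OF x j] by simp
    next
      case False
      then have "d 0 \<le> (\<Sum>l<j. d l)" using le by simp
      then have "(\<lambda>i\<in>{..<d j}. z ((\<Sum>l<j. d l) + i)) = (\<lambda>i\<in>{..<d j}. y ((\<Sum>l<j. d l) + i))"
        by (auto simp: z_def I_def fun_eq_iff)
      then show ?thesis using Wx(2)[OF y j] by simp
    qed
    ultimately have "z \<in> W" by (simp add: W_def product_domain_def Cn_eq n_def)
    then show ?thesis by (simp only: z_def)
  qed
  have rect': "(\<lambda>k. if k \<in> {..<n} - I then x k else y k) \<in> W" if x: "x \<in> W" and y: "y \<in> W" for x y
  proof -
    have "(\<lambda>k. if k \<in> {..<n} - I then x k else y k) = (\<lambda>k. if k \<in> I then y k else x k)"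
      using Wx(1)[OF x] Wx(1)[OF y] by (auto simp: fun_eq_iff extensional_def)
    then show ?thesis using rect[OF y x] by simp
  qed
  interpret product_open n W R0 I
  proof
    show "I \<subseteq> {..<n}" using d0 by (auto simp: I_def)
    show "I \<noteq> {}" using assms(1) assms(2)[of 0] by (auto simp: I_def lessThan_empty_iff)
    show "{..<n} - I \<noteq> {}" using d0 by (auto simp: I_def)
  qed (use open_W bdd_W R0 rect rect' in auto)
  have "W1_dolbeault_vanishes n 0 (n - 1) W" by (rule dolbeault_vanishes) (auto simp: I_def)
  then show ?thesis by (simp only: n_def W_def)
qed

end
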